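(* Let $F$ be a topologically transitive step skew-product map $F(\xi,x)=(\sigma(\xi),f_{\xi_0}(x))$ on $\Sigma_N\times\mathbb{S}^1$, $N\ge2$, whose fiber maps $f_0,\dots,f_{N-1}$ are $C^1$ diffeomorphisms of $\mathbb{S}^1$. Assume that $F$ satisfies Axioms CEC$\pm$ and Acc$\pm$ and that $F$ is proximal, so that $F$ has exactly two ergodic measures of maximal entropy, $\mu_-$ and $\mu_+$, with $h(\mu_\pm)=\log N$ and $\chi(\mu_-)<0<\chi(\mu_+)$. Then no measure which is a nontrivial convex combination of $\mu_-$ and $\mu_+$ is a weak$\ast$ and in entropy limit of ergodic measures; that is, for $t\in(0,1)$ and $\mu=t\mu_-+(1-t)\mu_+$ there is no sequence of $F$-ergodic probability measures $(\nu_k)_k$ with $\nu_k\to\mu$ in the weak$\ast$ topology and $h(\nu_k)\to h(\mu)$.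
   Context: Setting. $N\ge2$; $\Sigma_N=\{0,\dots,N-1\}^{\mathbb{Z}}$ with the left shift $\sigma$; $\Sigma_N\times\mathbb{S}^1$ has the product topology. Notation: $f_{[\xi_0\dots\xi_n]}=f_{\xi_n}\circ\cdots\circ f_{\xi_0}$, $f_{[\xi_{-m}\dots\xi_{-1}.]}=(f_{[\xi_{-m}\dots\xi_{-1}]})^{-1}$, $f^n_\xi=f_{[\xi_0\dots\xi_{n-1}]}$ and $f^{-n}_\xi=f_{[\xi_{-n}\dots\xi_{-1}.]}$. For $J\subset\mathbb{S}^1$, $\mathcal{O}^+(J)$ is the union of $f_{[\theta_0\dots\theta_{n-1}]}(J)$ over all $n\ge1$ and all words, and $\mathcal{O}^-(J)$ the union of $f_{[\theta_{-m}\dots\theta_{-1}.]}(J)$ over all $m\ge1$ and all words. Axioms. $F$ satisfies Axioms CEC$\pm$ and Acc$\pm$ if there are closed (nontrivial) intervals $J^+,J^-\subset\mathbb{S}^1$ such that: CEC$+(J^+)$: there are positive constants $K_1,\dots,K_5$ such that for every interval $H\subset\mathbb{S}^1$ intersecting $J^+$ with $|H|<K_1$ there is a finite word $(\eta_0\dots\eta_{\ell-1})$ with $\ell\le K_2|\log|H||+K_3$ such that $f_{[\eta_0\dots\eta_{\ell-1}]}(H)\supset B(J^+,K_4)$ (the $K_4$-neighborhood of $J^+$) and $\log|(f_{[\eta_0\dots\eta_{\ell-1}]})'(x)|\ge \ell K_5$ for every $x\in H$; CEC$-(J^-)$: the same condition holds for $J^-$ and the step skew-product $F^{-1}$ (i.e.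 for the maps $f_0^{-1},\dots,f_{N-1}^{-1}$); Acc$+(J^+)$: $\mathcal{O}^+(\mathrm{int}\,J^+)=\mathbb{S}^1$; Acc$-(J^-)$: $\mathcal{O}^-(\mathrm{int}\,J^-)=\mathbb{S}^1$. Proximality. $F$ is proximal if for every $x,y\in\mathbb{S}^1$ there is at least one $\xi\in\Sigma_N$ with $|f^n_\xi(x)-f^n_\xi(y)|\to0$ as $|n|\to\infty$. $h(\mu)$ is the metric entropy of an $F$-invariant probability measure $\mu$ and $\chi(\mu)=\int\log|f_{\xi_0}'(x)|\,d\mu(\xi,x)$. *)

theory Defs
  imports "HOL-Probability.Probability"
begin

quotient_type circle = real / "\<lambda>x y :: real. x - y \<in> \<int>"
proof (rule equivpI)
  show "reflp (\<lambda>x y :: real. x - y \<in> \<int>)"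
    by (simp add: reflp_def)
  show "symp (\<lambda>x y :: real. x - y \<in> \<int>)"
    by (metis (no_types, lifting) Ints_minus minus_diff_eq sympI)
  show "transp (\<lambda>x y :: real. x - y \<in> \<int>)"
    by (rule transpI) (metis Ints_add diff_add_cancel diff_diff_eq2)
qed

lift_definition circle_of :: "real \<Rightarrow> circle" is "\<lambda>t. t" .

instantiation circle :: ab_group_add
begin

lift_definition zero_circle :: circle is 0 .

lift_definition plus_circle :: "circle \<Rightarrow> circle \<Rightarrow> circle" is "(+)"
  by (metis Ints_add add_diff_add)

lift_definition uminus_circle :: "circle \<Rightarrow> circle" is uminus
  by (metis Ints_minus minus_diff_commute minus_diff_eq uminus_add_conv_diff
      add.commute diff_minus_eq_add)

lift_definition minus_circle :: "circle \<Rightarrow> circle \<Rightarrow> circle" is "(-)"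
  by (metis Ints_diff diff_diff_eq diff_diff_eq2 add_diff_eq add.commute diff_add_eq)

instance
  by standard (transfer; simp add: algebra_simps)+

end

text \<open>The representative in \<open>[-1/2, 1/2)\<close> of a point of the circle.\<close>

lift_definition circle_rep :: "circle \<Rightarrow> real" is "\<lambda>t. t - of_int (round t)"
proof -
  fix s t :: real
  assume "s - t \<in> \<int>"
  then obtain k where "s = t + of_int k"
    by (metis Ints_cases add.commute diff_add_cancel)
  then have "round s = round t + k"
    unfolding round_def using floor_add_int[of "t + 1/2" k] by (simp add: algebra_simps)
  with \<open>s = t + of_int k\<close> show "s - of_int (round s) = t - of_int (round t)"
    by simp
qed

lemma circle_of_rep: "circle_of (circle_rep x) = x"
  by transfer simp

lemma circle_rep_zero: "circle_rep 0 = 0"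
  by transfer simp

lemma abs_circle_rep_le: "\<bar>circle_rep (circle_of t)\<bar> \<le> \<bar>t\<bar>"
  by transfer (metis abs_minus_commute round_diff_minimal of_int_0 diff_zero)

lemma circle_of_add: "circle_of (s + t) = circle_of s + circle_of t"
  by transfer simp

lemma circle_of_minus: "circle_of (- t) = - circle_of t"
  by transfer simp

lemma abs_circle_rep_minus: "\<bar>circle_rep (- x)\<bar> = \<bar>circle_rep x\<bar>"
  by (metis abs_circle_rep_le abs_minus_cancel add.inverse_inverse antisym
      circle_of_minus circle_of_rep)

lemma abs_circle_rep_triangle: "\<bar>circle_rep (x + y)\<bar> \<le> \<bar>circle_rep x\<bar> + \<bar>circle_rep y\<bar>"
  by (metis abs_circle_rep_le abs_triangle_ineq circle_of_add circle_of_rep order_trans)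

instantiation circle :: metric_space
begin

definition dist_circle :: "circle \<Rightarrow> circle \<Rightarrow> real" where
  "dist_circle x y = \<bar>circle_rep (x - y)\<bar>"

definition uniformity_circle :: "(circle \<times> circle) filter" where
  "uniformity_circle = (INF e\<in>{0<..}. principal {(x, y). dist x y < e})"

definition open_circle :: "circle set \<Rightarrow> bool" where
  "open_circle U \<longleftrightarrow> (\<forall>x\<in>U. \<forall>\<^sub>F (x', y) in uniformity. x' = x \<longrightarrow> y \<in> U)"

instance
proof
  fix x y z :: circle
  show "dist x y = 0 \<longleftrightarrow> x = y"
    unfolding dist_circle_def
    by (metis abs_eq_0 circle_of_rep circle_rep_zero eq_iff_diff_eq_0)
  show "dist x y \<le> dist x z + dist y z"
    unfolding dist_circle_def
    using abs_circle_rep_triangle[of "x - z" "z - y"] abs_circle_rep_minus[of "y - z"]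
    by simp
qed (simp_all add: uniformity_circle_def open_circle_def)

end

text \<open>
  One-point sets are excluded: their length is \<open>0\<close>, and \<open>ln 0 = 0\<close> would be meaningless below.
\<close>

definition circle_interval :: "circle set \<Rightarrow> bool" where
  "circle_interval H \<longleftrightarrow>
     H \<noteq> UNIV \<and> (\<exists>I :: real set. is_interval I \<and> interior I \<noteq> {} \<and> H = circle_of ` I)"

definition circle_length :: "circle set \<Rightarrow> real" where
  "circle_length H = measure lborel {t \<in> {0..<1}. circle_of t \<in> H}"

text \<open>
  The map \<open>g\<close> read near \<open>x\<close> in the charts \<open>t \<mapsto> x + t\<close> and \<open>t \<mapsto> g x + t\<close>. Differentiability of the
  chart expression at \<open>0\<close> forces \<open>g\<close> to be continuous at \<open>x\<close>.
\<close>

definition circle_chart :: "(circle \<Rightarrow> circle) \<Rightarrow> circle \<Rightarrow> real \<Rightarrow> real" where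
  "circle_chart g x = (\<lambda>t. circle_rep (g (x + circle_of t) - g x))"

definition circle_deriv :: "(circle \<Rightarrow> circle) \<Rightarrow> circle \<Rightarrow> real" where
  "circle_deriv g x = deriv (circle_chart g x) 0"

definition C1_circle_map :: "(circle \<Rightarrow> circle) \<Rightarrow> bool" where
  "C1_circle_map g \<longleftrightarrow>
     (\<forall>x. circle_chart g x differentiable at 0) \<and> continuous_on UNIV (circle_deriv g)"

definition C1_circle_diffeo :: "(circle \<Rightarrow> circle) \<Rightarrow> bool" where
  "C1_circle_diffeo g \<longleftrightarrow> bij g \<and> C1_circle_map g \<and> C1_circle_map (inv g)"

definition topologically_transitive :: "('a::topological_space \<Rightarrow> 'a) \<Rightarrow> bool" where
  "topologically_transitive T \<longleftrightarrow>
     (\<forall>U V. open U \<and> U \<noteq> {} \<and> open V \<and> V \<noteq> {} \<longrightarrow> (\<exists>n. (T ^^ n) ` U \<inter> V \<noteq> {}))"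

definition invariant_prob :: "('a::topological_space \<Rightarrow> 'a) \<Rightarrow> 'a measure \<Rightarrow> bool" where
  "invariant_prob T M \<longleftrightarrow>
     prob_space M \<and> sets M = sets borel \<and> T \<in> measurable M M \<and> distr M M T = M"

definition ergodic_prob :: "('a::topological_space \<Rightarrow> 'a) \<Rightarrow> 'a measure \<Rightarrow> bool" where
  "ergodic_prob T M \<longleftrightarrow>
     invariant_prob T M \<and> (\<forall>A\<in>sets M. T -` A = A \<longrightarrow> measure M A = 0 \<or> measure M A = 1)"

definition finite_partitions :: "'a measure \<Rightarrow> 'a set set set" where
  "finite_partitions M = {P. finite P \<and> P \<subseteq> sets M \<and> partition_on (space M) P}"

text \<open>Atoms of measure zero contribute \<open>0\<close>, since \<open>0 * ln 0 = 0\<close>.\<close>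

definition partition_entropy :: "'a measure \<Rightarrow> 'a set set \<Rightarrow> real" where
  "partition_entropy M P = - (\<Sum>A\<in>P. measure M A * ln (measure M A))"

text \<open>The join of the partitions \<open>T\<^sup>-\<^sup>i P\<close> for \<open>i < n\<close>.\<close>

definition iterated_partition :: "('a \<Rightarrow> 'a) \<Rightarrow> 'a measure \<Rightarrow> 'a set set \<Rightarrow> nat \<Rightarrow> 'a set set" where
  "iterated_partition T M P n =
     {A. A \<noteq> {} \<and> (\<exists>c. (\<forall>i<n. c i \<in> P) \<and> A = {x \<in> space M. \<forall>i<n. (T ^^ i) x \<in> c i})}"

definition entropy_wrt_partition :: "('a \<Rightarrow> 'a) \<Rightarrow> 'a measure \<Rightarrow> 'a set set \<Rightarrow> real" where
  "entropy_wrt_partition T M P =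
     lim (\<lambda>n. partition_entropy M (iterated_partition T M P n) / real n)"

definition metric_entropy :: "('a \<Rightarrow> 'a) \<Rightarrow> 'a measure \<Rightarrow> ereal" where
  "metric_entropy T M = (SUP P\<in>finite_partitions M. ereal (entropy_wrt_partition T M P))"

definition ergodic_max_entropy :: "('a::topological_space \<Rightarrow> 'a) \<Rightarrow> 'a measure \<Rightarrow> bool" where
  "ergodic_max_entropy T M \<longleftrightarrow>
     ergodic_prob T M \<and> (\<forall>M'. invariant_prob T M' \<longrightarrow> metric_entropy T M' \<le> metric_entropy T M)"

definition convex_comb :: "real \<Rightarrow> 'a measure \<Rightarrow> 'a measure \<Rightarrow> 'a measure" where
  "convex_comb t M M' = measure_of (space M) (sets M)
     (\<lambda>A. ennreal t * emeasure M A + ennreal (1 - t) * emeasure M' A)"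

text \<open>To be used on compact spaces, where continuous functions are bounded.\<close>

definition weak_star_conv :: "(nat \<Rightarrow> 'a::topological_space measure) \<Rightarrow> 'a measure \<Rightarrow> bool" where
  "weak_star_conv \<nu> \<mu> \<longleftrightarrow>
     (\<forall>\<phi> :: 'a \<Rightarrow> real. continuous_on UNIV \<phi> \<longrightarrow>
        (\<lambda>k. integral\<^sup>L (\<nu> k) \<phi>) \<longlonglongrightarrow> integral\<^sup>L \<mu> \<phi>)"

text \<open>
  The symbols are the elements of a finite type \<open>'n\<close> with the discrete topology, so
  \<open>int \<Rightarrow> 'n\<close> with its product topology is the two-sided shift space.
\<close>

definition skew :: "('n \<Rightarrow> circle \<Rightarrow> circle) \<Rightarrow> (int \<Rightarrow> 'n) \<times> circle \<Rightarrow> (int \<Rightarrow> 'n) \<times> circle" where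
  "skew f = (\<lambda>(\<xi>, x). (\<lambda>i. \<xi> (i + 1), f (\<xi> 0) x))"

text \<open>
  For a word \<open>w = [a\<^sub>0, \<dots>, a\<^sub>n]\<close>, \<open>fold f w\<close> is the composition \<open>f a\<^sub>n \<circ> \<dots> \<circ> f a\<^sub>0\<close>.
\<close>

definition fiber_iterate :: "('n \<Rightarrow> circle \<Rightarrow> circle) \<Rightarrow> (int \<Rightarrow> 'n) \<Rightarrow> int \<Rightarrow> circle \<Rightarrow> circle" where
  "fiber_iterate f \<xi> n =
     (if n \<ge> 0 then fold f (map \<xi> [0..n - 1]) else inv (fold f (map \<xi> [n..-1])))"

definition forward_orbit :: "('n \<Rightarrow> circle \<Rightarrow> circle) \<Rightarrow> circle set \<Rightarrow> circle set" where
  "forward_orbit f J = (\<Union>w\<in>{w. w \<noteq> []}. fold f w ` J)"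

definition backward_orbit :: "('n \<Rightarrow> circle \<Rightarrow> circle) \<Rightarrow> circle set \<Rightarrow> circle set" where
  "backward_orbit f J = (\<Union>w\<in>{w. w \<noteq> []}. inv (fold f w) ` J)"

definition CEC_plus :: "('n \<Rightarrow> circle \<Rightarrow> circle) \<Rightarrow> circle set \<Rightarrow> bool" where
  "CEC_plus f J \<longleftrightarrow>
     (\<exists>K1 K2 K3 K4 K5 :: real. K1 > 0 \<and> K2 > 0 \<and> K3 > 0 \<and> K4 > 0 \<and> K5 > 0 \<and>
       (\<forall>H. circle_interval H \<and> H \<inter> J \<noteq> {} \<and> circle_length H < K1 \<longrightarrow>
         (\<exists>w. w \<noteq> [] \<and> real (length w) \<le> K2 * \<bar>ln (circle_length H)\<bar> + K3 \<and>
            (\<Union>x\<in>J. ball x K4) \<subseteq> fold f w ` H \<and>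
            (\<forall>x\<in>H. ln \<bar>circle_deriv (fold f w) x\<bar> \<ge> real (length w) * K5))))"

definition CEC_minus :: "('n \<Rightarrow> circle \<Rightarrow> circle) \<Rightarrow> circle set \<Rightarrow> bool" where
  "CEC_minus f J \<longleftrightarrow> CEC_plus (\<lambda>i. inv (f i)) J"

definition axioms_CEC_Acc :: "('n \<Rightarrow> circle \<Rightarrow> circle) \<Rightarrow> bool" where
  "axioms_CEC_Acc f \<longleftrightarrow>
     (\<exists>Jp Jm. circle_interval Jp \<and> closed Jp \<and> circle_interval Jm \<and> closed Jm \<and>
        CEC_plus f Jp \<and> CEC_minus f Jm \<and>
        forward_orbit f (interior Jp) = UNIV \<and> backward_orbit f (interior Jm) = UNIV)"

definition proximal :: "('n \<Rightarrow> circle \<Rightarrow> circle) \<Rightarrow> bool" where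
  "proximal f \<longleftrightarrow>
     (\<forall>x y. \<exists>\<xi>. ((\<lambda>n. dist (fiber_iterate f \<xi> n x) (fiber_iterate f \<xi> n y)) \<longlongrightarrow> 0)
        (sup at_top at_bot))"

definition lyapunov :: "('n::topological_space \<Rightarrow> circle \<Rightarrow> circle) \<Rightarrow> ((int \<Rightarrow> 'n) \<times> circle) measure \<Rightarrow> real" where
  "lyapunov f \<mu> = (\<integral>(\<xi>, x). ln \<bar>circle_deriv (f (\<xi> 0)) x\<bar> \<partial>\<mu>)"

end

theory Submission
  imports Defs "HOL-Real_Asymp.Real_Asymp"
begin

text \<open>
  Minimality of both semigroup actions and proximality force synchronization: for most long words
  all points of the circle are pairwise contracted. An invariant finitely additive mean on all
  subsets of the circle, obtained from Tychonoff's theorem, supplies this estimate. Hence almost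
  every past determines a point of the circle, and the graph of this attractor carries an ergodic
  measure \<open>\<mu>\<^sub>-\<close> with Bernoulli marginal. If \<open>\<nu>\<close> is ergodic with nonpositive exponent, exponentially
  close points shadow each other, so Gibbs' inequality on an exponential grid of starting points,
  with weights given by Birkhoff sums of an observable, bounds the entropy of \<open>\<nu>\<close> strictly below
  \<open>log N\<close>, uniformly as long as the integrals of the observable against \<open>\<nu>\<close> and \<open>\<mu>\<^sub>-\<close> stay apart.
  Time reversal gives \<open>\<mu>\<^sub>+\<close> and the analogous bound for nonnegative exponents. Were the exponent of
  \<open>\<mu>\<^sub>-\<close> not negative, the two measures would coincide and all fiber maps would share an invariant
  probability, hence by synchronization a fixed point. Finally, an ergodic measure close to a
  nontrivial convex combination has exponent far from both extremes, so one of the two entropy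
  gaps applies to it.
\<close>

text \<open>A nonpositive exponent is what makes the entropy estimate work: along a typical orbit
  the derivatives grow subexponentially, so a grid of about \<open>exp (4 * n * e)\<close> starting
  points contains one whose orbit stays close up to time n, and naming it costs only the rate
  \<open>4 * e\<close>, with e as small as desired. Words are compared with the uniform distribution
  tilted by the exponential of a Birkhoff sum. The tilt keeps the total mass at most 1 when the
  tilting function has exponential mean at most 1 over the next letter, given the past; hence
  observables are first moved into the past by inverse iterates, which changes no integral against
  an invariant measure. Finite additivity suffices for synchronization because only masses of balls
  and of their images are compared: the image of a small arc under a word either keeps two given
  points close or contains a ball of definite mass, and the average mass of the images is the mass
  of the arc. The approximating measures may have exponents of either sign, so the gap is needed in
  both time directions; word entropies agree under reversal because reading a word backwards loses
  nothing.\<close>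

section \<open>Metric and topology of the circle\<close>

lemma circle_of_eq_iff: "circle_of s = circle_of t \<longleftrightarrow> s - t \<in> \<int>"
  by transfer simp

lemma circle_rep_bounds: "- 1/2 \<le> circle_rep x" "circle_rep x < 1/2"
  by (transfer; simp add: round_def; linarith)+

lemma circle_rep_of: "- 1/2 \<le> t \<Longrightarrow> t < 1/2 \<Longrightarrow> circle_rep (circle_of t) = t"
  by transfer (simp add: round_def floor_eq_iff)

lemma circle_of_zero: "circle_of 0 = 0"
  by transfer simp

lemma circle_of_diff: "circle_of (s - t) = circle_of s - circle_of t"
  by transfer simp

lemma circle_of_int [simp]: "circle_of (of_int k) = 0"
  by transfer simp

lemma dist_circle_of: "dist (circle_of s) (circle_of t) = \<bar>circle_rep (circle_of (s - t))\<bar>"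
  by (simp add: dist_circle_def circle_of_diff)

lemma dist_circle_of_le: "dist (circle_of s) (circle_of t) \<le> \<bar>s - t\<bar>"
  by (simp add: dist_circle_of abs_circle_rep_le)

lemma dist_circle_add_right [simp]: "dist (x + z) (y + z) = dist x (y :: circle)"
  by (simp add: dist_circle_def)

lemma dist_circle_le_half: "dist x (y :: circle) \<le> 1/2"
  using circle_rep_bounds[of "x - y"] by (simp add: dist_circle_def abs_le_iff)

lemma dist_circle_rep: "dist (x :: circle) y = \<bar>circle_rep (y - x)\<bar>"
  by (metis abs_circle_rep_minus dist_circle_def minus_diff_eq)

lemma continuous_circle_of [continuous_intros]: "continuous_on S circle_of"
proof (rule continuous_on_subset[OF _ subset_UNIV], unfold continuous_on_iff, intro ballI allI impI)
  fix x e :: real assume "0 < e"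
  then show "\<exists>d>0. \<forall>x'\<in>UNIV. dist x' x < d \<longrightarrow> dist (circle_of x') (circle_of x) < e"
    by (intro exI[of _ e]) (auto simp: dist_real_def intro: le_less_trans[OF dist_circle_of_le])
qed

lemma circle_of_surj01: "\<exists>t. 0 \<le> t \<and> t < 1 \<and> circle_of t = x"
proof -
  have "circle_of (frac (circle_rep x)) = circle_of (circle_rep x)"
    unfolding circle_of_eq_iff by (simp add: frac_def)
  then show ?thesis
    by (intro exI[of _ "frac (circle_rep x)"]) (simp add: circle_of_rep frac_lt_1)
qed

lemma compact_circle: "compact (UNIV :: circle set)"
proof -
  have "circle_of ` {0..1} = UNIV"
  proof (intro equalityI subset_UNIV subsetI)
    fix x show "x \<in> circle_of ` {0..1}"
      using circle_of_surj01[of x] by (auto intro!: image_eqI)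
  qed
  with compact_continuous_image[OF continuous_circle_of[of "{0..1}"]] show ?thesis by simp
qed

lemma circle_near:
  obtains t where "x = y + circle_of t" "\<bar>t\<bar> = dist x y"
  by (metis add.commute circle_of_rep diff_add_cancel dist_circle_def)

lemma ball_circle_of: "ball (circle_of t) r = circle_of ` {t - r<..<t + r}"
proof (intro equalityI subsetI)
  fix x assume "x \<in> ball (circle_of t) r"
  then have *: "dist x (circle_of t) < r" by (simp add: dist_commute)
  obtain s where s: "x = circle_of t + circle_of s" "\<bar>s\<bar> = dist x (circle_of t)" by (rule circle_near)
  show "x \<in> circle_of ` {t - r<..<t + r}"
    using s * by (intro image_eqI[of _ _ "t + s"]) (auto simp: circle_of_add)
next
  fix x assume "x \<in> circle_of ` {t - r<..<t + r}"
  then obtain s where "x = circle_of s" "\<bar>t - s\<bar> < r" by (auto simp: abs_less_iff)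
  then show "x \<in> ball (circle_of t) r" using dist_circle_of_le[of t s] by simp
qed

lemma open_circle_of_image:
  assumes "open I" shows "open (circle_of ` I)"
proof (unfold open_contains_ball, intro ballI)
  fix x assume "x \<in> circle_of ` I"
  then obtain t where t: "t \<in> I" "x = circle_of t" by auto
  with assms obtain r where "r > 0" "ball t r \<subseteq> I" by (auto simp: open_contains_ball)
  then show "\<exists>e>0. ball x e \<subseteq> circle_of ` I"
    by (intro exI[of _ r]) (simp add: t ball_circle_of ball_eq_greaterThanLessThan image_mono)
qed

lemma connected_circle_of_interval: "connected (circle_of ` {a<..<b})"
  by (intro connected_continuous_image continuous_circle_of) auto

lemma connected_ball_circle: "connected (ball (x :: circle) r)"
  by (metis ball_circle_of circle_of_rep connected_circle_of_interval)

lemma circle_of_inj_Ico: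
  assumes "circle_of s = circle_of t" "\<bar>s - t\<bar> < 1" shows "s = t"
proof -
  obtain k :: int where "s - t = of_int k" using assms(1) by (auto simp: circle_of_eq_iff elim: Ints_cases)
  with assms(2) have "k = 0" by linarith
  with \<open>s - t = of_int k\<close> show ?thesis by simp
qed

text \<open>Two points missing from both arcs between \<open>p\<close> and \<open>q\<close> would disconnect the set.\<close>

lemma connected_circle_contains_ball:
  fixes C :: "circle set"
  assumes C: "connected C" "p \<in> C" "q \<in> C" "dist p q \<ge> e" "e > 0"
  shows "\<exists>z. ball z (e/4) \<subseteq> C"
proof -
  \<comment> \<open>Normal form: the short arc from p to q is \<open>{a..a + t}\<close>. The two
    balls are centred at the midpoints of the two arcs, and radius e/4 keeps \<open>s1\<close>
    inside the short arc and \<open>s2\<close> inside the long one. The case of negative t is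
    reduced to this one by exchanging p and q.\<close>
  have *: "\<exists>z. ball z (e/4) \<subseteq> C"
    if pq: "p = circle_of a" "q = circle_of (a + t)" "e \<le> t" "t \<le> 1/2" "p \<in> C" "q \<in> C" for p q a t
  proof (rule ccontr)
    assume "\<nexists>z. ball z (e/4) \<subseteq> C"
    then have "\<not> ball (circle_of (a + t/2)) (e/4) \<subseteq> C" "\<not> ball (circle_of (a + t/2 + 1/2)) (e/4) \<subseteq> C"
      by auto
    then have "\<exists>s1. circle_of s1 \<notin> C \<and> a + t/2 - e/4 < s1 \<and> s1 < a + t/2 + e/4"
      "\<exists>s2. circle_of s2 \<notin> C \<and> a + t/2 + 1/2 - e/4 < s2 \<and> s2 < a + t/2 + 1/2 + e/4"
      unfolding ball_circle_of image_subset_iff by auto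
    then obtain s1 s2 where s: "circle_of s1 \<notin> C" "circle_of s2 \<notin> C"
      "a + t/2 - e/4 < s1" "s1 < a + t/2 + e/4"
      "a + t/2 + 1/2 - e/4 < s2" "s2 < a + t/2 + 1/2 + e/4"
      by blast
    have o: "a < s1" "s1 < a + t" "a + t < s2" "s2 < a + 1"
      using s pq \<open>e > 0\<close> by auto
    define U where "U = circle_of ` {s1<..<s2}"
    define V where "V = circle_of ` {s2 - 1<..<s1}"
    have "open U" "open V" by (auto simp: U_def V_def intro!: open_circle_of_image)
    moreover have "C \<subseteq> U \<union> V"
    proof
      fix x assume "x \<in> C"
      obtain u where u: "x = circle_of u" "s2 - 1 < u" "u \<le> s2"
      proof -
        define v where "v = circle_rep x"
        define u where "u = v + of_int \<lfloor>s2 - v\<rfloor>"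
        have "circle_of u = circle_of v" unfolding circle_of_eq_iff by (simp add: u_def)
        then have "x = circle_of u" by (simp add: v_def circle_of_rep)
        moreover have "s2 - 1 < u" "u \<le> s2" unfolding u_def by linarith+
        ultimately show ?thesis using that by auto
      qed
      with \<open>x \<in> C\<close> s(1,2) have "u \<noteq> s1" "u \<noteq> s2" by auto
      with u show "x \<in> U \<union> V" by (auto simp: U_def V_def intro!: imageI)
    qed
    moreover have "U \<inter> V \<inter> C = {}"
    proof -
      have "U \<inter> V = {}"
      proof (rule ccontr)
        assume "U \<inter> V \<noteq> {}"
        then obtain u v where uv: "s1 < u" "u < s2" "s2 - 1 < v" "v < s1" "circle_of u = circle_of v"
          by (auto simp: U_def V_def)
        then have "u = v" using circle_of_inj_Ico[of u v] o by auto
        with uv show False by auto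
      qed
      then show ?thesis by auto
    qed
    moreover have "p \<in> V \<inter> C" "q \<in> U \<inter> C"
      using pq o by (auto simp: U_def V_def)
    ultimately show False using connectedD[OF \<open>connected C\<close>, of U V] by blast
  qed
  obtain t where t: "q = p + circle_of t" "\<bar>t\<bar> = dist q p" by (rule circle_near)
  have "\<bar>t\<bar> \<le> 1/2" "e \<le> \<bar>t\<bar>" using t dist_circle_le_half[of q p] C by (auto simp: dist_commute)
  show ?thesis
  proof (cases "t \<ge> 0")
    case True
    then show ?thesis
      using *[of p "circle_rep p" q t] t C \<open>\<bar>t\<bar> \<le> 1/2\<close> \<open>e \<le> \<bar>t\<bar>\<close>
      by (simp add: circle_of_rep circle_of_add)
  next
    case False
    have "p = circle_of (circle_rep q + (- t))"
      unfolding circle_of_add circle_of_minus circle_of_rep by (simp add: t)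
    then show ?thesis
      using *[of q "circle_rep q" p "- t"] C \<open>\<bar>t\<bar> \<le> 1/2\<close> \<open>e \<le> \<bar>t\<bar>\<close> False
      by (simp add: circle_of_rep)
  qed
qed

section \<open>Continuously differentiable circle maps\<close>

lemma C1_circle_map_continuous:
  assumes "C1_circle_map g" shows "continuous_on UNIV g"
proof (unfold continuous_on_iff, intro ballI allI impI)
  fix x and e :: real assume "0 < e"
  have "circle_chart g x differentiable at 0" using assms by (simp add: C1_circle_map_def)
  then have "isCont (circle_chart g x) 0" by (rule differentiable_imp_continuous_within)
  then obtain d where d: "d > 0" "\<And>t. \<bar>t\<bar> < d \<Longrightarrow> \<bar>circle_chart g x t - circle_chart g x 0\<bar> < e"
    using \<open>0 < e\<close> unfolding continuous_at_eps_delta by (fastforce simp: dist_real_def)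
  show "\<exists>d>0. \<forall>x'\<in>UNIV. dist x' x < d \<longrightarrow> dist (g x') (g x) < e"
  proof (intro exI conjI ballI impI)
    fix y assume "dist y x < d"
    obtain t where t: "y = x + circle_of t" "\<bar>t\<bar> = dist y x" by (rule circle_near)
    with d(2)[of t] \<open>dist y x < d\<close> show "dist (g y) (g x) < e"
      by (simp add: circle_chart_def dist_circle_def circle_of_zero circle_rep_zero)
  qed fact
qed

lemma circle_chart_deriv:
  assumes "C1_circle_map g"
  shows "(circle_chart g x has_real_derivative circle_deriv g x) (at 0)"
  using assms unfolding C1_circle_map_def circle_deriv_def
  by (metis DERIV_deriv_iff_real_differentiable)

text \<open>Below 1/4 the sum of the representatives stays in the fundamental interval, so nothing
  wraps around. This is how charts at neighbouring points are glued.\<close>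

lemma circle_rep_add:
  "\<bar>circle_rep x\<bar> < 1/4 \<Longrightarrow> \<bar>circle_rep y\<bar> < 1/4 \<Longrightarrow> circle_rep (x + y) = circle_rep x + circle_rep y"
  using circle_rep_of[of "circle_rep x + circle_rep y"] by (simp add: circle_of_add circle_of_rep)

lemma uniformly_continuous_circle:
  fixes g :: "circle \<Rightarrow> 'b::metric_space"
  assumes "continuous_on UNIV g" "e > 0"
  shows "\<exists>d>0. \<forall>x y. dist x y < d \<longrightarrow> dist (g x) (g y) < e"
  using compact_uniformly_continuous[OF assms(1) compact_circle] assms(2)
  unfolding uniformly_continuous_on_def by (metis UNIV_I dist_commute)

text \<open>Mean value inequality for the chart at x, read on the segment from 0 to t. Uniform
  continuity of the derivative makes the radius independent of x.\<close>

lemma C1_circle_map_Lipschitz: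
  assumes g: "C1_circle_map g" and "e > 0"
  shows "\<exists>r>0. \<forall>x y. dist x y < r \<longrightarrow> dist (g x) (g y) \<le> (\<bar>circle_deriv g x\<bar> + e) * dist x y"
proof -
  obtain r1 where r1: "r1 > 0" "\<And>x y. dist x y < r1 \<Longrightarrow> dist (g x) (g y) < 1/4"
    using uniformly_continuous_circle[OF C1_circle_map_continuous[OF g], of "1/4"] by auto
  have c: "continuous_on UNIV (circle_deriv g)" using g by (simp add: C1_circle_map_def)
  obtain r2 where r2: "r2 > 0" "\<And>x y. dist x y < r2 \<Longrightarrow> dist (circle_deriv g x) (circle_deriv g y) < e"
    using uniformly_continuous_circle[OF c \<open>e > 0\<close>] by auto
  define r where "r = min r1 r2"
  have "dist (g x) (g y) \<le> (\<bar>circle_deriv g x\<bar> + e) * dist x y" if "dist x y < r" for x y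
  proof -
    obtain t where t: "y = x + circle_of t" "\<bar>t\<bar> = dist y x" by (rule circle_near)
    define h where "h = circle_chart g x"
    have dist_s: "dist (x + circle_of s) x \<le> \<bar>s\<bar>" for s
      by (simp add: dist_circle_def abs_circle_rep_le)
    \<comment> \<open>The derivative of a chart is given only at 0. Near s the chart at x is a
      constant plus the translated chart at \<open>x + circle_of s\<close>, since both displacements
      of the images are below 1/4 and their representatives add.\<close>
    have h': "(h has_real_derivative circle_deriv g (x + circle_of s)) (at s)" if s: "\<bar>s\<bar> < r" for s
    proof -
      have "((\<lambda>u. u - s) has_real_derivative 1) (at s)"
        by (auto intro!: derivative_eq_intros)
      moreover have "(circle_chart g (x + circle_of s) has_real_derivative circle_deriv g (x + circle_of s)) (at (s - s))"
        using circle_chart_deriv[OF g] by simp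
      ultimately have "((\<lambda>u. circle_chart g (x + circle_of s) (u - s)) has_real_derivative
              circle_deriv g (x + circle_of s) * 1) (at s)"
        by (intro DERIV_chain2)
      from DERIV_add[OF DERIV_const this, of "h s"]
      have *: "((\<lambda>u. h s + circle_chart g (x + circle_of s) (u - s)) has_real_derivative
              circle_deriv g (x + circle_of s)) (at s)" by simp
      show ?thesis
      proof (rule has_field_derivative_transform_within[OF *, of "r"])
        show "0 < r" using r1 r2 by (simp add: r_def)
        fix u assume "dist u s < r"
        then have u: "\<bar>u - s\<bar> < r" by (simp add: dist_real_def)
        have e1: "x + circle_of s + circle_of (u - s) = x + circle_of u"
          by (simp add: circle_of_diff)
        have "\<bar>circle_rep (g (x + circle_of s) - g x)\<bar> < 1/4"
          using r1(2)[of "x + circle_of s" x] dist_s[of s] s by (simp add: dist_circle_def r_def)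
        moreover have "\<bar>circle_rep (g (x + circle_of u) - g (x + circle_of s))\<bar> < 1/4"
        proof -
          have "dist (x + circle_of u) (x + circle_of s) \<le> \<bar>u - s\<bar>"
            using dist_circle_of_le[of u s] by (metis add.commute dist_circle_add_right)
          then show ?thesis
            using r1(2)[of "x + circle_of u" "x + circle_of s"] u by (simp add: dist_circle_def r_def)
        qed
        ultimately show "h s + circle_chart g (x + circle_of s) (u - s) = h u"
          using circle_rep_add[of "g (x + circle_of s) - g x" "g (x + circle_of u) - g (x + circle_of s)"]
          by (simp add: h_def circle_chart_def e1)
      qed auto
    qed
    have h0: "h 0 = 0" by (simp add: h_def circle_chart_def circle_of_zero circle_rep_zero)
    have ht: "\<bar>h t\<bar> = dist (g x) (g y)"
      by (simp add: h_def circle_chart_def dist_circle_rep flip: t(1))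
    have tr: "\<bar>t\<bar> < r" using t(2) that by (metis dist_commute)
    have "norm (h t - h 0) \<le> (\<bar>circle_deriv g x\<bar> + e) * norm (t - 0)"
    proof (rule field_differentiable_bound[where S = "{-\<bar>t\<bar>..\<bar>t\<bar>}" and f' = "\<lambda>s. circle_deriv g (x + circle_of s)"])
      show "convex {- \<bar>t\<bar>..\<bar>t\<bar>}" by simp
      fix s assume s: "s \<in> {- \<bar>t\<bar>..\<bar>t\<bar>}"
      then have sr: "\<bar>s\<bar> < r" using tr by auto
      then show "(h has_field_derivative circle_deriv g (x + circle_of s)) (at s within {- \<bar>t\<bar>..\<bar>t\<bar>})"
        by (intro has_field_derivative_at_within[OF h'])
      have "dist (x + circle_of s) x < r2" using dist_s[of s] sr by (simp add: r_def)
      then have "dist (circle_deriv g (x + circle_of s)) (circle_deriv g x) < e" by (rule r2)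
      then show "norm (circle_deriv g (x + circle_of s)) \<le> \<bar>circle_deriv g x\<bar> + e"
        by (auto simp: dist_real_def)
    qed auto
    then show ?thesis using t(2) by (simp add: h0 ht dist_commute)
  qed
  moreover have "r > 0" using r1(1) r2(1) by (simp add: r_def)
  ultimately show ?thesis by blast
qed

lemma C1_diffeo_inv: "C1_circle_diffeo g \<Longrightarrow> C1_circle_diffeo (inv g)"
  by (simp add: C1_circle_diffeo_def bij_imp_bij_inv inv_inv_eq)

text \<open>Chain rule: the charts of g and of its inverse compose to the identity for parameters
  below 1/2. As a consequence the derivative never vanishes and its logarithm is continuous.\<close>

lemma circle_deriv_inv:
  assumes "C1_circle_diffeo g"
  shows "circle_deriv (inv g) (g x) * circle_deriv g x = 1"
proof -
  have g: "bij g" "C1_circle_map g" "C1_circle_map (inv g)"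
    using assms by (auto simp: C1_circle_diffeo_def)
  have c0: "circle_chart g x 0 = 0" by (simp add: circle_chart_def circle_of_zero circle_rep_zero)
  have "((\<lambda>t. circle_chart (inv g) (g x) (circle_chart g x t)) has_real_derivative
      circle_deriv (inv g) (g x) * circle_deriv g x) (at 0)"
    by (rule DERIV_chain2) (use circle_chart_deriv[OF g(2), of x] circle_chart_deriv[OF g(3), of "g x"] c0 in auto)
  moreover have "((\<lambda>t. circle_chart (inv g) (g x) (circle_chart g x t)) has_real_derivative 1) (at 0)"
  proof (rule has_field_derivative_transform_within[OF DERIV_ident, of "1/2"])
    fix t :: real assume "dist t 0 < 1/2"
    then show "t = circle_chart (inv g) (g x) (circle_chart g x t)"
      using g(1) by (simp add: circle_chart_def circle_of_rep bij_is_inj circle_rep_of dist_real_def)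
  qed auto
  ultimately show ?thesis by (rule DERIV_unique)
qed

lemma circle_deriv_nonzero: "C1_circle_diffeo g \<Longrightarrow> circle_deriv g x \<noteq> 0"
  using circle_deriv_inv[of g x] by auto

text \<open>By compactness the derivative is bounded away from 0, so the additive error can be
  chosen as e times its minimum and becomes a factor \<open>exp e\<close>. In this multiplicative
  form errors accumulate linearly in the exponent along an orbit.\<close>

lemma C1_circle_diffeo_Lipschitz:
  assumes g: "C1_circle_diffeo g" and "e > 0"
  shows "\<exists>r>0. \<forall>x y. dist x y < r \<longrightarrow> dist (g x) (g y) \<le> exp (ln \<bar>circle_deriv g x\<bar> + e) * dist x y"
proof -
  have c1: "C1_circle_map g" using g by (simp add: C1_circle_diffeo_def)
  have "continuous_on UNIV (\<lambda>x. \<bar>circle_deriv g x\<bar>)"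
    using c1 by (auto simp: C1_circle_map_def intro: continuous_intros)
  then obtain z where z: "\<And>x. \<bar>circle_deriv g z\<bar> \<le> \<bar>circle_deriv g x\<bar>"
    using continuous_attains_inf[OF compact_circle UNIV_not_empty] by blast
  define d where "d = \<bar>circle_deriv g z\<bar> * e"
  have z0: "\<bar>circle_deriv g z\<bar> > 0" using circle_deriv_nonzero[OF g] by simp
  then have "d > 0" using \<open>e > 0\<close> by (simp add: d_def)
  obtain r where r: "r > 0"
    "\<And>x y. dist x y < r \<Longrightarrow> dist (g x) (g y) \<le> (\<bar>circle_deriv g x\<bar> + d) * dist x y"
    using C1_circle_map_Lipschitz[OF c1 \<open>d > 0\<close>] by auto
  have "\<bar>circle_deriv g x\<bar> + d \<le> exp (ln \<bar>circle_deriv g x\<bar> + e)" for x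
  proof -
    have "\<bar>circle_deriv g x\<bar> + d \<le> \<bar>circle_deriv g x\<bar> * (1 + e)"
      using z[of x] \<open>e > 0\<close> by (simp add: d_def algebra_simps mult_left_mono)
    also have "\<dots> \<le> \<bar>circle_deriv g x\<bar> * exp e"
      by (intro mult_left_mono) auto
    also have "\<dots> = exp (ln \<bar>circle_deriv g x\<bar> + e)"
      using circle_deriv_nonzero[OF g, of x] by (simp add: exp_add)
    finally show ?thesis .
  qed
  then have "dist (g x) (g y) \<le> exp (ln \<bar>circle_deriv g x\<bar> + e) * dist x y" if "dist x y < r" for x y
    by (meson r(2)[OF that] order_trans mult_right_mono zero_le_dist)
  with r(1) show ?thesis by blast
qed

text \<open>Supplies the short intervals to which the covering axioms are applied. Length is
  measured in the fundamental domain \<open>{0..<1}\<close>, where the arc is covered by three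
  translates of an interval of length \<open>2 * r\<close>; hence the crude bound
  \<open>6 * r\<close>.\<close>

lemma circle_interval_small_ball:
  assumes "open V" "x \<in> V" "K > (0::real)"
  obtains H where "circle_interval H" "x \<in> H" "H \<subseteq> V" "circle_length H < K"
proof -
  obtain e where e: "e > 0" "ball x e \<subseteq> V" using assms by (auto simp: open_contains_ball)
  obtain a where a: "0 \<le> a" "a < 1" "circle_of a = x" using circle_of_surj01 by blast
  define r where "r = min (min e K / 8) (1/8)"
  have r: "0 < r" "r < e" "6 * r < K" "r < 1/4" using e assms(3) by (auto simp: r_def min_def)
  define H where "H = circle_of ` {a - r..a + r}"
  have "H \<subseteq> V"
  proof -
    have "H \<subseteq> ball x e" unfolding a(3)[symmetric] ball_circle_of H_def using r by (intro image_mono) auto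
    with e show ?thesis by simp
  qed
  moreover have "x \<in> H" using a r by (auto simp: H_def)
  moreover have "circle_interval H"
  proof -
    have "circle_of (a + 1/2) \<notin> H"
    proof
      assume "circle_of (a + 1/2) \<in> H"
      then obtain s where s: "a - r \<le> s" "s \<le> a + r" "circle_of (a + 1/2) = circle_of s" by (auto simp: H_def)
      then have "a + 1/2 = s" using r by (intro circle_of_inj_Ico) (auto simp: abs_less_iff)
      with s r show False by simp
    qed
    moreover have "is_interval {a - r..a + r}" "interior {a - r..a + r} \<noteq> {}"
      using r by (auto simp: is_interval_cc)
    ultimately show ?thesis unfolding circle_interval_def H_def by blast
  qed
  moreover have "circle_length H < K"
  proof -
    let ?S = "{t \<in> {0..<1}. circle_of t \<in> H}"
    have sub: "?S \<subseteq> {a - r..a + r} \<union> ({a + 1 - r..a + 1 + r} \<union> {a - 1 - r..a - 1 + r})"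
    proof
      fix t assume "t \<in> ?S"
      then obtain s where s: "0 \<le> t" "t < 1" "a - r \<le> s" "s \<le> a + r" "t - s \<in> \<int>"
        by (auto simp: H_def circle_of_eq_iff)
      then obtain k :: int where k: "t - s = of_int k" by (auto elim: Ints_cases)
      have "real_of_int k < 2" "real_of_int k > -2" using k s a r by linarith+
      then have "k < 2" "k > -2" by linarith+
      then consider "k = 0" | "k = 1" | "k = -1" by linarith
      then show "t \<in> {a - r..a + r} \<union> ({a + 1 - r..a + 1 + r} \<union> {a - 1 - r..a - 1 + r})"
        using k s by cases auto
    qed
    have em: "emeasure lborel ?S \<le> ennreal (6 * r)"
    proof -
      have "emeasure lborel ?S \<le> emeasure lborel ({a - r..a + r} \<union> ({a + 1 - r..a + 1 + r} \<union> {a - 1 - r..a - 1 + r}))"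
        by (intro emeasure_mono sub) auto
      also have "\<dots> \<le> emeasure lborel {a - r..a + r} + emeasure lborel ({a + 1 - r..a + 1 + r} \<union> {a - 1 - r..a - 1 + r})"
        by (intro emeasure_subadditive) auto
      also have "\<dots> \<le> emeasure lborel {a - r..a + r} + (emeasure lborel {a + 1 - r..a + 1 + r} + emeasure lborel {a - 1 - r..a - 1 + r})"
        by (intro add_left_mono emeasure_subadditive) auto
      also have "\<dots> = ennreal (2 * r) + (ennreal (2 * r) + ennreal (2 * r))" using r by simp
      also have "\<dots> = ennreal (6 * r)" using r by (simp flip: ennreal_plus)
      finally show ?thesis .
    qed
    have "circle_length H \<le> 6 * r"
      unfolding circle_length_def measure_def using enn2real_mono[OF em] r by simp
    with r show ?thesis by simp
  qed
  ultimately show ?thesis using that by blast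
qed

subsection \<open>Averages over words\<close>

text \<open>Expectation over a uniformly random word of length n. It replaces integration over the
  shift space wherever only finitely many letters matter.\<close>

definition wavg :: "nat \<Rightarrow> ('n::finite list \<Rightarrow> real) \<Rightarrow> real" where
  "wavg n g = (\<Sum>w | length w = n. g w) / real CARD('n) ^ n"

lemma finite_words [simp]: "finite {w :: 'n::finite list. length w = n}"
  using finite_lists_length_eq[of "UNIV :: 'n set" n] by simp

lemma card_words: "card {w :: 'n::finite list. length w = n} = CARD('n) ^ n"
  using card_lists_length_eq[of "UNIV :: 'n set" n] by simp

lemma wavg_0 [simp]: "wavg 0 g = g []"
proof -
  have "{w :: 'a list. length w = 0} = {[]}" by auto
  then show ?thesis by (simp add: wavg_def)
qed

text \<open>Independence of consecutive blocks of letters; the Markov property of the random walk on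
  the circle in finite form.\<close>

lemma wavg_append:
  fixes g :: "'n::finite list \<Rightarrow> real"
  shows "wavg (m + n) g = wavg m (\<lambda>u. wavg n (\<lambda>w. g (u @ w)))"
proof -
  have "(\<Sum>w | length w = m + n. g w) = (\<Sum>(u, w) \<in> {u. length u = m} \<times> {w. length w = n}. g (u @ w))"
    by (rule sum.reindex_bij_witness[of _ "\<lambda>(u, w). u @ w" "\<lambda>w. (take m w, drop m w)"]) auto
  also have "\<dots> = (\<Sum>u | length u = m. \<Sum>w | length w = n. g (u @ w))"
    by (simp add: sum.cartesian_product)
  finally show ?thesis
    by (simp add: wavg_def power_add sum_divide_distrib[symmetric] mult.commute)
qed

lemma wavg_1:
  fixes g :: "'n::finite list \<Rightarrow> real"
  shows "wavg (Suc 0) g = (\<Sum>i\<in>UNIV. g [i]) / real CARD('n)"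
proof -
  have "(\<Sum>w | length w = Suc 0. g w) = (\<Sum>i\<in>UNIV. g [i])"
    by (rule sum.reindex_bij_witness[of _ "\<lambda>i. [i]" hd]) (auto simp: length_Suc_conv)
  then show ?thesis by (simp add: wavg_def)
qed

lemma wavg_add: "wavg n (\<lambda>w. g w + h w) = wavg n g + wavg n h"
  by (simp add: wavg_def sum.distrib add_divide_distrib)

lemma wavg_diff: "wavg n (\<lambda>w. g w - h w) = wavg n g - wavg n h"
  by (simp add: wavg_def sum_subtractf diff_divide_distrib)

lemma wavg_cmult: "wavg n (\<lambda>w. c * g w) = c * wavg n g"
  by (simp add: wavg_def sum_distrib_left)

lemma wavg_mult_right: "wavg n (\<lambda>w. g w * c) = wavg n g * c"
  by (simp add: wavg_def sum_distrib_right)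

lemma wavg_divide: "wavg n (\<lambda>w. g w / c) = wavg n g / c"
  by (simp add: wavg_def sum_divide_distrib[symmetric] mult.commute)

lemma wavg_sum: "wavg n (\<lambda>w. \<Sum>i\<in>I. g i w) = (\<Sum>i\<in>I. wavg n (g i))"
  by (simp add: wavg_def sum.swap[of _ I] sum_divide_distrib)

lemma wavg_const [simp]: "wavg n (\<lambda>w :: 'n::finite list. c) = c"
  by (simp add: wavg_def card_words)

lemma wavg_mono: "(\<And>w. length w = n \<Longrightarrow> g w \<le> h w) \<Longrightarrow> wavg n g \<le> wavg n h"
  unfolding wavg_def by (intro divide_right_mono sum_mono) auto

lemma wavg_cong: "(\<And>w. length w = n \<Longrightarrow> g w = h w) \<Longrightarrow> wavg n g = wavg n h"
  unfolding wavg_def by (intro arg_cong2[where f = "(/)"] sum.cong) auto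

lemma wavg_le_const: "(\<And>w. length w = n \<Longrightarrow> g w \<le> c) \<Longrightarrow> wavg n g \<le> c"
  using wavg_mono[of n g "\<lambda>_. c"] by simp

lemma wavg_ge_const: "(\<And>w. length w = n \<Longrightarrow> c \<le> g w) \<Longrightarrow> c \<le> wavg n g"
  using wavg_mono[of n "\<lambda>_. c" g] by simp

lemma wavg_nonneg: "(\<And>w. length w = n \<Longrightarrow> 0 \<le> g w) \<Longrightarrow> 0 \<le> wavg n g"
  by (rule wavg_ge_const)

lemma wavg_abs: "\<bar>wavg n g\<bar> \<le> wavg n (\<lambda>w. \<bar>g w\<bar>)"
  by (simp add: wavg_def sum_abs divide_right_mono)

lemma wavg_Suc:
  fixes g :: "'n::finite list \<Rightarrow> real"
  shows "wavg (Suc n) g = (\<Sum>i\<in>UNIV. wavg n (\<lambda>w. g (i # w))) / real CARD('n)"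
  using wavg_append[of "Suc 0" n g] by (simp add: wavg_1)

lemma wavg_snoc:
  fixes g :: "'n::finite list \<Rightarrow> real"
  shows "wavg (Suc n) g = wavg n (\<lambda>w. (\<Sum>i\<in>UNIV. g (w @ [i])) / real CARD('n))"
  using wavg_append[of n "Suc 0" g] by (simp add: wavg_1)

text \<open>A single good word lowers the average in proportion to its probability. This produces
  the geometric decay in the synchronization estimate.\<close>

lemma wavg_single_le:
  fixes g :: "'n::finite list \<Rightarrow> real"
  assumes "length u = n" "\<And>w. length w = n \<Longrightarrow> g w \<le> a" "g u \<le> b" "b \<le> a"
  shows "wavg n g \<le> a - (a - b) / real CARD('n) ^ n"
proof -
  have "(\<Sum>w | length w = n. a - g w) \<ge> (\<Sum>w\<in>{u}. a - g w)"
    by (rule sum_mono2) (use assms in auto)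
  then have "a - b \<le> (\<Sum>w | length w = n. a - g w)" using assms by simp
  then have "(a - b) / real CARD('n) ^ n \<le> wavg n (\<lambda>w. a - g w)"
    by (simp add: wavg_def divide_right_mono)
  then show ?thesis by (simp add: wavg_diff)
qed

subsection \<open>Minimality of both semigroup actions\<close>

lemma bij_fold: "(\<And>i. bij (f i)) \<Longrightarrow> bij (fold f w)"
  by (induction w) (auto intro: bij_comp)

lemma inv_fold: "(\<And>i. bij (f i)) \<Longrightarrow> inv (fold f w) = fold (\<lambda>i. inv (f i)) (rev w)"
  by (induction w) (auto simp: o_inv_distrib bij_fold)

lemma continuous_fold:
  fixes f :: "'n \<Rightarrow> 'a::topological_space \<Rightarrow> 'a"
  shows "(\<And>i. continuous_on UNIV (f i)) \<Longrightarrow> continuous_on UNIV (fold f w)"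
proof (induction w)
  case (Cons a w)
  then have "continuous_on UNIV (fold f w \<circ> f a)"
    by (intro continuous_on_compose) (auto intro: continuous_on_subset)
  then show ?case by (simp add: comp_def)
qed (auto intro: continuous_intros)

lemma skew_iterate_snd: "\<exists>w. snd ((skew f ^^ n) z) = fold f w (snd z)"
proof (induction n)
  case 0
  show ?case by (intro exI[of _ "[]"]) simp
next
  case (Suc n)
  then obtain w where "snd ((skew f ^^ n) z) = fold f w (snd z)" by blast
  then have "snd ((skew f ^^ Suc n) z) = fold f (w @ [fst ((skew f ^^ n) z) 0]) (snd z)"
    by (simp add: skew_def case_prod_unfold)
  then show ?case by blast
qed

text \<open>Transitivity of the skew product, tested on products of the whole shift space with fiber
  sets.\<close>

lemma transitive_words:
  fixes f :: "'n::topological_space \<Rightarrow> circle \<Rightarrow> circle"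
  assumes "topologically_transitive (skew f)" "open U" "U \<noteq> {}" "open V" "V \<noteq> {}"
  obtains w x where "x \<in> U" "fold f w x \<in> V"
proof -
  have "open ((UNIV :: (int \<Rightarrow> 'n) set) \<times> U)" "open ((UNIV :: (int \<Rightarrow> 'n) set) \<times> V)"
    using assms by (auto intro: open_Times)
  moreover have "(UNIV :: (int \<Rightarrow> 'n) set) \<times> U \<noteq> {}" "(UNIV :: (int \<Rightarrow> 'n) set) \<times> V \<noteq> {}"
    using assms by auto
  ultimately obtain n where "(skew f ^^ n) ` (UNIV \<times> U) \<inter> UNIV \<times> V \<noteq> {}"
    using assms(1) unfolding topologically_transitive_def by metis
  then obtain z where z: "snd z \<in> U" "snd ((skew f ^^ n) z) \<in> V"
  proof -
    from \<open>(skew f ^^ n) ` (UNIV \<times> U) \<inter> UNIV \<times> V \<noteq> {}\<close>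
    obtain z' where "z' \<in> (skew f ^^ n) ` (UNIV \<times> U)" "snd z' \<in> V"
      unfolding ex_in_conv[symmetric] Int_iff mem_Times_iff by (elim exE conjE)
    moreover from this(1) obtain z where "z' = (skew f ^^ n) z" "z \<in> UNIV \<times> U"
      by (rule imageE)
    ultimately show ?thesis by (intro that[of z]) (simp_all add: mem_Times_iff)
  qed
  then show ?thesis using skew_iterate_snd[where f = f and n = n and z = z] that by auto
qed

text \<open>Accessibility carries y by a word to a point z in the interior of J. Transitivity gives
  x in J that a word u sends into V, and a tiny interval H around x is still sent into V by u. The
  backward covering axiom expands H over a neighbourhood of J, so some backward word maps a point of
  H to z; read forwards, this word sends z into H, and u then leads into V.\<close>

lemma forward_minimal:
  fixes f :: "'n::topological_space \<Rightarrow> circle \<Rightarrow> circle"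
  assumes bij: "\<And>i. bij (f i)" and cont: "\<And>i. continuous_on UNIV (f i)"
    and trans: "topologically_transitive (skew f)"
    and ax: "axioms_CEC_Acc f" and V: "open V" "V \<noteq> {}"
  shows "\<exists>w. fold f w y \<in> V"
proof -
  obtain J where J: "CEC_minus f J" "backward_orbit f (interior J) = UNIV"
    using ax by (auto simp: axioms_CEC_Acc_def)
  have y: "y \<in> backward_orbit f (interior J)" by (simp add: J(2))
  obtain w z where w: "z \<in> interior J" "y = inv (fold f w) z"
    using y unfolding backward_orbit_def by auto
  have z: "fold f w y = z" using bij_fold[of f w] bij w(2) by (simp add: bij_is_surj surj_f_inv_f)
  have zJ: "z \<in> J" using w interior_subset by blast
  obtain u x where u: "x \<in> interior J" "fold f u x \<in> V"
  proof (rule transitive_words[OF trans open_interior[of J] _ V])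
    show "interior J \<noteq> {}" using w by auto
  qed (use that in blast)
  obtain K1 K4 where K: "K1 > 0" "K4 > 0"
    "\<And>H. circle_interval H \<Longrightarrow> H \<inter> J \<noteq> {} \<Longrightarrow> circle_length H < K1 \<Longrightarrow>
       \<exists>w. (\<Union>x\<in>J. ball x K4) \<subseteq> fold (\<lambda>i. inv (f i)) w ` H"
    using J(1) unfolding CEC_minus_def CEC_plus_def by metis
  have "open (fold f u -` V)" using continuous_fold[of f u] cont V(1)
    by (auto intro: open_vimage)
  then obtain H where H: "circle_interval H" "x \<in> H" "H \<subseteq> fold f u -` V" "circle_length H < K1"
    using circle_interval_small_ball[of "fold f u -` V" x K1] u K(1) by auto
  have "x \<in> J" using u interior_subset by blast
  then obtain v where "(\<Union>x\<in>J. ball x K4) \<subseteq> fold (\<lambda>i. inv (f i)) v ` H" using K(3)[of H] H by auto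
  moreover have "z \<in> (\<Union>x\<in>J. ball x K4)" using zJ K(2) by (intro UN_I[of z]) auto
  ultimately have "z \<in> fold (\<lambda>i. inv (f i)) v ` H" by (rule subsetD)
  then obtain h where h: "h \<in> H" "z = fold (\<lambda>i. inv (f i)) v h" by (elim imageE)
  have "fold (\<lambda>i. inv (f i)) v = inv (fold f (rev v))" using inv_fold[of f "rev v"] bij by simp
  then have "fold f (rev v) z = h"
    using h(2) bij_fold[of f "rev v"] bij by (simp add: bij_is_surj surj_f_inv_f)
  then have "fold f (w @ rev v @ u) y \<in> V" using z h(1) H(3) by auto
  then show ?thesis by blast
qed

text \<open>The time-reversed argument, with the forward covering axiom. Transitivity is a forward
  notion, so here it is applied from V to J, and the interval H lies around the image point
  \<open>fold f u x\<close>, where the reversed word leads back into V.\<close>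

lemma backward_minimal:
  fixes f :: "'n::topological_space \<Rightarrow> circle \<Rightarrow> circle"
  assumes bij: "\<And>i. bij (f i)" and cont: "\<And>i. continuous_on UNIV (\<lambda>x. inv (f i) x)"
    and trans: "topologically_transitive (skew f)"
    and ax: "axioms_CEC_Acc f" and V: "open V" "V \<noteq> {}"
  shows "\<exists>w. fold (\<lambda>i. inv (f i)) w y \<in> V"
proof -
  let ?g = "\<lambda>i. inv (f i)"
  have bg: "bij (?g i)" for i using bij by (simp add: bij_imp_bij_inv)
  have gf: "fold ?g (rev v) (fold f v x) = x" for v x
    using inv_fold[of f v] bij bij_fold[of f v] by (metis bij_is_inj inv_f_f)
  obtain J where J: "CEC_plus f J" "forward_orbit f (interior J) = UNIV"
    using ax by (auto simp: axioms_CEC_Acc_def)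
  have y: "y \<in> forward_orbit f (interior J)" by (simp add: J(2))
  obtain w z where w: "z \<in> interior J" "y = fold f w z"
    using y unfolding forward_orbit_def by auto
  have zJ: "z \<in> J" using w interior_subset by blast
  obtain u x where u: "x \<in> V" "fold f u x \<in> interior J"
  proof (rule transitive_words[OF trans V open_interior[of J]])
    show "interior J \<noteq> {}" using w by auto
  qed (use that in blast)
  obtain K1 K4 where K: "K1 > 0" "K4 > 0"
    "\<And>H. circle_interval H \<Longrightarrow> H \<inter> J \<noteq> {} \<Longrightarrow> circle_length H < K1 \<Longrightarrow>
       \<exists>w. (\<Union>x\<in>J. ball x K4) \<subseteq> fold f w ` H"
    using J(1) unfolding CEC_plus_def by metis
  have "open (fold ?g (rev u) -` V)" using continuous_fold[of ?g "rev u"] cont V(1)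
    by (auto intro: open_vimage)
  then obtain H where H: "circle_interval H" "fold f u x \<in> H" "H \<subseteq> fold ?g (rev u) -` V" "circle_length H < K1"
    using circle_interval_small_ball[of "fold ?g (rev u) -` V" "fold f u x" K1] u K(1) by (auto simp: gf)
  have "fold f u x \<in> J" using u interior_subset by blast
  then obtain v where "(\<Union>x\<in>J. ball x K4) \<subseteq> fold f v ` H" using K(3)[of H] H by auto
  moreover have "z \<in> (\<Union>x\<in>J. ball x K4)" using zJ K(2) by (intro UN_I[of z]) auto
  ultimately have "z \<in> fold f v ` H" by (rule subsetD)
  then obtain h where h: "h \<in> H" "z = fold f v h" by (elim imageE)
  have "fold ?g (rev w @ rev v @ rev u) y \<in> V"
    using h H(3) w by (auto simp: gf)
  then show ?thesis by blast
qed

subsection \<open>Synchronization\<close>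

text \<open>A cluster point, in Tychonoff's topology on all set functions, of empirical frequencies.\<close>

lemma invariant_mean:
  fixes f :: "'n::finite \<Rightarrow> 'a \<Rightarrow> 'a"
  assumes bij: "\<And>i. bij (f i)"
  obtains \<psi> :: "'a set \<Rightarrow> real" where "\<And>S. 0 \<le> \<psi> S" "\<psi> UNIV = 1"
    "\<And>S T. S \<inter> T = {} \<Longrightarrow> \<psi> (S \<union> T) = \<psi> S + \<psi> T"
    "\<And>S. \<psi> S = (\<Sum>i\<in>UNIV. \<psi> (f i ` S)) / real CARD('n)"
proof -
  define p :: 'a where "p = undefined"
  \<comment> \<open>The probability that the preimage of p under a random word of length j lies in
    S. Moving S instead of p means that one more letter at the start of the word replaces S by its
    image under a single map.\<close>
  define u where "u j S = wavg j (\<lambda>w. of_bool (p \<in> fold f w ` S))" for j S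
  define A where "A n S = (\<Sum>j<n. u j S) / real n" for n S
  have u01: "0 \<le> u j S" "u j S \<le> 1" for j S
    by (auto simp: u_def intro!: wavg_nonneg wavg_le_const)
  have A01: "0 \<le> A n S" "A n S \<le> 1" for n S
  proof -
    show "0 \<le> A n S" by (simp add: A_def sum_nonneg u01)
    have "(\<Sum>j<n. u j S) \<le> (\<Sum>j<n. 1)" by (intro sum_mono u01)
    then show "A n S \<le> 1" by (cases "n = 0") (simp_all add: A_def divide_le_eq_1)
  qed
  define U :: "('a set \<Rightarrow> real) set" where "U = PiE UNIV (\<lambda>_. {0..1})"
  have "compact U"
  proof -
    have "compactin (product_topology (\<lambda>_. euclidean) UNIV) (PiE (UNIV :: 'a set set) (\<lambda>_. {0..1::real}))"
      unfolding compactin_PiE by simp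
    then show ?thesis by (simp add: U_def euclidean_product_topology)
  qed
  moreover have "filtermap A sequentially \<noteq> bot" by (simp add: filtermap_bot_iff)
  moreover have "filtermap A sequentially \<le> principal U"
    unfolding le_principal eventually_filtermap U_def by (intro always_eventually) (simp add: A01 PiE_def)
  ultimately obtain \<psi> where \<psi>: "inf (nhds \<psi>) (filtermap A sequentially) \<noteq> bot"
    unfolding compact_filter eventually_filtermap by (auto simp: le_principal eventually_filtermap)
  \<comment> \<open>The cluster point is pulled back to a filter on the natural numbers finer than
    \<open>sequentially\<close>; along it the frequencies of all sets converge
    simultaneously.\<close>
  define G where "G = inf (filtercomap A (nhds \<psi>)) sequentially"
  have "G \<noteq> bot"
  proof
    assume "G = bot"
    then obtain P R where PQ: "eventually P (nhds \<psi>)" "eventually R sequentially" "\<And>n. P (A n) \<Longrightarrow> R n \<Longrightarrow> False"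
      unfolding G_def trivial_limit_def eventually_inf eventually_filtercomap by metis
    have "eventually (\<lambda>\<theta>. \<not> P \<theta>) (filtermap A sequentially)"
      unfolding eventually_filtermap using PQ(2) by (rule eventually_mono) (use PQ(3) in blast)
    with PQ(1) have "eventually (\<lambda>_. False) (inf (nhds \<psi>) (filtermap A sequentially))"
      unfolding eventually_inf by blast
    with \<psi> show False by (simp add: trivial_limit_def)
  qed
  have "(A \<longlongrightarrow> \<psi>) G" unfolding G_def filterlim_def
    by (metis filtermap_mono filtermap_filtercomap inf_le1 order_trans)
  then have lim: "((\<lambda>n. A n S) \<longlongrightarrow> \<psi> S) G" for S
  proof -
    have "continuous_on UNIV (\<lambda>\<theta> :: 'a set \<Rightarrow> real. \<theta> S)" by (rule continuous_on_product_coordinates)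
    then have o: "open ((\<lambda>\<theta> :: 'a set \<Rightarrow> real. \<theta> S) -` T)" if "open T" for T
      using that by (auto intro: open_vimage)
    show ?thesis
    proof (rule topological_tendstoI)
      fix T assume "open T" "\<psi> S \<in> T"
      with topological_tendstoD[OF \<open>(A \<longlongrightarrow> \<psi>) G\<close> o[of T]]
      show "eventually (\<lambda>n. A n S \<in> T) G" by simp
    qed
  qed
  have Gle: "G \<le> sequentially" by (simp add: G_def)
  have ev: "eventually (\<lambda>n. n > 0) G"
    using filter_leD[OF Gle eventually_gt_at_top[of 0]] .
  show ?thesis
  proof (rule that[of \<psi>])
    show "0 \<le> \<psi> S" for S
      by (rule tendsto_lowerbound[OF lim]) (use A01 \<open>G \<noteq> bot\<close> in auto)
    have "A n UNIV = 1" if "n > 0" for n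
    proof -
      have "fold f w ` UNIV = UNIV" for w using bij_fold[of f w] bij by (simp add: bij_is_surj)
      then show ?thesis using that by (simp add: A_def u_def)
    qed
    then have "eventually (\<lambda>n. A n UNIV = 1) G" using ev by (auto elim: eventually_mono)
    from tendsto_eventually[OF this] show "\<psi> UNIV = 1"
      using lim[of UNIV] \<open>G \<noteq> bot\<close> by (meson tendsto_unique)
    show "\<psi> (S \<union> T) = \<psi> S + \<psi> T" if "S \<inter> T = {}" for S T
    proof -
      have "of_bool (p \<in> fold f w ` (S \<union> T)) = (of_bool (p \<in> fold f w ` S) :: real) + of_bool (p \<in> fold f w ` T)" for w
        using bij_is_inj[OF bij_fold[of f w]] bij that by (auto dest: injD)
      then have "A n (S \<union> T) = A n S + A n T" for n
        by (simp add: A_def u_def wavg_add sum.distrib add_divide_distrib)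
      then have "((\<lambda>n. A n (S \<union> T)) \<longlongrightarrow> \<psi> S + \<psi> T) G"
        using tendsto_add[OF lim[of S] lim[of T]] by simp
      then show ?thesis using lim \<open>G \<noteq> bot\<close> by (meson tendsto_unique)
    qed
    show "\<psi> S = (\<Sum>i\<in>UNIV. \<psi> (f i ` S)) / real CARD('n)" for S
    proof -
      have "(\<Sum>i\<in>UNIV. u j (f i ` S)) / real CARD('n) = u (Suc j) S" for j
        by (simp add: u_def wavg_Suc image_comp)
      \<comment> \<open>Averaging over the images of S shifts the summation index of the Cesaro mean
        by one, so only the two boundary terms survive, divided by n.\<close>
      then have eq: "(\<Sum>i\<in>UNIV. A n (f i ` S)) / real CARD('n) = A n S + (u n S - u 0 S) / real n" for n
      proof -
        assume *: "\<And>j. (\<Sum>i\<in>UNIV. u j (f i ` S)) / real CARD('n) = u (Suc j) S"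
        have "(\<Sum>i\<in>UNIV. A n (f i ` S)) / real CARD('n) = (\<Sum>j<n. (\<Sum>i\<in>UNIV. u j (f i ` S)) / real CARD('n)) / real n"
          unfolding A_def sum_divide_distrib[symmetric] by (subst sum.swap) (simp add: sum_divide_distrib mult.commute)
        also have "\<dots> = (\<Sum>j<n. u (Suc j) S) / real n" by (simp only: *)
        also have "(\<Sum>j<n. u (Suc j) S) = (\<Sum>j<n. u j S) + (u n S - u 0 S)"
          using sum_lessThan_telescope[of "\<lambda>j. u j S" n] by (simp add: sum_subtractf)
        finally show ?thesis by (simp add: A_def add_divide_distrib)
      qed
      have "((\<lambda>n. (u n S - u 0 S) / real n) \<longlongrightarrow> 0) sequentially"
      proof (rule Lim_null_comparison)
        show "eventually (\<lambda>n. norm ((u n S - u 0 S) / real n) \<le> 1 / real n) sequentially"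
        proof (intro always_eventually allI)
          fix n
          have "\<bar>u n S - u 0 S\<bar> \<le> 1" using u01[of n S] u01[of 0 S] by linarith
          then show "norm ((u n S - u 0 S) / real n) \<le> 1 / real n" by (simp add: divide_right_mono)
        qed
      qed (rule lim_1_over_n)
      then have "((\<lambda>n. (u n S - u 0 S) / real n) \<longlongrightarrow> 0) G" by (rule filterlim_mono[OF _ order_refl Gle])
      from tendsto_add[OF lim[of S] this]
      have "((\<lambda>n. (\<Sum>i\<in>UNIV. A n (f i ` S)) / real CARD('n)) \<longlongrightarrow> \<psi> S) G" by (simp add: eq)
      moreover have "((\<lambda>n. (\<Sum>i\<in>UNIV. A n (f i ` S)) / real CARD('n)) \<longlongrightarrow> (\<Sum>i\<in>UNIV. \<psi> (f i ` S)) / real CARD('n)) G"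
        by (intro tendsto_divide tendsto_sum lim tendsto_const) simp
      ultimately show ?thesis using \<open>G \<noteq> bot\<close> by (meson tendsto_unique)
    qed
  qed
qed


lemma infinite_circle: "infinite (UNIV :: circle set)"
proof
  assume "finite (UNIV :: circle set)"
  then have "finite (circle_of ` {0<..<1})" by (rule rev_finite_subset) simp
  moreover have "inj_on circle_of {0<..<1}"
    by (rule inj_onI, rule circle_of_inj_Ico) (auto simp: abs_less_iff)
  ultimately have "finite {0<..<1::real}" by (rule finite_imageD)
  then show False by (simp add: infinite_Ioo)
qed

section \<open>Minimal contracting families of circle homeomorphisms\<close>

text \<open>The topological properties on which synchronization rests. They are available for the
  fiber maps and for their inverses, and the locale is instantiated for both families.\<close>

locale circle_homeos =
  fixes f :: "'n::finite \<Rightarrow> circle \<Rightarrow> circle"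
  assumes bij: "\<And>i. bij (f i)"
    and cont: "\<And>i. continuous_on UNIV (f i)"
    and cont_inv: "\<And>i. continuous_on UNIV (inv (f i))"
    and fwd_min: "\<And>y V. open V \<Longrightarrow> V \<noteq> {} \<Longrightarrow> \<exists>w. fold f w y \<in> V"
    and bwd_min: "\<And>y V. open V \<Longrightarrow> V \<noteq> {} \<Longrightarrow> \<exists>w. fold (\<lambda>i. inv (f i)) w y \<in> V"
    and contracting: "\<And>x y e. e > 0 \<Longrightarrow> \<exists>w. dist (fold f w x) (fold f w y) < e"
begin

lemma no_finite_invariant:
  assumes "finite Z" "z \<in> Z" "\<And>i z. z \<in> Z \<Longrightarrow> f i z \<in> Z" shows False
proof -
  have Z: "fold f w z \<in> Z" if "z \<in> Z" for w z using that by (induction w arbitrary: z) (auto intro: assms)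
  have "- Z \<noteq> {}" using infinite_circle assms(1) by (metis Compl_UNIV_eq double_compl finite_subset subset_refl)
  moreover have "open (- Z)" using finite_imp_closed[OF assms(1)] by (rule open_Compl)
  ultimately show False using fwd_min[of "- Z" z] Z assms(2) by blast
qed

lemma fold_inverse: "inv (fold f w) (fold f w x) = x" "fold f w (inv (fold f w) x) = x"
  using bij_fold[of f w] bij by (auto simp: bij_is_inj bij_is_surj surj_f_inv_f)

lemma open_fold_image: "open V \<Longrightarrow> open (fold f w ` V)"
proof -
  assume "open V"
  have "continuous_on UNIV (inv (fold f w))"
    unfolding inv_fold[OF bij] by (rule continuous_fold) (rule cont_inv)
  then have "open (inv (fold f w) -` V)" using \<open>open V\<close> by (auto intro: open_vimage)
  moreover have "inv (fold f w) -` V = fold f w ` V"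
  proof (intro equalityI subsetI)
    fix x assume "x \<in> inv (fold f w) -` V"
    then show "x \<in> fold f w ` V"
      by (intro image_eqI[of _ _ "inv (fold f w) x"]) (simp_all add: fold_inverse)
  qed (auto simp: fold_inverse)
  ultimately show ?thesis by simp
qed

end

text \<open>\<open>mean_avg\<close> is stationarity for the inverse maps, since the image of S under
  \<open>f i\<close> is its preimage under \<open>inv (f i)\<close>. The mean is defined on all
  sets, so no measurability question arises for images of balls.\<close>

locale circle_invariant_mean = circle_homeos f for f :: "'n::finite \<Rightarrow> circle \<Rightarrow> circle" +
  fixes \<psi> :: "circle set \<Rightarrow> real"
  assumes mean_nonneg: "0 \<le> \<psi> S" and mean_UNIV: "\<psi> UNIV = 1"
    and mean_Un: "S \<inter> T = {} \<Longrightarrow> \<psi> (S \<union> T) = \<psi> S + \<psi> T"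
    and mean_avg: "\<psi> S = (\<Sum>i\<in>UNIV. \<psi> (f i ` S)) / real CARD('n)"
begin

lemma mean_mono: "S \<subseteq> T \<Longrightarrow> \<psi> S \<le> \<psi> T"
  using mean_Un[of S "T - S"] mean_nonneg[of "T - S"] by (simp add: Un_absorb1)

lemma mean_empty: "\<psi> {} = 0"
  using mean_Un[of "{}" "{}"] by simp

lemma mean_UN_le: "finite Z \<Longrightarrow> \<psi> (\<Union>z\<in>Z. S z) \<le> (\<Sum>z\<in>Z. \<psi> (S z))"
proof (induction Z rule: finite_induct)
  case (insert z Z)
  have "\<psi> (\<Union>z\<in>insert z Z. S z) = \<psi> (S z \<union> ((\<Union>z\<in>Z. S z) - S z))" by (simp add: Un_Diff_cancel)
  also have "\<dots> = \<psi> (S z) + \<psi> ((\<Union>z\<in>Z. S z) - S z)" by (rule mean_Un) auto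
  also have "\<dots> \<le> \<psi> (S z) + \<psi> (\<Union>z\<in>Z. S z)" by (simp add: mean_mono)
  finally show ?case using insert by simp
qed (simp add: mean_empty)

lemma mean_UN_disjoint:
  "finite Z \<Longrightarrow> (\<And>x y. x \<in> Z \<Longrightarrow> y \<in> Z \<Longrightarrow> x \<noteq> y \<Longrightarrow> S x \<inter> S y = {}) \<Longrightarrow>
    \<psi> (\<Union>z\<in>Z. S z) = (\<Sum>z\<in>Z. \<psi> (S z))"
proof (induction Z rule: finite_induct)
  case (insert z Z)
  have "S z \<inter> (\<Union>z\<in>Z. S z) = {}" using insert by blast
  then show ?case using mean_Un[of "S z" "\<Union>z\<in>Z. S z"] insert by simp
qed (simp add: mean_empty)

text \<open>All terms of the stationarity average are nonnegative, so each letter costs at most the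
  number of symbols as a factor. In particular images of null sets are null, which is the way to
  full support.\<close>

lemma mean_image_le: "\<psi> (fold f w ` S) \<le> real CARD('n) ^ length w * \<psi> S"
proof (induction w arbitrary: S)
  case (Cons i w)
  have "\<psi> (f i ` S) \<le> (\<Sum>i\<in>UNIV. \<psi> (f i ` S))"
    by (rule member_le_sum) (auto simp: mean_nonneg)
  also have "\<dots> = real CARD('n) * \<psi> S" by (subst mean_avg[of S]) simp
  finally have "\<psi> (f i ` S) \<le> real CARD('n) * \<psi> S" .
  then have "real CARD('n) ^ length w * \<psi> (f i ` S) \<le> real CARD('n) ^ length w * (real CARD('n) * \<psi> S)"
    by (intro mult_left_mono) auto
  with Cons[of "f i ` S"] have "\<psi> (fold f w ` f i ` S) \<le> real CARD('n) ^ length w * (real CARD('n) * \<psi> S)"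
    by (rule order_trans)
  then show ?case by (simp add: image_comp mult_ac)
qed simp

lemma mean_wavg: "wavg n (\<lambda>w. \<psi> (fold f w ` S)) = \<psi> S"
proof (induction n arbitrary: S)
  case (Suc n)
  have "wavg (Suc n) (\<lambda>w. \<psi> (fold f w ` S)) = (\<Sum>i\<in>UNIV. wavg n (\<lambda>w. \<psi> (fold f w ` f i ` S))) / real CARD('n)"
    by (simp add: wavg_Suc image_comp)
  also have "\<dots> = \<psi> S" unfolding Suc by (rule mean_avg[symmetric])
  finally show ?case .
qed simp

text \<open>A maximum principle. Let \<open>a z\<close> be the limiting mass of small balls at z. It
  is at most its average over the points \<open>f i z\<close>, and its sum over any finite set is at
  most 1, so a positive value is reached at only finitely many points. The maximum would then be
  attained on a nonempty finite set, which the averaging inequality makes invariant under every map,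
  against minimality. A Lebesgue number makes the radius uniform.\<close>

lemma mean_atomless:
  assumes "\<eta> > 0"
  obtains r where "r > 0" "\<And>x. \<psi> (ball x r) < \<eta>"
proof -
  define a where "a z = Inf ((\<lambda>r. \<psi> (ball z r)) ` {0<..})" for z
  have bdd: "bdd_below ((\<lambda>r. \<psi> (ball z r)) ` {0<..})" for z
    by (rule bdd_belowI[of _ 0]) (auto simp: mean_nonneg)
  have a_le: "a z \<le> \<psi> (ball z r)" if "r > 0" for z r
    unfolding a_def by (rule cInf_lower[OF _ bdd]) (use that in auto)
  have a0: "0 \<le> a z" for z
    unfolding a_def by (rule cInf_greatest) (auto simp: mean_nonneg)
  have a_near: "\<exists>r>0. \<psi> (ball z r) < a z + e" if "e > 0" for z e
  proof -
    have "Inf ((\<lambda>r. \<psi> (ball z r)) ` {0<..}) < a z + e" using that by (simp add: a_def)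
    then have "\<exists>v\<in>(\<lambda>r. \<psi> (ball z r)) ` {0<..}. v < a z + e"
      by (subst (asm) cInf_less_iff[OF _ bdd]) auto
    then show ?thesis by blast
  qed
  have a_avg: "a z \<le> (\<Sum>i\<in>UNIV. a (f i z)) / real CARD('n)" for z
  proof (rule field_le_epsilon)
    fix e :: real assume "e > 0"
    have "\<exists>r. \<forall>i. r i > 0 \<and> \<psi> (ball (f i z) (r i)) < a (f i z) + e"
      using a_near[OF \<open>e > 0\<close>] by (intro choice allI)
    then obtain r where r: "\<And>i. r i > 0" "\<And>i. \<psi> (ball (f i z) (r i)) < a (f i z) + e" by blast
    have "\<exists>d>0. \<forall>y. dist y z < d \<longrightarrow> dist (f i y) (f i z) < r i" for i
      using cont[of i, unfolded continuous_on_iff, rule_format, OF UNIV_I r(1)] by simp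
    then have "\<exists>d. \<forall>i. d i > 0 \<and> (\<forall>y. dist y z < d i \<longrightarrow> dist (f i y) (f i z) < r i)"
      by (intro choice allI)
    then obtain d where d: "\<And>i. d i > 0" "\<And>i y. dist y z < d i \<Longrightarrow> dist (f i y) (f i z) < r i"
      by blast
    define d0 where "d0 = Min (range d)"
    have d0: "d0 > 0" "\<And>i. d0 \<le> d i" using d(1) by (auto simp: d0_def)
    have sub: "f i ` ball z d0 \<subseteq> ball (f i z) (r i)" for i
    proof -
      have "dist (f i z) (f i y) < r i" if "dist z y < d0" for y
        using d(2)[of y i] d0(2)[of i] that by (simp add: dist_commute)
      then show ?thesis by auto
    qed
    have "a z \<le> \<psi> (ball z d0)" by (rule a_le) (rule d0)
    also have "\<dots> = (\<Sum>i\<in>UNIV. \<psi> (f i ` ball z d0)) / real CARD('n)" by (rule mean_avg)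
    also have "\<dots> \<le> (\<Sum>i\<in>UNIV. a (f i z) + e) / real CARD('n)"
      by (intro divide_right_mono sum_mono order_trans[OF mean_mono[OF sub] less_imp_le[OF r(2)]]) auto
    also have "\<dots> = (\<Sum>i\<in>UNIV. a (f i z)) / real CARD('n) + e"
      by (simp add: sum.distrib add_divide_distrib)
    finally show "a z \<le> (\<Sum>i\<in>UNIV. a (f i z)) / real CARD('n) + e" .
  qed
  have sum_a: "(\<Sum>z\<in>Z. a z) \<le> 1" if "finite Z" for Z
  proof -
    \<comment> \<open>The minimal distance between distinct points of Z. The number 1 is inserted so
      that the minimum exists even when Z has fewer than two points.\<close>
    define D where "D = insert 1 ((\<lambda>(x, y). dist x y) ` {(x, y) \<in> Z \<times> Z. x \<noteq> y})"
    have "finite {(x, y) \<in> Z \<times> Z. x \<noteq> y}" using that by (rule_tac finite_subset[of _ "Z \<times> Z"]) auto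
    then have "finite D" by (simp add: D_def)
    define r where "r = Min D / 2"
    have "r > 0" using \<open>finite D\<close> by (auto simp: r_def D_def)
    have sep: "2 * r \<le> dist x y" if "x \<in> Z" "y \<in> Z" "x \<noteq> y" for x y
    proof -
      have "(\<lambda>(x, y). dist x y) (x, y) \<in> D"
        unfolding D_def by (intro insertI2 imageI) (use that in simp)
      then show ?thesis using Min_le[OF \<open>finite D\<close>] by (simp add: r_def)
    qed
    have disj: "ball x r \<inter> ball y r = {}" if "x \<in> Z" "y \<in> Z" "x \<noteq> y" for x y
    proof (rule ccontr)
      assume "ball x r \<inter> ball y r \<noteq> {}"
      then obtain v where "dist x v < r" "dist y v < r" by auto
      then have "dist x y < 2 * r" using dist_triangle[of x y v] by (simp add: dist_commute)
      with sep[OF that] show False by simp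
    qed
    have "(\<Sum>z\<in>Z. a z) \<le> (\<Sum>z\<in>Z. \<psi> (ball z r))" by (intro sum_mono a_le) (rule \<open>r > 0\<close>)
    also have "\<dots> = \<psi> (\<Union>z\<in>Z. ball z r)" using mean_UN_disjoint[OF that disj] by simp
    also have "\<dots> \<le> 1" using mean_mono[of _ UNIV] mean_UNIV by simp
    finally show ?thesis .
  qed
  have "a z0 = 0" for z0
  proof (rule ccontr)
    assume "a z0 \<noteq> 0"
    with a0[of z0] have pos: "a z0 > 0" by simp
    define L where "L = {z. a z0 \<le> a z}"
    have "finite L"
    proof (rule ccontr)
      assume "infinite L"
      obtain n :: nat where n: "1 < real n * a z0" using ex_less_of_nat_mult[OF pos] by blast
      obtain Z where Z: "Z \<subseteq> L" "finite Z" "card Z = n"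
        using infinite_arbitrarily_large[OF \<open>infinite L\<close>] by blast
      have "real n * a z0 = (\<Sum>z\<in>Z. a z0)" using Z by simp
      also have "\<dots> \<le> (\<Sum>z\<in>Z. a z)" using Z by (intro sum_mono) (auto simp: L_def)
      also have "\<dots> \<le> 1" using sum_a Z by simp
      finally show False using n by simp
    qed
    have "z0 \<in> L" by (simp add: L_def)
    define m where "m = Max (a ` L)"
    have m: "a z \<le> m" for z
    proof (cases "z \<in> L")
      case False
      then have "a z \<le> a z0" by (simp add: L_def)
      also have "\<dots> \<le> m" using \<open>finite L\<close> \<open>z0 \<in> L\<close> by (simp add: m_def)
      finally show ?thesis .
    qed (use \<open>finite L\<close> in \<open>simp add: m_def\<close>)
    have "m \<in> a ` L" unfolding m_def using \<open>finite L\<close> \<open>z0 \<in> L\<close> by (intro Max_in) auto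
    then obtain z1 where z1: "z1 \<in> L" "a z1 = m" by auto
    define Z where "Z = {z. a z = m}"
    have "Z \<subseteq> L" using m[of z0] by (auto simp: Z_def L_def)
    then have "finite Z" using \<open>finite L\<close> finite_subset by blast
    moreover have "z1 \<in> Z" using z1 by (simp add: Z_def)
    moreover have "f i z \<in> Z" if "z \<in> Z" for i z
    proof (rule ccontr)
      assume "f i z \<notin> Z"
      then have "a (f i z) < m" using m[of "f i z"] by (simp add: Z_def)
      then have "\<exists>i\<in>UNIV. a (f i z) < m" by blast
      then have "(\<Sum>i\<in>UNIV. a (f i z)) < (\<Sum>i\<in>(UNIV :: 'n set). m)"
        by (intro sum_strict_mono_ex1 finite ballI m)
      then have "(\<Sum>i\<in>UNIV. a (f i z)) / real CARD('n) < m" by (simp add: divide_less_eq mult.commute)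
      with a_avg[of z] that show False by (simp add: Z_def)
    qed
    ultimately show False by (rule no_finite_invariant)
  qed
  then have "\<exists>r. \<forall>z. r z > 0 \<and> \<psi> (ball z (r z)) < \<eta>"
    using a_near[OF assms] by (intro choice allI) simp
  then obtain r where r: "\<And>z. r z > 0" "\<And>z. \<psi> (ball z (r z)) < \<eta>" by blast
  have cov: "UNIV \<subseteq> \<Union> (range (\<lambda>z. ball z (r z)))"
  proof
    fix x
    have "x \<in> ball x (r x)" using r(1)[of x] by simp
    then show "x \<in> \<Union> (range (\<lambda>z. ball z (r z)))" by blast
  qed
  have op: "open b" if "b \<in> range (\<lambda>z. ball z (r z))" for b using that by (elim imageE) simp
  from Heine_Borel_lemma[OF compact_circle cov op]
  obtain e where e: "e > 0" "\<And>x. x \<in> UNIV \<Longrightarrow> \<exists>b\<in>range (\<lambda>z. ball z (r z)). ball x e \<subseteq> b"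
    by blast
  show ?thesis
  proof (rule that[OF e(1)])
    fix x
    obtain z where "ball x e \<subseteq> ball z (r z)" using e(2)[OF UNIV_I, of x] by (elim bexE imageE) simp
    then show "\<psi> (ball x e) < \<eta>" using mean_mono r(2) by (meson le_less_trans)
  qed
qed

text \<open>All images of an open set of mass zero would be null, while backward minimality and
  compactness let finitely many of them cover the circle. A finite cover by balls of radius r/2
  turns positivity into a uniform lower bound.\<close>

lemma mean_full_support:
  assumes "r > 0"
  obtains d where "d > 0" "\<And>z. d \<le> \<psi> (ball z r)"
proof -
  have pos: "\<psi> V > 0" if V: "open V" "V \<noteq> {}" for V
  proof (rule ccontr)
    assume "\<not> \<psi> V > 0"
    then have "\<psi> V = 0" using mean_nonneg[of V] by simp
    then have 0: "\<psi> (fold f w ` V) \<le> 0" for w using mean_image_le[of w V] by simp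
    have "UNIV \<subseteq> (\<Union>w\<in>UNIV. fold f w ` V)"
    proof
      fix y
      obtain w where "fold (\<lambda>i. inv (f i)) w y \<in> V" using bwd_min[OF V] by blast
      then have "inv (fold f (rev w)) y \<in> V" by (simp add: inv_fold bij)
      then show "y \<in> (\<Union>w\<in>UNIV. fold f w ` V)"
        by (intro UN_I[of "rev w"] image_eqI[of _ _ "inv (fold f (rev w)) y"]) (simp_all add: fold_inverse)
    qed
    from compactE_image[OF compact_circle open_fold_image[OF V(1)] this]
    obtain W where W: "finite W" "UNIV \<subseteq> (\<Union>w\<in>W. fold f w ` V)" .
    then have "1 \<le> \<psi> (\<Union>w\<in>W. fold f w ` V)" using mean_mono[OF W(2)] mean_UNIV by simp
    also have "\<dots> \<le> (\<Sum>w\<in>W. \<psi> (fold f w ` V))" by (rule mean_UN_le) fact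
    also have "\<dots> \<le> 0" by (intro sum_nonpos 0)
    finally show False by simp
  qed
  have cov: "UNIV \<subseteq> (\<Union>z\<in>(UNIV :: circle set). ball z (r/2))"
  proof
    fix x :: circle
    have "x \<in> ball x (r/2)" using assms by simp
    then show "x \<in> (\<Union>z\<in>UNIV. ball z (r/2))" by blast
  qed
  obtain D where D: "finite D" "(UNIV :: circle set) \<subseteq> (\<Union>z\<in>D. ball z (r/2))"
    by (rule compactE_image[OF compact_circle _ cov]) auto
  define d where "d = Min ((\<lambda>z. \<psi> (ball z (r/2))) ` D)"
  have "D \<noteq> {}" using D(2) by blast
  have "d > 0" unfolding d_def
    using D(1) \<open>D \<noteq> {}\<close> assms by (subst Min_gr_iff) (simp_all add: pos)
  moreover have "d \<le> \<psi> (ball z r)" for z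
  proof -
    obtain z' where z': "z' \<in> D" "dist z' z < r/2"
      using subsetD[OF D(2) UNIV_I[of z]] by auto
    have "ball z' (r/2) \<subseteq> ball z r"
    proof
      fix x assume "x \<in> ball z' (r/2)"
      then show "x \<in> ball z r" using z'(2) dist_triangle[of z x z'] by (simp add: dist_commute)
    qed
    then have "\<psi> (ball z' (r/2)) \<le> \<psi> (ball z r)" by (rule mean_mono)
    moreover have "d \<le> \<psi> (ball z' (r/2))" unfolding d_def using D(1) z' by (intro Min_le) auto
    ultimately show ?thesis by simp
  qed
  ultimately show ?thesis by (rule that)
qed

text \<open>For points closer than r: if a word separates them by e, the image of the ball around x
  contains a ball of radius e/4 and has mass at least d, while the average mass of the images is
  below \<open>\<theta>/2 * d\<close>; by Markov's inequality this has probability at most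
  \<theta>/2, at every time. For arbitrary points, one word of a finite list brings them r-close,
  and it occurs with probability at least p; each attempt therefore multiplies the remaining excess
  by at most \<open>1 - p\<close>.\<close>

lemma synchronization_aux:
  assumes "e > 0" "\<theta> > 0"
  shows "\<exists>n0. \<forall>n\<ge>n0. \<forall>x y. wavg n (\<lambda>w. of_bool (e \<le> dist (fold f w x) (fold f w y))) \<le> \<theta>"
proof -
  define E where "E n x y = wavg n (\<lambda>w. of_bool (e \<le> dist (fold f w x) (fold f w y)))" for n x y
  obtain d where d: "d > 0" "\<And>z. d \<le> \<psi> (ball z (e/4))"
    using mean_full_support[of "e/4"] assms by auto
  obtain r where r: "r > 0" "\<And>x. \<psi> (ball x r) < \<theta>/2 * d"
    using mean_atomless[of "\<theta>/2 * d"] assms d by auto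
  have near: "E n x y \<le> \<theta>/2" if "dist x y < r" for n x y
  proof -
    have "E n x y \<le> wavg n (\<lambda>w. \<psi> (fold f w ` ball x r) / d)"
      unfolding E_def
    proof (rule wavg_mono)
      fix w
      show "of_bool (e \<le> dist (fold f w x) (fold f w y)) \<le> \<psi> (fold f w ` ball x r) / d"
      proof (cases "e \<le> dist (fold f w x) (fold f w y)")
        case True
        have "connected (fold f w ` ball x r)"
          by (intro connected_continuous_image connected_ball_circle continuous_on_subset[OF continuous_fold[OF cont]]) simp
        moreover have "fold f w x \<in> fold f w ` ball x r" "fold f w y \<in> fold f w ` ball x r"
          using that r(1) by (auto intro!: imageI)
        ultimately obtain z where "ball z (e/4) \<subseteq> fold f w ` ball x r"
          using connected_circle_contains_ball[of "fold f w ` ball x r" "fold f w x" "fold f w y" e] True assms(1)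
          by blast
        then have "d \<le> \<psi> (fold f w ` ball x r)" using d(2)[of z] mean_mono by (meson order_trans)
        then show ?thesis using d(1) by (simp add: True)
      qed (use d(1) mean_nonneg in auto)
    qed
    also have "\<dots> = \<psi> (ball x r) / d" by (simp add: wavg_divide mean_wavg)
    also have "\<dots> \<le> \<theta>/2" using r(2)[of x] d(1) by (simp add: divide_le_eq)
    finally show ?thesis .
  qed
  \<comment> \<open>By compactness of the torus finitely many contracting words serve all pairs of
    points, which bounds their lengths by M and their probabilities from below by p.\<close>
  have "UNIV \<subseteq> (\<Union>w\<in>UNIV. {z. dist (fold f w (fst z)) (fold f w (snd z)) < r})"
    using contracting[OF r(1)] by auto
  moreover have "open {z. dist (fold f w (fst z)) (fold f w (snd z)) < r}" for w
    by (intro open_Collect_less continuous_intros continuous_on_compose2[OF continuous_fold[OF cont, where w = w]]) auto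
  moreover have "compact (UNIV :: (circle \<times> circle) set)"
    using compact_Times[OF compact_circle compact_circle] by simp
  ultimately obtain W where W: "finite W" "UNIV \<subseteq> (\<Union>w\<in>W. {z. dist (fold f w (fst z)) (fold f w (snd z)) < r})"
    by (rule_tac compactE_image[of UNIV UNIV "\<lambda>w. {z. dist (fold f w (fst z)) (fold f w (snd z)) < r}"]) auto
  have "W \<noteq> {}" using W(2) by blast
  define M where "M = Max (length ` W)"
  define p where "p = 1 / real CARD('n) ^ M"
  have p: "0 < p" "p \<le> 1" by (auto simp: p_def)
  have E1: "E n x y \<le> 1" for n x y unfolding E_def by (rule wavg_le_const) auto
  have ind: "E k x y \<le> \<theta>/2 + (1 - p) ^ l" if "k \<ge> l * M" for k l x y
    using that
  proof (induction l arbitrary: k x y)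
    case 0
    then show ?case using E1[of k x y] assms by simp
  next
    case (Suc l)
    \<comment> \<open>Condition on the first letters, as many as u has. If they spell u, the pair is
      r-close and the bound \<theta>/2 applies; for all other words the induction hypothesis does,
      with at least \<open>l * M\<close> letters left.\<close>
    obtain u where u: "u \<in> W" "dist (fold f u x) (fold f u y) < r"
      using subsetD[OF W(2) UNIV_I[of "(x, y)"]] by auto
    have uM: "length u \<le> M" unfolding M_def using W(1) u(1) by (intro Max_ge) auto
    define j where "j = length u"
    have kj: "k = j + (k - j)" "l * M \<le> k - j" using Suc(2) uM by (auto simp: j_def)
    have "E k x y = wavg j (\<lambda>v. E (k - j) (fold f v x) (fold f v y))"
      unfolding E_def by (subst kj(1), subst wavg_append) simp
    also have "\<dots> \<le> (\<theta>/2 + (1 - p) ^ l) - ((\<theta>/2 + (1 - p) ^ l) - \<theta>/2) / real CARD('n) ^ j"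
      by (rule wavg_single_le[of u]) (use Suc.IH kj(2) near[OF u(2)] p in \<open>auto simp: j_def\<close>)
    also have "\<dots> = \<theta>/2 + (1 - p) ^ l * (1 - 1 / real CARD('n) ^ j)" by (simp add: algebra_simps)
    also have "\<dots> \<le> \<theta>/2 + (1 - p) ^ l * (1 - p)"
    proof -
      have "p \<le> 1 / real CARD('n) ^ j" unfolding p_def
        using uM by (intro divide_left_mono power_increasing) (auto simp: j_def)
      then show ?thesis using p by (intro add_left_mono mult_left_mono) auto
    qed
    finally show ?case by (simp add: mult.commute)
  qed
  obtain l where l: "(1 - p) ^ l < \<theta>/2"
    using real_arch_pow_inv[of "\<theta>/2" "1 - p"] assms p by auto
  have "E n x y \<le> \<theta>" if "n \<ge> l * M" for n x y
    using ind[OF that, of x y] l by simp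
  then show ?thesis unfolding E_def by blast
qed

end

context circle_homeos
begin

lemma synchronization:
  assumes "e > 0" "\<theta> > 0"
  shows "\<exists>n0. \<forall>n\<ge>n0. \<forall>x y. wavg n (\<lambda>w. of_bool (e \<le> dist (fold f w x) (fold f w y))) \<le> \<theta>"
proof -
  obtain \<psi> where \<psi>: "\<And>S. 0 \<le> \<psi> S" "\<psi> UNIV = 1"
    "\<And>S T. S \<inter> T = {} \<Longrightarrow> \<psi> (S \<union> T) = \<psi> S + \<psi> T"
    "\<And>S. \<psi> S = (\<Sum>i\<in>UNIV. \<psi> (f i ` S)) / real CARD('n)"
    using invariant_mean[where f = f, OF bij] by blast
  interpret circle_invariant_mean f \<psi> by unfold_locales (fact \<psi>)+
  show ?thesis using assms by (rule synchronization_aux)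
qed

end

subsection \<open>Local observables on the phase space\<close>

text \<open>Observables seeing the letters at positions in the half-open window from a to b,
  equicontinuous in the fiber. Thus b = 0 means dependence on the strict past, and b = 1 admits the
  present letter as well.\<close>

definition local_fun :: "int \<Rightarrow> int \<Rightarrow> ((int \<Rightarrow> 'n) \<times> circle \<Rightarrow> real) \<Rightarrow> bool" where
  "local_fun a b \<phi> \<longleftrightarrow> (\<exists>B. \<forall>z. \<bar>\<phi> z\<bar> \<le> B) \<and>
     (\<forall>\<xi> \<xi>' x. (\<forall>i. a \<le> i \<and> i < b \<longrightarrow> \<xi> i = \<xi>' i) \<longrightarrow> \<phi> (\<xi>, x) = \<phi> (\<xi>', x)) \<and>
     (\<forall>e>0. \<exists>d>0. \<forall>\<xi> x y. dist x y < d \<longrightarrow> \<bar>\<phi> (\<xi>, x) - \<phi> (\<xi>, y)\<bar> < e)"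

lemma local_funI:
  assumes "\<And>z. \<bar>\<phi> z\<bar> \<le> B"
    "\<And>\<xi> \<xi>' x. (\<And>i. a \<le> i \<Longrightarrow> i < b \<Longrightarrow> \<xi> i = \<xi>' i) \<Longrightarrow> \<phi> (\<xi>, x) = \<phi> (\<xi>', x)"
    "\<And>e. e > 0 \<Longrightarrow> \<exists>d>0. \<forall>\<xi> x y. dist x y < d \<longrightarrow> \<bar>\<phi> (\<xi>, x) - \<phi> (\<xi>, y)\<bar> < e"
  shows "local_fun a b \<phi>"
  unfolding local_fun_def using assms by blast

lemma local_fun_bound:
  assumes "local_fun a b \<phi>" obtains B where "B > 0" "\<And>z. \<bar>\<phi> z\<bar> \<le> B"
proof -
  obtain B where B: "\<And>z. \<bar>\<phi> z\<bar> \<le> B" using assms unfolding local_fun_def by blast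
  show ?thesis
  proof (rule that[of "max B 1"])
    show "\<bar>\<phi> z\<bar> \<le> max B 1" for z using B[of z] by simp
  qed simp
qed

lemma local_fun_cong:
  assumes "local_fun a b \<phi>" "\<And>i. a \<le> i \<Longrightarrow> i < b \<Longrightarrow> \<xi> i = \<xi>' i"
  shows "\<phi> (\<xi>, x) = \<phi> (\<xi>', x)"
  using assms unfolding local_fun_def by blast

lemma local_fun_equicont:
  assumes "local_fun a b \<phi>" "e > 0"
  obtains d where "d > 0" "\<And>\<xi> x y. dist x y < d \<Longrightarrow> \<bar>\<phi> (\<xi>, x) - \<phi> (\<xi>, y)\<bar> < e"
  using assms unfolding local_fun_def by blast

lemma local_fun_mono:
  fixes \<phi> :: "(int \<Rightarrow> 'n) \<times> circle \<Rightarrow> real"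
  assumes "local_fun a b \<phi>" "a' \<le> a" "b \<le> b'" shows "local_fun a' b' \<phi>"
proof -
  obtain B where B: "\<And>z. \<bar>\<phi> z\<bar> \<le> B" using local_fun_bound[OF assms(1)] by blast
  show ?thesis
  proof (rule local_funI[OF B])
    fix \<xi> \<xi>' :: "int \<Rightarrow> 'n" and x :: circle assume "\<And>i. a' \<le> i \<Longrightarrow> i < b' \<Longrightarrow> \<xi> i = \<xi>' i"
    then show "\<phi> (\<xi>, x) = \<phi> (\<xi>', x)" using assms by (intro local_fun_cong[OF assms(1)]) auto
  next
    fix e :: real assume "e > 0"
    then show "\<exists>d>0. \<forall>\<xi> x y. dist x y < d \<longrightarrow> \<bar>\<phi> (\<xi>, x) - \<phi> (\<xi>, y)\<bar> < e"
      using assms(1) unfolding local_fun_def by blast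
  qed
qed

lemma local_fun_const: "local_fun a b (\<lambda>_. c)"
  by (rule local_funI[of _ "\<bar>c\<bar>"]) (auto intro: exI[of _ 1])

text \<open>A common source for sums, differences and products: all values lie in a compact
  rectangle, on which h is bounded and uniformly continuous.\<close>

lemma local_fun_compose2:
  fixes h :: "real \<Rightarrow> real \<Rightarrow> real" and \<phi> \<psi> :: "(int \<Rightarrow> 'n) \<times> circle \<Rightarrow> real"
  assumes \<phi>: "local_fun a b \<phi>" and \<psi>: "local_fun a b \<psi>"
    and h: "continuous_on UNIV (\<lambda>p. h (fst p) (snd p))"
  shows "local_fun a b (\<lambda>z. h (\<phi> z) (\<psi> z))"
proof -
  obtain B1 where B1: "B1 > 0" "\<And>z. \<bar>\<phi> z\<bar> \<le> B1" using local_fun_bound[OF \<phi>] by blast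
  obtain B2 where B2: "B2 > 0" "\<And>z. \<bar>\<psi> z\<bar> \<le> B2" using local_fun_bound[OF \<psi>] by blast
  define S where "S = {-B1..B1} \<times> {-B2..B2}"
  have inS: "(\<phi> z, \<psi> z) \<in> S" for z using B1(2)[of z] B2(2)[of z] by (auto simp: S_def abs_le_iff)
  have S: "compact S" unfolding S_def by (intro compact_Times compact_Icc)
  have cS: "continuous_on S (\<lambda>p. h (fst p) (snd p))" using h by (rule continuous_on_subset) simp
  have "bounded ((\<lambda>p. h (fst p) (snd p)) ` S)"
    by (intro compact_imp_bounded compact_continuous_image cS S)
  then obtain B where B: "\<And>p. p \<in> S \<Longrightarrow> \<bar>h (fst p) (snd p)\<bar> \<le> B"
    unfolding bounded_iff by (auto simp: image_iff)
  show ?thesis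
  proof (rule local_funI[of _ B])
    show "\<bar>h (\<phi> z) (\<psi> z)\<bar> \<le> B" for z using B[OF inS[of z]] by simp
  next
    fix \<xi> \<xi>' :: "int \<Rightarrow> 'n" and x :: circle assume eq: "\<And>i. a \<le> i \<Longrightarrow> i < b \<Longrightarrow> \<xi> i = \<xi>' i"
    have "\<phi> (\<xi>, x) = \<phi> (\<xi>', x)" "\<psi> (\<xi>, x) = \<psi> (\<xi>', x)"
      using local_fun_cong[OF \<phi> eq] local_fun_cong[OF \<psi> eq] by auto
    then show "h (\<phi> (\<xi>, x)) (\<psi> (\<xi>, x)) = h (\<phi> (\<xi>', x)) (\<psi> (\<xi>', x))" by simp
  next
    fix e :: real assume "e > 0"
    then obtain d where d: "d > 0" "\<And>p q. p \<in> S \<Longrightarrow> q \<in> S \<Longrightarrow> dist q p < d \<Longrightarrow> dist (h (fst q) (snd q)) (h (fst p) (snd p)) < e"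
      using compact_uniformly_continuous[OF cS S] unfolding uniformly_continuous_on_def by metis
    obtain d1 where d1: "d1 > 0" "\<And>\<xi> x y. dist x y < d1 \<Longrightarrow> \<bar>\<phi> (\<xi>, x) - \<phi> (\<xi>, y)\<bar> < d/2"
      using local_fun_equicont[OF \<phi>, of "d/2"] d(1) by (metis half_gt_zero)
    obtain d2 where d2: "d2 > 0" "\<And>\<xi> x y. dist x y < d2 \<Longrightarrow> \<bar>\<psi> (\<xi>, x) - \<psi> (\<xi>, y)\<bar> < d/2"
      using local_fun_equicont[OF \<psi>, of "d/2"] d(1) by (metis half_gt_zero)
    show "\<exists>d>0. \<forall>\<xi> x y. dist x y < d \<longrightarrow> \<bar>h (\<phi> (\<xi>, x)) (\<psi> (\<xi>, x)) - h (\<phi> (\<xi>, y)) (\<psi> (\<xi>, y))\<bar> < e"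
    proof (intro exI[of _ "min d1 d2"] conjI allI impI)
      fix \<xi> :: "int \<Rightarrow> 'n" and x y :: circle assume xy: "dist x y < min d1 d2"
      have "dist (\<phi> (\<xi>, x), \<psi> (\<xi>, x)) (\<phi> (\<xi>, y), \<psi> (\<xi>, y)) \<le> \<bar>\<phi> (\<xi>, x) - \<phi> (\<xi>, y)\<bar> + \<bar>\<psi> (\<xi>, x) - \<psi> (\<xi>, y)\<bar>"
        unfolding dist_Pair_Pair dist_real_def by (rule sqrt_sum_squares_le_sum_abs[THEN order_trans]) simp
      also have "\<dots> < d" using d1(2)[of x y \<xi>] d2(2)[of x y \<xi>] xy by simp
      finally show "\<bar>h (\<phi> (\<xi>, x)) (\<psi> (\<xi>, x)) - h (\<phi> (\<xi>, y)) (\<psi> (\<xi>, y))\<bar> < e"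
        using d(2)[OF inS inS] by (simp add: dist_real_def)
    qed (use d1 d2 in simp)
  qed
qed

lemma local_fun_add: "local_fun a b \<phi> \<Longrightarrow> local_fun a b \<psi> \<Longrightarrow> local_fun a b (\<lambda>z. \<phi> z + \<psi> z)"
  by (rule local_fun_compose2[where h = "(+)"]) (intro continuous_intros | assumption)+

lemma local_fun_diff: "local_fun a b \<phi> \<Longrightarrow> local_fun a b \<psi> \<Longrightarrow> local_fun a b (\<lambda>z. \<phi> z - \<psi> z)"
  by (rule local_fun_compose2[where h = "(-)"]) (intro continuous_intros | assumption)+

lemma local_fun_mult: "local_fun a b \<phi> \<Longrightarrow> local_fun a b \<psi> \<Longrightarrow> local_fun a b (\<lambda>z. \<phi> z * \<psi> z)"
  by (rule local_fun_compose2[where h = "\<lambda>u v. u * v"]) (intro continuous_intros | assumption)+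

lemma local_fun_sum:
  "(\<And>j. j \<in> I \<Longrightarrow> local_fun a b (\<phi> j)) \<Longrightarrow> local_fun a b (\<lambda>z. \<Sum>j\<in>I. \<phi> j z)"
  by (induction I rule: infinite_finite_induct) (auto intro: local_fun_const local_fun_add)

text \<open>The general form of composition with the skew product, its inverse and the transition maps.\<close>

lemma local_fun_compose:
  fixes g :: "'n \<Rightarrow> circle \<Rightarrow> circle" and \<phi> :: "(int \<Rightarrow> 'n) \<times> circle \<Rightarrow> real"
    and \<tau> :: "(int \<Rightarrow> 'n) \<Rightarrow> int \<Rightarrow> 'n" and s :: "(int \<Rightarrow> 'n) \<Rightarrow> 'n"
  assumes \<phi>: "local_fun a b \<phi>" and g: "\<And>i. continuous_on UNIV (g i)" and fin: "finite (UNIV :: 'n set)"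
    and \<tau>: "\<And>\<xi> \<xi>' i. (\<And>i. a' \<le> i \<Longrightarrow> i < b' \<Longrightarrow> \<xi> i = \<xi>' i) \<Longrightarrow> a \<le> i \<Longrightarrow> i < b \<Longrightarrow> \<tau> \<xi> i = \<tau> \<xi>' i"
    and s: "\<And>\<xi> \<xi>'. (\<And>i. a' \<le> i \<Longrightarrow> i < b' \<Longrightarrow> \<xi> i = \<xi>' i) \<Longrightarrow> s \<xi> = s \<xi>'"
  shows "local_fun a' b' (\<lambda>(\<xi>, x). \<phi> (\<tau> \<xi>, g (s \<xi>) x))"
proof -
  obtain B where B: "\<And>z. \<bar>\<phi> z\<bar> \<le> B" using local_fun_bound[OF \<phi>] by blast
  show ?thesis
  proof (rule local_funI[of _ B])
    show "\<bar>case z of (\<xi>, x) \<Rightarrow> \<phi> (\<tau> \<xi>, g (s \<xi>) x)\<bar> \<le> B" for z by (simp add: case_prod_unfold B)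
  next
    fix \<xi> \<xi>' :: "int \<Rightarrow> 'n" and x :: circle assume eq: "\<And>i. a' \<le> i \<Longrightarrow> i < b' \<Longrightarrow> \<xi> i = \<xi>' i"
    have "s \<xi> = s \<xi>'" by (rule s[OF eq])
    moreover have "\<phi> (\<tau> \<xi>, g (s \<xi>) x) = \<phi> (\<tau> \<xi>', g (s \<xi>) x)"
      by (rule local_fun_cong[OF \<phi> \<tau>[OF eq]])
    ultimately show "(case (\<xi>, x) of (\<xi>, x) \<Rightarrow> \<phi> (\<tau> \<xi>, g (s \<xi>) x)) = (case (\<xi>', x) of (\<xi>, x) \<Rightarrow> \<phi> (\<tau> \<xi>, g (s \<xi>) x))"
      by simp
  next
    fix e :: real assume "e > 0"
    obtain d where d: "d > 0" "\<And>\<xi> x y. dist x y < d \<Longrightarrow> \<bar>\<phi> (\<xi>, x) - \<phi> (\<xi>, y)\<bar> < e"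
      using local_fun_equicont[OF \<phi> \<open>e > 0\<close>] by blast
    have "\<exists>r. \<forall>i. r i > 0 \<and> (\<forall>x y. dist x y < r i \<longrightarrow> dist (g i x) (g i y) < d)"
      by (intro choice allI uniformly_continuous_circle[OF g d(1)])
    then obtain r where r: "\<And>i. r i > 0" "\<And>i x y. dist x y < r i \<Longrightarrow> dist (g i x) (g i y) < d" by blast
    define r0 where "r0 = Min (range r)"
    have r0: "r0 > 0" "\<And>i. r0 \<le> r i" using r(1) fin by (auto simp: r0_def)
    show "\<exists>d>0. \<forall>\<xi> x y. dist x y < d \<longrightarrow>
       \<bar>(case (\<xi>, x) of (\<xi>, x) \<Rightarrow> \<phi> (\<tau> \<xi>, g (s \<xi>) x)) - (case (\<xi>, y) of (\<xi>, x) \<Rightarrow> \<phi> (\<tau> \<xi>, g (s \<xi>) x))\<bar> < e"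
    proof (intro exI[of _ r0] conjI allI impI r0)
      fix \<xi> :: "int \<Rightarrow> 'n" and x y :: circle assume "dist x y < r0"
      then have "dist x y < r (s \<xi>)" using r0(2)[of "s \<xi>"] by simp
      from d(2)[OF r(2)[of x y "s \<xi>", OF this]]
      show "\<bar>(case (\<xi>, x) of (\<xi>, x) \<Rightarrow> \<phi> (\<tau> \<xi>, g (s \<xi>) x)) - (case (\<xi>, y) of (\<xi>, x) \<Rightarrow> \<phi> (\<tau> \<xi>, g (s \<xi>) x))\<bar> < e"
        by simp
    qed
  qed
qed

section \<open>The inverse skew product and windows in the past\<close>

definition skew_inv :: "('n \<Rightarrow> circle \<Rightarrow> circle) \<Rightarrow> (int \<Rightarrow> 'n) \<times> circle \<Rightarrow> (int \<Rightarrow> 'n) \<times> circle" where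
  "skew_inv f = (\<lambda>(\<xi>, x). (\<lambda>i. \<xi> (i - 1), inv (f (\<xi> (- 1))) x))"

lemma skew_inverse:
  assumes "\<And>i. bij (f i)"
  shows "skew_inv f (skew f z) = z" "skew f (skew_inv f z) = z"
  using assms by (auto simp: skew_def skew_inv_def case_prod_unfold bij_is_inj bij_is_surj surj_f_inv_f)

lemma local_fun_skew:
  fixes f :: "'n::finite \<Rightarrow> circle \<Rightarrow> circle"
  assumes "local_fun a b \<phi>" "\<And>i. continuous_on UNIV (f i)" "a' \<le> a + 1" "b + 1 \<le> b'" "a' \<le> 0" "1 \<le> b'"
  shows "local_fun a' b' (\<lambda>z. \<phi> (skew f z))"
proof -
  have "local_fun a' b' (\<lambda>(\<xi>, x). \<phi> ((\<lambda>i. \<xi> (i + 1)), f (\<xi> 0) x))"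
    by (rule local_fun_compose[OF assms(1,2)]) (use assms in auto)
  then show ?thesis by (simp add: skew_def case_prod_unfold)
qed

lemma local_fun_skew_inv:
  fixes f :: "'n::finite \<Rightarrow> circle \<Rightarrow> circle"
  assumes "local_fun a b \<phi>" "\<And>i. continuous_on UNIV (inv (f i))" "a' \<le> a - 1" "b - 1 \<le> b'" "a' \<le> - 1" "0 \<le> b'"
  shows "local_fun a' b' (\<lambda>z. \<phi> (skew_inv f z))"
proof -
  have "local_fun a' b' (\<lambda>(\<xi>, x). \<phi> ((\<lambda>i. \<xi> (i - 1)), inv (f (\<xi> (- 1))) x))"
    by (rule local_fun_compose[OF assms(1,2)]) (use assms in auto)
  then show ?thesis by (simp add: skew_inv_def case_prod_unfold)
qed

lemma local_fun_skew_iterate: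
  fixes f :: "'n::finite \<Rightarrow> circle \<Rightarrow> circle"
  assumes \<phi>: "local_fun a b \<phi>" and f: "\<And>i. continuous_on UNIV (f i)" and "b \<ge> 0"
  shows "local_fun (min a 0) (b + int n) (\<lambda>z. \<phi> ((skew f ^^ n) z))"
proof (induction n)
  case 0
  then show ?case using local_fun_mono[OF \<phi>] by simp
next
  case (Suc n)
  from local_fun_skew[OF Suc f, of "min a 0" "b + int (Suc n)"] show ?case
    using \<open>b \<ge> 0\<close> by (simp add: funpow_swap1)
qed

text \<open>Each inverse step moves the window one place to the left. Integrals against an invariant
  measure are therefore determined by those of observables of the past.\<close>

lemma local_fun_past:
  fixes f :: "'n::finite \<Rightarrow> circle \<Rightarrow> circle"
  assumes \<phi>: "local_fun a (int n) \<phi>" and f: "\<And>i. continuous_on UNIV (inv (f i))"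
  shows "\<exists>a'. local_fun a' 0 (\<lambda>z. \<phi> ((skew_inv f ^^ n) z))"
  using \<phi>
proof (induction n arbitrary: a \<phi>)
  case 0
  then show ?case by auto
next
  case (Suc n)
  have "local_fun (min (a - 1) (- 1)) (int n) (\<lambda>z. \<phi> (skew_inv f z))"
    by (rule local_fun_skew_inv[OF Suc(2) f]) auto
  from Suc.IH[OF this] show ?case by simp
qed

subsection \<open>Topology and Borel sets of the phase space\<close>

lemma open_coordinate: "open {\<xi> :: int \<Rightarrow> 'n::discrete_topology. \<xi> i = c}"
proof -
  have "open ((\<lambda>\<xi> :: int \<Rightarrow> 'n. \<xi> i) -` {c})"
    by (intro open_vimage continuous_on_product_coordinates) (simp add: discrete_topology_class.open_discrete)
  then show ?thesis by (simp add: vimage_def)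
qed

definition cyl :: "nat \<Rightarrow> (int \<Rightarrow> 'n) \<Rightarrow> (int \<Rightarrow> 'n) set" where
  "cyl K v = {\<xi>. \<forall>i. - int K \<le> i \<and> i < int K \<longrightarrow> \<xi> i = v i}"

lemma cyl_eq_INT: "cyl K v = (\<Inter>i\<in>{- int K..<int K}. {\<xi>. \<xi> i = v i})"
  by (auto simp: cyl_def)

lemma open_cyl: "open (cyl K (v :: int \<Rightarrow> 'n::discrete_topology))"
  unfolding cyl_eq_INT by (intro open_INT open_coordinate finite_atLeastLessThan_int ballI)

lemma closed_cyl: "closed (cyl K (v :: int \<Rightarrow> 'n::discrete_topology))"
proof -
  have "- {\<xi>. \<xi> i = c} = (\<Union>c'\<in>-{c}. {\<xi> :: int \<Rightarrow> 'n. \<xi> i = c'})" for i c by auto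
  then have "closed {\<xi> :: int \<Rightarrow> 'n. \<xi> i = c}" for i c
    unfolding closed_def by (simp add: open_coordinate open_UN)
  then show ?thesis unfolding cyl_eq_INT by (intro closed_INT ballI)
qed

lemma local_fun_continuous:
  fixes \<phi> :: "(int \<Rightarrow> 'n::discrete_topology) \<times> circle \<Rightarrow> real"
  assumes \<phi>: "local_fun a b \<phi>" shows "continuous_on UNIV \<phi>"
proof (unfold continuous_on_def, intro ballI tendstoI)
  fix z and e :: real assume "e > 0"
  obtain \<xi> :: "int \<Rightarrow> 'n" and x :: circle where z: "z = (\<xi>, x)" by fastforce
  define K where "K = nat (max \<bar>a\<bar> \<bar>b\<bar>)"
  obtain d where d: "d > 0" "\<And>\<xi> x y. dist x y < d \<Longrightarrow> \<bar>\<phi> (\<xi>, x) - \<phi> (\<xi>, y)\<bar> < e"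
    using local_fun_equicont[OF \<phi> \<open>e > 0\<close>] by blast
  have "dist (\<phi> (\<xi>', y)) (\<phi> (\<xi>, x)) < e" if "\<xi>' \<in> cyl K \<xi>" "y \<in> ball x d" for \<xi>' :: "int \<Rightarrow> 'n" and y :: circle
  proof -
    have "\<phi> (\<xi>', y) = \<phi> (\<xi>, y)"
    proof (rule local_fun_cong[OF \<phi>])
      fix i assume "a \<le> i" "i < b"
      then have "- int K \<le> i" "i < int K" unfolding K_def by linarith+
      then show "\<xi>' i = \<xi> i" using that(1) by (simp add: cyl_def)
    qed
    then show ?thesis using d(2)[of y x \<xi>] that(2) by (simp add: dist_real_def dist_commute)
  qed
  then show "\<forall>\<^sub>F w in at z within UNIV. dist (\<phi> w) (\<phi> z) < e"
    unfolding eventually_at_topological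
    by (intro exI[of _ "cyl K \<xi> \<times> ball x d"])
      (auto simp: z d(1) open_cyl intro!: open_Times, simp add: cyl_def)
qed

lemma local_fun_measurable:
  fixes \<phi> :: "(int \<Rightarrow> 'n::discrete_topology) \<times> circle \<Rightarrow> real"
  assumes "local_fun a b \<phi>" "sets M = sets borel" shows "\<phi> \<in> borel_measurable M"
  using borel_measurable_continuous_onI[OF local_fun_continuous[OF assms(1)]]
  unfolding measurable_cong_sets[OF assms(2) refl] .

lemma local_fun_integrable:
  fixes \<phi> :: "(int \<Rightarrow> 'n::discrete_topology) \<times> circle \<Rightarrow> real"
  assumes "local_fun a b \<phi>" "sets M = sets borel" "prob_space M" shows "integrable M \<phi>"
proof -
  interpret prob_space M by fact
  obtain B where B: "\<And>z. \<bar>\<phi> z\<bar> \<le> B" using local_fun_bound[OF assms(1)] by blast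
  show ?thesis by (rule integrable_const_bound[of _ B]) (auto simp: B local_fun_measurable[OF assms(1,2)])
qed

lemma continuous_fiber:
  fixes g :: "'n::discrete_topology \<Rightarrow> circle \<Rightarrow> 'b::topological_space"
  assumes "\<And>a. continuous_on UNIV (g a)"
  shows "continuous_on UNIV (\<lambda>z :: (int \<Rightarrow> 'n) \<times> circle. g (fst z k) (snd z))"
  unfolding continuous_on_open_vimage[OF open_UNIV]
proof (intro allI impI)
  fix T :: "'b set" assume "open T"
  have "(\<lambda>z :: (int \<Rightarrow> 'n) \<times> circle. g (fst z k) (snd z)) -` T \<inter> UNIV = (\<Union>a. {\<xi> :: int \<Rightarrow> 'n. \<xi> k = a} \<times> (g a -` T))" by auto
  moreover have "open (\<Union>a. {\<xi> :: int \<Rightarrow> 'n. \<xi> k = a} \<times> (g a -` T))"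
    by (intro open_UN ballI open_Times open_coordinate open_vimage \<open>open T\<close> assms)
  ultimately show "open ((\<lambda>z :: (int \<Rightarrow> 'n) \<times> circle. g (fst z k) (snd z)) -` T \<inter> UNIV)" by simp
qed

lemma continuous_skew:
  fixes f :: "'n::discrete_topology \<Rightarrow> circle \<Rightarrow> circle"
  assumes "\<And>i. continuous_on UNIV (f i)" shows "continuous_on UNIV (skew f)"
proof -
  have "continuous_on UNIV (\<lambda>z :: (int \<Rightarrow> 'n) \<times> circle. \<lambda>i. fst z (i + 1))"
  proof (rule continuous_on_coordinatewise_then_product)
    fix i
    show "continuous_on UNIV (\<lambda>z :: (int \<Rightarrow> 'n) \<times> circle. fst z (i + 1))"
      by (rule continuous_on_compose2[OF continuous_on_product_coordinates continuous_on_fst[OF continuous_on_id]]) auto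
  qed
  from continuous_on_Pair[OF this continuous_fiber[OF assms]] show ?thesis
    by (simp add: skew_def case_prod_unfold)
qed

lemma continuous_skew_inv:
  fixes f :: "'n::discrete_topology \<Rightarrow> circle \<Rightarrow> circle"
  assumes "\<And>i. continuous_on UNIV (inv (f i))" shows "continuous_on UNIV (skew_inv f)"
proof -
  have "continuous_on UNIV (\<lambda>z :: (int \<Rightarrow> 'n) \<times> circle. \<lambda>i. fst z (i - 1))"
  proof (rule continuous_on_coordinatewise_then_product)
    fix i
    show "continuous_on UNIV (\<lambda>z :: (int \<Rightarrow> 'n) \<times> circle. fst z (i - 1))"
      by (rule continuous_on_compose2[OF continuous_on_product_coordinates continuous_on_fst[OF continuous_on_id]]) auto
  qed
  from continuous_on_Pair[OF this continuous_fiber[OF assms]] show ?thesis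
    by (simp add: skew_inv_def case_prod_unfold)
qed

text \<open>A generator of the Borel sets that is stable under intersection. The fiber factor is
  closed so that its indicator is a pointwise limit of continuous functions of the distance to
  it.\<close>

definition boxes :: "((int \<Rightarrow> 'n) \<times> circle) set set" where
  "boxes = {cyl K v \<times> C | K v C. closed C}"

lemma boxesI: "closed C \<Longrightarrow> cyl K v \<times> C \<in> boxes"
  unfolding boxes_def by blast

lemma Int_stable_boxes: "Int_stable (boxes :: ((int \<Rightarrow> 'n) \<times> circle) set set)"
proof (rule Int_stableI)
  \<comment> \<open>For K at most K' the longer cylinder lies in the shorter one or is disjoint from
    it. An empty intersection is written as a box with empty fiber factor.\<close>
  have *: "(cyl K v \<times> C) \<inter> (cyl K' v' \<times> C') \<in> boxes" if C: "closed C" "closed C'" "K \<le> K'"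
    for K K' C C' and v v' :: "int \<Rightarrow> 'n"
  proof (cases "v' \<in> cyl K v")
    case True
    then have "(cyl K v \<times> C) \<inter> (cyl K' v' \<times> C') = cyl K' v' \<times> (C \<inter> C')"
      using \<open>K \<le> K'\<close> by (auto simp: cyl_def)
    then show ?thesis using C by (simp add: boxesI closed_Int)
  next
    case False
    then have "(cyl K v \<times> C) \<inter> (cyl K' v' \<times> C') = cyl K v \<times> {}"
      using \<open>K \<le> K'\<close> by (auto simp: cyl_def)
    then show ?thesis by (simp only: boxesI closed_empty)
  qed
  fix A B assume "A \<in> (boxes :: ((int \<Rightarrow> 'n) \<times> circle) set set)" "B \<in> (boxes :: ((int \<Rightarrow> 'n) \<times> circle) set set)"
  then obtain K v C K' v' C' where "A = cyl K v \<times> C" "B = cyl K' v' \<times> C'" "closed C" "closed C'"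
    unfolding boxes_def by blast
  then show "A \<inter> B \<in> boxes"
    using *[of C C' K K' v v'] *[of C' C K' K v' v] by (cases "K \<le> K'") (simp_all add: Int_commute)
qed

lemma finite_range_cyl: "finite (range (cyl K :: (int \<Rightarrow> 'n::finite) \<Rightarrow> _))"
proof -
  let ?F = "{v :: int \<Rightarrow> 'n. \<forall>i. (i \<in> {- int K..<int K} \<longrightarrow> v i \<in> UNIV) \<and> (i \<notin> {- int K..<int K} \<longrightarrow> v i = undefined)}"
  have "finite ?F" by (rule finite_set_of_finite_funs) auto
  moreover have "range (cyl K) \<subseteq> cyl K ` ?F"
  proof
    fix A assume "A \<in> range (cyl K :: (int \<Rightarrow> 'n) \<Rightarrow> _)"
    then obtain v where "A = cyl K v" by blast
    then have "A = cyl K (\<lambda>i. if i \<in> {- int K..<int K} then v i else undefined)"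
      by (auto simp: cyl_def)
    then show "A \<in> cyl K ` ?F" by (simp only:) (rule imageI, simp)
  qed
  ultimately show ?thesis by (meson finite_imageI finite_subset)
qed

lemma open_contains_cyl:
  assumes "open U" "(\<xi>, x) \<in> U"
  obtains K r where "r > 0" "cyl K \<xi> \<times> ball x r \<subseteq> U"
proof -
  obtain A B where AB: "open A" "open B" "\<xi> \<in> A" "x \<in> B" "A \<times> B \<subseteq> U"
    using assms by (rule open_prod_elim[elim_format]) (auto simp: mem_Times_iff)
  obtain r where r: "r > 0" "ball x r \<subseteq> B" using AB by (auto simp: open_contains_ball)
  have "openin (product_topology (\<lambda>_. euclidean) UNIV) A" using AB(1) by (simp add: euclidean_product_topology)
  then obtain X where X: "\<xi> \<in> Pi\<^sub>E UNIV X" "finite {i. X i \<noteq> topspace euclidean}" "Pi\<^sub>E UNIV X \<subseteq> A"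
    using product_topology_open_contains_basis[OF _ AB(3)] by blast
  define I where "I = {i. X i \<noteq> UNIV}"
  have "finite I" using X(2) by (simp add: I_def)
  define K where "K = nat (Max (insert 0 (abs ` I))) + 1"
  have I: "- int K \<le> i \<and> i < int K" if "i \<in> I" for i
  proof -
    have "\<bar>i\<bar> \<le> Max (insert 0 (abs ` I))" using \<open>finite I\<close> that by (intro Max_ge) auto
    then show ?thesis unfolding K_def by linarith
  qed
  have "cyl K \<xi> \<subseteq> A"
  proof
    fix \<eta> assume "\<eta> \<in> cyl K \<xi>"
    then have eq: "\<eta> i = \<xi> i" if "i \<in> I" for i using I[OF that] by (simp add: cyl_def)
    have "\<eta> i \<in> X i" for i
    proof (cases "i \<in> I")
      case True
      then show ?thesis using eq X(1) by (auto simp: PiE_def)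
    qed (simp add: I_def)
    then show "\<eta> \<in> A" using X(3) by (auto simp: PiE_def)
  qed
  then have "cyl K \<xi> \<times> ball x r \<subseteq> U" using r AB(5) by blast
  with r(1) show ?thesis by (rule that)
qed

text \<open>Second countability made concrete: cylinders times closed balls with rational centre and
  radius \<open>1 / real (Suc m)\<close> are countably many, and every open set is a union of such
  boxes.\<close>

lemma open_in_sigma_boxes:
  fixes U :: "((int \<Rightarrow> 'n::{finite,discrete_topology}) \<times> circle) set"
  assumes "open U" shows "U \<in> sets (sigma UNIV boxes)"
proof -
  define \<B> where "\<B> = (\<Union>K. \<Union>q\<in>\<rat>. \<Union>m::nat. (\<lambda>c. c \<times> cball (circle_of q) (1 / real (Suc m))) ` range (cyl K :: (int \<Rightarrow> 'n) \<Rightarrow> _))"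
  have "countable \<B>" unfolding \<B>_def
    by (intro countable_UN countable_rat countable_image countable_finite finite_range_cyl countableI_type)
  then have c: "countable {B \<in> \<B>. B \<subseteq> U}" by simp
  have "\<B> \<subseteq> boxes" unfolding \<B>_def by (auto intro!: boxesI)
  then have s: "{B \<in> \<B>. B \<subseteq> U} \<subseteq> sets (sigma UNIV boxes)" by auto
  have "U = \<Union>{B \<in> \<B>. B \<subseteq> U}"
  proof (intro equalityI subsetI)
    fix z assume "z \<in> U"
    obtain \<xi> x where z: "z = (\<xi>, x)" by fastforce
    obtain K r where r: "r > 0" "cyl K \<xi> \<times> ball x r \<subseteq> U"
      by (rule open_contains_cyl[OF assms \<open>z \<in> U\<close>[unfolded z]])
    obtain m :: nat where m: "inverse (real (Suc m)) < r/2" using reals_Archimedean[of "r/2"] r by auto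
    define t where "t = circle_rep x"
    obtain q where q: "q \<in> \<rat>" "t - 1 / real (Suc m) < q" "q < t"
      using Rats_dense_in_real[of "t - 1 / real (Suc m)" t] by auto
    have dx: "dist (circle_of q) x \<le> 1 / real (Suc m)"
      using dist_circle_of_le[of q t] q by (simp add: t_def circle_of_rep)
    have "cball (circle_of q) (1 / real (Suc m)) \<subseteq> ball x r"
    proof
      fix y assume "y \<in> cball (circle_of q) (1 / real (Suc m))"
      then have "dist x y \<le> 2 / real (Suc m)" using dx dist_triangle[of x y "circle_of q"]
        by (simp add: dist_commute)
      also have "\<dots> < r" using m by (simp add: field_simps)
      finally show "y \<in> ball x r" by simp
    qed
    then have "cyl K \<xi> \<times> cball (circle_of q) (1 / real (Suc m)) \<subseteq> U" using r(2) by blast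
    moreover have "cyl K \<xi> \<times> cball (circle_of q) (1 / real (Suc m)) \<in> \<B>"
      unfolding \<B>_def using q(1) by blast
    moreover have "z \<in> cyl K \<xi> \<times> cball (circle_of q) (1 / real (Suc m))" using dx by (simp add: z cyl_def)
    ultimately show "z \<in> \<Union>{B \<in> \<B>. B \<subseteq> U}" by blast
  qed blast
  moreover have "\<Union>{B \<in> \<B>. B \<subseteq> U} \<in> sets (sigma UNIV boxes)" by (rule sets.countable_Union[OF c s])
  ultimately show ?thesis by simp
qed

lemma sets_borel_boxes:
  "sets (borel :: ((int \<Rightarrow> 'n::{finite,discrete_topology}) \<times> circle) measure) = sigma_sets UNIV boxes"
proof (rule antisym)
  have "{U :: ((int \<Rightarrow> 'n) \<times> circle) set. open U} \<subseteq> sigma_sets UNIV boxes"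
    using open_in_sigma_boxes by auto
  then have "sigma_sets UNIV {U :: ((int \<Rightarrow> 'n) \<times> circle) set. open U} \<subseteq> sigma_sets UNIV boxes"
    by (rule sigma_sets_mono)
  then show "sets (borel :: ((int \<Rightarrow> 'n) \<times> circle) measure) \<subseteq> sigma_sets UNIV boxes"
    by (simp add: borel_def)
  have "boxes \<subseteq> sets (borel :: ((int \<Rightarrow> 'n) \<times> circle) measure)"
    unfolding boxes_def by (auto intro!: borel_closed closed_Times closed_cyl)
  then show "sigma_sets UNIV boxes \<subseteq> sets (borel :: ((int \<Rightarrow> 'n) \<times> circle) measure)"
    using sets.sigma_sets_subset[of boxes borel] by simp
qed

text \<open>The steepening tents \<open>max 0 (1 - real m * infdist x C)\<close> converge to the
  indicator of the closed set C. The empty set is treated apart because its \<open>infdist\<close>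
  is 0 by convention.\<close>

lemma box_approx:
  fixes v :: "int \<Rightarrow> 'n"
  assumes "closed C"
  obtains \<phi> where "\<And>m :: nat. local_fun (- int K) (int K) (\<phi> m)"
    "\<And>m (z :: (int \<Rightarrow> 'n) \<times> circle). 0 \<le> \<phi> m z \<and> \<phi> m z \<le> 1"
    "\<And>z. (\<lambda>m. \<phi> m z) \<longlonglongrightarrow> indicator (cyl K v \<times> C) z"
proof (cases "C = {}")
  case True
  show ?thesis by (rule that[of "\<lambda>_ _. 0"]) (auto simp: True local_fun_const)
next
  case False
  define \<phi> :: "nat \<Rightarrow> (int \<Rightarrow> 'n) \<times> circle \<Rightarrow> real"
    where "\<phi> m z = indicator (cyl K v) (fst z) * max 0 (1 - real m * infdist (snd z) C)" for m z
  show ?thesis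
  proof (rule that[of \<phi>])
    show b: "0 \<le> \<phi> m z \<and> \<phi> m z \<le> 1" for m z
      by (auto simp: \<phi>_def indicator_def infdist_nonneg)
    show "local_fun (- int K) (int K) (\<phi> m)" for m
    proof (rule local_funI[of _ 1])
      show "\<bar>\<phi> m z\<bar> \<le> 1" for z using b[of m z] by simp
    next
      fix \<xi> \<xi>' :: "int \<Rightarrow> 'n" and x :: circle assume "\<And>i. - int K \<le> i \<Longrightarrow> i < int K \<Longrightarrow> \<xi> i = \<xi>' i"
      then show "\<phi> m (\<xi>, x) = \<phi> m (\<xi>', x)" by (simp add: \<phi>_def indicator_def cyl_def)
    next
      fix e :: real assume "e > 0"
      show "\<exists>d>0. \<forall>\<xi> x y. dist x y < d \<longrightarrow> \<bar>\<phi> m (\<xi>, x) - \<phi> m (\<xi>, y)\<bar> < e"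
      proof (intro exI[of _ "e / (real m + 1)"] conjI allI impI)
        fix \<xi> :: "int \<Rightarrow> 'n" and x y :: circle assume d: "dist x y < e / (real m + 1)"
        have "\<bar>\<phi> m (\<xi>, x) - \<phi> m (\<xi>, y)\<bar> \<le> real m * \<bar>infdist x C - infdist y C\<bar>"
        proof -
          have "\<bar>max 0 (1 - real m * infdist x C) - max 0 (1 - real m * infdist y C)\<bar> \<le> \<bar>real m * infdist x C - real m * infdist y C\<bar>"
            by (auto simp: max_def abs_if)
          also have "\<dots> = real m * \<bar>infdist x C - infdist y C\<bar>"
            by (simp add: abs_mult flip: right_diff_distrib)
          finally show ?thesis by (auto simp: \<phi>_def indicator_def)
        qed
        also have "\<dots> \<le> real m * dist x y" by (intro mult_left_mono infdist_triangle_abs) auto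
        also have "\<dots> < e"
        proof -
          have "real m * dist x y \<le> (real m + 1) * dist x y" by (intro mult_right_mono) auto
          also have "\<dots> < e" using d by (simp add: pos_less_divide_eq mult.commute)
          finally show ?thesis .
        qed
        finally show "\<bar>\<phi> m (\<xi>, x) - \<phi> m (\<xi>, y)\<bar> < e" .
      qed (use \<open>e > 0\<close> in simp)
    qed
    show "(\<lambda>m. \<phi> m z) \<longlonglongrightarrow> indicator (cyl K v \<times> C) z" for z
    proof (cases "snd z \<in> C")
      case True
      then have "\<phi> m z = indicator (cyl K v \<times> C) z" for m
        by (cases z) (simp add: \<phi>_def indicator_def)
      then show ?thesis by simp
    next
      case notC: False
      then have pos: "infdist (snd z) C > 0" using \<open>closed C\<close> False
        by (metis in_closed_iff_infdist_zero infdist_nonneg less_eq_real_def)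
      obtain n :: nat where n: "1 < real n * infdist (snd z) C" using ex_less_of_nat_mult[OF pos] by blast
      have "\<phi> m z = indicator (cyl K v \<times> C) z" if "m \<ge> n" for m
      proof -
        have "real n * infdist (snd z) C \<le> real m * infdist (snd z) C" using that pos by (intro mult_right_mono) auto
        then have "1 - real m * infdist (snd z) C \<le> 0" using n by linarith
        then show ?thesis using notC by (cases z) (simp add: \<phi>_def indicator_def)
      qed
      then show ?thesis by (intro tendsto_eventually eventually_sequentiallyI[of n])
    qed
  qed
qed

text \<open>Indicators of boxes are bounded limits of local observables, and boxes generate the
  Borel sets and are stable under intersection.\<close>

lemma measure_eq_local_fun:
  fixes M N :: "((int \<Rightarrow> 'n::{finite,discrete_topology}) \<times> circle) measure"
  assumes M: "prob_space M" "sets M = sets borel" and N: "prob_space N" "sets N = sets borel"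
    and eq: "\<And>K \<phi>. local_fun (- int K) (int K) \<phi> \<Longrightarrow> integral\<^sup>L M \<phi> = integral\<^sup>L N \<phi>"
  shows "M = N"
proof -
  interpret M: prob_space M by fact
  interpret N: prob_space N by fact
  have box: "emeasure M A = emeasure N A" if "A \<in> boxes" for A
  proof -
    obtain K v C where A: "A = cyl K v \<times> C" "closed C" using \<open>A \<in> boxes\<close> unfolding boxes_def by blast
    obtain \<phi> where \<phi>: "\<And>m :: nat. local_fun (- int K) (int K) (\<phi> m)"
      "\<And>m z. 0 \<le> \<phi> m z \<and> \<phi> m z \<le> 1" "\<And>z. (\<lambda>m. \<phi> m z) \<longlonglongrightarrow> indicator (cyl K v \<times> C) z"
      using box_approx[OF A(2), of K v] by blast
    have Ab: "A \<in> sets borel" unfolding A(1) using A(2) by (intro borel_closed closed_Times closed_cyl)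
    have lim: "(\<lambda>m. integral\<^sup>L L (\<phi> m)) \<longlonglongrightarrow> measure L A" if L: "prob_space L" "sets L = sets borel" for L
    proof -
      interpret L: prob_space L by fact
      have "(\<lambda>m. integral\<^sup>L L (\<phi> m)) \<longlonglongrightarrow> integral\<^sup>L L (indicator A)"
        by (rule integral_dominated_convergence[where w = "\<lambda>_. 1"])
          (use \<phi> L Ab in \<open>auto intro: local_fun_measurable simp: A(1)\<close>)
      then show ?thesis using Ab L(2) by simp
    qed
    have "measure M A = measure N A"
      using LIMSEQ_unique[OF lim[OF M] lim[OF N, folded eq[OF \<phi>(1)]]] .
    then show ?thesis by (simp add: M.emeasure_eq_measure N.emeasure_eq_measure)
  qed
  show ?thesis
  proof (rule measure_eqI_generator_eq[OF Int_stable_boxes, of UNIV M N "\<lambda>_. UNIV"])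
    have "(UNIV :: ((int \<Rightarrow> 'n) \<times> circle) set) = cyl 0 undefined \<times> UNIV" by (auto simp: cyl_def)
    then have "(UNIV :: ((int \<Rightarrow> 'n) \<times> circle) set) \<in> boxes" using boxesI[OF closed_UNIV, of 0 "undefined :: int \<Rightarrow> 'n"] by simp
    then show "range (\<lambda>_ :: nat. UNIV :: ((int \<Rightarrow> 'n) \<times> circle) set) \<subseteq> boxes" by blast
  qed (auto simp: box M N sets_borel_boxes)
qed

text \<open>Density of local observables in mean, by Dynkin induction over the boxes. For a disjoint
  union the tail is discarded at the cost e/2 and the remaining n sets share the other half.\<close>

lemma indicator_approx:
  fixes M :: "((int \<Rightarrow> 'n::{finite,discrete_topology}) \<times> circle) measure"
  assumes M: "prob_space M" "sets M = sets borel" and "A \<in> sets borel" "e > 0"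
  shows "\<exists>K \<phi>. local_fun (- int K) (int K) \<phi> \<and> (\<integral>z. \<bar>indicator A z - \<phi> z\<bar> \<partial>M) < e"
proof -
  interpret prob_space M by fact
  have "boxes \<subseteq> Pow (UNIV :: ((int \<Rightarrow> 'n) \<times> circle) set)" by simp
  moreover have "A \<in> sigma_sets UNIV boxes" using assms(3) by (simp add: sets_borel_boxes)
  ultimately show ?thesis using \<open>e > 0\<close>
  proof (induction arbitrary: e rule: sigma_sets_induct_disjoint[OF Int_stable_boxes, of UNIV, consumes 2, case_names basic empty compl union])
    case (basic A)
    then obtain K v C where A: "A = cyl K v \<times> C" "closed C" unfolding boxes_def by blast
    obtain \<phi> where \<phi>: "\<And>m :: nat. local_fun (- int K) (int K) (\<phi> m)"
      "\<And>m z. 0 \<le> \<phi> m z \<and> \<phi> m z \<le> 1" "\<And>z. (\<lambda>m. \<phi> m z) \<longlonglongrightarrow> indicator (cyl K v \<times> C) z"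
      using box_approx[OF A(2), of K v] by blast
    have Ab: "A \<in> sets M" unfolding A(1) M(2) using A(2) by (intro borel_closed closed_Times closed_cyl)
    have lim: "(\<lambda>m. \<bar>indicator A z - \<phi> m z\<bar>) \<longlonglongrightarrow> 0" for z
      using tendsto_rabs[OF tendsto_diff[OF tendsto_const \<phi>(3)[of z]], of "indicator A z"] by (simp add: A(1))
    have "(\<lambda>m. \<integral>z. \<bar>indicator A z - \<phi> m z\<bar> \<partial>M) \<longlonglongrightarrow> (\<integral>z. 0 \<partial>M)"
    proof (rule integral_dominated_convergence[where w = "\<lambda>_. 1"])
      show "(\<lambda>z. \<bar>indicator A z - \<phi> m z\<bar>) \<in> borel_measurable M" for m
        using local_fun_measurable[OF \<phi>(1) M(2), of m] Ab by simp
      show "AE z in M. norm \<bar>indicator A z - \<phi> m z\<bar> \<le> 1" for m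
      proof (intro AE_I2)
        fix z show "norm \<bar>indicator A z - \<phi> m z\<bar> \<le> 1"
          using \<phi>(2)[of m z] by (cases "z \<in> A") auto
      qed
    qed (use lim in auto)
    then have "(\<lambda>m. \<integral>z. \<bar>indicator A z - \<phi> m z\<bar> \<partial>M) \<longlonglongrightarrow> 0" by simp
    from order_tendstoD(2)[OF this \<open>e > 0\<close>]
    obtain m where "(\<integral>z. \<bar>indicator A z - \<phi> m z\<bar> \<partial>M) < e" unfolding eventually_sequentially by blast
    then show ?case using \<phi>(1) by blast
  next
    case empty
    then show ?case using local_fun_const[of "- int 0" "int 0" 0]
      by (intro exI[of _ 0] exI[of _ "\<lambda>_. 0"]) simp
  next
    case (compl A)
    then obtain K \<phi> where \<phi>: "local_fun (- int K) (int K) \<phi>" "(\<integral>z. \<bar>indicator A z - \<phi> z\<bar> \<partial>M) < e" by blast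
    have "\<bar>indicator (UNIV - A) z - (1 - \<phi> z)\<bar> = \<bar>indicator A z - \<phi> z\<bar>" for z
      by (auto simp: indicator_def abs_if)
    then show ?case using \<phi> local_fun_diff[OF local_fun_const[of _ _ 1] \<phi>(1)]
      by (intro exI[of _ K] exI[of _ "\<lambda>z. 1 - \<phi> z"]) simp
  next
    case (union A)
    have Ab: "A i \<in> sets M" for i using union(2) by (auto simp: M sets_borel_boxes)
    have "(\<lambda>n. measure M (\<Union>i\<in>{..<n}. A i)) \<longlonglongrightarrow> measure M (\<Union>n. \<Union>i\<in>{..<n}. A i)"
    proof (rule finite_Lim_measure_incseq)
      show "incseq (\<lambda>n. \<Union>i\<in>{..<n}. A i)" unfolding incseq_def by (intro allI impI UN_mono) auto
    qed (use Ab in auto)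
    moreover have "(\<Union>n. \<Union>i\<in>{..<n}. A i) = (\<Union>i. A i)" by blast
    ultimately have "(\<lambda>n. measure M (\<Union>i\<in>{..<n}. A i)) \<longlonglongrightarrow> measure M (\<Union>i. A i)" by simp
    from order_tendstoD(1)[OF this, of "measure M (\<Union>i. A i) - e/2"] \<open>e > 0\<close>
    obtain n where n: "measure M (\<Union>i. A i) - e/2 < measure M (\<Union>i\<in>{..<n}. A i)"
      unfolding eventually_sequentially by auto
    \<comment> \<open>The share of each of the n sets; the denominator \<open>real n + 1\<close>
      also covers n = 0.\<close>
    define e' where "e' = e / 2 / (real n + 1)"
    have "e' > 0" using \<open>e > 0\<close> by (simp add: e'_def)
    have "\<exists>p. \<forall>i. local_fun (- int (fst (p i))) (int (fst (p i))) (snd (p i)) \<and> (\<integral>z. \<bar>indicator (A i) z - snd (p i) z\<bar> \<partial>M) < e'"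
      by (rule choice) (use union(3)[OF \<open>e' > 0\<close>] in auto)
    then obtain p where p: "\<And>i. local_fun (- int (fst (p i))) (int (fst (p i))) (snd (p i))"
      "\<And>i. (\<integral>z. \<bar>indicator (A i) z - snd (p i) z\<bar> \<partial>M) < e'" by blast
    define K where "K = Max (insert 0 ((\<lambda>i. fst (p i)) ` {..<n}))"
    have K: "fst (p i) \<le> K" if "i < n" for i unfolding K_def using that by (intro Max_ge) auto
    define \<phi> where "\<phi> z = (\<Sum>i<n. snd (p i) z)" for z
    have lp: "local_fun (- int K) (int K) (snd (p i))" if "i < n" for i
      by (rule local_fun_mono[OF p(1)]) (use K[OF that] in auto)
    have \<phi>: "local_fun (- int K) (int K) \<phi>"
      unfolding \<phi>_def by (rule local_fun_sum) (simp add: lp)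
    have int1: "integrable M (\<lambda>z. \<bar>indicator (A i) z - snd (p i) z\<bar>)" for i
      using local_fun_integrable[OF p(1) M(2,1)] Ab[of i]
      by (intro integrable_abs Bochner_Integration.integrable_diff) (auto simp: integrable_indicator_iff emeasure_eq_measure)
    let ?U = "\<Union>i. A i" and ?V = "\<Union>i\<in>{..<n}. A i"
    have ind: "indicator ?V z = (\<Sum>i<n. indicator (A i) z :: real)" for z
      by (rule indicator_UN_disjoint[OF finite_lessThan disjoint_family_on_mono[OF subset_UNIV union(1)]])
    have bd: "\<bar>indicator ?U z - \<phi> z\<bar> \<le> (indicator ?U z - indicator ?V z) + (\<Sum>i<n. \<bar>indicator (A i) z - snd (p i) z\<bar>)" for z
    proof -
      have "\<bar>indicator ?U z - \<phi> z\<bar> \<le> \<bar>indicator ?U z - indicator ?V z\<bar> + \<bar>indicator ?V z - \<phi> z\<bar>" by linarith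
      also have "\<bar>indicator ?U z - indicator ?V z :: real\<bar> = indicator ?U z - indicator ?V z"
        by (auto simp: indicator_def)
      also have "\<bar>indicator ?V z - \<phi> z\<bar> \<le> (\<Sum>i<n. \<bar>indicator (A i) z - snd (p i) z\<bar>)"
        unfolding ind \<phi>_def sum_subtractf[symmetric] by (rule sum_abs)
      finally show ?thesis by simp
    qed
    have iUV: "integrable M (\<lambda>z. indicator ?U z - indicator ?V z :: real)"
      using Ab by (intro Bochner_Integration.integrable_diff) (auto simp: integrable_indicator_iff emeasure_eq_measure)
    have "(\<integral>z. \<bar>indicator ?U z - \<phi> z\<bar> \<partial>M) \<le> (\<integral>z. (indicator ?U z - indicator ?V z) + (\<Sum>i<n. \<bar>indicator (A i) z - snd (p i) z\<bar>) \<partial>M)"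
    proof (rule integral_mono)
      show "integrable M (\<lambda>z. \<bar>indicator ?U z - \<phi> z\<bar>)"
        using local_fun_integrable[OF \<phi> M(2,1)] Ab
        by (intro integrable_abs Bochner_Integration.integrable_diff) (auto simp: integrable_indicator_iff emeasure_eq_measure)
      show "integrable M (\<lambda>z. (indicator ?U z - indicator ?V z) + (\<Sum>i<n. \<bar>indicator (A i) z - snd (p i) z\<bar>))"
        by (intro Bochner_Integration.integrable_add iUV Bochner_Integration.integrable_sum int1)
    qed (rule bd)
    also have "\<dots> = (\<integral>z. (indicator ?U z - indicator ?V z) \<partial>M) + (\<Sum>i<n. \<integral>z. \<bar>indicator (A i) z - snd (p i) z\<bar> \<partial>M)"
      by (subst Bochner_Integration.integral_add[OF iUV Bochner_Integration.integrable_sum[OF int1]])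
        (simp add: Bochner_Integration.integral_sum int1)
    also have "(\<integral>z. (indicator ?U z - indicator ?V z :: real) \<partial>M) = measure M ?U - measure M ?V"
      using Ab by (subst Bochner_Integration.integral_diff) (auto simp: integrable_indicator_iff emeasure_eq_measure)
    also have "\<dots> < e/2" using n by simp
    also have "(\<Sum>i<n. \<integral>z. \<bar>indicator (A i) z - snd (p i) z\<bar> \<partial>M) \<le> real n * e'"
      using sum_bounded_above[of "{..<n}" "\<lambda>i. \<integral>z. \<bar>indicator (A i) z - snd (p i) z\<bar> \<partial>M" e'] p(2) by (simp add: less_imp_le)
    also have "real n * e' \<le> e/2" using \<open>e > 0\<close> by (simp add: e'_def field_simps)
    finally have "(\<integral>z. \<bar>indicator ?U z - \<phi> z\<bar> \<partial>M) < e" by simp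
    with \<phi> show ?case by blast
  qed
qed

subsection \<open>Words read off a sequence\<close>

definition word :: "int \<Rightarrow> nat \<Rightarrow> (int \<Rightarrow> 'n) \<Rightarrow> 'n list" where
  "word a n \<xi> = map (\<lambda>k. \<xi> (a + int k)) [0..<n]"

lemma length_word [simp]: "length (word a n \<xi>) = n"
  by (simp add: word_def)

lemma word_0 [simp]: "word a 0 \<xi> = []"
  by (simp add: word_def)

lemma word_append: "word a (m + n) \<xi> = word a m \<xi> @ word (a + int m) n \<xi>"
  by (rule nth_equalityI) (auto simp: word_def nth_append)

lemma word_Suc: "word a (Suc n) \<xi> = \<xi> a # word (a + 1) n \<xi>"
  using word_append[of a "Suc 0" n \<xi>] by (simp add: word_def)

lemma word_snoc: "word a (Suc n) \<xi> = word a n \<xi> @ [\<xi> (a + int n)]"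
  using word_append[of a n "Suc 0" \<xi>] by (simp add: word_def)

lemma word_eq_iff: "word a n \<xi> = w \<longleftrightarrow> length w = n \<and> (\<forall>k<n. \<xi> (a + int k) = w ! k)"
  by (auto simp: word_def list_eq_iff_nth_eq)

lemma word_shift: "word a n (\<lambda>i. \<xi> (i + c)) = word (a + c) n \<xi>"
  by (simp add: word_def algebra_simps)

section \<open>The uniform Bernoulli measure\<close>

text \<open>Its sigma-algebra is the product of the discrete ones. Measurability of maps into the
  Borel sets of the phase space is later checked on boxes, whose cylinders are events about
  words.\<close>

definition bern :: "(int \<Rightarrow> 'n::finite) measure" where
  "bern = Pi\<^sub>M UNIV (\<lambda>_. measure_pmf (pmf_of_set UNIV))"

lemma prob_space_bern: "prob_space bern"
  unfolding bern_def by (intro prob_space_PiM prob_space_measure_pmf)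

lemma space_bern [simp]: "space (bern :: (int \<Rightarrow> 'n::finite) measure) = UNIV"
  by (simp add: bern_def space_PiM)

lemma UNIV_sets_bern [simp]: "UNIV \<in> sets (bern :: (int \<Rightarrow> 'n::finite) measure)"
  using sets.top[of bern] by simp

lemma word_vimage_bern: "word a n -` {w} \<in> sets (bern :: (int \<Rightarrow> 'n::finite) measure)"
proof (cases "length w = n")
  case True
  have c: "(\<lambda>\<xi> :: int \<Rightarrow> 'n. \<xi> i) -` {v} \<in> sets bern" for i v
  proof -
    have "(\<lambda>\<xi> :: int \<Rightarrow> 'n. \<xi> i) \<in> measurable bern (measure_pmf (pmf_of_set UNIV))"
      unfolding bern_def by (rule measurable_component_singleton) simp
    from measurable_sets[OF this, of "{v}"] show ?thesis by simp
  qed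
  have "word a n -` {w} = UNIV - (\<Union>k\<in>{..<n}. UNIV - (\<lambda>\<xi> :: int \<Rightarrow> 'n. \<xi> (a + int k)) -` {w ! k})"
    using True by (auto simp: word_eq_iff)
  also have "\<dots> \<in> sets bern"
    using c by (intro sets.Diff sets.finite_UN) (auto intro: sets.top[of bern, simplified])
  finally show ?thesis .
next
  case False
  then have "word a n -` {w} = {}" by auto
  then show ?thesis by simp
qed

lemma measurable_word: "word a n \<in> measurable (bern :: (int \<Rightarrow> 'n::finite) measure) (count_space UNIV)"
proof (rule measurable_count_space_eq_countable[THEN iffD2])
  show "countable (UNIV :: 'n list set)" by simp
  show "word a n \<in> space bern \<rightarrow> UNIV \<and> (\<forall>w\<in>UNIV. word a n -` {w} \<inter> space (bern :: (int \<Rightarrow> 'n) measure) \<in> sets bern)"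
    by (simp add: word_vimage_bern)
qed

lemma prob_word:
  fixes w :: "'n::finite list"
  assumes "length w = n"
  shows "measure bern (word a n -` {w}) = 1 / real CARD('n) ^ n"
proof -
  interpret product_prob_space "\<lambda>_ :: int. measure_pmf (pmf_of_set (UNIV :: 'n set))" UNIV
    by unfold_locales
  define J where "J = {a..<a + int n}"
  have eq: "word a n -` {w} = {\<xi> \<in> space (Pi\<^sub>M UNIV (\<lambda>_. measure_pmf (pmf_of_set UNIV))). \<forall>i\<in>J. \<xi> i \<in> {w ! nat (i - a)}}"
  proof (intro equalityI subsetI)
    fix \<xi> assume "\<xi> \<in> word a n -` {w}"
    then have *: "\<xi> (a + int k) = w ! k" if "k < n" for k using that by (auto simp: word_eq_iff)
    have "\<xi> i = w ! nat (i - a)" if "i \<in> J" for i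
      using *[of "nat (i - a)"] that by (auto simp: J_def)
    then show "\<xi> \<in> {\<xi> \<in> space (Pi\<^sub>M UNIV (\<lambda>_. measure_pmf (pmf_of_set UNIV))). \<forall>i\<in>J. \<xi> i \<in> {w ! nat (i - a)}}"
      by (simp add: space_PiM)
  next
    fix \<xi> assume "\<xi> \<in> {\<xi> \<in> space (Pi\<^sub>M UNIV (\<lambda>_. measure_pmf (pmf_of_set UNIV))). \<forall>i\<in>J. \<xi> i \<in> {w ! nat (i - a)}}"
    then have *: "\<xi> i = w ! nat (i - a)" if "i \<in> J" for i using that by auto
    have "\<xi> (a + int k) = w ! k" if "k < n" for k
      using *[of "a + int k"] that by (auto simp: J_def)
    then show "\<xi> \<in> word a n -` {w}" using assms by (simp add: word_eq_iff)
  qed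
  have "emeasure bern (word a n -` {w}) = (\<Prod>i\<in>J. emeasure (measure_pmf (pmf_of_set (UNIV :: 'n set))) {w ! nat (i - a)})"
    unfolding eq bern_def by (rule emeasure_PiM_Collect) (auto simp: J_def)
  also have "\<dots> = (\<Prod>i\<in>J. ennreal (1 / real CARD('n)))"
    by (intro prod.cong refl) (simp add: emeasure_pmf_single)
  also have "\<dots> = ennreal ((1 / real CARD('n)) ^ n)"
    by (simp add: J_def ennreal_power)
  finally show ?thesis
    by (simp add: measure_def power_one_over)
qed

text \<open>Every window of n letters is uniformly distributed under the Bernoulli measure. This is
  the bridge from integrals over sequences to averages over words.\<close>

lemma integral_word:
  fixes g :: "'n::finite list \<Rightarrow> real"
  shows "(\<integral>\<xi>. g (word a n \<xi>) \<partial>bern) = wavg n g"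
proof -
  interpret prob_space "bern :: (int \<Rightarrow> 'n) measure" by (rule prob_space_bern)
  have "g (word a n \<xi>) = (\<Sum>w | length w = n. g w * indicator (word a n -` {w}) \<xi>)" for \<xi>
  proof -
    have "(\<Sum>w | length w = n. g w * indicator (word a n -` {w}) \<xi>) = (\<Sum>w | length w = n. if w = word a n \<xi> then g w else 0)"
      by (intro sum.cong refl) (auto simp: indicator_def)
    also have "\<dots> = g (word a n \<xi>)" by (simp add: sum.delta)
    finally show ?thesis by simp
  qed
  then have "(\<integral>\<xi>. g (word a n \<xi>) \<partial>bern) = (\<integral>\<xi>. (\<Sum>w | length w = n. g w * indicator (word a n -` {w}) \<xi>) \<partial>bern)"
    by simp
  also have "\<dots> = (\<Sum>w | length w = n. \<integral>\<xi>. g w * indicator (word a n -` {w}) \<xi> \<partial>bern)"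
    by (rule Bochner_Integration.integral_sum)
      (intro integrable_mult_right integrable_real_indicator word_vimage_bern, simp add: emeasure_eq_measure)
  also have "\<dots> = (\<Sum>w | length w = n. g w * (1 / real CARD('n) ^ n))"
    by (intro sum.cong refl) (simp add: prob_word)
  finally show ?thesis by (simp add: wavg_def sum_divide_distrib)
qed

section \<open>The Markov chain of random letters\<close>

locale random_circle = circle_homeos f for f :: "'n::{finite,discrete_topology} \<Rightarrow> circle \<Rightarrow> circle"
begin

text \<open>The skew product with the letter at position 0 replaced by i, which the shift moves to
  position -1. With random i this is a Markov chain that adds one letter to the past; the leftover
  letters at nonnegative positions are invisible to observables of the past.\<close>

definition step :: "'n \<Rightarrow> (int \<Rightarrow> 'n) \<times> circle \<Rightarrow> (int \<Rightarrow> 'n) \<times> circle" where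
  "step i z = ((\<lambda>j. if j = - 1 then i else fst z (j + 1)), f i (snd z))"

abbreviation push :: "'n list \<Rightarrow> (int \<Rightarrow> 'n) \<times> circle \<Rightarrow> (int \<Rightarrow> 'n) \<times> circle" where
  "push \<equiv> fold step"

text \<open>The n-step transition operator of this chain: for an observable of the past, its
  expected value n steps later when the future letters are random.\<close>

definition markov :: "nat \<Rightarrow> ((int \<Rightarrow> 'n) \<times> circle \<Rightarrow> real) \<Rightarrow> (int \<Rightarrow> 'n) \<times> circle \<Rightarrow> real" where
  "markov n \<phi> z = wavg n (\<lambda>w. \<phi> (push w z))"

lemma skew_eq_step: "skew f z = step (fst z 0) z"
  by (auto simp: skew_def step_def case_prod_unfold)

lemma fst_skew_iterate: "fst ((skew f ^^ n) z) i = fst z (i + int n)"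
proof (induction n arbitrary: i)
  case (Suc n)
  have "fst ((skew f ^^ Suc n) z) i = fst ((skew f ^^ n) z) (i + 1)"
    by (simp add: skew_def case_prod_unfold)
  then show ?case by (simp add: Suc algebra_simps)
qed simp

lemma skew_iterate_push: "(skew f ^^ n) z = push (word 0 n (fst z)) z"
proof (induction n)
  case (Suc n)
  have "(skew f ^^ Suc n) z = step (fst ((skew f ^^ n) z) 0) ((skew f ^^ n) z)"
    by (simp add: skew_eq_step)
  then show ?case by (simp add: Suc[symmetric] word_snoc fst_skew_iterate)
qed simp

lemma snd_push: "snd (push w z) = fold f w (snd z)"
  by (induction w arbitrary: z) (auto simp: step_def)

text \<open>Each pushed letter moves the interval of agreement one place to the left and fills
  position -1 of both sequences with the same letter.\<close>

lemma push_agree: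
  assumes "\<And>j. k \<le> j \<Longrightarrow> j < 0 \<Longrightarrow> fst z j = fst z' j" "k - int (length w) \<le> j" "j < 0"
  shows "fst (push w z) j = fst (push w z') j"
  using assms
proof (induction w arbitrary: z z' k)
  case (Cons i w)
  have "fst (step i z) j = fst (step i z') j" if "k - 1 \<le> j" "j < 0" for j
    using that Cons.prems(1)[of "j + 1"] by (auto simp: step_def)
  from Cons.IH[OF this, of "k - 1"] Cons.prems(2,3) show ?case by simp
qed simp

text \<open>Once the word is as long as the window, the original past is forgotten and only the
  starting fiber point matters.\<close>

lemma past_push_cong:
  assumes "local_fun a 0 \<phi>" "- a \<le> int (length w)" "snd z = snd z'"
  shows "\<phi> (push w z) = \<phi> (push w z')"
proof -
  have "fst (push w z) i = fst (push w z') i" if "a \<le> i" "i < 0" for i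
    by (rule push_agree[of 0]) (use that assms(2) in auto)
  then have "\<phi> (fst (push w z), snd (push w z)) = \<phi> (fst (push w z'), snd (push w z))"
    by (intro local_fun_cong[OF assms(1)])
  moreover have "snd (push w z) = snd (push w z')" by (simp add: snd_push assms(3))
  ultimately show ?thesis by (metis prod.collapse)
qed

text \<open>The point reached at time \<open>0\<close> by the orbit started at \<open>0\<close> at time \<open>- n\<close>.\<close>

definition pull :: "nat \<Rightarrow> (int \<Rightarrow> 'n) \<Rightarrow> circle" where
  "pull n \<xi> = fold f (word (- int n) n \<xi>) 0"

text \<open>The orbit of the pulled-back point is the orbit of the fiber point 0 started m steps
  earlier, so \<open>m + j\<close> consecutive letters are pushed.\<close>

lemma skew_iterate_pull:
  "(skew f ^^ j) (\<xi>, pull m \<xi>) = push (word (- int m) (m + j) \<xi>) ((\<lambda>i. \<xi> (i - int m)), 0)"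
proof -
  let ?z = "((\<lambda>i. \<xi> (i - int m)), 0 :: circle)"
  have w: "word 0 n (\<lambda>i. \<xi> (i - int m)) = word (- int m) n \<xi>" for n
    using word_shift[of 0 n \<xi> "- int m"] by simp
  have "(\<xi>, pull m \<xi>) = (skew f ^^ m) ?z"
  proof (rule prod_eqI)
    show "fst (\<xi>, pull m \<xi>) = fst ((skew f ^^ m) ?z)" by (rule ext) (simp add: fst_skew_iterate)
    show "snd (\<xi>, pull m \<xi>) = snd ((skew f ^^ m) ?z)"
      unfolding skew_iterate_push snd_push by (simp add: w pull_def)
  qed
  then have "(skew f ^^ j) (\<xi>, pull m \<xi>) = (skew f ^^ (j + m)) ?z" by (simp add: funpow_add)
  then show ?thesis unfolding skew_iterate_push by (simp add: w add.commute)
qed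

lemma measurable_pull: "pull n \<in> measurable bern borel"
proof -
  have "(\<lambda>\<xi>. (\<lambda>w. fold f w 0) (word (- int n) n \<xi>)) \<in> measurable bern borel"
    by (rule measurable_compose[OF measurable_word]) simp
  then show ?thesis unfolding pull_def[abs_def] by simp
qed

section \<open>Convergence of pullbacks and the attractor\<close>

text \<open>The last m letters before time 0 consist of \<open>m - n\<close> older ones and the n
  most recent. Both pullbacks end with the same n maps, applied to 0 and to the point reached by the
  older letters, and synchronization is uniform in these two points.\<close>

lemma prob_pull_far:
  assumes "e > 0" "\<theta> > 0"
  shows "\<exists>n0. \<forall>n\<ge>n0. \<forall>m\<ge>n. measure bern {\<xi>. e \<le> dist (pull n \<xi>) (pull m \<xi>)} \<le> \<theta>"
proof -
  interpret prob_space "bern :: (int \<Rightarrow> 'n) measure" by (rule prob_space_bern)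
  obtain n0 where n0: "\<And>n x y. n \<ge> n0 \<Longrightarrow> wavg n (\<lambda>w. of_bool (e \<le> dist (fold f w x) (fold f w y))) \<le> \<theta>"
    using synchronization[OF assms] by blast
  have "measure bern {\<xi>. e \<le> dist (pull n \<xi>) (pull m \<xi>)} \<le> \<theta>" if "n \<ge> n0" "m \<ge> n" for n m
  proof -
    define k where "k = m - n"
    have m: "m = k + n" using that by (simp add: k_def)
    have w: "word (- int m) m \<xi> = word (- int m) k \<xi> @ word (- int n) n \<xi>" for \<xi> :: "int \<Rightarrow> 'n"
      unfolding m word_append[of _ k n] by simp
    have drop: "drop k (word (- int m) m \<xi>) = word (- int n) n \<xi>" for \<xi> :: "int \<Rightarrow> 'n" unfolding w by simp
    have "measure bern {\<xi>. e \<le> dist (pull n \<xi>) (pull m \<xi>)} = (\<integral>\<xi>. indicator {\<xi>. e \<le> dist (pull n \<xi>) (pull m \<xi>)} \<xi> \<partial>bern)"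
      by simp
    also have "\<dots> = (\<integral>\<xi>. (\<lambda>v. of_bool (e \<le> dist (fold f (drop k v) 0) (fold f v 0))) (word (- int m) m \<xi>) \<partial>bern)"
      by (intro Bochner_Integration.integral_cong refl) (simp add: drop pull_def indicator_def)
    also have "\<dots> = wavg m (\<lambda>v. of_bool (e \<le> dist (fold f (drop k v) 0) (fold f v 0)))"
      by (rule integral_word)
    also have "\<dots> = wavg k (\<lambda>u. wavg n (\<lambda>w. of_bool (e \<le> dist (fold f w 0) (fold f w (fold f u 0)))))"
      unfolding m wavg_append by (intro wavg_cong) simp
    also have "\<dots> \<le> \<theta>" by (intro wavg_le_const n0 that)
    finally show ?thesis .
  qed
  then show ?thesis by blast
qed

text \<open>Summable distances and summable probabilities, as needed for the Borel-Cantelli lemma: a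
  Cauchy property in probability becomes almost sure convergence along a subsequence.\<close>

definition good_times :: "(nat \<Rightarrow> nat) \<Rightarrow> bool" where
  "good_times r \<longleftrightarrow> strict_mono r \<and>
     (\<forall>k. measure bern {\<xi>. (1/2) ^ k \<le> dist (pull (r k) \<xi>) (pull (r (Suc k)) \<xi>)} \<le> (1/2) ^ k)"

lemma good_times_exist: "\<exists>r. good_times r"
proof -
  have "\<exists>n0. \<forall>k. \<forall>n\<ge>n0 k. \<forall>m\<ge>n. measure bern {\<xi>. (1/2) ^ k \<le> dist (pull n \<xi>) (pull m \<xi>)} \<le> (1/2) ^ k"
    by (intro choice allI prob_pull_far) auto
  then obtain n0 where n0: "\<And>k n m. n \<ge> n0 k \<Longrightarrow> m \<ge> n \<Longrightarrow> measure bern {\<xi>. (1/2) ^ k \<le> dist (pull n \<xi>) (pull m \<xi>)} \<le> (1/2) ^ k"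
    by blast
  \<comment> \<open>The sum exceeds every single threshold \<open>n0 k\<close>, and the summand k
    makes the sequence strictly increasing.\<close>
  define r where "r k = (\<Sum>i\<le>k. n0 i) + k" for k
  have r: "strict_mono r" by (rule strict_monoI_Suc) (simp add: r_def)
  have "n0 k \<le> r k" for k
    using member_le_sum[of k "{..k}" n0] by (simp add: r_def)
  then have "good_times r"
    unfolding good_times_def using r n0 strict_mono_less_eq[OF r] by simp
  then show ?thesis by blast
qed

definition times :: "nat \<Rightarrow> nat" where "times = (SOME r. good_times r)"

lemma good_times_times: "good_times times"
  unfolding times_def using good_times_exist by (rule someI_ex)

lemma times_ge: "k \<le> times k"
  using good_times_times by (intro strict_mono_imp_increasing) (simp add: good_times_def)

definition fast :: "(int \<Rightarrow> 'n) set" where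
  "fast = {\<xi>. \<forall>\<^sub>F k in sequentially. dist (pull (times k) \<xi>) (pull (times (Suc k)) \<xi>) < (1/2) ^ k}"

text \<open>Off the full-measure set \<open>fast\<close> the value 0 is a default; it keeps the map
  total and measurable.\<close>

definition attractor :: "(int \<Rightarrow> 'n) \<Rightarrow> circle" where
  "attractor \<xi> = (if \<xi> \<in> fast then lim (\<lambda>k. pull (times k) \<xi>) else 0)"

lemma far_sets: "{\<xi>. e \<le> dist (pull n \<xi>) (pull m \<xi>)} \<in> sets bern"
proof -
  define k where "k = max n m"
  define g where "g v = (fold f (drop (k - n) v) 0, fold f (drop (k - m) v) 0)" for v
  have w: "drop (k - j) (word (- int k) k \<xi>) = word (- int j) j \<xi>" if "j \<le> k" for j and \<xi> :: "int \<Rightarrow> 'n"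
  proof -
    have "word (- int k) ((k - j) + j) \<xi> = word (- int k) (k - j) \<xi> @ word (- int j) j \<xi>"
      using that unfolding word_append by (simp add: of_nat_diff)
    then show ?thesis using that by simp
  qed
  have "{\<xi>. e \<le> dist (pull n \<xi>) (pull m \<xi>)} = word (- int k) k -` {v. e \<le> dist (fst (g v)) (snd (g v))} \<inter> space bern"
  proof -
    have "n \<le> k" "m \<le> k" by (auto simp: k_def)
    then show ?thesis by (auto simp: g_def pull_def w)
  qed
  also have "\<dots> \<in> sets bern" by (rule measurable_sets[OF measurable_word]) simp
  finally show ?thesis .
qed

lemma fast_sets: "fast \<in> sets bern"
proof -
  have "fast = (\<Union>N. \<Inter>k\<in>{N..}. UNIV - {\<xi>. (1/2) ^ k \<le> dist (pull (times k) \<xi>) (pull (times (Suc k)) \<xi>)})"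
    unfolding fast_def eventually_sequentially by (force simp: not_le)
  also have "\<dots> \<in> sets bern"
    using far_sets sets.top[of bern] by (intro sets.countable_UN' sets.countable_INT'' sets.countable_INT' sets.Diff) auto
  finally show ?thesis .
qed

text \<open>Borel-Cantelli with the geometric bounds of \<open>good_times\<close>.\<close>

lemma AE_fast: "AE \<xi> in bern. \<xi> \<in> fast"
proof -
  interpret prob_space "bern :: (int \<Rightarrow> 'n) measure" by (rule prob_space_bern)
  let ?A = "\<lambda>k. {\<xi>. (1/2) ^ k \<le> dist (pull (times k) \<xi>) (pull (times (Suc k)) \<xi>)}"
  have "summable (\<lambda>k. measure bern (?A k))"
  proof (rule summable_comparison_test'[where g = "\<lambda>k. (1/2) ^ k" and N = 0])
    show "summable (\<lambda>k. (1/2 :: real) ^ k)" by (rule summable_geometric) simp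
    show "norm (measure bern (?A k)) \<le> (1/2) ^ k" for k
      using good_times_times by (simp add: good_times_def)
  qed
  then have "AE \<xi> in bern. \<forall>\<^sub>F k in sequentially. \<xi> \<in> space bern - ?A k"
    by (intro borel_cantelli_AE1 far_sets) (auto simp: emeasure_eq_measure)
  then show ?thesis
    by (rule AE_mp) (auto simp: fast_def not_le intro!: AE_I2)
qed

lemma fast_convergent:
  assumes "\<xi> \<in> fast" shows "(\<lambda>k. pull (times k) \<xi>) \<longlonglongrightarrow> attractor \<xi>"
proof -
  define s where "s k = pull (times k) \<xi>" for k
  obtain K where K: "\<And>k. k \<ge> K \<Longrightarrow> dist (s k) (s (Suc k)) < (1/2) ^ k"
    using assms by (auto simp: fast_def eventually_sequentially s_def)
  have d: "dist (s m) (s n) \<le> 2 * (1/2) ^ m - 2 * (1/2) ^ n" if "K \<le> m" "m \<le> n" for m n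
    using that(2)
  proof (induction n rule: dec_induct)
    case (step n)
    have "dist (s m) (s (Suc n)) \<le> dist (s m) (s n) + dist (s n) (s (Suc n))" by (rule dist_triangle)
    then show ?case using step.IH K[of n] step.hyps that(1) by simp
  qed simp
  have "Cauchy s"
  proof (rule metric_CauchyI)
    fix e :: real assume "e > 0"
    then obtain N where N: "(1/2 :: real) ^ N < e / 4" using real_arch_pow_inv[of "e/4" "1/2"] by auto
    have "dist (s m) (s n) < e" if "m \<ge> max K N" "n \<ge> max K N" for m n
    proof -
      have *: "dist (s (max K N)) (s j) < e / 2" if "j \<ge> max K N" for j
      proof -
        have "dist (s (max K N)) (s j) \<le> 2 * (1/2) ^ max K N - 2 * (1/2) ^ j" by (rule d) (use that in auto)
        also have "\<dots> \<le> 2 * (1/2) ^ max K N" by simp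
        also have "\<dots> \<le> 2 * (1/2) ^ N" by (intro mult_left_mono power_decreasing) auto
        also have "\<dots> < e / 2" using N by simp
        finally show ?thesis .
      qed
      show ?thesis using *[OF that(1)] *[OF that(2)] dist_triangle3[of "s m" "s n" "s (max K N)"]
        by (simp add: dist_commute)
    qed
    then show "\<exists>M. \<forall>m\<ge>M. \<forall>n\<ge>M. dist (s m) (s n) < e" by blast
  qed
  then obtain l where "s \<longlonglongrightarrow> l"
    using compact_imp_complete[OF compact_circle] unfolding complete_def by auto
  then show ?thesis using assms limI by (auto simp: attractor_def s_def[abs_def])
qed

lemma measurable_attractor: "attractor \<in> measurable bern borel"
proof (rule borel_measurable_LIMSEQ_metric)
  show "(\<lambda>\<xi>. if \<xi> \<in> fast then pull (times k) \<xi> else 0) \<in> borel_measurable bern" for k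
    by (intro measurable_If measurable_pull) (simp_all add: fast_sets)
  show "(\<lambda>k. if \<xi> \<in> fast then pull (times k) \<xi> else 0) \<longlonglongrightarrow> attractor \<xi>" for \<xi>
    using fast_convergent[of \<xi>] by (cases "\<xi> \<in> fast") (simp_all add: attractor_def)
qed

section \<open>The measure on the graph of the attractor\<close>

definition mu :: "((int \<Rightarrow> 'n) \<times> circle) measure" where
  "mu = distr bern borel (\<lambda>\<xi>. (\<xi>, attractor \<xi>))"

lemma cyl_word: "cyl K v = word (- int K) (2 * K) -` {word (- int K) (2 * K) v}"
proof -
  have "\<xi> \<in> cyl K v \<longleftrightarrow> word (- int K) (2 * K) \<xi> = word (- int K) (2 * K) v" for \<xi> :: "int \<Rightarrow> 'a"
  proof
    assume "word (- int K) (2 * K) \<xi> = word (- int K) (2 * K) v"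
    then have *: "\<xi> (- int K + int k) = v (- int K + int k)" if "k < 2 * K" for k
      using that by (simp add: word_eq_iff) (simp add: word_def)
    have "\<xi> i = v i" if "- int K \<le> i" "i < int K" for i
      using *[of "nat (i + int K)"] that by simp
    then show "\<xi> \<in> cyl K v" by (simp add: cyl_def)
  qed (auto simp: cyl_def word_def)
  then show ?thesis by auto
qed

lemma measurable_graph: "(\<lambda>\<xi>. (\<xi>, attractor \<xi>)) \<in> measurable bern borel"
proof (rule measurable_sigma_sets[OF sets_borel_boxes])
  fix A assume "A \<in> (boxes :: ((int \<Rightarrow> 'n) \<times> circle) set set)"
  then obtain K v C where A: "A = cyl K v \<times> C" "closed C" unfolding boxes_def by blast
  have "(\<lambda>\<xi>. (\<xi>, attractor \<xi>)) -` A \<inter> space bern = cyl K v \<inter> (attractor -` C \<inter> space bern)"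
    by (auto simp: A)
  also have "\<dots> \<in> sets bern"
    using measurable_sets[OF measurable_attractor borel_closed[OF A(2)]] word_vimage_bern
    by (intro sets.Int) (simp_all add: cyl_word)
  finally show "(\<lambda>\<xi>. (\<xi>, attractor \<xi>)) -` A \<inter> space bern \<in> sets bern" .
qed auto

lemma prob_space_mu: "prob_space mu"
  unfolding mu_def by (rule prob_space.prob_space_distr[OF prob_space_bern measurable_graph])

lemma sets_mu [simp]: "sets mu = sets borel"
  by (simp add: mu_def)

lemma measure_mu_word:
  assumes "length w = n"
  shows "measure mu {z. word a n (fst z) = w} = 1 / real CARD('n) ^ n"
proof -
  have "{z :: (int \<Rightarrow> 'n) \<times> circle. word a n (fst z) = w} = (\<Inter>k\<in>{..<n}. {\<xi>. \<xi> (a + int k) = w ! k} \<times> UNIV)"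
    using assms by (auto simp: word_eq_iff)
  also have "open \<dots>" by (intro open_INT ballI open_Times open_coordinate open_UNIV finite_lessThan)
  finally have "measure mu {z. word a n (fst z) = w} = measure bern ((\<lambda>\<xi>. (\<xi>, attractor \<xi>)) -` {z. word a n (fst z) = w} \<inter> space bern)"
    unfolding mu_def by (intro measure_distr measurable_graph) simp
  also have "(\<lambda>\<xi>. (\<xi>, attractor \<xi>)) -` {z. word a n (fst z) = w} \<inter> space bern = word a n -` {w}" by auto
  finally show ?thesis using prob_word[OF assms] by simp
qed

text \<open>Dominated convergence along the almost surely convergent pullbacks. It reduces
  identities for \<open>mu\<close> to statements about \<open>pull\<close>, hence about finite
  words.\<close>

lemma integral_pull_tendsto:
  assumes \<phi>: "local_fun a b \<phi>"
  shows "(\<lambda>k. \<integral>\<xi>. \<phi> (\<xi>, pull (times k) \<xi>) \<partial>bern) \<longlonglongrightarrow> integral\<^sup>L mu \<phi>"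
proof -
  interpret prob_space "bern :: (int \<Rightarrow> 'n) measure" by (rule prob_space_bern)
  obtain B where B: "\<And>z. \<bar>\<phi> z\<bar> \<le> B" using local_fun_bound[OF \<phi>] by blast
  have \<phi>m: "\<phi> \<in> borel_measurable borel" by (rule local_fun_measurable[OF \<phi> refl])
  have mp: "(\<lambda>\<xi>. (\<xi>, pull m \<xi>)) \<in> measurable bern borel" for m
  proof (rule measurable_sigma_sets[OF sets_borel_boxes])
    fix A assume "A \<in> (boxes :: ((int \<Rightarrow> 'n) \<times> circle) set set)"
    then obtain K v C where A: "A = cyl K v \<times> C" "closed C" unfolding boxes_def by blast
    have "(\<lambda>\<xi>. (\<xi>, pull m \<xi>)) -` A \<inter> space bern = cyl K v \<inter> (pull m -` C \<inter> space bern)"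
      by (auto simp: A)
    also have "\<dots> \<in> sets bern"
      using measurable_sets[OF measurable_pull borel_closed[OF A(2)]] word_vimage_bern
      by (intro sets.Int) (simp_all add: cyl_word)
    finally show "(\<lambda>\<xi>. (\<xi>, pull m \<xi>)) -` A \<inter> space bern \<in> sets bern" .
  qed auto
  have "(\<lambda>k. \<integral>\<xi>. \<phi> (\<xi>, pull (times k) \<xi>) \<partial>bern) \<longlonglongrightarrow> (\<integral>\<xi>. \<phi> (\<xi>, attractor \<xi>) \<partial>bern)"
  proof (rule integral_dominated_convergence[where w = "\<lambda>_. B"])
    show "AE \<xi> in bern. (\<lambda>k. \<phi> (\<xi>, pull (times k) \<xi>)) \<longlonglongrightarrow> \<phi> (\<xi>, attractor \<xi>)"
    proof (rule AE_mp[OF AE_fast], rule AE_I2, rule impI)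
      fix \<xi> assume "\<xi> \<in> fast"
      show "(\<lambda>k. \<phi> (\<xi>, pull (times k) \<xi>)) \<longlonglongrightarrow> \<phi> (\<xi>, attractor \<xi>)"
      proof (rule tendstoI)
        fix e :: real assume "e > 0"
        obtain d where d: "d > 0" "\<And>\<xi> x y. dist x y < d \<Longrightarrow> \<bar>\<phi> (\<xi>, x) - \<phi> (\<xi>, y)\<bar> < e"
          using local_fun_equicont[OF \<phi> \<open>e > 0\<close>] by blast
        show "\<forall>\<^sub>F k in sequentially. dist (\<phi> (\<xi>, pull (times k) \<xi>)) (\<phi> (\<xi>, attractor \<xi>)) < e"
          using tendstoD[OF fast_convergent[OF \<open>\<xi> \<in> fast\<close>] d(1)]
          by (rule eventually_mono) (simp add: d(2) dist_real_def)
      qed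
    qed
  qed (use B measurable_compose[OF measurable_graph \<phi>m] measurable_compose[OF mp \<phi>m] in auto)
  also have "(\<integral>\<xi>. \<phi> (\<xi>, attractor \<xi>) \<partial>bern) = integral\<^sup>L mu \<phi>"
    unfolding mu_def by (rule integral_distr[symmetric, OF measurable_graph \<phi>m])
  finally show ?thesis .
qed

text \<open>The right-hand side depends on m and j only through \<open>m + j\<close>: iterating the
  map amounts to starting earlier. This is the origin of the invariance of \<open>mu\<close>. The
  sequence \<zeta> is arbitrary because the word covers the whole window.\<close>

lemma integral_pull_iterate:
  assumes \<phi>: "local_fun a 0 \<phi>" and m: "- a \<le> int m"
  shows "(\<integral>\<xi>. \<phi> ((skew f ^^ j) (\<xi>, pull m \<xi>)) \<partial>bern) = wavg (m + j) (\<lambda>w. \<phi> (push w (\<zeta>, 0)))"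
proof -
  have "(\<integral>\<xi>. \<phi> ((skew f ^^ j) (\<xi>, pull m \<xi>)) \<partial>bern) = (\<integral>\<xi>. (\<lambda>w. \<phi> (push w (\<zeta>, 0))) (word (- int m) (m + j) \<xi>) \<partial>bern)"
    by (intro Bochner_Integration.integral_cong refl)
      (use m in \<open>simp add: skew_iterate_pull, intro past_push_cong[OF \<phi>], auto\<close>)
  then show ?thesis unfolding integral_word[where g = "\<lambda>w. \<phi> (push w (\<zeta>, 0))"] .
qed

text \<open>After a common word as long as the window, two states share the visible past and differ
  in the fiber only, where synchronization makes them d-close for most words.\<close>

lemma markov_oscillation:
  assumes \<phi>: "local_fun a 0 \<phi>" and "e > 0"
  shows "\<exists>n0. \<forall>n\<ge>n0. \<forall>z z'. \<bar>markov n \<phi> z - markov n \<phi> z'\<bar> \<le> e"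
proof -
  obtain B where B: "B > 0" "\<And>z. \<bar>\<phi> z\<bar> \<le> B" using local_fun_bound[OF \<phi>] by blast
  obtain d where d: "d > 0" "\<And>\<xi> x y. dist x y < d \<Longrightarrow> \<bar>\<phi> (\<xi>, x) - \<phi> (\<xi>, y)\<bar> < e/2"
    using local_fun_equicont[OF \<phi>, of "e/2"] \<open>e > 0\<close> by (metis half_gt_zero)
  \<comment> \<open>A word that fails to bring the points together costs at most
    \<open>2 * B\<close>, so the proportion \<open>e / (4 * B)\<close> contributes e/2;
    equicontinuity uses the other half.\<close>
  obtain n0 where n0: "\<And>n x y. n \<ge> n0 \<Longrightarrow> wavg n (\<lambda>w. of_bool (d \<le> dist (fold f w x) (fold f w y))) \<le> e / (4 * B)"
    using synchronization[of d "e / (4 * B)"] d(1) B(1) \<open>e > 0\<close> by auto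
  have "\<bar>markov n \<phi> z - markov n \<phi> z'\<bar> \<le> e" if n: "n \<ge> max n0 (nat (- a))" for n z z'
  proof -
    have "\<bar>markov n \<phi> z - markov n \<phi> z'\<bar> \<le> wavg n (\<lambda>w. \<bar>\<phi> (push w z) - \<phi> (push w z')\<bar>)"
      unfolding markov_def wavg_diff[symmetric] by (rule wavg_abs)
    also have "\<dots> \<le> wavg n (\<lambda>w. e/2 + 2 * B * of_bool (d \<le> dist (fold f w (snd z)) (fold f w (snd z'))))"
    proof (rule wavg_mono)
      fix w :: "'n list" assume w: "length w = n"
      have eq: "\<phi> (push w z') = \<phi> (fst (push w z), fold f w (snd z'))"
      proof -
        have "fst (push w z') i = fst (push w z) i" if "a \<le> i" "i < 0" for i
          by (rule push_agree[of 0]) (use that n w in auto)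
        then have "\<phi> (fst (push w z'), snd (push w z')) = \<phi> (fst (push w z), snd (push w z'))"
          by (intro local_fun_cong[OF \<phi>])
        then show ?thesis by (metis prod.collapse snd_push)
      qed
      have eq': "\<phi> (push w z) = \<phi> (fst (push w z), fold f w (snd z))" by (simp add: snd_push[symmetric])
      show "\<bar>\<phi> (push w z) - \<phi> (push w z')\<bar> \<le> e/2 + 2 * B * of_bool (d \<le> dist (fold f w (snd z)) (fold f w (snd z')))"
      proof (cases "d \<le> dist (fold f w (snd z)) (fold f w (snd z'))")
        case True
        then show ?thesis using B(2)[of "push w z"] B(2)[of "push w z'"] \<open>e > 0\<close> by (simp add: abs_le_iff)
      next
        case False
        then show ?thesis using d(2)[of "fold f w (snd z)" "fold f w (snd z')" "fst (push w z)"]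
          unfolding eq eq' by simp
      qed
    qed
    also have "\<dots> \<le> e/2 + 2 * B * (e / (4 * B))"
      unfolding wavg_add wavg_cmult wavg_const using n B(1)
      by (intro add_left_mono mult_left_mono n0) auto
    also have "\<dots> = e" using B(1) by simp
    finally show ?thesis .
  qed
  then show ?thesis by blast
qed

lemma markov_append: "markov (m + n) \<phi> z = markov m (markov n \<phi>) z"
  by (simp add: markov_def[abs_def] wavg_append)

text \<open>The integral along a late pullback is \<open>markov (j + n)\<close> at a fixed state,
  that is, an average of values of \<open>markov n\<close>. All these values differ by at most e,
  and the integrals converge to the one against \<open>mu\<close>.\<close>

lemma markov_converges:
  assumes \<phi>: "local_fun a 0 \<phi>" and "e > 0"
  shows "\<exists>n0. \<forall>n\<ge>n0. \<forall>z. \<bar>markov n \<phi> z - integral\<^sup>L mu \<phi>\<bar> \<le> e"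
proof -
  obtain n0 where n0: "\<And>n z z'. n \<ge> n0 \<Longrightarrow> \<bar>markov n \<phi> z - markov n \<phi> z'\<bar> \<le> e"
    using markov_oscillation[OF assms] by blast
  have "\<bar>markov n \<phi> z - integral\<^sup>L mu \<phi>\<bar> \<le> e" if "n \<ge> n0" for n z
  proof (rule tendsto_upperbound[of "\<lambda>k. \<bar>markov n \<phi> z - (\<integral>\<xi>. \<phi> (\<xi>, pull (times k) \<xi>) \<partial>bern)\<bar>" _ sequentially])
    show "(\<lambda>k. \<bar>markov n \<phi> z - (\<integral>\<xi>. \<phi> (\<xi>, pull (times k) \<xi>) \<partial>bern)\<bar>) \<longlonglongrightarrow> \<bar>markov n \<phi> z - integral\<^sup>L mu \<phi>\<bar>"
      by (intro tendsto_rabs tendsto_diff tendsto_const integral_pull_tendsto[OF \<phi>])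
    show "\<forall>\<^sub>F k in sequentially. \<bar>markov n \<phi> z - (\<integral>\<xi>. \<phi> (\<xi>, pull (times k) \<xi>) \<partial>bern)\<bar> \<le> e"
    proof (rule eventually_sequentiallyI[of "max n (nat (- a))"])
      fix k assume k: "max n (nat (- a)) \<le> k"
      define j where "j = times k - n"
      have "n \<le> times k" "- a \<le> int (times k)" using k times_ge[of k] by linarith+
      then have "(\<integral>\<xi>. \<phi> (\<xi>, pull (times k) \<xi>) \<partial>bern) = markov (j + n) \<phi> (undefined, 0)"
        using integral_pull_iterate[OF \<phi>, of "times k" 0 undefined] by (simp add: markov_def j_def)
      also have "\<dots> = markov j (markov n \<phi>) (undefined, 0)" by (rule markov_append)
      finally have I: "(\<integral>\<xi>. \<phi> (\<xi>, pull (times k) \<xi>) \<partial>bern) = markov j (markov n \<phi>) (undefined, 0)" .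
      have "\<bar>markov n \<phi> z - markov j (markov n \<phi>) (undefined, 0)\<bar> = \<bar>wavg j (\<lambda>w. markov n \<phi> z - markov n \<phi> (push w (undefined, 0)))\<bar>"
        by (simp add: wavg_diff markov_def[of j])
      also have "\<dots> \<le> wavg j (\<lambda>w. \<bar>markov n \<phi> z - markov n \<phi> (push w (undefined, 0))\<bar>)" by (rule wavg_abs)
      also have "\<dots> \<le> e" by (intro wavg_le_const n0 that)
      finally show "\<bar>markov n \<phi> z - (\<integral>\<xi>. \<phi> (\<xi>, pull (times k) \<xi>) \<partial>bern)\<bar> \<le> e" unfolding I .
    qed
  qed simp
  then show ?thesis by blast
qed

section \<open>Invariance, mixing and ergodicity\<close>

lemma measurable_skew: "skew f \<in> measurable borel borel"
  by (rule borel_measurable_continuous_onI[OF continuous_skew[OF cont]])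

lemma measurable_skew_iterate: "(skew f ^^ n) \<in> measurable borel borel"
proof (induction n)
  case (Suc n)
  have "(\<lambda>z. skew f ((skew f ^^ n) z)) \<in> measurable borel borel"
    by (rule measurable_compose[OF Suc measurable_skew])
  then show ?case by (simp add: comp_def)
qed simp

lemma measurable_skew_inv: "skew_inv f \<in> measurable borel borel"
  by (rule borel_measurable_continuous_onI[OF continuous_skew_inv[OF cont_inv]])

lemma skew_inv_iterate: "(skew_inv f ^^ n) ((skew f ^^ n) z) = z" "(skew f ^^ n) ((skew_inv f ^^ n) z) = z"
proof -
  have *: "(g ^^ n) ((h ^^ n) z) = z" if "\<And>z. g (h z) = z" for g h :: "(int \<Rightarrow> 'n) \<times> circle \<Rightarrow> (int \<Rightarrow> 'n) \<times> circle"
  proof (induction n)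
    case (Suc n)
    have "(g ^^ Suc n) ((h ^^ Suc n) z) = (g ^^ n) (g (h ((h ^^ n) z)))"
      by (simp add: funpow_swap1)
    then show ?case by (simp add: that Suc)
  qed simp
  show "(skew_inv f ^^ n) ((skew f ^^ n) z) = z" "(skew f ^^ n) ((skew_inv f ^^ n) z) = z"
    by (intro * skew_inverse[OF bij])+
qed

text \<open>Iterating j times adds j random letters to the pullback, and by the uniform convergence
  of \<open>markov\<close> the number of letters is immaterial in the limit.\<close>

lemma mu_past_iterate:
  assumes \<phi>: "local_fun a 0 \<phi>"
  shows "integral\<^sup>L mu (\<lambda>z. \<phi> ((skew f ^^ j) z)) = integral\<^sup>L mu \<phi>"
proof (rule LIMSEQ_unique)
  have l: "local_fun (min a 0) (0 + int j) (\<lambda>z. \<phi> ((skew f ^^ j) z))"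
    by (rule local_fun_skew_iterate[OF \<phi> cont]) simp
  show "(\<lambda>k. \<integral>\<xi>. \<phi> ((skew f ^^ j) (\<xi>, pull (times k) \<xi>)) \<partial>bern) \<longlonglongrightarrow> integral\<^sup>L mu (\<lambda>z. \<phi> ((skew f ^^ j) z))"
    by (rule integral_pull_tendsto[OF l])
  show "(\<lambda>k. \<integral>\<xi>. \<phi> ((skew f ^^ j) (\<xi>, pull (times k) \<xi>)) \<partial>bern) \<longlonglongrightarrow> integral\<^sup>L mu \<phi>"
  proof (rule LIMSEQ_I)
    fix e :: real assume "e > 0"
    obtain n0 where n0: "\<And>n z. n \<ge> n0 \<Longrightarrow> \<bar>markov n \<phi> z - integral\<^sup>L mu \<phi>\<bar> \<le> e/2"
      using markov_converges[OF \<phi>, of "e/2"] \<open>e > 0\<close> by auto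
    have "norm ((\<integral>\<xi>. \<phi> ((skew f ^^ j) (\<xi>, pull (times k) \<xi>)) \<partial>bern) - integral\<^sup>L mu \<phi>) < e"
      if k: "k \<ge> max n0 (nat (- a))" for k
    proof -
      have "- a \<le> int (times k)" "n0 \<le> times k + j" using k times_ge[of k] by linarith+
      then show ?thesis
        using integral_pull_iterate[OF \<phi>, of "times k" j undefined] n0[of "times k + j" "(undefined, 0)"] \<open>e > 0\<close>
        by (simp add: markov_def)
    qed
    then show "\<exists>no. \<forall>k\<ge>no. norm ((\<integral>\<xi>. \<phi> ((skew f ^^ j) (\<xi>, pull (times k) \<xi>)) \<partial>bern) - integral\<^sup>L mu \<phi>) < e"
      by blast
  qed
qed

text \<open>Every local observable is an observable of the past composed with an iterate, and one
  further iterate leaves the integral unchanged.\<close>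

lemma mu_invariant: "distr mu mu (skew f) = mu"
proof (rule measure_eq_local_fun)
  have m: "skew f \<in> measurable mu mu" using measurable_skew by (simp add: measurable_cong_sets[OF sets_mu sets_mu])
  show "prob_space (distr mu mu (skew f))" by (rule prob_space.prob_space_distr[OF prob_space_mu m])
  fix K and \<phi> :: "(int \<Rightarrow> 'n) \<times> circle \<Rightarrow> real" assume \<phi>: "local_fun (- int K) (int K) \<phi>"
  define \<psi> where "\<psi> z = \<phi> ((skew_inv f ^^ K) z)" for z
  obtain a where \<psi>: "local_fun a 0 \<psi>"
    unfolding \<psi>_def[abs_def] using local_fun_past[where f = f, OF \<phi> cont_inv] by blast
  have eq: "\<phi> z = \<psi> ((skew f ^^ K) z)" for z by (simp add: \<psi>_def skew_inv_iterate)
  have "integral\<^sup>L (distr mu mu (skew f)) \<phi> = (\<integral>z. \<phi> (skew f z) \<partial>mu)"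
    by (rule integral_distr[OF m local_fun_measurable[OF \<phi> sets_mu]])
  also have "\<dots> = (\<integral>z. \<psi> ((skew f ^^ Suc K) z) \<partial>mu)"
    unfolding eq by (simp add: funpow_swap1)
  also have "\<dots> = integral\<^sup>L mu \<psi>" by (rule mu_past_iterate[OF \<psi>])
  also have "\<dots> = (\<integral>z. \<psi> ((skew f ^^ K) z) \<partial>mu)" by (rule mu_past_iterate[OF \<psi>, symmetric])
  also have "\<dots> = integral\<^sup>L mu \<phi>" by (simp add: eq[symmetric])
  finally show "integral\<^sup>L (distr mu mu (skew f)) \<phi> = integral\<^sup>L mu \<phi>" .
qed (simp_all add: prob_space_mu)

lemma invariant_prob_mu: "invariant_prob (skew f) mu"
  unfolding invariant_prob_def using prob_space_mu mu_invariant measurable_skew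
  by (simp add: measurable_cong_sets[OF sets_mu sets_mu])

lemma invariant_integral_iterate:
  assumes \<nu>: "invariant_prob (skew f) \<nu>" and \<phi>: "\<phi> \<in> borel_measurable borel"
  shows "integral\<^sup>L \<nu> (\<lambda>z. \<phi> ((skew f ^^ n) z)) = (integral\<^sup>L \<nu> \<phi> :: real)"
proof (induction n)
  case (Suc n)
  have s: "sets \<nu> = sets borel" and m: "skew f \<in> measurable \<nu> \<nu>" and d: "distr \<nu> \<nu> (skew f) = \<nu>"
    using \<nu> by (auto simp: invariant_prob_def)
  have \<phi>m: "(\<lambda>z. \<phi> ((skew f ^^ n) z)) \<in> borel_measurable \<nu>"
    using measurable_compose[OF measurable_skew_iterate \<phi>] by (simp add: measurable_cong_sets[OF s refl])
  have "integral\<^sup>L \<nu> (\<lambda>z. \<phi> ((skew f ^^ n) z)) = integral\<^sup>L (distr \<nu> \<nu> (skew f)) (\<lambda>z. \<phi> ((skew f ^^ n) z))"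
    by (simp add: d)
  also have "\<dots> = integral\<^sup>L \<nu> (\<lambda>z. \<phi> ((skew f ^^ n) (skew f z)))"
    by (rule integral_distr[OF m \<phi>m])
  finally show ?case using Suc by (simp add: funpow_swap1)
qed simp

text \<open>At the level of words, conditioning on the first m letters replaces
  \<open>\<phi>2\<close> n steps later by \<open>markov n \<phi>2\<close>, which is uniformly close
  to its mean; the bound on \<open>\<phi>1\<close> controls the error.\<close>

lemma mu_mixing:
  assumes \<phi>1: "local_fun a 0 \<phi>1" and \<phi>2: "local_fun a 0 \<phi>2"
  shows "(\<lambda>n. integral\<^sup>L mu (\<lambda>z. \<phi>1 z * \<phi>2 ((skew f ^^ n) z))) \<longlonglongrightarrow> integral\<^sup>L mu \<phi>1 * integral\<^sup>L mu \<phi>2"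
proof (rule LIMSEQ_I)
  fix e :: real assume "e > 0"
  interpret prob_space "bern :: (int \<Rightarrow> 'n) measure" by (rule prob_space_bern)
  define c where "c = integral\<^sup>L mu \<phi>2"
  obtain B where B: "B > 0" "\<And>z. \<bar>\<phi>1 z\<bar> \<le> B" using local_fun_bound[OF \<phi>1] by blast
  obtain n0 where n0: "\<And>n z. n \<ge> n0 \<Longrightarrow> \<bar>markov n \<phi>2 z - c\<bar> \<le> e / (2 * B)"
    unfolding c_def using markov_converges[OF \<phi>2, of "e / (2 * B)"] \<open>e > 0\<close> B(1) by auto
  have "\<bar>integral\<^sup>L mu (\<lambda>z. \<phi>1 z * \<phi>2 ((skew f ^^ n) z)) - integral\<^sup>L mu \<phi>1 * c\<bar> \<le> e/2" if "n \<ge> n0" for n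
  proof (rule tendsto_upperbound)
    have l2: "local_fun (min a 0) (0 + int n) (\<lambda>z. \<phi>2 ((skew f ^^ n) z))"
      by (rule local_fun_skew_iterate[OF \<phi>2 cont]) simp
    have "local_fun (min a 0) (0 + int n) (\<lambda>z. \<phi>1 z * \<phi>2 ((skew f ^^ n) z))"
      by (rule local_fun_mult[OF local_fun_mono[OF \<phi>1] l2]) auto
    from integral_pull_tendsto[OF this] integral_pull_tendsto[OF \<phi>1]
    show "(\<lambda>k. \<bar>(\<integral>\<xi>. \<phi>1 (\<xi>, pull (times k) \<xi>) * \<phi>2 ((skew f ^^ n) (\<xi>, pull (times k) \<xi>)) \<partial>bern) -
        (\<integral>\<xi>. \<phi>1 (\<xi>, pull (times k) \<xi>) \<partial>bern) * c\<bar>)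
      \<longlonglongrightarrow> \<bar>integral\<^sup>L mu (\<lambda>z. \<phi>1 z * \<phi>2 ((skew f ^^ n) z)) - integral\<^sup>L mu \<phi>1 * c\<bar>"
      by (intro tendsto_rabs tendsto_diff tendsto_mult tendsto_const)
    show "\<forall>\<^sub>F k in sequentially. \<bar>(\<integral>\<xi>. \<phi>1 (\<xi>, pull (times k) \<xi>) * \<phi>2 ((skew f ^^ n) (\<xi>, pull (times k) \<xi>)) \<partial>bern) -
        (\<integral>\<xi>. \<phi>1 (\<xi>, pull (times k) \<xi>) \<partial>bern) * c\<bar> \<le> e/2"
    proof (rule eventually_sequentiallyI[of "nat (- a)"])
      fix k assume k: "nat (- a) \<le> k"
      define m where "m = times k"
      have m: "- a \<le> int m" using k times_ge[of k] unfolding m_def by linarith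
      define z0 :: "(int \<Rightarrow> 'n) \<times> circle" where "z0 = (undefined, 0)"
      have w: "take m (word (- int m) (m + n) \<xi>) = word (- int m) m \<xi>" for \<xi> :: "int \<Rightarrow> 'n"
        unfolding word_append by simp
      have pull1: "\<phi>1 (\<xi>, pull m \<xi>) = \<phi>1 (push (word (- int m) m \<xi>) z0)" for \<xi>
        using skew_iterate_pull[of 0 \<xi> m] m past_push_cong[OF \<phi>1, of "word (- int m) m \<xi>" "((\<lambda>i. \<xi> (i - int m)), 0)" z0]
        by (simp add: z0_def)
      have pull2: "\<phi>2 ((skew f ^^ n) (\<xi>, pull m \<xi>)) = \<phi>2 (push (word (- int m) (m + n) \<xi>) z0)" for \<xi>
        unfolding skew_iterate_pull using m by (intro past_push_cong[OF \<phi>2]) (auto simp: z0_def)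
      have "(\<integral>\<xi>. \<phi>1 (\<xi>, pull m \<xi>) * \<phi>2 ((skew f ^^ n) (\<xi>, pull m \<xi>)) \<partial>bern)
          = (\<integral>\<xi>. (\<lambda>v. \<phi>1 (push (take m v) z0) * \<phi>2 (push v z0)) (word (- int m) (m + n) \<xi>) \<partial>bern)"
        by (simp add: pull1 pull2 w)
      also have "\<dots> = wavg (m + n) (\<lambda>v. \<phi>1 (push (take m v) z0) * \<phi>2 (push v z0))"
        by (rule integral_word)
      also have "\<dots> = wavg m (\<lambda>u. \<phi>1 (push u z0) * markov n \<phi>2 (push u z0))"
        unfolding wavg_append by (intro wavg_cong) (simp add: wavg_cmult markov_def)
      finally have I1: "(\<integral>\<xi>. \<phi>1 (\<xi>, pull m \<xi>) * \<phi>2 ((skew f ^^ n) (\<xi>, pull m \<xi>)) \<partial>bern)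
          = wavg m (\<lambda>u. \<phi>1 (push u z0) * markov n \<phi>2 (push u z0))" .
      have I2: "(\<integral>\<xi>. \<phi>1 (\<xi>, pull m \<xi>) \<partial>bern) = wavg m (\<lambda>u. \<phi>1 (push u z0))"
        unfolding pull1 by (rule integral_word)
      have "\<bar>wavg m (\<lambda>u. \<phi>1 (push u z0) * markov n \<phi>2 (push u z0)) - wavg m (\<lambda>u. \<phi>1 (push u z0)) * c\<bar>
          = \<bar>wavg m (\<lambda>u. \<phi>1 (push u z0) * (markov n \<phi>2 (push u z0) - c))\<bar>"
        by (simp add: wavg_diff wavg_mult_right right_diff_distrib)
      also have "\<dots> \<le> wavg m (\<lambda>u. \<bar>\<phi>1 (push u z0) * (markov n \<phi>2 (push u z0) - c)\<bar>)" by (rule wavg_abs)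
      also have "\<dots> \<le> e/2"
      proof (rule wavg_le_const)
        fix u :: "'n list"
        have "\<bar>\<phi>1 (push u z0) * (markov n \<phi>2 (push u z0) - c)\<bar> \<le> B * (e / (2 * B))"
          unfolding abs_mult using B n0[OF that] by (intro mult_mono) auto
        then show "\<bar>\<phi>1 (push u z0) * (markov n \<phi>2 (push u z0) - c)\<bar> \<le> e/2" using B(1) by simp
      qed
      finally show "\<bar>(\<integral>\<xi>. \<phi>1 (\<xi>, pull (times k) \<xi>) * \<phi>2 ((skew f ^^ n) (\<xi>, pull (times k) \<xi>)) \<partial>bern) -
        (\<integral>\<xi>. \<phi>1 (\<xi>, pull (times k) \<xi>) \<partial>bern) * c\<bar> \<le> e/2"
        using I1 I2 by (simp add: m_def)
    qed
  qed simp
  then show "\<exists>no. \<forall>n\<ge>no. norm (integral\<^sup>L mu (\<lambda>z. \<phi>1 z * \<phi>2 ((skew f ^^ n) z)) - integral\<^sup>L mu \<phi>1 * integral\<^sup>L mu \<phi>2) < e"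
    using \<open>e > 0\<close> unfolding c_def[symmetric] by (intro exI[of _ n0] allI impI) (fastforce simp: c_def)
qed

text \<open>An approximating observable may be composed with an inverse iterate at no cost, because
  both A and \<open>mu\<close> are invariant.\<close>

lemma past_approx:
  assumes A: "A \<in> sets borel" "skew f -` A = A" and "e > 0"
  shows "\<exists>a \<phi>. local_fun a 0 \<phi> \<and> (\<integral>z. \<bar>indicator A z - \<phi> z\<bar> \<partial>mu) < e"
proof -
  obtain K \<phi> where \<phi>: "local_fun (- int K) (int K) \<phi>" "(\<integral>z. \<bar>indicator A z - \<phi> z\<bar> \<partial>mu) < e"
    using indicator_approx[OF prob_space_mu sets_mu A(1) \<open>e > 0\<close>] by blast
  define \<psi> where "\<psi> z = \<phi> ((skew_inv f ^^ K) z)" for z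
  obtain a where \<psi>: "local_fun a 0 \<psi>"
    unfolding \<psi>_def[abs_def] using local_fun_past[where f = f, OF \<phi>(1) cont_inv] by blast
  have inv: "(skew f ^^ n) z \<in> A \<longleftrightarrow> z \<in> A" for n z
  proof (induction n)
    case (Suc n)
    have "skew f y \<in> A \<longleftrightarrow> y \<in> A" for y using A(2) by auto
    then show ?case by (simp add: Suc)
  qed simp
  have "(\<integral>z. \<bar>indicator A z - \<psi> z\<bar> \<partial>mu) = (\<integral>z. \<bar>indicator A ((skew f ^^ K) z) - \<psi> ((skew f ^^ K) z)\<bar> \<partial>mu)"
    by (rule invariant_integral_iterate[OF invariant_prob_mu, symmetric])
      (use A local_fun_measurable[OF \<psi> refl] in measurable)
  also have "\<dots> = (\<integral>z. \<bar>indicator A z - \<phi> z\<bar> \<partial>mu)"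
    by (simp add: \<psi>_def skew_inv_iterate indicator_def inv)
  also note \<phi>(2)
  finally show ?thesis using \<psi> by blast
qed

text \<open>For invariant A the correlation of its indicator with itself does not depend on time,
  while mixing drives the correlation of approximating observables to the product of their means.
  Hence \<open>p = p * p\<close>.\<close>

lemma ergodic_prob_mu: "ergodic_prob (skew f) mu"
  unfolding ergodic_prob_def
proof (intro conjI ballI impI invariant_prob_mu)
  interpret prob_space mu by (rule prob_space_mu)
  fix A assume "A \<in> sets mu" and inv: "skew f -` A = A"
  then have A: "A \<in> sets borel" by simp
  have Amu: "A \<in> sets mu" using A by simp
  define p where "p = measure mu A"
  have p: "0 \<le> p" "p \<le> 1" by (auto simp: p_def)
  have invn: "(skew f ^^ n) z \<in> A \<longleftrightarrow> z \<in> A" for n z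
  proof (induction n)
    case (Suc n)
    have "skew f y \<in> A \<longleftrightarrow> y \<in> A" for y using inv by auto
    then show ?case by (simp add: Suc)
  qed simp
  have intA: "integrable mu (indicator A :: _ \<Rightarrow> real)"
    using Amu by (simp add: integrable_indicator_iff emeasure_eq_measure)
  have "\<bar>p - p * p\<bar> \<le> 5 * e" if epos: "e > 0" for e
  proof -
    obtain a2 \<phi>2 where \<phi>2': "local_fun a2 0 \<phi>2" "(\<integral>z. \<bar>indicator A z - \<phi>2 z\<bar> \<partial>mu) < e"
      using past_approx[OF A inv epos] by blast
    obtain B where B: "B > 0" "\<And>z. \<bar>\<phi>2 z\<bar> \<le> B" using local_fun_bound[OF \<phi>2'(1)] by blast
    \<comment> \<open>\<open>\<phi>1\<close> is chosen after \<open>\<phi>2\<close>, because its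
      error is multiplied by the bound B of \<open>\<phi>2\<close>.\<close>
    have "e / B > 0" using epos B by simp
    then obtain a1 \<phi>1 where \<phi>1': "local_fun a1 0 \<phi>1" "(\<integral>z. \<bar>indicator A z - \<phi>1 z\<bar> \<partial>mu) < e / B"
      using past_approx[OF A inv] by blast
    define a where "a = min a1 a2"
    have \<phi>1: "local_fun a 0 \<phi>1" by (rule local_fun_mono[OF \<phi>1'(1)]) (auto simp: a_def)
    have \<phi>2: "local_fun a 0 \<phi>2" by (rule local_fun_mono[OF \<phi>2'(1)]) (auto simp: a_def)
    have i1: "integrable mu \<phi>1" by (rule local_fun_integrable[OF \<phi>1 sets_mu prob_space_mu])
    have i2: "integrable mu \<phi>2" by (rule local_fun_integrable[OF \<phi>2 sets_mu prob_space_mu])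
    have d: "\<bar>p - integral\<^sup>L mu \<phi>\<bar> \<le> (\<integral>z. \<bar>indicator A z - \<phi> z\<bar> \<partial>mu)" if "integrable mu \<phi>" for \<phi>
    proof -
      have "p - integral\<^sup>L mu \<phi> = (\<integral>z. indicator A z - \<phi> z \<partial>mu)"
        using intA that Amu by (subst Bochner_Integration.integral_diff) (auto simp: p_def)
      then show ?thesis using integral_abs_bound[of mu "\<lambda>z. indicator A z - \<phi> z"] by simp
    qed
    obtain n where n: "\<bar>integral\<^sup>L mu (\<lambda>z. \<phi>1 z * \<phi>2 ((skew f ^^ n) z)) - integral\<^sup>L mu \<phi>1 * integral\<^sup>L mu \<phi>2\<bar> < e"
      using LIMSEQ_D[OF mu_mixing[OF \<phi>1 \<phi>2] epos] by auto
    have l2n: "local_fun (min a 0) (0 + int n) (\<lambda>z. \<phi>2 ((skew f ^^ n) z))"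
      by (rule local_fun_skew_iterate[OF \<phi>2 cont]) simp
    have i12: "integrable mu (\<lambda>z. \<phi>1 z * \<phi>2 ((skew f ^^ n) z))"
      by (rule local_fun_integrable[OF local_fun_mult[OF local_fun_mono[OF \<phi>1] l2n] sets_mu prob_space_mu]) auto
    have iA1: "integrable mu (\<lambda>z. \<bar>indicator A z - \<phi>1 z\<bar>)" and iA2: "integrable mu (\<lambda>z. \<bar>indicator A z - \<phi>2 z\<bar>)"
      using intA i1 i2 by auto
    have iA2n: "integrable mu (\<lambda>z. \<bar>indicator A ((skew f ^^ n) z) - \<phi>2 ((skew f ^^ n) z)\<bar>)"
    proof -
      have "integrable mu (\<lambda>z. \<phi>2 ((skew f ^^ n) z))"
        by (rule local_fun_integrable[OF l2n sets_mu prob_space_mu])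
      moreover have "(\<lambda>z. indicator A ((skew f ^^ n) z) :: real) = indicator A" by (auto simp: indicator_def invn)
      ultimately show ?thesis using intA by auto
    qed
    have eq2: "(\<integral>z. \<bar>indicator A ((skew f ^^ n) z) - \<phi>2 ((skew f ^^ n) z)\<bar> \<partial>mu) = (\<integral>z. \<bar>indicator A z - \<phi>2 z\<bar> \<partial>mu)"
      by (rule invariant_integral_iterate[OF invariant_prob_mu])
        (use A local_fun_measurable[OF \<phi>2 refl] in measurable)
    have "\<bar>p - integral\<^sup>L mu (\<lambda>z. \<phi>1 z * \<phi>2 ((skew f ^^ n) z))\<bar> \<le> (\<integral>z. \<bar>indicator A z - \<phi>1 z * \<phi>2 ((skew f ^^ n) z)\<bar> \<partial>mu)"
      by (rule d[OF i12])
    also have "\<dots> \<le> (\<integral>z. B * \<bar>indicator A z - \<phi>1 z\<bar> + \<bar>indicator A ((skew f ^^ n) z) - \<phi>2 ((skew f ^^ n) z)\<bar> \<partial>mu)"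
    proof (rule integral_mono)
      show "integrable mu (\<lambda>z. \<bar>indicator A z - \<phi>1 z * \<phi>2 ((skew f ^^ n) z)\<bar>)" using intA i12 by auto
      show "integrable mu (\<lambda>z. B * \<bar>indicator A z - \<phi>1 z\<bar> + \<bar>indicator A ((skew f ^^ n) z) - \<phi>2 ((skew f ^^ n) z)\<bar>)"
        using iA1 iA2n by auto
      fix z
      let ?i = "indicator A z :: real" and ?j = "\<phi>2 ((skew f ^^ n) z)"
      \<comment> \<open>The indicator equals its square, which allows the two factors to be replaced
        one after the other.\<close>
      have "?i - \<phi>1 z * ?j = (?i - \<phi>1 z) * ?j + ?i * (?i - ?j)"
        by (auto simp: indicator_def algebra_simps)
      then have "\<bar>?i - \<phi>1 z * ?j\<bar> \<le> \<bar>?i - \<phi>1 z\<bar> * \<bar>?j\<bar> + \<bar>?i\<bar> * \<bar>?i - ?j\<bar>"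
        by (metis abs_mult abs_triangle_ineq)
      also have "\<dots> \<le> \<bar>?i - \<phi>1 z\<bar> * B + 1 * \<bar>?i - ?j\<bar>"
        using B(2) by (intro add_mono mult_mono) (auto simp: indicator_def)
      finally show "\<bar>?i - \<phi>1 z * ?j\<bar> \<le> B * \<bar>?i - \<phi>1 z\<bar> + \<bar>indicator A ((skew f ^^ n) z) - ?j\<bar>"
        by (simp add: indicator_def invn mult.commute)
    qed
    also have "\<dots> = B * (\<integral>z. \<bar>indicator A z - \<phi>1 z\<bar> \<partial>mu) + (\<integral>z. \<bar>indicator A z - \<phi>2 z\<bar> \<partial>mu)"
      using iA1 iA2n by (simp add: eq2)
    also have "\<dots> \<le> B * (e / B) + e"
      using \<phi>1'(2) \<phi>2'(2) B(1) by (intro add_mono mult_left_mono) auto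
    also have "\<dots> = 2 * e" using B(1) by simp
    finally have s1: "\<bar>p - integral\<^sup>L mu (\<lambda>z. \<phi>1 z * \<phi>2 ((skew f ^^ n) z))\<bar> \<le> 2 * e" .
    have c2: "\<bar>integral\<^sup>L mu \<phi>2\<bar> \<le> B"
    proof -
      have "\<bar>integral\<^sup>L mu \<phi>2\<bar> \<le> (\<integral>z. \<bar>\<phi>2 z\<bar> \<partial>mu)" by (rule integral_abs_bound)
      also have "\<dots> \<le> (\<integral>z. B \<partial>mu)" using B(2) i2 by (intro integral_mono) auto
      finally show ?thesis by (simp add: prob_space)
    qed
    have "\<bar>integral\<^sup>L mu \<phi>1 * integral\<^sup>L mu \<phi>2 - p * p\<bar> \<le> 2 * e"
    proof -
      have "integral\<^sup>L mu \<phi>1 * integral\<^sup>L mu \<phi>2 - p * p = - ((p - integral\<^sup>L mu \<phi>1) * integral\<^sup>L mu \<phi>2) - p * (p - integral\<^sup>L mu \<phi>2)"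
        by (simp add: algebra_simps)
      then have "\<bar>integral\<^sup>L mu \<phi>1 * integral\<^sup>L mu \<phi>2 - p * p\<bar> \<le> \<bar>p - integral\<^sup>L mu \<phi>1\<bar> * \<bar>integral\<^sup>L mu \<phi>2\<bar> + \<bar>p\<bar> * \<bar>p - integral\<^sup>L mu \<phi>2\<bar>"
        by (simp add: abs_mult[symmetric])
      also have "\<dots> \<le> (e / B) * B + 1 * e"
        using d[OF i1] d[OF i2] \<phi>1'(2) \<phi>2'(2) c2 p B(1) by (intro add_mono mult_mono) auto
      also have "\<dots> = 2 * e" using B(1) by simp
      finally show ?thesis .
    qed
    then show ?thesis using s1 n by linarith
  qed
  then have "\<bar>p - p * p\<bar> \<le> 0" using field_le_epsilon[of "\<bar>p - p * p\<bar>" 0]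
    by (metis add_0 divide_pos_pos nonzero_mult_div_cancel_left times_divide_eq_right zero_less_numeral zero_neq_numeral)
  then have "p * (1 - p) = 0" by (simp add: algebra_simps)
  then show "measure mu A = 0 \<or> measure mu A = 1" by (auto simp: p_def)
qed

end

subsection \<open>Entropy of finite-valued functions\<close>

definition fiber_prob :: "'a measure \<Rightarrow> ('a \<Rightarrow> 'b) \<Rightarrow> 'b \<Rightarrow> real" where
  "fiber_prob M g a = measure M (g -` {a} \<inter> space M)"

text \<open>Shannon entropy of a random variable, with natural logarithms. With functions instead of
  partitions, joins become pairs and refinement becomes functional dependence.\<close>

definition fun_entropy :: "'a measure \<Rightarrow> ('a \<Rightarrow> 'b) \<Rightarrow> real" where
  "fun_entropy M g = - (\<Sum>a\<in>g ` space M. fiber_prob M g a * ln (fiber_prob M g a))"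

lemma fiber_prob_nonneg: "0 \<le> fiber_prob M g a"
  by (simp add: fiber_prob_def)

context prob_space
begin

lemma integral_simple_fun:
  fixes h :: "'b \<Rightarrow> real"
  assumes g: "simple_function M g"
  shows "(\<integral>z. h (g z) \<partial>M) = (\<Sum>a\<in>g ` space M. fiber_prob M g a * h a)"
    and "integrable M (\<lambda>z. h (g z))"
proof -
  have fin: "finite (g ` space M)" and s: "\<And>a. g -` {a} \<inter> space M \<in> sets M"
    using g by (auto simp: simple_function_def intro: simple_functionD)
  have eq: "h (g z) = (\<Sum>a\<in>g ` space M. h a * indicator (g -` {a} \<inter> space M) z)" if "z \<in> space M" for z
  proof -
    have "(\<Sum>a\<in>g ` space M. h a * indicator (g -` {a} \<inter> space M) z) = (\<Sum>a\<in>g ` space M. if a = g z then h a else 0)"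
      by (intro sum.cong refl) (auto simp: indicator_def that)
    then show ?thesis using fin that by (simp add: sum.delta)
  qed
  have int: "integrable M (\<lambda>z. h a * indicator (g -` {a} \<inter> space M) z)" for a
    by (intro integrable_mult_right integrable_real_indicator s) (simp add: emeasure_eq_measure)
  have "(\<integral>z. h (g z) \<partial>M) = (\<integral>z. (\<Sum>a\<in>g ` space M. h a * indicator (g -` {a} \<inter> space M) z) \<partial>M)"
    by (rule Bochner_Integration.integral_cong[OF refl eq])
  also have "\<dots> = (\<Sum>a\<in>g ` space M. \<integral>z. h a * indicator (g -` {a} \<inter> space M) z \<partial>M)"
    by (rule Bochner_Integration.integral_sum[OF int])
  also have "\<dots> = (\<Sum>a\<in>g ` space M. fiber_prob M g a * h a)"
    using s by (intro sum.cong refl) (simp add: fiber_prob_def mult.commute)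
  finally show "(\<integral>z. h (g z) \<partial>M) = (\<Sum>a\<in>g ` space M. fiber_prob M g a * h a)" .
  show "integrable M (\<lambda>z. h (g z))"
    by (subst Bochner_Integration.integrable_cong[OF refl eq]) (auto intro!: Bochner_Integration.integrable_sum int)
qed

lemma sum_fiber_prob:
  assumes "simple_function M g" shows "(\<Sum>a\<in>g ` space M. fiber_prob M g a) = 1"
  using integral_simple_fun(1)[OF assms, of "\<lambda>_. 1"] by (simp add: prob_space)

text \<open>The inequality of \<open>ln s\<close> and s - 1 at the ratio of q to the true
  probability. The competitor q may have mass less than 1, as the tilted distributions used for the
  entropy gap do.\<close>

lemma Gibbs:
  assumes g: "simple_function M g"
    and q: "\<And>a. a \<in> g ` space M \<Longrightarrow> 0 \<le> q a" "(\<Sum>a\<in>g ` space M. q a) \<le> 1"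
    and pq: "\<And>a. a \<in> g ` space M \<Longrightarrow> q a = 0 \<Longrightarrow> fiber_prob M g a = 0"
  shows "fun_entropy M g \<le> (\<integral>z. - ln (q (g z)) \<partial>M)"
proof -
  let ?p = "fiber_prob M g"
  have "?p a * ln (q a) - ?p a * ln (?p a) \<le> q a - ?p a" if a: "a \<in> g ` space M" for a
  proof (cases "?p a = 0")
    case False
    then have p: "?p a > 0" using fiber_prob_nonneg[of M g a] by simp
    have qp: "q a > 0" using q(1)[OF a] pq[OF a] False by fastforce
    have "ln (q a / ?p a) \<le> q a / ?p a - 1" by (rule ln_le_minus_one) (use p qp in simp)
    then have "?p a * ln (q a / ?p a) \<le> ?p a * (q a / ?p a - 1)" using p by (intro mult_left_mono) auto
    then show ?thesis using p qp by (simp add: ln_div right_diff_distrib)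
  qed (use q(1)[OF a] in simp)
  then have "(\<Sum>a\<in>g ` space M. ?p a * ln (q a) - ?p a * ln (?p a)) \<le> (\<Sum>a\<in>g ` space M. q a - ?p a)"
    by (intro sum_mono)
  also have "\<dots> \<le> 0" using q(2) sum_fiber_prob[OF g] by (simp add: sum_subtractf)
  finally have "fun_entropy M g \<le> (\<Sum>a\<in>g ` space M. ?p a * (- ln (q a)))"
    by (simp add: fun_entropy_def sum_subtractf sum_negf)
  then show ?thesis using integral_simple_fun(1)[OF g, of "\<lambda>a. - ln (q a)"] by simp
qed

lemma fun_entropy_integral:
  "simple_function M g \<Longrightarrow> fun_entropy M g = (\<integral>z. - ln (fiber_prob M g (g z)) \<partial>M)"
  by (subst integral_simple_fun(1)) (simp_all add: fun_entropy_def sum_negf)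

text \<open>The competitor is the uniform distribution on S.\<close>

lemma fun_entropy_le_card:
  assumes g: "simple_function M g" and sub: "g ` space M \<subseteq> S" "finite S"
  shows "fun_entropy M g \<le> ln (real (card S))"
proof -
  have "g ` space M \<noteq> {}" using not_empty by simp
  then have S: "card S > 0" "card (g ` space M) \<le> card S" using sub by (auto simp: card_gt_0_iff card_mono)
  have "fun_entropy M g \<le> (\<integral>z. - ln ((\<lambda>_. 1 / real (card S)) (g z)) \<partial>M)"
    by (rule Gibbs[OF g]) (use S in auto)
  also have "\<dots> = ln (real (card S))" using S by (simp add: prob_space ln_div)
  finally show ?thesis .
qed

text \<open>Each fiber of g lies in a fiber of h, which has larger probability and hence carries
  less information.\<close>

lemma fun_entropy_data_processing:
  assumes g: "simple_function M g" and h: "simple_function M h"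
    and det: "\<And>z z'. z \<in> space M \<Longrightarrow> z' \<in> space M \<Longrightarrow> g z = g z' \<Longrightarrow> h z = h z'"
  shows "fun_entropy M h \<le> fun_entropy M g"
proof -
  define k where "k a = h (SOME z. z \<in> space M \<and> g z = a)" for a
  have k: "h z = k (g z)" if "z \<in> space M" for z
  proof -
    have "(SOME y. y \<in> space M \<and> g y = g z) \<in> space M \<and> g (SOME y. y \<in> space M \<and> g y = g z) = g z"
      by (rule someI[of _ z]) (simp add: that)
    then show ?thesis unfolding k_def using det[OF that] by metis
  qed
  have "fun_entropy M h = (\<integral>z. - ln (fiber_prob M h (h z)) \<partial>M)" by (rule fun_entropy_integral[OF h])
  also have "\<dots> = (\<integral>z. - ln (fiber_prob M h (k (g z))) \<partial>M)"
    by (intro Bochner_Integration.integral_cong refl) (simp add: k)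
  also have "\<dots> = (\<Sum>a\<in>g ` space M. fiber_prob M g a * - ln (fiber_prob M h (k a)))"
    by (rule integral_simple_fun(1)[OF g])
  also have "\<dots> \<le> (\<Sum>a\<in>g ` space M. fiber_prob M g a * - ln (fiber_prob M g a))"
  proof (rule sum_mono)
    fix a assume "a \<in> g ` space M"
    have le: "fiber_prob M g a \<le> fiber_prob M h (k a)"
      unfolding fiber_prob_def by (rule finite_measure_mono) (use k simple_functionD(2)[OF h] in auto)
    show "fiber_prob M g a * - ln (fiber_prob M h (k a)) \<le> fiber_prob M g a * - ln (fiber_prob M g a)"
    proof (cases "fiber_prob M g a = 0")
      case False
      then have "fiber_prob M g a > 0" using fiber_prob_nonneg[of M g a] by simp
      then show ?thesis using le by (intro mult_left_mono) auto
    qed simp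
  qed
  finally show ?thesis by (simp add: fun_entropy_def sum_negf)
qed

text \<open>Subadditivity, with the product of the marginal distributions as competitor.\<close>

lemma fun_entropy_Pair_le:
  assumes g: "simple_function M g" and h: "simple_function M h"
  shows "fun_entropy M (\<lambda>z. (g z, h z)) \<le> fun_entropy M g + fun_entropy M h"
proof -
  let ?gh = "\<lambda>z. (g z, h z)"
  have gh: "simple_function M ?gh" by (rule simple_function_Pair[OF g h])
  have fin: "finite (g ` space M)" "finite (h ` space M)" using g h by (auto simp: simple_function_def)
  let ?q = "\<lambda>(a, b). fiber_prob M g a * fiber_prob M h b"
  have le: "fiber_prob M ?gh (a, b) \<le> fiber_prob M g a" "fiber_prob M ?gh (a, b) \<le> fiber_prob M h b" for a b
    unfolding fiber_prob_def by (rule finite_measure_mono; use simple_functionD(2)[OF g] simple_functionD(2)[OF h] in auto)+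
  have "fun_entropy M ?gh \<le> (\<integral>z. - ln (?q (?gh z)) \<partial>M)"
  proof (rule Gibbs[OF gh])
    have "(\<Sum>a\<in>?gh ` space M. ?q a) \<le> (\<Sum>a\<in>g ` space M \<times> h ` space M. ?q a)"
      using fin by (intro sum_mono2) (auto simp: fiber_prob_nonneg)
    also have "\<dots> = 1" using sum_fiber_prob[OF g] sum_fiber_prob[OF h]
      by (simp add: sum.cartesian_product[symmetric] sum_distrib_left[symmetric] sum_distrib_right[symmetric])
    finally show "(\<Sum>a\<in>?gh ` space M. ?q a) \<le> 1" .
    fix c assume "?q c = 0"
    then have "fiber_prob M g (fst c) = 0 \<or> fiber_prob M h (snd c) = 0" by (auto simp: case_prod_unfold)
    moreover have "fiber_prob M ?gh c \<le> fiber_prob M g (fst c)" "fiber_prob M ?gh c \<le> fiber_prob M h (snd c)"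
      using le[of "fst c" "snd c"] by auto
    ultimately show "fiber_prob M ?gh c = 0" using fiber_prob_nonneg[of M ?gh c] by linarith
  qed (auto simp: fiber_prob_nonneg)
  also have "\<dots> = (\<Sum>c\<in>?gh ` space M. fiber_prob M ?gh c * - ln (?q c))"
    by (rule integral_simple_fun(1)[OF gh])
  also have "\<dots> = (\<Sum>c\<in>?gh ` space M. fiber_prob M ?gh c * (- ln (fiber_prob M g (fst c)) - ln (fiber_prob M h (snd c))))"
  proof (rule sum.cong[OF refl])
    fix c
    show "fiber_prob M ?gh c * - ln (?q c) = fiber_prob M ?gh c * (- ln (fiber_prob M g (fst c)) - ln (fiber_prob M h (snd c)))"
    proof (cases "fiber_prob M ?gh c = 0")
      case False
      then have "fiber_prob M ?gh c > 0" using fiber_prob_nonneg[of M ?gh c] by simp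
      then have "fiber_prob M g (fst c) > 0" "fiber_prob M h (snd c) > 0"
        using le[of "fst c" "snd c"] by auto
      then show ?thesis by (simp add: case_prod_unfold ln_mult)
    qed simp
  qed
  also have "\<dots> = (\<integral>z. - ln (fiber_prob M g (g z)) - ln (fiber_prob M h (h z)) \<partial>M)"
    by (subst integral_simple_fun(1)[OF gh, of "\<lambda>c. - ln (fiber_prob M g (fst c)) - ln (fiber_prob M h (snd c))", simplified, symmetric]) simp
  also have "\<dots> = fun_entropy M g + fun_entropy M h"
    using integral_simple_fun(2)[OF g, of "\<lambda>a. - ln (fiber_prob M g a)"] integral_simple_fun(2)[OF h, of "\<lambda>a. ln (fiber_prob M h a)"]
    by (simp add: fun_entropy_integral g h)
  finally show ?thesis .
qed

lemma fun_entropy_nonneg: assumes "simple_function M g" shows "0 \<le> fun_entropy M g"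
proof -
  have "fiber_prob M g a * ln (fiber_prob M g a) \<le> 0" for a
  proof (cases "fiber_prob M g a = 0")
    case False
    then have "0 < fiber_prob M g a" "fiber_prob M g a \<le> 1" using fiber_prob_nonneg[of M g a]
      by (simp_all add: fiber_prob_def zero_less_measure_iff)
    then show ?thesis by (simp add: mult_nonneg_nonpos)
  qed simp
  then have "(\<Sum>a\<in>g ` space M. fiber_prob M g a * ln (fiber_prob M g a)) \<le> 0" by (intro sum_nonpos)
  then show ?thesis by (simp add: fun_entropy_def)
qed

end

text \<open>The competitor has mass 1 - d at the dominant value and d/m at every other one; the
  resulting bound tends to 0 with d for fixed m. A form of Fano's inequality, meant for variables
  that record rare errors.\<close>

lemma fun_entropy_small:
  assumes "e > (0::real)" "m > 0"
  obtains d where "d > 0" "\<And>(M :: 'a measure) (g :: 'a \<Rightarrow> 'b) S a0. prob_space M \<Longrightarrow> simple_function M g \<Longrightarrow>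
     g ` space M \<subseteq> S \<Longrightarrow> finite S \<Longrightarrow> card S \<le> m \<Longrightarrow> measure M {z \<in> space M. g z \<noteq> a0} \<le> d \<Longrightarrow> fun_entropy M g \<le> e"
proof -
  have "((\<lambda>x. - ln (1 - x) + x * (ln (real m) - ln x)) \<longlongrightarrow> 0) (at_right 0)" by real_asymp
  then have "\<forall>\<^sub>F x in at_right 0. - ln (1 - x) + x * (ln (real m) - ln x) < e"
    using assms(1) by (rule order_tendstoD)
  moreover have "\<forall>\<^sub>F x :: real in at_right 0. x < 1/2" by (rule eventually_at_rightI[of 0 "1/2"]) auto
  moreover have "\<forall>\<^sub>F x :: real in at_right 0. 0 < x" by (simp add: eventually_at_right_less)
  ultimately have "\<forall>\<^sub>F x in at_right 0. - ln (1 - x) + x * (ln (real m) - ln x) < e \<and> x < 1/2 \<and> 0 < x"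
    by (intro eventually_conj)
  then obtain d where d: "- ln (1 - d) + d * (ln (real m) - ln d) < e" "d < 1/2" "0 < d"
    using eventually_happens[of _ "at_right (0::real)"] trivial_limit_at_right_real by blast
  show ?thesis
  proof (rule that[OF d(3)])
    fix M :: "'a measure" and g :: "'a \<Rightarrow> 'b" and S a0
    assume M: "prob_space M" and g: "simple_function M g" and S: "g ` space M \<subseteq> S" "finite S" "card S \<le> m"
      and bad: "measure M {z \<in> space M. g z \<noteq> a0} \<le> d"
    interpret prob_space M by fact
    define q where "q a = (if a = a0 then 1 - d else d / real m)" for a
    have q0: "q a > 0" for a using d assms(2) by (simp add: q_def)
    have "(\<Sum>a\<in>g ` space M. q a) \<le> (\<Sum>a\<in>insert a0 S. q a)"
      using S q0 by (intro sum_mono2) (auto intro: less_imp_le)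
    also have "\<dots> = q a0 + (\<Sum>a\<in>S - {a0}. q a)" using S(2) by (simp add: sum.insert_remove)
    also have "(\<Sum>a\<in>S - {a0}. q a) = real (card (S - {a0})) * (d / real m)"
      by (simp add: q_def)
    also have "\<dots> \<le> real m * (d / real m)"
      using S d(3) card_Diff1_le[of S a0] by (intro mult_right_mono) auto
    finally have qs: "(\<Sum>a\<in>g ` space M. q a) \<le> 1" using assms(2) by (simp add: q_def)
    have Bs: "{z \<in> space M. g z \<noteq> a0} \<in> sets M"
    proof -
      have "{z \<in> space M. g z \<noteq> a0} = space M - (g -` {a0} \<inter> space M)" by auto
      then show ?thesis using simple_functionD(2)[OF g, of "{a0}"] by auto
    qed
    have iB: "integrable M (indicator {z \<in> space M. g z \<noteq> a0} :: _ \<Rightarrow> real)"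
      using Bs by (simp add: integrable_indicator_iff emeasure_eq_measure)
    have "fun_entropy M g \<le> (\<integral>z. - ln (q (g z)) \<partial>M)"
      by (rule Gibbs[OF g _ qs]) (use q0 in \<open>auto intro: less_imp_le dest: order_less_imp_not_eq2\<close>)
    also have "\<dots> \<le> (\<integral>z. - ln (1 - d) + (ln (real m) - ln d) * indicator {z \<in> space M. g z \<noteq> a0} z \<partial>M)"
    proof (rule integral_mono)
      show "integrable M (\<lambda>z. - ln (q (g z)))" by (rule integral_simple_fun(2)[OF g])
      show "integrable M (\<lambda>z. - ln (1 - d) + (ln (real m) - ln d) * indicator {z \<in> space M. g z \<noteq> a0} z)"
        using iB by auto
      fix z assume "z \<in> space M"
      have "ln (1 - d) \<le> 0" using d by simp
      then show "- ln (q (g z)) \<le> - ln (1 - d) + (ln (real m) - ln d) * indicator {z \<in> space M. g z \<noteq> a0} z"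
        using d assms(2) \<open>z \<in> space M\<close> by (auto simp: q_def indicator_def ln_div)
    qed
    also have "\<dots> = - ln (1 - d) + (ln (real m) - ln d) * measure M {z \<in> space M. g z \<noteq> a0}"
      using iB Bs by (simp add: prob_space)
    also have "\<dots> \<le> - ln (1 - d) + (ln (real m) - ln d) * d"
    proof -
      have "ln d \<le> 0" using d by simp
      moreover have "0 \<le> ln (real m)" using assms(2) by simp
      ultimately show ?thesis using bad by (intro add_left_mono mult_left_mono) auto
    qed
    also have "\<dots> \<le> e" using d(1) by (simp add: mult.commute)
    finally show "fun_entropy M g \<le> e" .
  qed
qed

subsection \<open>Entropy of iterated partitions\<close>

definition itinerary :: "('a \<Rightarrow> 'a) \<Rightarrow> ('a \<Rightarrow> 'b) \<Rightarrow> nat \<Rightarrow> 'a \<Rightarrow> 'b list" where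
  "itinerary T p n z = map (\<lambda>i. p ((T ^^ i) z)) [0..<n]"

lemma itinerary_eq_iff: "itinerary T p n z = itinerary T p n z' \<longleftrightarrow> (\<forall>i<n. p ((T ^^ i) z) = p ((T ^^ i) z'))"
  by (auto simp: itinerary_def)

lemma itinerary_append: "itinerary T p (m + n) z = itinerary T p m z @ itinerary T p n ((T ^^ m) z)"
proof -
  have "(T ^^ i) z = (T ^^ (i - m)) ((T ^^ m) z)" if "m \<le> i" for i
    using funpow_add[of "i - m" m T] that by simp
  note shift = this
  show ?thesis
  proof (rule nth_equalityI)
    fix i assume "i < length (itinerary T p (m + n) z)"
    then have i: "i < m + n" by (simp add: itinerary_def)
    show "itinerary T p (m + n) z ! i = (itinerary T p m z @ itinerary T p n ((T ^^ m) z)) ! i"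
    proof (cases "i < m")
      case False
      have "itinerary T p (m + n) z ! i = p ((T ^^ (i - m)) ((T ^^ m) z))"
        using i False by (subst shift[symmetric]) (simp_all add: itinerary_def)
      then show ?thesis using i False by (simp add: itinerary_def nth_append)
    qed (use i in \<open>simp add: itinerary_def nth_append\<close>)
  qed (simp add: itinerary_def)
qed

definition cell_of :: "'a set set \<Rightarrow> 'a \<Rightarrow> 'a set" where
  "cell_of P z = (THE A. A \<in> P \<and> z \<in> A)"

lemma cell_of:
  assumes "partition_on UNIV P"
  shows "cell_of P z \<in> P" "z \<in> cell_of P z" "A \<in> P \<Longrightarrow> z \<in> A \<Longrightarrow> cell_of P z = A"
proof -
  have U: "\<Union>P = UNIV" and d: "disjoint P" using assms by (auto simp: partition_on_def)
  obtain A0 where A0: "A0 \<in> P" "z \<in> A0" using U by blast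
  have uniq: "B = A" if "A \<in> P" "z \<in> A" "B \<in> P" "z \<in> B" for A B
    using disjointD[OF d that(3) that(1)] that(2,4) by blast
  have eq: "cell_of P z = A" if "A \<in> P" "z \<in> A" for A
    unfolding cell_of_def by (rule the_equality) (use that uniq in auto)
  show "cell_of P z \<in> P" "z \<in> cell_of P z" "A \<in> P \<Longrightarrow> z \<in> A \<Longrightarrow> cell_of P z = A"
    using eq[OF A0] A0 eq[of A] by simp_all
qed

text \<open>The nonempty atoms of the join are exactly the fibers of the itinerary map.\<close>

lemma partition_entropy_iterated:
  assumes P: "partition_on UNIV P" and sp: "space M = UNIV"
  shows "partition_entropy M (iterated_partition T M P n) = fun_entropy M (itinerary T (cell_of P) n)"
proof -
  let ?g = "itinerary T (cell_of P) n"
  let ?F = "\<lambda>a. ?g -` {a}"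
  have same: "z \<in> ?F (?g z0) \<longleftrightarrow> (\<forall>i<n. (T ^^ i) z \<in> cell_of P ((T ^^ i) z0))" for z z0
  proof -
    have "cell_of P y = cell_of P y0 \<longleftrightarrow> y \<in> cell_of P y0" for y y0
      using cell_of[OF P] by metis
    then show ?thesis by (simp add: itinerary_eq_iff)
  qed
  have "iterated_partition T M P n = ?F ` range ?g"
  proof (intro equalityI subsetI)
    fix A assume "A \<in> iterated_partition T M P n"
    then obtain c z0 where c: "\<And>i. i < n \<Longrightarrow> c i \<in> P" "A = {x. \<forall>i<n. (T ^^ i) x \<in> c i}" "z0 \<in> A"
      by (auto simp: iterated_partition_def sp)
    have "c i = cell_of P ((T ^^ i) z0)" if "i < n" for i
      using cell_of(3)[OF P c(1)[OF that]] c(2,3) that by auto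
    then have "z \<in> A \<longleftrightarrow> z \<in> ?F (?g z0)" for z unfolding same using c(2) by auto
    then have "A = ?F (?g z0)" by blast
    then show "A \<in> ?F ` range ?g" by blast
  next
    fix A assume "A \<in> ?F ` range ?g"
    then obtain z0 where A: "A = ?F (?g z0)" by blast
    then have "z0 \<in> A" by simp
    moreover have "A = {x \<in> space M. \<forall>i<n. (T ^^ i) x \<in> cell_of P ((T ^^ i) z0)}"
    proof -
      have "z \<in> A \<longleftrightarrow> (\<forall>i<n. (T ^^ i) z \<in> cell_of P ((T ^^ i) z0))" for z unfolding A by (rule same)
      then show ?thesis by (auto simp: sp)
    qed
    ultimately show "A \<in> iterated_partition T M P n"
      unfolding iterated_partition_def using cell_of(1)[OF P]
      by (intro CollectI conjI exI[of _ "\<lambda>i. cell_of P ((T ^^ i) z0)"]) auto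
  qed
  moreover have "inj_on ?F (range ?g)" by (intro inj_onI) auto
  ultimately show ?thesis
    by (simp add: partition_entropy_def fun_entropy_def fiber_prob_def sp sum.reindex)
qed

text \<open>Entropy with respect to a partition is defined through \<open>lim\<close>, so the limit
  must be known to exist before an upper bound can be passed to it.\<close>

lemma Fekete_subadditive:
  fixes a :: "nat \<Rightarrow> real"
  assumes nonneg: "\<And>n. 0 \<le> a n" and sub: "\<And>m n. a (m + n) \<le> a m + a n"
  shows "convergent (\<lambda>n. a n / real n)"
proof -
  define L where "L = Inf ((\<lambda>n. a n / real n) ` {1..})"
  have bdd: "bdd_below ((\<lambda>n. a n / real n) ` {1..})" by (rule bdd_belowI[of _ 0]) (auto simp: nonneg)
  have L: "L \<le> a n / real n" if "n \<ge> 1" for n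
    unfolding L_def by (rule cInf_lower[OF _ bdd]) (use that in auto)
  have mult: "a (q * m) \<le> real q * a m" if "q \<ge> 1" for q m
    using that
  proof (induction q rule: dec_induct)
    case (step q)
    have "a (Suc q * m) \<le> a m + a (q * m)" using sub[of m "q * m"] by simp
    then show ?case using step by (simp add: algebra_simps)
  qed simp
  have "(\<lambda>n. a n / real n) \<longlonglongrightarrow> L"
  proof (rule LIMSEQ_I)
    fix e :: real assume "e > 0"
    then have "L < L + e/2" by simp
    then have "\<exists>v\<in>(\<lambda>n. a n / real n) ` {1..}. v < L + e/2"
      unfolding L_def by (subst (asm) cInf_less_iff[OF _ bdd]) auto
    then obtain m where m: "m \<ge> 1" "a m / real m < L + e/2" by auto
    define C where "C = Max (a ` {..m})"
    have C: "a r \<le> C" if "r \<le> m" for r unfolding C_def using that by (intro Max_ge) auto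
    have C0: "0 \<le> C" using C[of 0] nonneg[of 0] by simp
    obtain n1 :: nat where n1: "2 * C / e < real n1" using reals_Archimedean2 by blast
    have "norm (a n / real n - L) < e" if n: "n \<ge> max (max n1 m) 1" for n
    proof -
      have n0: "real n > 0" using n by simp
      define q where "q = n div m"
      have q: "q \<ge> 1" using n m by (simp add: q_def div_greater_zero_iff Suc_leI)
      have nq: "n = q * m + n mod m" by (simp add: q_def)
      have "a n \<le> a (q * m) + a (n mod m)" by (subst nq) (rule sub)
      also have "\<dots> \<le> real q * a m + C"
        using mult[OF q, of m] C[of "n mod m"] m(1) by (intro add_mono) (auto simp: less_imp_le)
      finally have "a n / real n \<le> (real q * a m + C) / real n" by (rule divide_right_mono) simp
      also have "\<dots> = real q * a m / real n + C / real n" by (rule add_divide_distrib)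
      also have "real q * a m / real n \<le> a m / real m"
      proof -
        have "q * m \<le> n" by (simp add: q_def)
        then have "real q * real m \<le> real n" by (metis of_nat_le_iff of_nat_mult)
        then have "real q * real m * a m \<le> real n * a m" by (intro mult_right_mono nonneg)
        then show ?thesis using n0 m(1) by (simp add: field_simps)
      qed
      also have "C / real n < e / 2"
      proof -
        have "2 * C / e < real n" using n1 n by simp
        then show ?thesis using \<open>e > 0\<close> n0 by (simp add: field_simps)
      qed
      finally have "a n / real n < L + e" using m(2) by simp
      moreover have "L \<le> a n / real n" using n by (intro L) simp
      ultimately show ?thesis by simp
    qed
    then show "\<exists>no. \<forall>n\<ge>no. norm (a n / real n - L) < e" by blast
  qed
  then show ?thesis by (rule convergentI)
qed

text \<open>Invariance preserves the probabilities of the fibers; surjectivity makes the two entropy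
  sums run over the same set of values.\<close>

lemma fun_entropy_compose_invariant:
  assumes T: "T \<in> measurable M M" "distr M M T = M" "surj T" and sp: "space M = UNIV"
    and g: "simple_function M g"
  shows "fun_entropy M (\<lambda>z. g (T z)) = fun_entropy M g"
proof -
  have "fiber_prob M (\<lambda>z. g (T z)) a = fiber_prob M g a" for a
  proof -
    have "fiber_prob M g a = measure (distr M M T) (g -` {a} \<inter> space M)" by (simp add: T(2) fiber_prob_def)
    also have "\<dots> = measure M (T -` (g -` {a} \<inter> space M) \<inter> space M)"
      by (rule measure_distr[OF T(1)]) (rule simple_functionD(2)[OF g])
    finally show ?thesis by (simp add: fiber_prob_def sp vimage_def)
  qed
  moreover have "range (\<lambda>z. g (T z)) = range g"
    using T(3) by (simp add: image_image[of g T UNIV, symmetric])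
  ultimately show ?thesis by (simp add: fun_entropy_def sp)
qed

lemma simple_function_invariant:
  assumes "T \<in> measurable M M" "simple_function M g"
  shows "simple_function M (\<lambda>z. g (T z))"
  by (rule simple_function_comp[OF assms])

lemma simple_function_itinerary:
  assumes T: "T \<in> measurable M M" and p: "simple_function M p"
  shows "simple_function M (itinerary T p n)"
proof (induction n)
  case 0
  show ?case by (simp add: itinerary_def[abs_def])
next
  case (Suc n)
  have Tn: "(T ^^ n) \<in> measurable M M"
  proof (induction n)
    case (Suc n)
    from measurable_compose[OF Suc T] show ?case by (simp add: comp_def)
  qed simp
  have "simple_function M (\<lambda>z. (\<lambda>(u, v). u @ [v]) (itinerary T p n z, p ((T ^^ n) z)))"
    by (rule simple_function_compose1[OF simple_function_Pair[OF Suc simple_function_invariant[OF Tn p]]])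
  then show ?case by (simp add: itinerary_def[abs_def])
qed

subsection \<open>The fibers carry no entropy\<close>

text \<open>The representative in [0, 1), in contrast to \<open>circle_rep\<close>, whose values are
  centred at 0. It serves to order points when break points are counted.\<close>

definition circle_pos :: "circle \<Rightarrow> real" where "circle_pos x = frac (circle_rep x)"

lemma circle_pos_bounds: "0 \<le> circle_pos x" "circle_pos x < 1"
  by (auto simp: circle_pos_def frac_lt_1)

lemma circle_of_circle_pos: "circle_of (circle_pos x) = x"
proof -
  have "circle_of (frac (circle_rep x)) = circle_of (circle_rep x)"
    unfolding circle_of_eq_iff by (simp add: frac_def)
  then show ?thesis by (simp add: circle_pos_def circle_of_rep)
qed

lemma circle_pos_circle_of: "0 \<le> t \<Longrightarrow> t < 1 \<Longrightarrow> circle_pos (circle_of t) = t"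
  using circle_pos_bounds[of "circle_of t"] by (intro circle_of_inj_Ico) (auto simp: circle_of_circle_pos abs_less_iff)

lemma measurable_circle_pos: "circle_pos \<in> borel_measurable borel"
proof (subst borel_measurable_iff_le, intro allI)
  fix a :: real
  consider "a < 0" | "0 \<le> a" "a < 1" | "1 \<le> a" by linarith
  then have "closed {x. circle_pos x \<le> a}"
  proof cases
    case 1
    then have "{x. circle_pos x \<le> a} = {}" using circle_pos_bounds(1) by (auto simp: not_le intro: less_le_trans)
    then show ?thesis by simp
  next
    case 2
    have "{x. circle_pos x \<le> a} = circle_of ` {0..a}"
    proof (intro equalityI subsetI)
      fix x assume "x \<in> {x. circle_pos x \<le> a}"
      then show "x \<in> circle_of ` {0..a}"
        using circle_pos_bounds(1)[of x] by (intro image_eqI[of _ _ "circle_pos x"]) (auto simp: circle_of_circle_pos)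
    qed (use 2 circle_pos_circle_of in auto)
    then show ?thesis by (simp add: compact_imp_closed compact_continuous_image[OF continuous_circle_of compact_Icc])
  next
    case 3
    then have "{x. circle_pos x \<le> a} = UNIV" using circle_pos_bounds(2) by (auto intro: less_imp_le less_le_trans)
    then show ?thesis by simp
  qed
  then show "{w \<in> space borel. circle_pos w \<le> a} \<in> sets borel" by (simp add: borel_closed)
qed

definition arc_index :: "nat \<Rightarrow> circle \<Rightarrow> nat" where "arc_index m x = nat \<lfloor>real m * circle_pos x\<rfloor>"

lemma arc_index_bounds: "real (arc_index m x) \<le> real m * circle_pos x" "real m * circle_pos x < real (arc_index m x) + 1"
proof -
  have "0 \<le> \<lfloor>real m * circle_pos x\<rfloor>" using circle_pos_bounds(1)[of x] by simp
  then have "real (arc_index m x) = of_int \<lfloor>real m * circle_pos x\<rfloor>" by (simp add: arc_index_def)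
  then show "real (arc_index m x) \<le> real m * circle_pos x" "real m * circle_pos x < real (arc_index m x) + 1" by linarith+
qed

lemma arc_index_less: assumes "m > 0" shows "arc_index m x < m"
proof -
  have "real (arc_index m x) < real m * 1"
    using arc_index_bounds(1)[of m x] circle_pos_bounds(2)[of x] assms by (meson le_less_trans mult_strict_left_mono of_nat_0_less_iff)
  then show ?thesis by simp
qed

lemma arc_index_eq_dist:
  assumes "m > 0" "arc_index m x = arc_index m y" shows "dist x y \<le> 1 / real m"
proof -
  have "\<bar>real m * circle_pos x - real m * circle_pos y\<bar> \<le> 1"
    using arc_index_bounds[of m x] arc_index_bounds[of m y] assms(2) by linarith
  then have "real m * \<bar>circle_pos x - circle_pos y\<bar> \<le> 1" by (simp add: abs_mult flip: right_diff_distrib)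
  then have "\<bar>circle_pos x - circle_pos y\<bar> \<le> 1 / real m" using assms(1) by (simp add: field_simps)
  then show ?thesis using dist_circle_of_le[of "circle_pos x" "circle_pos y"] by (simp add: circle_of_circle_pos)
qed

definition grid :: "nat \<Rightarrow> circle set" where "grid m = (\<lambda>i. circle_of (real i / real m)) ` {..<m}"

lemma finite_grid: "finite (grid m)" "card (grid m) \<le> m"
  unfolding grid_def using card_image_le[of "{..<m}" "\<lambda>i. circle_of (real i / real m)"] by auto

lemma grid_cell:
  assumes "m > 0" "x \<notin> grid m"
  shows "x \<in> circle_of ` {real (arc_index m x) / real m<..<(real (arc_index m x) + 1) / real m}"
proof -
  have "circle_pos x \<noteq> real (arc_index m x) / real m"
  proof
    assume "circle_pos x = real (arc_index m x) / real m"
    then have "x = circle_of (real (arc_index m x) / real m)" by (metis circle_of_circle_pos)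
    then have "x \<in> grid m" unfolding grid_def using arc_index_less[OF assms(1), of x] by (intro image_eqI) auto
    with assms(2) show False ..
  qed
  then have "real m * circle_pos x \<noteq> real (arc_index m x)" using assms(1) by (auto simp: field_simps)
  then have "real (arc_index m x) < real m * circle_pos x" using arc_index_bounds(1)[of m x] by simp
  then have "circle_pos x \<in> {real (arc_index m x) / real m<..<(real (arc_index m x) + 1) / real m}"
    using arc_index_bounds(2)[of m x] assms(1) by (simp add: field_simps)
  then have "circle_of (circle_pos x) \<in> circle_of ` {real (arc_index m x) / real m<..<(real (arc_index m x) + 1) / real m}" by (rule imageI)
  then show ?thesis by (simp add: circle_of_circle_pos)
qed

lemma arc_index_on_cell:
  assumes "i < m" "x \<in> circle_of ` {real i / real m<..<(real i + 1) / real m}"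
  shows "arc_index m x = i"
proof -
  obtain t where t: "x = circle_of t" "real i / real m < t" "t < (real i + 1) / real m" using assms(2) by auto
  have m: "real m > 0" using assms(1) by simp
  have "0 \<le> real i / real m" by simp
  then have "0 \<le> t" using t(2) by linarith
  moreover have "(real i + 1) / real m \<le> 1" using assms(1) by (simp add: field_simps)
  then have "t < 1" using t(3) by linarith
  ultimately have "circle_pos x = t" using t(1) circle_pos_circle_of by simp
  moreover have "real i \<le> real m * t" "real m * t < real i + 1" using t(2,3) m by (simp_all add: field_simps)
  ultimately have "\<lfloor>real m * circle_pos x\<rfloor> = int i" by (simp add: floor_eq_iff)
  then show ?thesis by (simp add: arc_index_def)
qed

text \<open>Off the grid the circle is the disjoint union of the open cells, so a connected set
  avoiding the grid stays in one of them.\<close>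

lemma arc_index_connected:
  assumes C: "connected C" "C \<inter> grid m = {}" "m > 0" "u \<in> C" "v \<in> C"
  shows "arc_index m u = arc_index m v"
proof (rule ccontr)
  assume ne: "arc_index m u \<noteq> arc_index m v"
  let ?c = "\<lambda>i :: nat. circle_of ` {real i / real m<..<(real i + 1) / real m}"
  let ?U = "?c (arc_index m u)" and ?V = "\<Union>i\<in>{..<m} - {arc_index m u}. ?c i"
  have "open ?U" "open ?V" by (auto intro!: open_circle_of_image)
  moreover have "C \<subseteq> ?U \<union> ?V"
  proof
    fix x assume "x \<in> C"
    then have "x \<in> ?c (arc_index m x)" using C by (intro grid_cell) auto
    then show "x \<in> ?U \<union> ?V" using arc_index_less[OF C(3), of x] by (cases "arc_index m x = arc_index m u") auto
  qed
  moreover have "?U \<inter> ?V = {}"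
  proof (rule ccontr)
    assume "?U \<inter> ?V \<noteq> {}"
    then obtain x i where x: "x \<in> ?U" "i < m" "i \<noteq> arc_index m u" "x \<in> ?c i" by blast
    then show False using arc_index_on_cell[of "arc_index m u" m x] arc_index_on_cell[of i m x] arc_index_less[OF C(3), of u] by metis
  qed
  moreover have "u \<in> ?U \<inter> C" using C grid_cell[of m u] by auto
  moreover have "v \<in> ?V \<inter> C"
    using C grid_cell[of m v] arc_index_less[OF C(3), of v] ne by (metis (no_types, lifting) DiffI IntI UN_I disjoint_iff lessThan_iff singletonD)
  ultimately show False using connectedD[OF C(1), of ?U ?V] by blast
qed

lemma simple_function_measurableI:
  assumes "g \<in> measurable M (count_space UNIV)" "finite S" "g ` space M \<subseteq> S"
  shows "simple_function M g"
  unfolding simple_function_def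
  using assms measurable_sets[OF assms(1)] finite_subset by auto

lemma measurable_word_fst: "(\<lambda>z. word a n (fst z)) \<in> measurable (borel :: ((int \<Rightarrow> 'n::{finite,discrete_topology}) \<times> circle) measure) (count_space UNIV)"
proof (rule measurable_count_space_eq_countable[THEN iffD2])
  show "countable (UNIV :: 'n list set)" by simp
  have "open ((\<lambda>z :: (int \<Rightarrow> 'n) \<times> circle. word a n (fst z)) -` {w})" for w
  proof (cases "length w = n")
    case True
    then have "(\<lambda>z :: (int \<Rightarrow> 'n) \<times> circle. word a n (fst z)) -` {w} = (\<Inter>k\<in>{..<n}. {\<xi>. \<xi> (a + int k) = w ! k} \<times> UNIV)"
      by (auto simp: word_eq_iff)
    also have "open \<dots>" by (intro open_INT ballI open_Times open_coordinate open_UNIV finite_lessThan)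
    finally show ?thesis .
  next
    case False
    then have "(\<lambda>z :: (int \<Rightarrow> 'n) \<times> circle. word a n (fst z)) -` {w} = {}" by auto
    then show ?thesis by simp
  qed
  then show "(\<lambda>z. word a n (fst z)) \<in> space borel \<rightarrow> UNIV \<and> (\<forall>w\<in>UNIV. (\<lambda>z :: (int \<Rightarrow> 'n) \<times> circle. word a n (fst z)) -` {w} \<inter> space borel \<in> sets borel)"
    by (auto intro: borel_open)
qed

lemma simple_function_word:
  fixes M :: "((int \<Rightarrow> 'n::{finite,discrete_topology}) \<times> circle) measure"
  assumes "sets M = sets borel" shows "simple_function M (\<lambda>z. word a n (fst z))"
proof (rule simple_function_measurableI)
  show "(\<lambda>z. word a n (fst z)) \<in> measurable M (count_space UNIV)"
    using measurable_word_fst by (simp add: measurable_cong_sets[OF assms refl])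
  show "finite {w :: 'n list. length w = n}" by simp
qed auto

definition word_entropy :: "((int \<Rightarrow> 'n) \<times> circle) measure \<Rightarrow> nat \<Rightarrow> real" where
  "word_entropy M n = fun_entropy M (\<lambda>z. word 0 n (fst z))"

context random_circle
begin

text \<open>A finite label fixing a point up to distance 1/m in the fiber and outside a window of
  \<open>2 * k\<close> letters. Such labels approximate every finite measurable partition.\<close>

definition window_label :: "nat \<Rightarrow> nat \<Rightarrow> (int \<Rightarrow> 'n) \<times> circle \<Rightarrow> 'n list \<times> nat" where
  "window_label k m z = (word (- int k) (2 * k) (fst z), arc_index m (snd z))"

text \<open>Positions in \<open>[0, 1)\<close> of the points that the first \<open>n\<close> fiber maps send into the grid.\<close>

definition breaks :: "nat \<Rightarrow> nat \<Rightarrow> 'n list \<Rightarrow> real set" where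
  "breaks m n w = circle_pos ` (\<Union>j<n. inv (fold f (take j w)) ` grid m)"

text \<open>The position of t relative to the break points. The two counts differ exactly when t is
  itself a break point, so break points and the gaps between them receive different codes.\<close>

definition cell :: "nat \<Rightarrow> nat \<Rightarrow> 'n list \<Rightarrow> real \<Rightarrow> nat \<times> nat" where
  "cell m n w t = (card {d \<in> breaks m n w. d < t}, card {d \<in> breaks m n w. d \<le> t})"

lemma breaks_finite: "finite (breaks m n w)" "card (breaks m n w) \<le> n * m"
proof -
  let ?U = "\<Union>j<n. inv (fold f (take j w)) ` grid m"
  show "finite (breaks m n w)" by (auto simp: breaks_def finite_grid)
  have "card ?U \<le> (\<Sum>j<n. card (inv (fold f (take j w)) ` grid m))" by (rule card_UN_le) simp
  also have "\<dots> \<le> (\<Sum>j<n. m)"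
    by (intro sum_mono order_trans[OF card_image_le finite_grid(2)] finite_grid(1))
  finally have "card ?U \<le> n * m" by simp
  moreover have "card (breaks m n w) \<le> card ?U"
    unfolding breaks_def by (rule card_image_le) (auto simp: finite_grid)
  ultimately show "card (breaks m n w) \<le> n * m" by simp
qed

lemma cell_range: "cell m n w t \<in> {..n * m} \<times> {..n * m}"
proof -
  have "card {d \<in> breaks m n w. P d} \<le> n * m" for P
    by (rule order_trans[OF card_mono breaks_finite(2)]) (auto simp: breaks_finite)
  then show ?thesis by (simp add: cell_def)
qed

text \<open>Equal codes at distinct positions exclude any break point in the closed interval between
  them. The image of this arc under the first j maps is then connected and misses the grid.\<close>

lemma cell_eq_aux:
  assumes eq: "cell m n w (circle_pos x) = cell m n w (circle_pos y)" and le: "circle_pos x \<le> circle_pos y" and "j < n" "m > 0"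
  shows "arc_index m (fold f (take j w) x) = arc_index m (fold f (take j w) y)"
proof (cases "circle_pos x = circle_pos y")
  case True
  then have "x = y" by (metis circle_of_circle_pos)
  then show ?thesis by simp
next
  case False
  then have lt: "circle_pos x < circle_pos y" using le by simp
  let ?D = "breaks m n w"
  have fin: "finite {d \<in> ?D. P d}" for P using breaks_finite(1)[of m n w] by simp
  have s1: "{d \<in> ?D. d < circle_pos x} = {d \<in> ?D. d < circle_pos y}"
    by (rule card_subset_eq[OF fin]) (use eq lt in \<open>auto simp: cell_def\<close>)
  have s2: "{d \<in> ?D. d \<le> circle_pos x} = {d \<in> ?D. d \<le> circle_pos y}"
    by (rule card_subset_eq[OF fin]) (use eq lt in \<open>auto simp: cell_def\<close>)
  have none: "d \<notin> ?D" if "circle_pos x \<le> d" "d \<le> circle_pos y" for d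
  proof
    assume d: "d \<in> ?D"
    show False
    proof (cases "d < circle_pos y")
      case True
      then have "d \<in> {d \<in> ?D. d < circle_pos x}" unfolding s1 using d by simp
      then show False using that by simp
    next
      case False
      then have "d \<in> {d \<in> ?D. d \<le> circle_pos x}" unfolding s2 using d that by simp
      then show False using False lt by simp
    qed
  qed
  let ?g = "fold f (take j w)"
  let ?I = "circle_of ` {circle_pos x..circle_pos y}"
  have "connected (?g ` ?I)"
    by (intro connected_continuous_image continuous_circle_of connected_Icc continuous_on_subset[OF continuous_fold[OF cont]]) auto
  moreover have "?g ` ?I \<inter> grid m = {}"
  proof (rule ccontr)
    assume "?g ` ?I \<inter> grid m \<noteq> {}"
    then obtain t where t: "circle_pos x \<le> t" "t \<le> circle_pos y" "?g (circle_of t) \<in> grid m" by auto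
    have "circle_of t = inv ?g (?g (circle_of t))" by (simp add: fold_inverse)
    then have "circle_of t \<in> (\<Union>j<n. inv (fold f (take j w)) ` grid m)" using t(3) \<open>j < n\<close> by blast
    then have "circle_pos (circle_of t) \<in> ?D" unfolding breaks_def by (rule imageI)
    moreover have "circle_pos (circle_of t) = t"
      using t circle_pos_bounds(1)[of x] circle_pos_bounds(2)[of y] by (intro circle_pos_circle_of) auto
    ultimately show False using none t by auto
  qed
  moreover have "?g x \<in> ?g ` ?I" "?g y \<in> ?g ` ?I"
  proof -
    have x: "x \<in> ?I" by (rule image_eqI[of _ _ "circle_pos x"]) (simp_all add: le circle_of_circle_pos)
    have y: "y \<in> ?I" by (rule image_eqI[of _ _ "circle_pos y"]) (simp_all add: le circle_of_circle_pos)
    show "?g x \<in> ?g ` ?I" "?g y \<in> ?g ` ?I" by (rule imageI[OF x], rule imageI[OF y])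
  qed
  ultimately show ?thesis using \<open>m > 0\<close> by (intro arc_index_connected)
qed

lemma cell_eq:
  assumes "cell m n w (circle_pos x) = cell m n w (circle_pos y)" "j < n" "m > 0"
  shows "arc_index m (fold f (take j w) x) = arc_index m (fold f (take j w) y)"
proof (cases "circle_pos x \<le> circle_pos y")
  case False
  then show ?thesis using cell_eq_aux[of m n w y x j] assms by simp
qed (use cell_eq_aux assms in blast)

text \<open>The letters in the extended window fix the symbolic part of all labels and the maps
  applied in the fiber; the cell of the starting point then fixes all arc indices. Only polynomially
  many cells occur, and this is why the fiber adds no entropy.\<close>

lemma itinerary_window_label_determined:
  assumes w: "word (- int k) (n + 2 * k) (fst z) = word (- int k) (n + 2 * k) (fst z')"
    and c: "cell m n (word 0 n (fst z)) (circle_pos (snd z)) = cell m n (word 0 n (fst z')) (circle_pos (snd z'))" and m: "m > 0"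
  shows "itinerary (skew f) (window_label k m) n z = itinerary (skew f) (window_label k m) n z'"
  unfolding itinerary_eq_iff
proof (intro allI impI)
  fix j assume j: "j < n"
  have eqi: "fst z i = fst z' i" if "- int k \<le> i" "i < int n + int k" for i
  proof -
    have "word (- int k) (n + 2 * k) (fst z) ! nat (i + int k) = word (- int k) (n + 2 * k) (fst z') ! nat (i + int k)"
      by (simp add: w)
    moreover have "nat (i + int k) < n + 2 * k" using that by linarith
    ultimately show ?thesis using that by (simp add: word_def)
  qed
  have w0: "word 0 n (fst z) = word 0 n (fst z')" using eqi by (simp add: word_def)
  have s: "snd ((skew f ^^ j) z) = fold f (take j (word 0 n (fst z))) (snd z)" for z :: "(int \<Rightarrow> 'n) \<times> circle"
  proof -
    have "word 0 (j + (n - j)) (fst z) = word 0 j (fst z) @ word (int j) (n - j) (fst z)" unfolding word_append by simp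
    then have "take j (word 0 n (fst z)) = word 0 j (fst z)" using j by simp
    then show ?thesis by (simp add: skew_iterate_push snd_push)
  qed
  have "arc_index m (snd ((skew f ^^ j) z)) = arc_index m (snd ((skew f ^^ j) z'))"
    unfolding s w0 by (rule cell_eq[OF _ j m]) (use c w0 in simp)
  moreover have "word (- int k) (2 * k) (fst ((skew f ^^ j) z)) = word (- int k) (2 * k) (fst ((skew f ^^ j) z'))"
    using eqi j by (simp add: word_def fst_skew_iterate)
  ultimately show "window_label k m ((skew f ^^ j) z) = window_label k m ((skew f ^^ j) z')" by (simp add: window_label_def)
qed

lemma surj_skew: "surj (skew f)"
  by (rule surjI[of _ "skew_inv f"]) (rule skew_inverse(2)[OF bij])

context
  fixes \<nu> :: "((int \<Rightarrow> 'n) \<times> circle) measure"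
  assumes \<nu>: "invariant_prob (skew f) \<nu>"
begin

lemma invariant_prob_facts: "prob_space \<nu>" "sets \<nu> = sets borel" "skew f \<in> measurable \<nu> \<nu>" "distr \<nu> \<nu> (skew f) = \<nu>" "space \<nu> = UNIV"
proof -
  show s: "sets \<nu> = sets borel" using \<nu> by (auto simp: invariant_prob_def)
  show "space \<nu> = UNIV" using sets_eq_imp_space_eq[OF s] by simp
qed (use \<nu> in \<open>auto simp: invariant_prob_def\<close>)

interpretation nu: prob_space \<nu> by (rule invariant_prob_facts)

lemma fun_entropy_skew: "simple_function \<nu> g \<Longrightarrow> fun_entropy \<nu> (\<lambda>z. g (skew f z)) = fun_entropy \<nu> g"
  using invariant_prob_facts surj_skew by (intro fun_entropy_compose_invariant) auto

lemma skew_pow_measurable: "(skew f ^^ n) \<in> measurable \<nu> \<nu>"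
  using measurable_skew_iterate by (simp add: measurable_cong_sets[OF invariant_prob_facts(2,2)])

lemma fun_entropy_skew_pow: "simple_function \<nu> g \<Longrightarrow> fun_entropy \<nu> (\<lambda>z. g ((skew f ^^ n) z)) = fun_entropy \<nu> g"
proof (induction n)
  case (Suc n)
  have "fun_entropy \<nu> (\<lambda>z. g ((skew f ^^ Suc n) z)) = fun_entropy \<nu> (\<lambda>z. (\<lambda>z. g ((skew f ^^ n) z)) (skew f z))"
    by (simp add: funpow_swap1)
  also have "\<dots> = fun_entropy \<nu> (\<lambda>z. g ((skew f ^^ n) z))"
    by (rule fun_entropy_skew[OF simple_function_invariant[OF skew_pow_measurable Suc(2)]])
  finally show ?case using Suc by simp
qed simp

lemma fun_entropy_word: "fun_entropy \<nu> (\<lambda>z. word (- int k) n (fst z)) = word_entropy \<nu> n"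
proof -
  have eq: "word (- int k) n (fst ((skew f ^^ k) z)) = word 0 n (fst z)" for z
    by (simp add: word_def fst_skew_iterate)
  have "fun_entropy \<nu> (\<lambda>z. word (- int k) n (fst ((skew f ^^ k) z))) = fun_entropy \<nu> (\<lambda>z. word (- int k) n (fst z))"
    by (rule fun_entropy_skew_pow[OF simple_function_word[OF invariant_prob_facts(2)]])
  then show ?thesis unfolding eq by (simp add: word_entropy_def)
qed

lemma measurable_circle_pos_snd: "(\<lambda>z :: (int \<Rightarrow> 'n) \<times> circle. circle_pos (snd z)) \<in> borel_measurable \<nu>"
proof -
  have "(\<lambda>z :: (int \<Rightarrow> 'n) \<times> circle. snd z) \<in> measurable borel borel"
    by (intro borel_measurable_continuous_onI continuous_on_snd continuous_on_id)
  from measurable_compose[OF this measurable_circle_pos] show ?thesis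
    by (simp add: measurable_cong_sets[OF invariant_prob_facts(2) refl])
qed

lemma simple_function_window_label: assumes "m > 0" shows "simple_function \<nu> (window_label k m)"
proof -
  have "(\<lambda>z :: (int \<Rightarrow> 'n) \<times> circle. arc_index m (snd z)) \<in> measurable \<nu> (count_space UNIV)"
    unfolding arc_index_def using measurable_circle_pos_snd by measurable
  then have "simple_function \<nu> (\<lambda>z. arc_index m (snd z))"
    by (rule simple_function_measurableI[of _ _ "{..<m}"]) (use arc_index_less[OF assms] in auto)
  from simple_function_Pair[OF simple_function_word[OF invariant_prob_facts(2)] this] show ?thesis
    by (simp add: window_label_def[abs_def])
qed

lemma simple_function_cell: "simple_function \<nu> (\<lambda>z. cell m n (word 0 n (fst z)) (circle_pos (snd z)))"
proof (rule simple_function_measurableI)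
  have c: "card {d \<in> breaks m n w. R d} = (\<Sum>d\<in>breaks m n w. if R d then 1 else 0)" for w R
    unfolding card_eq_sum by (rule sum.inter_filter[OF breaks_finite(1)])
  have "(\<lambda>z. cell m n w (circle_pos (snd z))) \<in> measurable \<nu> (count_space UNIV)" for w
  proof -
    have 1: "(\<lambda>z. card {d \<in> breaks m n w. d < circle_pos (snd z)}) \<in> measurable \<nu> (count_space UNIV)"
      unfolding c using measurable_circle_pos_snd by measurable
    have 2: "(\<lambda>z. card {d \<in> breaks m n w. d \<le> circle_pos (snd z)}) \<in> measurable \<nu> (count_space UNIV)"
      unfolding c using measurable_circle_pos_snd by measurable
    show ?thesis unfolding cell_def
      using measurable_Pair[OF 1 2] by (simp add: pair_measure_countable)
  qed
  moreover have "(\<lambda>z. word 0 n (fst z)) \<in> measurable \<nu> (count_space UNIV)"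
    using measurable_word_fst by (simp add: measurable_cong_sets[OF invariant_prob_facts(2) refl])
  ultimately show "(\<lambda>z. cell m n (word 0 n (fst z)) (circle_pos (snd z))) \<in> measurable \<nu> (count_space UNIV)"
    by (rule measurable_compose_countable)
  show "finite ({..n * m} \<times> {..n * m})" by simp
qed (rule image_subsetI[OF cell_range])

text \<open>The cell takes at most (n * m + 1)^2 values, so its contribution is logarithmic in
  n.\<close>

lemma fun_entropy_itinerary_window_label:
  assumes "m > 0"
  shows "fun_entropy \<nu> (itinerary (skew f) (window_label k m) n) \<le> word_entropy \<nu> (n + 2 * k) + 2 * ln (real (n * m + 1))"
proof -
  let ?W = "\<lambda>z :: (int \<Rightarrow> 'n) \<times> circle. word (- int k) (n + 2 * k) (fst z)"
  let ?c = "\<lambda>z. cell m n (word 0 n (fst z)) (circle_pos (snd z))"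
  have sW: "simple_function \<nu> ?W" by (rule simple_function_word[OF invariant_prob_facts(2)])
  have "fun_entropy \<nu> (itinerary (skew f) (window_label k m) n) \<le> fun_entropy \<nu> (\<lambda>z. (?W z, ?c z))"
  proof (rule nu.fun_entropy_data_processing)
    show "simple_function \<nu> (\<lambda>z. (?W z, ?c z))" by (rule simple_function_Pair[OF sW simple_function_cell])
    show "simple_function \<nu> (itinerary (skew f) (window_label k m) n)"
      by (rule simple_function_itinerary[OF invariant_prob_facts(3) simple_function_window_label[OF assms]])
    show "itinerary (skew f) (window_label k m) n z = itinerary (skew f) (window_label k m) n z'" if "(?W z, ?c z) = (?W z', ?c z')" for z z'
      using that by (intro itinerary_window_label_determined assms) auto
  qed
  also have "\<dots> \<le> fun_entropy \<nu> ?W + fun_entropy \<nu> ?c" by (rule nu.fun_entropy_Pair_le[OF sW simple_function_cell])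
  also have "fun_entropy \<nu> ?W = word_entropy \<nu> (n + 2 * k)" by (rule fun_entropy_word)
  also have "fun_entropy \<nu> ?c \<le> ln (real (card ({..n * m} \<times> {..n * m})))"
    by (rule nu.fun_entropy_le_card[OF simple_function_cell image_subsetI[OF cell_range]]) simp
  also have "card ({..n * m} \<times> {..n * m}) = (n * m + 1) * (n * m + 1)"
    by (simp add: card_cartesian_product)
  also have "ln (real ((n * m + 1) * (n * m + 1))) = 2 * ln (real (n * m + 1))"
    unfolding of_nat_mult by (subst ln_mult) auto
  finally show ?thesis by simp
qed

lemma fun_entropy_itinerary_Suc:
  assumes "simple_function \<nu> p"
  shows "fun_entropy \<nu> (itinerary (skew f) p (m + n)) \<le> fun_entropy \<nu> (itinerary (skew f) p m) + fun_entropy \<nu> (itinerary (skew f) p n)"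
proof -
  let ?I = "itinerary (skew f) p"
  have s: "simple_function \<nu> (?I n)" for n by (rule simple_function_itinerary[OF invariant_prob_facts(3) assms])
  have s': "simple_function \<nu> (\<lambda>z. ?I n ((skew f ^^ m) z))" by (rule simple_function_invariant[OF skew_pow_measurable s])
  have "fun_entropy \<nu> (?I (m + n)) \<le> fun_entropy \<nu> (\<lambda>z. (?I m z, ?I n ((skew f ^^ m) z)))"
    by (rule nu.fun_entropy_data_processing[OF simple_function_Pair[OF s s'] s]) (simp add: itinerary_append)
  also have "\<dots> \<le> fun_entropy \<nu> (?I m) + fun_entropy \<nu> (\<lambda>z. ?I n ((skew f ^^ m) z))" by (rule nu.fun_entropy_Pair_le[OF s s'])
  also have "fun_entropy \<nu> (\<lambda>z. ?I n ((skew f ^^ m) z)) = fun_entropy \<nu> (?I n)" by (rule fun_entropy_skew_pow[OF s])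
  finally show ?thesis .
qed

lemma fun_entropy_itinerary_le:
  assumes "simple_function \<nu> p" shows "fun_entropy \<nu> (itinerary (skew f) p n) \<le> real n * fun_entropy \<nu> p"
proof (induction n)
  case 0
  have "fun_entropy \<nu> (itinerary (skew f) p 0) \<le> ln (real (card {itinerary (skew f) p 0 undefined}))"
    by (rule nu.fun_entropy_le_card[OF simple_function_itinerary[OF invariant_prob_facts(3) assms]]) (auto simp: itinerary_def)
  then show ?case by simp
next
  case (Suc n)
  have "fun_entropy \<nu> (itinerary (skew f) p (Suc 0)) \<le> fun_entropy \<nu> p"
    by (rule nu.fun_entropy_data_processing[OF assms simple_function_itinerary[OF invariant_prob_facts(3) assms]]) (simp add: itinerary_def)
  then show ?case using fun_entropy_itinerary_Suc[OF assms, of n "Suc 0"] Suc by (simp add: algebra_simps)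
qed

text \<open>Every member A of P is approximated in mean by a local observable
  \<open>\<phi> A\<close>, which the label determines up to 1/4. Wherever all observables are within
  1/4 of the indicators, the label reveals the cell; by Markov's inequality each A spoils this only
  on a set of measure at most \<open>4 * d'\<close>.\<close>

lemma approx_label:
  assumes P: "finite P" "P \<subseteq> sets \<nu>" "partition_on UNIV P" and "d > 0"
  shows "\<exists>k m \<pi>. m > 0 \<and> measure \<nu> {z. cell_of P z \<noteq> \<pi> (window_label k m z)} \<le> d"
proof -
  define d1 where "d1 = d / (real (card P) + 1)"
  define d' where "d' = d1 / 4"
  have d': "d' > 0" using \<open>d > 0\<close> by (simp add: d'_def d1_def)
  have Pb: "A \<in> sets borel" if "A \<in> P" for A using P(2) that invariant_prob_facts(2) by auto
  have "\<forall>A\<in>P. \<exists>p. local_fun (- int (fst p)) (int (fst p)) (snd p) \<and> (\<integral>z. \<bar>indicator A z - snd p z\<bar> \<partial>\<nu>) < d'"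
  proof
    fix A assume "A \<in> P"
    from indicator_approx[OF invariant_prob_facts(1,2) Pb[OF this] d']
    show "\<exists>p. local_fun (- int (fst p)) (int (fst p)) (snd p) \<and> (\<integral>z. \<bar>indicator A z - snd p z\<bar> \<partial>\<nu>) < d'" by auto
  qed
  from bchoice[OF this] obtain p where p: "\<And>A. A \<in> P \<Longrightarrow> local_fun (- int (fst (p A))) (int (fst (p A))) (snd (p A))"
    "\<And>A. A \<in> P \<Longrightarrow> (\<integral>z. \<bar>indicator A z - snd (p A) z\<bar> \<partial>\<nu>) < d'" by blast
  define \<phi> where "\<phi> A = snd (p A)" for A
  define k where "k = Max (insert 0 ((\<lambda>A. fst (p A)) ` P))"
  have k: "fst (p A) \<le> k" if "A \<in> P" for A unfolding k_def using P(1) that by (intro Max_ge) auto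
  have \<phi>: "local_fun (- int k) (int k) (\<phi> A)" if "A \<in> P" for A
    unfolding \<phi>_def by (rule local_fun_mono[OF p(1)[OF that]]) (use k[OF that] in auto)
  have "\<forall>A\<in>P. \<exists>r>0. \<forall>\<xi> x y. dist x y < r \<longrightarrow> \<bar>\<phi> A (\<xi>, x) - \<phi> A (\<xi>, y)\<bar> < 1/4"
  proof
    fix A assume "A \<in> P"
    obtain d where "d > 0" "\<And>\<xi> x y. dist x y < d \<Longrightarrow> \<bar>\<phi> A (\<xi>, x) - \<phi> A (\<xi>, y)\<bar> < 1/4"
      by (rule local_fun_equicont[OF \<phi>[OF \<open>A \<in> P\<close>], of "1/4"]) auto
    then show "\<exists>r>0. \<forall>\<xi> x y. dist x y < r \<longrightarrow> \<bar>\<phi> A (\<xi>, x) - \<phi> A (\<xi>, y)\<bar> < 1/4" by blast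
  qed
  from bchoice[OF this] obtain r where r: "\<And>A. A \<in> P \<Longrightarrow> r A > 0"
    "\<And>A \<xi> x y. A \<in> P \<Longrightarrow> dist x y < r A \<Longrightarrow> \<bar>\<phi> A (\<xi>, x) - \<phi> A (\<xi>, y)\<bar> < 1/4" by blast
  define r0 where "r0 = Min (insert 1 (r ` P))"
  have r0: "r0 > 0" "\<And>A. A \<in> P \<Longrightarrow> r0 \<le> r A" using r(1) P(1) by (auto simp: r0_def)
  obtain m0 :: nat where m0: "inverse (real (Suc m0)) < r0" using reals_Archimedean[OF r0(1)] by blast
  define m where "m = Suc m0"
  have m: "m > 0" "1 / real m < r0" using m0 by (auto simp: m_def inverse_eq_divide)
  have close: "\<bar>\<phi> A z - \<phi> A z'\<bar> < 1/4" if "A \<in> P" "window_label k m z = window_label k m z'" for A z z'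
  proof -
    have w: "word (- int k) (2 * k) (fst z) = word (- int k) (2 * k) (fst z')" and a: "arc_index m (snd z) = arc_index m (snd z')"
      using that(2) by (auto simp: window_label_def)
    have "\<phi> A (fst z, snd z) = \<phi> A (fst z', snd z)"
    proof (rule local_fun_cong[OF \<phi>[OF that(1)]])
      fix i assume i: "- int k \<le> i" "i < int k"
      have "word (- int k) (2 * k) (fst z) ! nat (i + int k) = word (- int k) (2 * k) (fst z') ! nat (i + int k)"
        by (simp add: w)
      moreover have "nat (i + int k) < 2 * k" using i by linarith
      ultimately show "fst z i = fst z' i" using i by (simp add: word_def)
    qed
    moreover have "dist (snd z) (snd z') < r A" using arc_index_eq_dist[OF m(1) a] m(2) r0(2)[OF that(1)] by linarith
    ultimately show ?thesis using r(2)[OF that(1), of "snd z" "snd z'" "fst z'"] by simp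
  qed
  define zc where "zc c = (SOME z. window_label k m z = c)" for c
  have zc: "window_label k m (zc (window_label k m z)) = window_label k m z" for z unfolding zc_def by (rule someI[of _ z]) simp
  \<comment> \<open>Decoding evaluates the observables at a sample point of the label. Two errors
    below 1/4 leave the true cell above 1/2 and every other cell below it.\<close>
  define \<pi> where "\<pi> c = (SOME A. A \<in> P \<and> \<phi> A (zc c) > 1/2)" for c
  define Bad where "Bad A = {z \<in> space \<nu>. 1/4 \<le> \<bar>indicator A z - \<phi> A z\<bar>}" for A
  have bad: "z \<in> (\<Union>A\<in>P. Bad A)" if "cell_of P z \<noteq> \<pi> (window_label k m z)" for z
  proof (rule ccontr)
    assume "z \<notin> (\<Union>A\<in>P. Bad A)"
    then have g: "\<bar>indicator A z - \<phi> A z\<bar> < 1/4" if "A \<in> P" for A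
      using that by (auto simp: Bad_def invariant_prob_facts(5) not_le)
    have cl: "\<bar>\<phi> A z - \<phi> A (zc (window_label k m z))\<bar> < 1/4" if "A \<in> P" for A by (rule close[OF that]) (simp add: zc)
    let ?A = "cell_of P z"
    note pl = cell_of[OF P(3), where z = z]
    have "\<pi> (window_label k m z) = ?A"
      unfolding \<pi>_def
    proof (rule some_equality)
      have "indicator ?A z = (1 :: real)" using pl(2) by simp
      then show "?A \<in> P \<and> 1/2 < \<phi> ?A (zc (window_label k m z))" using g[OF pl(1)] cl[OF pl(1)] pl(1) by linarith
    next
      fix B assume B: "B \<in> P \<and> 1/2 < \<phi> B (zc (window_label k m z))"
      show "B = ?A"
      proof (rule ccontr)
        assume "B \<noteq> ?A"
        then have "z \<notin> B" using pl(3)[where A = B] B by auto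
        then have "indicator B z = (0 :: real)" by simp
        then show False using g[of B] cl[of B] B by linarith
      qed
    qed
    then show False using that by simp
  qed
  have Badm: "Bad A \<in> sets \<nu>" "measure \<nu> (Bad A) \<le> 4 * d'" if "A \<in> P" for A
  proof -
    have A: "A \<in> sets \<nu>" using P(2) that by auto
    have \<phi>m: "\<phi> A \<in> borel_measurable \<nu>" by (rule local_fun_measurable[OF \<phi>[OF that] invariant_prob_facts(2)])
    show "Bad A \<in> sets \<nu>" unfolding Bad_def using A \<phi>m by measurable
    have int: "integrable \<nu> (\<lambda>z. \<bar>indicator A z - \<phi> A z\<bar>)"
      using local_fun_integrable[OF \<phi>[OF that] invariant_prob_facts(2,1)] A
      by (intro integrable_abs Bochner_Integration.integrable_diff) (auto simp: integrable_indicator_iff nu.emeasure_eq_measure)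
    have "measure \<nu> (Bad A) \<le> (\<integral>z. \<bar>indicator A z - \<phi> A z\<bar> \<partial>\<nu>) / (1/4)"
      unfolding Bad_def by (rule integral_Markov_inequality_measure[OF int, of UNIV]) (auto simp: invariant_prob_facts(2))
    then show "measure \<nu> (Bad A) \<le> 4 * d'" using p(2)[OF that] by (simp add: \<phi>_def)
  qed
  have "measure \<nu> {z. cell_of P z \<noteq> \<pi> (window_label k m z)} \<le> measure \<nu> (\<Union>A\<in>P. Bad A)"
    using bad Badm(1) P(1) by (intro nu.finite_measure_mono) auto
  also have "\<dots> \<le> (\<Sum>A\<in>P. measure \<nu> (Bad A))"
    using Badm(1) P(1) by (intro nu.finite_measure_subadditive_finite) auto
  also have "\<dots> \<le> (\<Sum>A\<in>P. 4 * d')" by (intro sum_mono Badm(2))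
  also have "\<dots> = real (card P) * d1" by (simp add: d'_def)
  also have "\<dots> = d * (real (card P) / (real (card P) + 1))" by (simp add: d1_def)
  also have "\<dots> \<le> d * 1" using \<open>d > 0\<close> by (intro mult_left_mono) auto
  finally show ?thesis using m(1) by (intro exI[of _ k] exI[of _ m] exI[of _ \<pi>]) simp
qed

text \<open>An arbitrary partition is recovered from window labels together with a correction symbol
  that is almost always trivial. Labels cost the entropy of words up to sublinear terms, and
  corrections cost at most e per step.\<close>

lemma metric_entropy_le:
  assumes L: "\<And>e. e > 0 \<Longrightarrow> \<exists>n0. \<forall>n\<ge>n0. word_entropy \<nu> n \<le> real n * (L + e)"
  shows "metric_entropy (skew f) \<nu> \<le> ereal L"
  unfolding metric_entropy_def
proof (rule SUP_least)
  fix P assume "P \<in> finite_partitions \<nu>"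
  then have P: "finite P" "P \<subseteq> sets \<nu>" "partition_on UNIV P"
    by (auto simp: finite_partitions_def invariant_prob_facts)
  define p where "p = cell_of P"
  have sp: "simple_function \<nu> p"
    unfolding simple_function_def
  proof (intro conjI ballI)
    show "finite (p ` space \<nu>)" by (rule finite_subset[OF _ P(1)]) (auto simp: p_def cell_of[OF P(3)])
    fix A assume "A \<in> p ` space \<nu>"
    then have A: "A \<in> P" by (auto simp: p_def cell_of[OF P(3)])
    then have "p -` {A} \<inter> space \<nu> = A" using cell_of[OF P(3)] by (auto simp: p_def invariant_prob_facts(5))
    then show "p -` {A} \<inter> space \<nu> \<in> sets \<nu>" using A P(2) by auto
  qed
  define a where "a n = fun_entropy \<nu> (itinerary (skew f) p n)" for n
  have an: "partition_entropy \<nu> (iterated_partition (skew f) \<nu> P n) = a n" for n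
    unfolding a_def p_def by (rule partition_entropy_iterated[OF P(3) invariant_prob_facts(5)])
  have si: "simple_function \<nu> (itinerary (skew f) g n)" if "simple_function \<nu> g" for n and g :: "(int \<Rightarrow> 'n) \<times> circle \<Rightarrow> 'c"
    by (rule simple_function_itinerary[OF invariant_prob_facts(3) that])
  have "convergent (\<lambda>n. a n / real n)"
    by (rule Fekete_subadditive) (auto simp: a_def fun_entropy_itinerary_Suc[OF sp] nu.fun_entropy_nonneg[OF si[OF sp]])
  then have lim: "(\<lambda>n. a n / real n) \<longlonglongrightarrow> entropy_wrt_partition (skew f) \<nu> P"
    unfolding entropy_wrt_partition_def an by (simp add: convergent_LIMSEQ_iff)
  have "entropy_wrt_partition (skew f) \<nu> P \<le> L + 2 * e" if epos: "e > 0" for e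
  proof -
    obtain d where d: "d > 0" "\<And>(M :: ((int \<Rightarrow> 'n) \<times> circle) measure) (g :: (int \<Rightarrow> 'n) \<times> circle \<Rightarrow> ((int \<Rightarrow> 'n) \<times> circle) set option) S a0.
       prob_space M \<Longrightarrow> simple_function M g \<Longrightarrow>
       g ` space M \<subseteq> S \<Longrightarrow> finite S \<Longrightarrow> card S \<le> card P + 1 \<Longrightarrow> measure M {z \<in> space M. g z \<noteq> a0} \<le> d \<Longrightarrow> fun_entropy M g \<le> e"
      using fun_entropy_small[OF epos, of "card P + 1"] by auto
    obtain k m \<pi> where km: "m > 0" "measure \<nu> {z. cell_of P z \<noteq> \<pi> (window_label k m z)} \<le> d"
      using approx_label[OF P d(1)] by blast
    \<comment> \<open>\<open>None\<close> stands for a correct guess from the label; otherwise the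
      true cell is recorded. The pair of label and correction determines p.\<close>
    define D where "D z = (if p z = \<pi> (window_label k m z) then None else Some (p z))" for z
    have sQ: "simple_function \<nu> (window_label k m)" by (rule simple_function_window_label[OF km(1)])
    have sD: "simple_function \<nu> D"
    proof -
      have "simple_function \<nu> (\<lambda>z. (\<lambda>(u, v). if u = \<pi> v then None else Some u) (p z, window_label k m z))"
        by (rule simple_function_compose1[OF simple_function_Pair[OF sp sQ]])
      then show ?thesis by (simp add: D_def[abs_def])
    qed
    have "D ` space \<nu> \<subseteq> insert None (Some ` P)" using cell_of(1)[OF P(3)] by (auto simp: D_def p_def)
    moreover have "card (insert None (Some ` P)) \<le> card P + 1"
      using card_insert_le_m1[of "card P + 1" "Some ` P" None] card_image_le[OF P(1), of Some] by simp
    moreover have "{z \<in> space \<nu>. D z \<noteq> None} = {z. cell_of P z \<noteq> \<pi> (window_label k m z)}"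
      by (auto simp: D_def p_def invariant_prob_facts(5))
    ultimately have HD: "fun_entropy \<nu> D \<le> e" using d(2)[OF invariant_prob_facts(1) sD, of "insert None (Some ` P)" None] P(1) km(2) by simp
    obtain n0 where n0: "\<And>n. n \<ge> n0 \<Longrightarrow> word_entropy \<nu> n \<le> real n * (L + e)" using L[OF epos] by blast
    have bound: "a n \<le> real (n + 2 * k) * (L + e) + 2 * ln (real (n * m + 1)) + real n * e" if "n \<ge> n0" for n
    proof -
      have "a n \<le> fun_entropy \<nu> (\<lambda>z. (itinerary (skew f) (window_label k m) n z, itinerary (skew f) D n z))"
        unfolding a_def
      proof (rule nu.fun_entropy_data_processing[OF simple_function_Pair[OF si[OF sQ] si[OF sD]] si[OF sp]])
        fix z z' assume "(itinerary (skew f) (window_label k m) n z, itinerary (skew f) D n z) = (itinerary (skew f) (window_label k m) n z', itinerary (skew f) D n z')"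
        then have eq: "window_label k m ((skew f ^^ i) z) = window_label k m ((skew f ^^ i) z')" "D ((skew f ^^ i) z) = D ((skew f ^^ i) z')" if "i < n" for i
          using that by (auto simp: itinerary_eq_iff)
        have "p y = p y'" if "window_label k m y = window_label k m y'" "D y = D y'" for y y'
          using that by (auto simp: D_def split: if_splits)
        then show "itinerary (skew f) p n z = itinerary (skew f) p n z'"
          unfolding itinerary_eq_iff using eq by blast
      qed
      also have "\<dots> \<le> fun_entropy \<nu> (itinerary (skew f) (window_label k m) n) + fun_entropy \<nu> (itinerary (skew f) D n)"
        by (rule nu.fun_entropy_Pair_le[OF si[OF sQ] si[OF sD]])
      also have "\<dots> \<le> (word_entropy \<nu> (n + 2 * k) + 2 * ln (real (n * m + 1))) + real n * fun_entropy \<nu> D"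
        by (intro add_mono fun_entropy_itinerary_window_label[OF km(1)] fun_entropy_itinerary_le[OF sD])
      also have "\<dots> \<le> (real (n + 2 * k) * (L + e) + 2 * ln (real (n * m + 1))) + real n * e"
        using HD that by (intro add_mono mult_left_mono n0) auto
      finally show ?thesis by simp
    qed
    have "(\<lambda>n. (real (n + 2 * k) * (L + e) + 2 * ln (real (n * m + 1)) + real n * e) / real n) \<longlonglongrightarrow> L + 2 * e"
    proof -
      have eq: "L + 2 * e = (L + e) + e" by simp
      show ?thesis unfolding eq using km(1) by real_asymp
    qed
    moreover have "\<forall>\<^sub>F n in sequentially. a n / real n \<le> (real (n + 2 * k) * (L + e) + 2 * ln (real (n * m + 1)) + real n * e) / real n"
      using bound by (intro eventually_sequentiallyI[of n0] divide_right_mono) auto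
    ultimately show ?thesis using lim by (intro tendsto_le[of sequentially]) auto
  qed
  from this[of "_ / 2"] have "entropy_wrt_partition (skew f) \<nu> P \<le> L + e" if "e > 0" for e using that by force
  then have "entropy_wrt_partition (skew f) \<nu> P \<le> L" by (rule field_le_epsilon)
  then show "ereal (entropy_wrt_partition (skew f) \<nu> P) \<le> ereal L" by simp
qed

end

end

subsection \<open>One half of the ergodic theorem\<close>

text \<open>A maximal ergodic argument. Unboundedness of the sums is an invariant property, so it
  holds almost nowhere or almost everywhere. In the second case the running maxima
  \<open>M n\<close> are eventually positive almost everywhere; since
  \<open>M (Suc n) z - M n (T z)\<close> equals \<open>\<phi> z\<close> plus the negative part of
  \<open>M n (T z)\<close>, integration and a limit give a nonnegative mean, a
  contradiction.\<close>

lemma ergodic_sums_bounded: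
  fixes \<phi> :: "'a::topological_space \<Rightarrow> real"
  assumes erg: "ergodic_prob T \<nu>" and \<phi>: "\<phi> \<in> borel_measurable \<nu>" "\<And>z. \<bar>\<phi> z\<bar> \<le> B"
    and neg: "integral\<^sup>L \<nu> \<phi> < 0"
  shows "AE z in \<nu>. bdd_above (range (\<lambda>n. \<Sum>j<n. \<phi> ((T ^^ j) z)))"
proof -
  have inv: "prob_space \<nu>" "sets \<nu> = sets borel" "T \<in> measurable \<nu> \<nu>" "distr \<nu> \<nu> T = \<nu>"
    using erg by (auto simp: ergodic_prob_def invariant_prob_def)
  have sp: "space \<nu> = UNIV" using sets_eq_imp_space_eq[OF inv(2)] by simp
  interpret prob_space \<nu> by (rule inv)
  have Tn: "(T ^^ n) \<in> measurable \<nu> \<nu>" for n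
  proof (induction n)
    case (Suc n)
    from measurable_compose[OF Suc inv(3)] show ?case by (simp add: comp_def)
  qed simp
  define S where "S n z = (\<Sum>j<n. \<phi> ((T ^^ j) z))" for n z
  have S_Suc: "S (Suc n) z = \<phi> z + S n (T z)" for n z
    unfolding S_def by (subst sum.lessThan_Suc_shift) (simp add: funpow_swap1)
  have S_m: "S n \<in> borel_measurable \<nu>" for n
    unfolding S_def by (intro borel_measurable_sum measurable_compose[OF Tn \<phi>(1)])
  define E where "E = {z. \<not> bdd_above (range (\<lambda>n. S n z))}"
  have E_iff: "z \<in> E \<longleftrightarrow> (\<forall>k :: nat. \<exists>n. real k < S n z)" for z
  proof
    assume "z \<in> E"
    show "\<forall>k :: nat. \<exists>n. real k < S n z"
    proof (rule ccontr)
      assume "\<not> (\<forall>k :: nat. \<exists>n. real k < S n z)"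
      then obtain k where "\<And>n. S n z \<le> real k" by (auto simp: not_less)
      then have "bdd_above (range (\<lambda>n. S n z))" by (intro bdd_aboveI[of _ "real k"]) auto
      with \<open>z \<in> E\<close> show False by (simp add: E_def)
    qed
  next
    assume k: "\<forall>k :: nat. \<exists>n. real k < S n z"
    show "z \<in> E" unfolding E_def
    proof (rule CollectI, rule notI)
      assume "bdd_above (range (\<lambda>n. S n z))"
      then obtain C where C: "\<And>n. S n z \<le> C" by (auto simp: bdd_above_def)
      obtain j :: nat where "C < real j" using reals_Archimedean2 by blast
      moreover obtain n where "real j < S n z" using k by blast
      ultimately show False using C[of n] by simp
    qed
  qed
  have E_sets: "E \<in> sets \<nu>"
  proof -
    have "E = (\<Inter>k :: nat. \<Union>n. {z \<in> space \<nu>. real k < S n z})" using E_iff by (auto simp: sp)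
    also have "\<dots> \<in> sets \<nu>" using S_m by measurable
    finally show ?thesis .
  qed
  have "T -` E = E"
  proof -
    have "bdd_above (range (\<lambda>n. S n (T z))) \<longleftrightarrow> bdd_above (range (\<lambda>n. S n z))" for z
    proof
      assume "bdd_above (range (\<lambda>n. S n (T z)))"
      then obtain C where C: "\<And>n. S n (T z) \<le> C" by (auto simp: bdd_above_def)
      have "S n z \<le> max 0 (\<phi> z + C)" for n
        using C[of "n - 1"] S_Suc[of "n - 1" z] by (cases n) (auto simp: S_def[of 0])
      then show "bdd_above (range (\<lambda>n. S n z))" by (intro bdd_aboveI[of _ "max 0 (\<phi> z + C)"]) auto
    next
      assume "bdd_above (range (\<lambda>n. S n z))"
      then obtain C where C: "\<And>n. S n z \<le> C" by (auto simp: bdd_above_def)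
      have "S n (T z) \<le> C - \<phi> z" for n using C[of "Suc n"] by (simp add: S_Suc)
      then show "bdd_above (range (\<lambda>n. S n (T z)))" by (intro bdd_aboveI[of _ "C - \<phi> z"]) auto
    qed
    then show ?thesis by (auto simp: E_def)
  qed
  then have "measure \<nu> E = 0 \<or> measure \<nu> E = 1"
    using erg E_sets by (simp add: ergodic_prob_def)
  moreover have "measure \<nu> E \<noteq> 1"
  proof
    assume E1: "measure \<nu> E = 1"
    \<comment> \<open>\<open>M n z\<close> is the maximum of the partial sums of lengths 1 to n + 1;
      the recursion replaces a maximum over a finite set.\<close>
    define M where "M = rec_nat \<phi> (\<lambda>_ m z. \<phi> z + max 0 (m (T z)))"
    have M0: "M 0 = \<phi>" and MS: "M (Suc n) z = \<phi> z + max 0 (M n (T z))" for n z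
      by (simp_all add: M_def)
    have mono: "M n z \<le> M (Suc n) z" for n z
    proof (induction n arbitrary: z)
      case (Suc n)
      have "max 0 (M n (T z)) \<le> max 0 (M (Suc n) (T z))" using Suc[of "T z"] by (simp add: max_def)
      then show ?case by (simp only: MS[of "Suc n"] MS[of n])
    qed (simp add: MS M0)
    have monoM: "M m z \<le> M n z" if "m \<le> n" for m n z
      using that by (induction n rule: dec_induct) (auto intro: order_trans mono)
    have SM: "S (Suc n) z \<le> M n z" for n z
    proof (induction n arbitrary: z)
      case (Suc n)
      have "S (Suc (Suc n)) z = \<phi> z + S (Suc n) (T z)" by (rule S_Suc)
      also have "\<dots> \<le> \<phi> z + max 0 (M n (T z))" using Suc[of "T z"] by simp
      finally show ?case by (simp add: MS)
    qed (simp add: S_def M0)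
    have M_m: "M n \<in> borel_measurable \<nu>" for n
    proof (induction n)
      case (Suc n)
      have "(\<lambda>z. \<phi> z + max 0 (M n (T z))) \<in> borel_measurable \<nu>"
        by (intro borel_measurable_add borel_measurable_max borel_measurable_const \<phi> measurable_compose[OF inv(3) Suc])
      then show ?case by (simp add: MS[abs_def] cong: measurable_cong)
    qed (simp add: M0 \<phi>)
    have B0: "0 \<le> B" using \<phi>(2)[of undefined] by simp
    have low: "- B \<le> M n z" for n z using monoM[of 0 n z] \<phi>(2)[of z] by (simp add: M0 abs_le_iff)
    have up: "M n z \<le> real (Suc n) * B" for n z
    proof (induction n arbitrary: z)
      case 0
      then show ?case using \<phi>(2)[of z] by (simp add: M0 abs_le_iff)
    next
      case (Suc n)
      have "0 \<le> real (Suc n) * B" using B0 by simp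
      then have "max 0 (M n (T z)) \<le> real (Suc n) * B" using Suc[of "T z"] by (rule max.boundedI)
      moreover have "\<phi> z \<le> B" using \<phi>(2)[of z] by (simp add: abs_le_iff)
      ultimately have "M (Suc n) z \<le> B + real (Suc n) * B" unfolding MS by (rule add_mono[rotated])
      then show ?case by (simp add: algebra_simps)
    qed
    have M_int: "integrable \<nu> (M n)" for n
    proof (rule integrable_const_bound[of _ "real (Suc n) * B"])
      have "\<bar>M n z\<bar> \<le> real (Suc n) * B" for z
      proof -
        have "B \<le> real (Suc n) * B" using B0 by (simp add: algebra_simps)
        then show ?thesis using low[of n z] up[of n z] by (simp add: abs_le_iff)
      qed
      then show "AE z in \<nu>. norm (M n z) \<le> real (Suc n) * B" by simp
    qed (rule M_m)
    have \<phi>_int: "integrable \<nu> \<phi>" using M_int[of 0] by (simp add: M0)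
    let ?N = "\<lambda>n z. max 0 (- M n z)"
    have N_int: "integrable \<nu> (?N n)" for n
      using M_int[of n] by (intro integrable_max) auto
    have inv_int: "integral\<^sup>L \<nu> (\<lambda>z. h (T z)) = integral\<^sup>L \<nu> h" if "h \<in> borel_measurable \<nu>" for h :: "'a \<Rightarrow> real"
      using integral_distr[OF inv(3) that] by (simp add: inv(4))
    have MT_int: "integrable \<nu> (\<lambda>z. M n (T z))" for n
      using integrable_distr[OF inv(3), of "M n"] M_int[of n] by (simp add: inv(4))
    \<comment> \<open>By invariance the increments of the monotone maxima have the same integral as
      the differences \<open>M (Suc n) z - M n (T z)\<close>.\<close>
    have key: "0 \<le> integral\<^sup>L \<nu> \<phi> + integral\<^sup>L \<nu> (?N n)" for n
    proof -
      have "0 \<le> integral\<^sup>L \<nu> (M (Suc n)) - integral\<^sup>L \<nu> (M n)"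
        using integral_mono[OF M_int[of n] M_int[of "Suc n"] mono] by simp
      also have "integral\<^sup>L \<nu> (M n) = integral\<^sup>L \<nu> (\<lambda>z. M n (T z))" by (rule inv_int[OF M_m, symmetric])
      also have "integral\<^sup>L \<nu> (M (Suc n)) - integral\<^sup>L \<nu> (\<lambda>z. M n (T z)) = integral\<^sup>L \<nu> (\<lambda>z. M (Suc n) z - M n (T z))"
        by (rule Bochner_Integration.integral_diff[OF M_int MT_int, symmetric])
      also have "\<dots> = integral\<^sup>L \<nu> (\<lambda>z. \<phi> z + ?N n (T z))"
        by (intro Bochner_Integration.integral_cong refl) (auto simp: MS max_def)
      also have "\<dots> = integral\<^sup>L \<nu> \<phi> + integral\<^sup>L \<nu> (\<lambda>z. ?N n (T z))"
        by (rule Bochner_Integration.integral_add[OF \<phi>_int]) (use MT_int[of n] in \<open>intro integrable_max, auto\<close>)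
      also have "integral\<^sup>L \<nu> (\<lambda>z. ?N n (T z)) = integral\<^sup>L \<nu> (?N n)"
        by (rule inv_int) (intro borel_measurable_max borel_measurable_const borel_measurable_uminus M_m)
      finally show ?thesis .
    qed
    have "(\<lambda>n. integral\<^sup>L \<nu> (?N n)) \<longlonglongrightarrow> integral\<^sup>L \<nu> (\<lambda>_. 0)"
    proof (rule integral_dominated_convergence[where w = "\<lambda>_. B"])
      show "AE z in \<nu>. (\<lambda>n. ?N n z) \<longlonglongrightarrow> 0"
      proof -
        have "AE z in \<nu>. z \<in> E" using E1 E_sets by (simp add: prob_eq_1)
        then show ?thesis
        proof (rule AE_mp, intro AE_I2 impI)
          fix z assume "z \<in> E"
          then obtain n0 where n0: "real 0 < S n0 z" using E_iff by blast
          then have "n0 \<noteq> 0" by (cases n0) (simp_all add: S_def)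
          then obtain m where m: "n0 = Suc m" by (cases n0) auto
          have "?N n z = 0" if "n \<ge> m" for n
            using SM[of m z] monoM[OF that, of z] n0 m by simp
          then show "(\<lambda>n. ?N n z) \<longlonglongrightarrow> 0" by (intro tendsto_eventually eventually_sequentiallyI[of m])
        qed
      qed
      show "AE z in \<nu>. norm (?N n z) \<le> B" for n using low[of n] B0 by (auto simp: max_def minus_le_iff)
      show "?N n \<in> borel_measurable \<nu>" for n using N_int by auto
    qed auto
    then have "(\<lambda>n. integral\<^sup>L \<nu> \<phi> + integral\<^sup>L \<nu> (?N n)) \<longlonglongrightarrow> integral\<^sup>L \<nu> \<phi> + 0"
      by (intro tendsto_add tendsto_const) simp
    then have "0 \<le> integral\<^sup>L \<nu> \<phi> + 0" by (rule tendsto_lowerbound) (use key in auto)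
    with neg show False by simp
  qed
  ultimately have "measure \<nu> E = 0" by simp
  then have "E \<in> null_sets \<nu>" using E_sets by (intro null_setsI) (simp_all add: emeasure_eq_measure)
  then have "AE z in \<nu>. z \<notin> E" by (rule AE_not_in)
  then show ?thesis unfolding E_def S_def by simp
qed

lemma local_fun_fiber:
  fixes g :: "'n::finite \<Rightarrow> circle \<Rightarrow> real"
  assumes "\<And>i. continuous_on UNIV (g i)"
  shows "local_fun 0 1 (\<lambda>z. g (fst z 0) (snd z))"
proof -
  have "\<exists>B. \<forall>i. \<forall>x. \<bar>g i x\<bar> \<le> B i"
  proof (intro choice allI)
    fix i
    have "bounded (g i ` UNIV)" by (intro compact_imp_bounded compact_continuous_image assms compact_circle)
    then show "\<exists>B. \<forall>x. \<bar>g i x\<bar> \<le> B" by (auto simp: bounded_iff)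
  qed
  then obtain B where B: "\<And>i x. \<bar>g i x\<bar> \<le> B i" by blast
  have BM: "B i \<le> Max (range B)" for i by simp
  show ?thesis
  proof (rule local_funI[of _ "Max (range B)"])
    show "\<bar>g (fst z 0) (snd z)\<bar> \<le> Max (range B)" for z by (rule order_trans[OF B BM])
  next
    fix \<xi> \<xi>' :: "int \<Rightarrow> 'n" and x
    assume "\<And>i. 0 \<le> i \<Longrightarrow> i < 1 \<Longrightarrow> \<xi> i = \<xi>' i"
    then show "g (fst (\<xi>, x) 0) (snd (\<xi>, x)) = g (fst (\<xi>', x) 0) (snd (\<xi>', x))" by simp
  next
    fix e :: real assume "e > 0"
    have "\<exists>r. \<forall>i. r i > 0 \<and> (\<forall>x y. dist x y < r i \<longrightarrow> dist (g i x) (g i y) < e)"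
      by (intro choice allI uniformly_continuous_circle[OF assms \<open>e > 0\<close>])
    then obtain r where r: "\<And>i. r i > 0" "\<And>i x y. dist x y < r i \<Longrightarrow> dist (g i x) (g i y) < e" by blast
    have "Min (range r) > 0" "\<And>i. Min (range r) \<le> r i" using r(1) by auto
    then show "\<exists>d>0. \<forall>\<xi> x y. dist x y < d \<longrightarrow> \<bar>g (fst (\<xi> :: int \<Rightarrow> 'n, x) 0) (snd (\<xi>, x)) - g (fst (\<xi>, y) 0) (snd (\<xi>, y))\<bar> < e"
      using r(2) by (intro exI[of _ "Min (range r)"]) (auto simp: dist_real_def dest: less_le_trans)
  qed
qed

section \<open>Shadowing and coding for nonpositive exponents\<close>

locale random_diffeo = random_circle f for f :: "'n::{finite,discrete_topology} \<Rightarrow> circle \<Rightarrow> circle" +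
  assumes diffeo: "\<And>i. C1_circle_diffeo (f i)"
begin

definition logder :: "(int \<Rightarrow> 'n) \<times> circle \<Rightarrow> real" where
  "logder z = ln \<bar>circle_deriv (f (fst z 0)) (snd z)\<bar>"

lemma lyapunov_logder: "lyapunov f \<nu> = integral\<^sup>L \<nu> logder"
  by (simp add: lyapunov_def logder_def[abs_def] case_prod_unfold)

lemma local_fun_logder: "local_fun 0 1 logder"
  unfolding logder_def[abs_def]
proof (rule local_fun_fiber[of "\<lambda>i x. ln \<bar>circle_deriv (f i) x\<bar>"])
  fix i
  have "continuous_on UNIV (circle_deriv (f i))" using diffeo by (simp add: C1_circle_diffeo_def C1_circle_map_def)
  then show "continuous_on UNIV (\<lambda>x. ln \<bar>circle_deriv (f i) x\<bar>)"
    using circle_deriv_nonzero[OF diffeo] by (intro continuous_on_ln continuous_on_rabs) auto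
qed

definition orbit_sum :: "((int \<Rightarrow> 'n) \<times> circle \<Rightarrow> real) \<Rightarrow> nat \<Rightarrow> (int \<Rightarrow> 'n) \<times> circle \<Rightarrow> real" where
  "orbit_sum \<phi> n z = (\<Sum>j<n. \<phi> ((skew f ^^ j) z))"

lemma orbit_sum_Suc: "orbit_sum \<phi> (Suc n) z = \<phi> z + orbit_sum \<phi> n (skew f z)"
  unfolding orbit_sum_def by (subst sum.lessThan_Suc_shift) (simp add: funpow_swap1)

text \<open>Subexponential growth of the derivatives makes exponentially close points shadow each other.\<close>

lemma shadowing:
  assumes "e > 0" "d > 0"
  shows "\<exists>r>0. \<forall>n \<xi> x y. (\<forall>j\<le>n. orbit_sum logder j (\<xi>, x) \<le> 2 * real n * e) \<longrightarrow>
     dist x y \<le> r * exp (- 4 * real n * e) \<longrightarrow>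
     (\<forall>j\<le>n. dist (snd ((skew f ^^ j) (\<xi>, x))) (snd ((skew f ^^ j) (\<xi>, y))) < d)"
proof -
  have "\<exists>r. \<forall>i. r i > 0 \<and> (\<forall>x y. dist x y < r i \<longrightarrow> dist (f i x) (f i y) \<le> exp (ln \<bar>circle_deriv (f i) x\<bar> + e) * dist x y)"
    by (intro choice allI C1_circle_diffeo_Lipschitz diffeo assms)
  then obtain r0 where r0: "\<And>i. r0 i > 0"
    "\<And>i x y. dist x y < r0 i \<Longrightarrow> dist (f i x) (f i y) \<le> exp (ln \<bar>circle_deriv (f i) x\<bar> + e) * dist x y" by blast
  \<comment> \<open>Half of the minimum, so that r lies strictly below d and below every Lipschitz
    radius.\<close>
  define r where "r = min d (Min (range r0)) / 2"
  have "Min (range r0) > 0" using r0(1) by auto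
  then have r: "r > 0" using assms(2) by (simp add: r_def)
  have "r \<le> d / 2" by (simp add: r_def)
  then have rd: "r < d" using assms(2) by simp
  have rr0: "r < r0 i" for i
  proof -
    have "Min (range r0) \<le> r0 i" by simp
    moreover have "r \<le> Min (range r0) / 2" unfolding r_def by simp
    ultimately show ?thesis using \<open>Min (range r0) > 0\<close> by linarith
  qed
  \<comment> \<open>Both bounds are proved together: staying within r permits the next one-step
    estimate, and the accumulated factor, at most \<open>exp (3 * real n * e)\<close>, is absorbed
    by the initial distance of order \<open>exp (- 4 * real n * e)\<close>.\<close>
  have main: "dist (snd ((skew f ^^ j) (\<xi>, x))) (snd ((skew f ^^ j) (\<xi>, y))) \<le> exp (orbit_sum logder j (\<xi>, x) + real j * e) * dist x y
      \<and> dist (snd ((skew f ^^ j) (\<xi>, x))) (snd ((skew f ^^ j) (\<xi>, y))) \<le> r"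
    if S: "\<forall>j\<le>n. orbit_sum logder j (\<xi>, x) \<le> 2 * real n * e" and xy: "dist x y \<le> r * exp (- 4 * real n * e)" and "j \<le> n"
    for n \<xi> x y j
    using \<open>j \<le> n\<close>
  proof (induction j)
    case 0
    have "exp (- 4 * real n * e) \<le> 1" using \<open>e > 0\<close> by simp
    then have "r * exp (- 4 * real n * e) \<le> r * 1" using r by (intro mult_left_mono) auto
    then show ?case using xy by (simp add: orbit_sum_def)
  next
    case (Suc j)
    let ?u = "snd ((skew f ^^ j) (\<xi>, x))" and ?v = "snd ((skew f ^^ j) (\<xi>, y))"
    have IH: "dist ?u ?v \<le> exp (orbit_sum logder j (\<xi>, x) + real j * e) * dist x y" "dist ?u ?v \<le> r"
      using Suc by auto
    have s: "snd ((skew f ^^ Suc j) (\<xi>, z)) = f (\<xi> (int j)) (snd ((skew f ^^ j) (\<xi>, z)))" for z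
      by (simp add: skew_eq_step step_def fst_skew_iterate)
    have l: "logder ((skew f ^^ j) (\<xi>, x)) = ln \<bar>circle_deriv (f (\<xi> (int j))) ?u\<bar>"
      by (simp add: logder_def fst_skew_iterate)
    have "dist ?u ?v < r0 (\<xi> (int j))" using IH(2) rr0[of "\<xi> (int j)"] by simp
    from r0(2)[OF this]
    have "dist (snd ((skew f ^^ Suc j) (\<xi>, x))) (snd ((skew f ^^ Suc j) (\<xi>, y))) \<le> exp (logder ((skew f ^^ j) (\<xi>, x)) + e) * dist ?u ?v"
      unfolding s l .
    also have "\<dots> \<le> exp (logder ((skew f ^^ j) (\<xi>, x)) + e) * (exp (orbit_sum logder j (\<xi>, x) + real j * e) * dist x y)"
      by (intro mult_left_mono IH(1)) simp
    also have "\<dots> = exp (orbit_sum logder (Suc j) (\<xi>, x) + real (Suc j) * e) * dist x y"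
      by (simp add: orbit_sum_def exp_add[symmetric] mult.assoc[symmetric] algebra_simps)
    finally have 1: "dist (snd ((skew f ^^ Suc j) (\<xi>, x))) (snd ((skew f ^^ Suc j) (\<xi>, y))) \<le> exp (orbit_sum logder (Suc j) (\<xi>, x) + real (Suc j) * e) * dist x y" .
    also have "\<dots> \<le> exp (3 * real n * e) * (r * exp (- 4 * real n * e))"
    proof (intro mult_mono xy)
      have "real (Suc j) * e \<le> real n * e" using Suc(2) \<open>e > 0\<close> by (intro mult_right_mono) auto
      moreover have "orbit_sum logder (Suc j) (\<xi>, x) \<le> 2 * real n * e" using S Suc(2) by blast
      ultimately have "orbit_sum logder (Suc j) (\<xi>, x) + real (Suc j) * e \<le> 3 * real n * e" by linarith
      then show "exp (orbit_sum logder (Suc j) (\<xi>, x) + real (Suc j) * e) \<le> exp (3 * real n * e)" by simp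
    qed auto
    also have "\<dots> = r * exp (- (real n * e))" by (simp add: mult.left_commute exp_add[symmetric] algebra_simps)
    also have "\<dots> \<le> r * 1" using r \<open>e > 0\<close> by (intro mult_left_mono) auto
    finally show ?case using 1 by simp
  qed
  show ?thesis
  proof (intro exI[of _ r] conjI allI impI)
    fix n \<xi> x y j
    assume a: "\<forall>j\<le>n. orbit_sum logder j (\<xi>, x) \<le> 2 * real n * e" "dist x y \<le> r * exp (- 4 * real n * e)" "j \<le> n"
    show "dist (snd ((skew f ^^ j) (\<xi>, x))) (snd ((skew f ^^ j) (\<xi>, y))) < d"
      using main[OF a] rd by linarith
  qed (rule r)
qed

text \<open>The Birkhoff sum of \<beta> along the orbit of z when the letters of w are read in place
  of those at positions 0, 1 and so on. It makes sense as a function of the word if \<beta> looks no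
  further than the present letter.\<close>

primrec word_sum :: "((int \<Rightarrow> 'n) \<times> circle \<Rightarrow> real) \<Rightarrow> 'n list \<Rightarrow> (int \<Rightarrow> 'n) \<times> circle \<Rightarrow> real" where
  "word_sum \<beta> [] z = 0"
| "word_sum \<beta> (i # w) z = \<beta> ((fst z)(0 := i), snd z) + word_sum \<beta> w (step i z)"

lemma word_sum_orbit: "word_sum \<beta> (word 0 n (fst z)) z = orbit_sum \<beta> n z"
proof (induction n arbitrary: z)
  case (Suc n)
  have "word 0 n (fst (skew f z)) = word 1 n (fst z)"
    using fst_skew_iterate[of 1 z] by (simp add: word_def add.commute)
  then show ?case using Suc[of "skew f z"]
    by (simp add: word_Suc orbit_sum_Suc skew_eq_step[symmetric])
qed (simp add: orbit_sum_def)

lemma word_sum_cong: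
  assumes \<beta>: "local_fun a 1 \<beta>" and "snd z = snd z'" and "\<And>i. a \<le> i \<Longrightarrow> i < 0 \<Longrightarrow> fst z i = fst z' i"
  shows "word_sum \<beta> w z = word_sum \<beta> w z'"
  using assms(2,3)
proof (induction w arbitrary: z z')
  case (Cons i w)
  have "\<beta> ((fst z)(0 := i), snd z) = \<beta> ((fst z')(0 := i), snd z)"
    by (rule local_fun_cong[OF \<beta>]) (use Cons.prems(2) in auto)
  moreover have "word_sum \<beta> w (step i z) = word_sum \<beta> w (step i z')"
    by (rule Cons.IH) (use Cons.prems in \<open>auto simp: step_def\<close>)
  ultimately show ?case using Cons.prems(1) by simp
qed simp

text \<open>Under random letters the exponentials of the partial sums form a supermartingale;
  condition on the first letter.\<close>

lemma word_sum_exp: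
  assumes "\<And>\<xi> x. (\<Sum>i\<in>UNIV. exp (\<beta> (\<xi>(0 := i), x))) / real CARD('n) \<le> 1"
  shows "wavg n (\<lambda>w. exp (word_sum \<beta> w z)) \<le> 1"
proof (induction n arbitrary: z)
  case (Suc n)
  have "wavg (Suc n) (\<lambda>w. exp (word_sum \<beta> w z)) = (\<Sum>i\<in>UNIV. exp (\<beta> ((fst z)(0 := i), snd z)) * wavg n (\<lambda>w. exp (word_sum \<beta> w (step i z)))) / real CARD('n)"
    by (simp add: wavg_Suc exp_add wavg_cmult)
  also have "\<dots> \<le> (\<Sum>i\<in>UNIV. exp (\<beta> ((fst z)(0 := i), snd z)) * 1) / real CARD('n)"
    by (intro divide_right_mono sum_mono mult_left_mono Suc) auto
  also have "\<dots> \<le> 1" using assms by simp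
  finally show ?case .
qed simp

text \<open>Words are coded with the weights q: the uniform weight times the exponential of a
  Birkhoff sum of \<beta>, averaged over R grid points of the fiber. The total mass is at most 1 by
  \<open>word_sum_exp\<close>. At the word of z, keeping one grid point bounds \<open>- ln q\<close>
  by the uniform cost plus \<open>ln R\<close> minus the Birkhoff sum of a shadowing orbit, which
  integrates to n times the mean of \<beta> up to small errors. The K additional letters are the
  past that \<beta> sees.\<close>

lemma entropy_gap_finite:
  assumes erg: "ergodic_prob (skew f) \<nu>" and lyap: "lyapunov f \<nu> \<le> 0"
    and \<beta>: "local_fun a 1 \<beta>" and avg: "\<And>\<xi> x. (\<Sum>i\<in>UNIV. exp (\<beta> (\<xi>(0 := i), x))) / real CARD('n) \<le> 1"
    and "\<epsilon> > 0"
  shows "\<exists>n0. \<forall>n\<ge>n0. word_entropy \<nu> n \<le> real n * (ln (real CARD('n)) - integral\<^sup>L \<nu> \<beta> + \<epsilon>)"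
proof -
  have inv: "invariant_prob (skew f) \<nu>" using erg by (simp add: ergodic_prob_def)
  note nf = invariant_prob_facts[OF inv]
  interpret prob_space \<nu> by (rule nf)
  define N where "N = real CARD('n)"
  have N: "N \<ge> 1" unfolding N_def using zero_less_card_finite[where 'a='n] by linarith
  obtain B where B: "B > 0" "\<And>z. \<bar>\<beta> z\<bar> \<le> B" using local_fun_bound[OF \<beta>] by blast
  \<comment> \<open>The rate \<open>4 * e\<close> of the grid and the shadowing error e together use
    a quarter of \<epsilon>.\<close>
  define e where "e = \<epsilon> / 20"
  have e: "e > 0" using \<open>\<epsilon> > 0\<close> by (simp add: e_def)
  obtain d where d: "d > 0" "\<And>\<xi> x y. dist x y < d \<Longrightarrow> \<bar>\<beta> (\<xi>, x) - \<beta> (\<xi>, y)\<bar> < e"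
    using local_fun_equicont[OF \<beta> e] by blast
  obtain r where r: "r > 0" "\<And>n \<xi> x y j. (\<forall>j\<le>n. orbit_sum logder j (\<xi>, x) \<le> 2 * real n * e) \<Longrightarrow>
     dist x y \<le> r * exp (- 4 * real n * e) \<Longrightarrow> j \<le> n \<Longrightarrow>
     dist (snd ((skew f ^^ j) (\<xi>, x))) (snd ((skew f ^^ j) (\<xi>, y))) < d"
    using shadowing[OF e d(1)] by blast
  define K where "K = nat (- a)"
  obtain \<Lambda> where \<Lambda>: "\<Lambda> > 0" "\<And>z. \<bar>logder z\<bar> \<le> \<Lambda>" using local_fun_bound[OF local_fun_logder] by blast
  have lm: "logder \<in> borel_measurable \<nu>" by (rule local_fun_measurable[OF local_fun_logder nf(2)])
  have li: "integrable \<nu> logder" by (rule local_fun_integrable[OF local_fun_logder nf(2,1)])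
  \<comment> \<open>Subtracting e makes the mean strictly negative although the exponent may vanish.
    Hence the derivative sums exceed \<open>j * e\<close> by at most a constant depending on the
    point.\<close>
  have "AE z in \<nu>. bdd_above (range (\<lambda>n. \<Sum>j<n. logder ((skew f ^^ j) z) - e))"
  proof (rule ergodic_sums_bounded[OF erg, of "\<lambda>z. logder z - e" "\<Lambda> + e"])
    show "\<bar>logder z - e\<bar> \<le> \<Lambda> + e" for z using \<Lambda>(2)[of z] e by linarith
    show "(\<integral>z. logder z - e \<partial>\<nu>) < 0" using lyap li e by (simp add: lyapunov_logder prob_space)
  qed (use lm in measurable)
  then have AEb: "AE z in \<nu>. \<exists>C :: nat. \<forall>j. orbit_sum logder j z - real j * e \<le> real C"
  proof (rule AE_mp, intro AE_I2 impI)
    fix z assume "bdd_above (range (\<lambda>n. \<Sum>j<n. logder ((skew f ^^ j) z) - e))"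
    then obtain c where c: "\<And>n. (\<Sum>j<n. logder ((skew f ^^ j) z) - e) \<le> c" by (auto simp: bdd_above_def)
    obtain C :: nat where C: "c \<le> real C" using real_arch_simple by blast
    have "orbit_sum logder j z - real j * e \<le> real C" for j
      using c[of j] C by (simp add: orbit_sum_def sum_subtractf)
    then show "\<exists>C :: nat. \<forall>j. orbit_sum logder j z - real j * e \<le> real C" by blast
  qed
  define Gd where "Gd C = {z \<in> space \<nu>. \<forall>j. orbit_sum logder j z - real j * e \<le> real C}" for C :: nat
  have om: "orbit_sum logder j \<in> borel_measurable \<nu>" for j
    unfolding orbit_sum_def by (intro borel_measurable_sum measurable_compose[OF skew_pow_measurable[OF inv] lm])
  have Gd_sets: "Gd C \<in> sets \<nu>" for C unfolding Gd_def using om by measurable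
  \<comment> \<open>On the exceptional set the Birkhoff sums are compared by the trivial bound
    \<open>2 * n * B\<close>, so this measure costs n times \<epsilon>/4.\<close>
  define \<delta> where "\<delta> = \<epsilon> / (8 * B)"
  have \<delta>: "\<delta> > 0" using \<open>\<epsilon> > 0\<close> B by (simp add: \<delta>_def)
  have "(\<lambda>C. measure \<nu> (Gd C)) \<longlonglongrightarrow> measure \<nu> (\<Union>C. Gd C)"
  proof (rule finite_Lim_measure_incseq)
    show "range Gd \<subseteq> sets \<nu>" using Gd_sets by auto
    show "incseq Gd" unfolding incseq_def Gd_def by (auto intro: order_trans)
  qed
  moreover have "measure \<nu> (\<Union>C. Gd C) = 1"
  proof (rule prob_eq_1[THEN iffD2])
    show "(\<Union>C. Gd C) \<in> events" using Gd_sets by blast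
    show "AE z in \<nu>. z \<in> (\<Union>C. Gd C)" using AEb by (rule AE_mp) (auto simp: Gd_def intro!: AE_I2)
  qed
  ultimately have "(\<lambda>C. measure \<nu> (Gd C)) \<longlonglongrightarrow> 1" by simp
  from order_tendstoD(1)[OF this, of "1 - \<delta>"] \<delta>
  obtain C where C: "1 - \<delta> < measure \<nu> (Gd C)" unfolding eventually_sequentially by auto
  have bad: "measure \<nu> (space \<nu> - Gd C) \<le> \<delta>" using C by (simp add: prob_compl[OF Gd_sets])
  have bound: "word_entropy \<nu> n \<le> (real K + real n) * ln N + (4 * real n * e + ln (1 / r + 2)) - real n * integral\<^sup>L \<nu> \<beta> + real n * e + 2 * real n * B * \<delta>"
    if n: "real C \<le> real n * e" for n
  proof -
    let ?W = "\<lambda>z :: (int \<Rightarrow> 'n) \<times> circle. word (- int K) (K + n) (fst z)"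
    \<comment> \<open>Fine enough for the shadowing distance
      \<open>r * exp (- 4 * real n * e)\<close>, with a logarithm that grows at the rate
      \<open>4 * e\<close>; the summand 1 keeps R positive.\<close>
    define R where "R = nat \<lceil>exp (4 * real n * e) / r\<rceil> + 1"
    have Rpos: "R > 0" by (simp add: R_def)
    have R1: "1 / real R \<le> r * exp (- 4 * real n * e)"
    proof -
      have "exp (4 * real n * e) / r \<le> real R" unfolding R_def by linarith
      then have "1 \<le> r * exp (- 4 * real n * e) * real R" using r(1) by (simp add: field_simps exp_minus)
      then show ?thesis using Rpos by (simp add: divide_le_eq)
    qed
    have R2: "ln (real R) \<le> 4 * real n * e + ln (1 / r + 2)"
    proof -
      have pos: "exp (4 * real n * e) / r \<ge> 0" using r(1) by simp
      have "real R \<le> exp (4 * real n * e) / r + 2" unfolding R_def using pos by linarith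
      also have "\<dots> \<le> exp (4 * real n * e) * (1 / r + 2)" using e by (simp add: algebra_simps)
      finally have "ln (real R) \<le> ln (exp (4 * real n * e) * (1 / r + 2))" using Rpos by simp
      also have "\<dots> = 4 * real n * e + ln (1 / r + 2)"
      proof -
        have "1 / r + 2 > 0" using r(1) by (simp add: add_pos_pos)
        then show ?thesis by (subst ln_mult) auto
      qed
      finally show ?thesis .
    qed
    \<comment> \<open>Completes the K letters of the past to a sequence with default values
      elsewhere; \<beta> does not see those.\<close>
    define ext where "ext v = (\<lambda>i. if - int K \<le> i \<and> i < 0 then v ! nat (i + int K) else undefined)" for v :: "'n list"
    define y where "y l = circle_of (real l / real R)" for l :: nat
    define q where "q u = (\<Sum>l<R. exp (word_sum \<beta> (drop K u) (ext (take K u), y l))) / real R / N ^ (K + n)" for u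
    have sW: "simple_function \<nu> ?W" by (rule simple_function_word[OF nf(2)])
    have qpos: "q u > 0" for u unfolding q_def using Rpos N
      by (intro divide_pos_pos sum_pos) auto
    have "(\<Sum>u\<in>?W ` space \<nu>. q u) \<le> (\<Sum>u | length u = K + n. q u)"
      by (rule sum_mono2) (auto intro: less_imp_le[OF qpos])
    also have "\<dots> = wavg (K + n) (\<lambda>u. (\<Sum>l<R. exp (word_sum \<beta> (drop K u) (ext (take K u), y l))) / real R)"
      by (simp add: wavg_def q_def N_def sum_divide_distrib)
    also have "\<dots> = wavg K (\<lambda>v. wavg n (\<lambda>w. (\<Sum>l<R. exp (word_sum \<beta> w (ext v, y l))) / real R))"
      unfolding wavg_append by (intro wavg_cong) simp
    also have "\<dots> \<le> 1"
    proof (rule wavg_le_const)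
      fix v :: "'n list"
      have "wavg n (\<lambda>w. (\<Sum>l<R. exp (word_sum \<beta> w (ext v, y l))) / real R) = (\<Sum>l<R. wavg n (\<lambda>w. exp (word_sum \<beta> w (ext v, y l)))) / real R"
        by (simp add: wavg_divide wavg_sum)
      also have "\<dots> \<le> (\<Sum>l<R. 1) / real R"
        by (intro divide_right_mono sum_mono word_sum_exp avg) simp
      finally show "wavg n (\<lambda>w. (\<Sum>l<R. exp (word_sum \<beta> w (ext v, y l))) / real R) \<le> 1" using Rpos by simp
    qed
    finally have q1: "(\<Sum>u\<in>?W ` space \<nu>. q u) \<le> 1" .
    have "word_entropy \<nu> n \<le> fun_entropy \<nu> ?W"
      unfolding word_entropy_def
    proof (rule fun_entropy_data_processing[OF sW simple_function_word[OF nf(2)]])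
      fix z z' :: "(int \<Rightarrow> 'n) \<times> circle" assume "?W z = ?W z'"
      then show "word 0 n (fst z) = word 0 n (fst z')" unfolding word_append by simp
    qed
    also have "\<dots> \<le> (\<integral>z. - ln (q (?W z)) \<partial>\<nu>)"
      by (rule Gibbs[OF sW less_imp_le[OF qpos] q1]) (use qpos in \<open>simp add: less_imp_neq[THEN not_sym]\<close>)
    also have "\<dots> \<le> (\<integral>z. ((real K + real n) * ln N + ln (real R) + real n * e) - orbit_sum \<beta> n z + 2 * real n * B * indicator (space \<nu> - Gd C) z \<partial>\<nu>)"
    proof (rule integral_mono)
      show "integrable \<nu> (\<lambda>z. - ln (q (?W z)))" by (rule integral_simple_fun(2)[OF sW])
      have "integrable \<nu> (orbit_sum \<beta> n)"
        unfolding orbit_sum_def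
        by (intro Bochner_Integration.integrable_sum local_fun_integrable[OF local_fun_skew_iterate[OF \<beta> cont] nf(2,1)]) simp
      moreover have "integrable \<nu> (indicator (space \<nu> - Gd C) :: _ \<Rightarrow> real)"
        using Gd_sets by (intro integrable_real_indicator) (auto simp: emeasure_eq_measure)
      ultimately show "integrable \<nu> (\<lambda>z. ((real K + real n) * ln N + ln (real R) + real n * e) - orbit_sum \<beta> n z + 2 * real n * B * indicator (space \<nu> - Gd C) z)"
        by auto
      fix z assume "z \<in> space \<nu>"
      obtain \<xi> x where z: "z = (\<xi>, x)" by fastforce
      define l where "l = arc_index R x"
      have lR: "l < R" unfolding l_def by (rule arc_index_less[OF Rpos])
      \<comment> \<open>Only the grid point in the arc of x is kept from the sum, and the artificial
        past may be replaced by the true one.\<close>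
      have low: "exp (orbit_sum \<beta> n (\<xi>, y l)) / real R / N ^ (K + n) \<le> q (?W z)"
      proof -
        have t: "take K (?W z) = word (- int K) K \<xi>" "drop K (?W z) = word 0 n \<xi>"
          unfolding word_append by (simp_all add: z)
        have "word_sum \<beta> (word 0 n \<xi>) (ext (word (- int K) K \<xi>), y l) = word_sum \<beta> (word 0 n \<xi>) (\<xi>, y l)"
        proof (rule word_sum_cong[OF \<beta>])
          fix i assume i: "a \<le> i" "i < 0"
          then have "- int K \<le> i" "nat (i + int K) < K" by (auto simp: K_def)
          then show "fst (ext (word (- int K) K \<xi>), y l) i = fst (\<xi>, y l) i" using i by (simp add: ext_def word_def)
        qed simp
        also have "\<dots> = orbit_sum \<beta> n (\<xi>, y l)" using word_sum_orbit[of \<beta> n "(\<xi>, y l)"] by simp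
        finally have eq: "word_sum \<beta> (drop K (?W z)) (ext (take K (?W z)), y l) = orbit_sum \<beta> n (\<xi>, y l)"
          unfolding t .
        have "exp (word_sum \<beta> (drop K (?W z)) (ext (take K (?W z)), y l)) \<le> (\<Sum>l<R. exp (word_sum \<beta> (drop K (?W z)) (ext (take K (?W z)), y l)))"
          using member_le_sum[of l "{..<R}" "\<lambda>l. exp (word_sum \<beta> (drop K (?W z)) (ext (take K (?W z)), y l))"] lR by simp
        then show ?thesis unfolding q_def eq[symmetric] using N by (intro divide_right_mono) auto
      qed
      have "- ln (q (?W z)) \<le> - ln (exp (orbit_sum \<beta> n (\<xi>, y l)) / real R / N ^ (K + n))"
        using low Rpos N by (intro le_imp_neg_le ln_mono) auto
      also have "\<dots> = (real K + real n) * ln N + ln (real R) - orbit_sum \<beta> n (\<xi>, y l)"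
        using Rpos N by (simp add: algebra_simps ln_div ln_mult ln_realpow)
      finally have 1: "- ln (q (?W z)) \<le> (real K + real n) * ln N + ln (real R) - orbit_sum \<beta> n (\<xi>, y l)" .
      have 2: "orbit_sum \<beta> n z - orbit_sum \<beta> n (\<xi>, y l) \<le> real n * e + 2 * real n * B * indicator (space \<nu> - Gd C) z"
      proof (cases "z \<in> Gd C")
        case True
        have S: "\<forall>j\<le>n. orbit_sum logder j (\<xi>, x) \<le> 2 * real n * e"
        proof (intro allI impI)
          fix j assume "j \<le> n"
          then have "real j * e \<le> real n * e" using e by (intro mult_right_mono) auto
          moreover have "orbit_sum logder j (\<xi>, x) - real j * e \<le> real C" using True by (auto simp: Gd_def z)
          ultimately show "orbit_sum logder j (\<xi>, x) \<le> 2 * real n * e" using n by linarith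
        qed
        have "arc_index R (y l) = l"
        proof -
          have "real l / real R < 1" using lR Rpos by simp
          then have "circle_pos (y l) = real l / real R" unfolding y_def by (intro circle_pos_circle_of) auto
          then show ?thesis using Rpos by (simp add: arc_index_def)
        qed
        then have "dist x (y l) \<le> 1 / real R" by (intro arc_index_eq_dist[OF Rpos]) (simp add: l_def)
        then have xy: "dist x (y l) \<le> r * exp (- 4 * real n * e)" using R1 by linarith
        have "orbit_sum \<beta> n z - orbit_sum \<beta> n (\<xi>, y l) = (\<Sum>j<n. \<beta> ((skew f ^^ j) (\<xi>, x)) - \<beta> ((skew f ^^ j) (\<xi>, y l)))"
          by (simp add: orbit_sum_def sum_subtractf z)
        also have "\<dots> \<le> (\<Sum>j<n. e)"
        proof (rule sum_mono)
          fix j assume "j \<in> {..<n}"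
          then have dd: "dist (snd ((skew f ^^ j) (\<xi>, x))) (snd ((skew f ^^ j) (\<xi>, y l))) < d"
            by (intro r(2)[OF S xy]) simp
          have ff: "fst ((skew f ^^ j) (\<xi>, y l)) = fst ((skew f ^^ j) (\<xi>, x))"
            by (rule ext) (simp add: fst_skew_iterate)
          have "\<bar>\<beta> (fst ((skew f ^^ j) (\<xi>, x)), snd ((skew f ^^ j) (\<xi>, x))) - \<beta> (fst ((skew f ^^ j) (\<xi>, x)), snd ((skew f ^^ j) (\<xi>, y l)))\<bar> < e"
            by (rule d(2)[OF dd])
          then show "\<beta> ((skew f ^^ j) (\<xi>, x)) - \<beta> ((skew f ^^ j) (\<xi>, y l)) \<le> e"
            by (simp add: ff[symmetric]) (simp add: ff)
        qed
        also have "\<dots> = real n * e" by simp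
        finally show ?thesis using True by simp
      next
        case False
        have ab: "\<bar>orbit_sum \<beta> n z'\<bar> \<le> real n * B" for z'
          unfolding orbit_sum_def
          by (rule order_trans[OF sum_abs])
            (use sum_bounded_above[of "{..<n}" "\<lambda>j. \<bar>\<beta> ((skew f ^^ j) z')\<bar>" B] B(2) in simp)
        have "0 \<le> real n * e" using e by simp
        then show ?thesis using ab[of z] ab[of "(\<xi>, y l)"] False \<open>z \<in> space \<nu>\<close> by (simp add: indicator_def abs_le_iff)
      qed
      show "- ln (q (?W z)) \<le> ((real K + real n) * ln N + ln (real R) + real n * e) - orbit_sum \<beta> n z + 2 * real n * B * indicator (space \<nu> - Gd C) z"
        using 1 2 by linarith
    qed
    also have "\<dots> = (real K + real n) * ln N + ln (real R) + real n * e - real n * integral\<^sup>L \<nu> \<beta> + 2 * real n * B * measure \<nu> (space \<nu> - Gd C)"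
    proof -
      have bj: "integrable \<nu> (\<lambda>z. \<beta> ((skew f ^^ j) z))" for j
        by (rule local_fun_integrable[OF local_fun_skew_iterate[OF \<beta> cont] nf(2,1)]) simp
      have i1: "integrable \<nu> (orbit_sum \<beta> n)" unfolding orbit_sum_def by (intro Bochner_Integration.integrable_sum bj)
      have I1: "integral\<^sup>L \<nu> (orbit_sum \<beta> n) = real n * integral\<^sup>L \<nu> \<beta>"
        unfolding orbit_sum_def
        by (simp add: Bochner_Integration.integral_sum bj invariant_integral_iterate[OF inv local_fun_measurable[OF \<beta> refl]])
      have i2: "integrable \<nu> (indicator (space \<nu> - Gd C) :: _ \<Rightarrow> real)"
        using Gd_sets by (intro integrable_real_indicator) (auto simp: emeasure_eq_measure)
      have I2: "integral\<^sup>L \<nu> (indicator (space \<nu> - Gd C) :: _ \<Rightarrow> real) = measure \<nu> (space \<nu> - Gd C)"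
        using Gd_sets by simp
      have "(space \<nu> - Gd C) \<inter> space \<nu> = space \<nu> - Gd C" by auto
      then show ?thesis using i1 i2 by (simp add: I1 I2 prob_space)
    qed
    also have "\<dots> \<le> (real K + real n) * ln N + (4 * real n * e + ln (1 / r + 2)) + real n * e - real n * integral\<^sup>L \<nu> \<beta> + 2 * real n * B * \<delta>"
      using R2 bad B(1) by (intro add_mono diff_mono mult_left_mono) auto
    finally show ?thesis by simp
  qed
  \<comment> \<open>The part of the bound that does not grow with n; \<open>n1\<close> makes it at
    most n times \<epsilon>/4, while \<open>n2\<close> ensures that the constant C is at most
    \<open>n * e\<close>.\<close>
  define c where "c = real K * ln N + ln (1 / r + 2)"
  obtain n1 :: nat where n1: "4 * \<bar>c\<bar> / \<epsilon> \<le> real n1" using real_arch_simple by blast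
  obtain n2 :: nat where n2: "real C / e \<le> real n2" using real_arch_simple by blast
  have "word_entropy \<nu> n \<le> real n * (ln N - integral\<^sup>L \<nu> \<beta> + \<epsilon>)" if "n \<ge> max n1 n2" for n
  proof -
    have "real C / e \<le> real n" using n2 that by simp
    then have "real C \<le> real n * e" using e by (simp add: divide_le_eq)
    note bd = bound[OF this]
    have "4 * \<bar>c\<bar> / \<epsilon> \<le> real n" using n1 that by simp
    then have "4 * \<bar>c\<bar> \<le> real n * \<epsilon>" using \<open>\<epsilon> > 0\<close> by (simp add: divide_le_eq)
    then have "c \<le> real n * \<epsilon> / 4" by linarith
    moreover have "2 * real n * B * \<delta> = real n * \<epsilon> / 4" using B(1) by (simp add: \<delta>_def)
    moreover have "4 * real n * e + real n * e = real n * \<epsilon> / 4" by (simp add: e_def)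
    ultimately have "word_entropy \<nu> n \<le> real n * ln N - real n * integral\<^sup>L \<nu> \<beta> + 3 * (real n * \<epsilon> / 4)"
      using bd unfolding c_def distrib_right by linarith
    also have "\<dots> \<le> real n * (ln N - integral\<^sup>L \<nu> \<beta> + \<epsilon>)" using \<open>\<epsilon> > 0\<close> by (simp add: algebra_simps)
    finally show ?thesis .
  qed
  then show ?thesis unfolding N_def by blast
qed

end

subsection \<open>Entropy bounds\<close>

text \<open>For a negative argument -y, multiply by \<open>exp y\<close>: the product of 1 + y and 1
  - y + y^2 is 1 + y^3, hence at least 1, and \<open>exp y\<close> is at least 1 + y.\<close>

lemma exp_le_quadratic: "\<bar>x\<bar> \<le> 1 \<Longrightarrow> exp x \<le> 1 + x + x\<^sup>2" for x :: real
proof (cases "x \<ge> 0")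
  case False
  assume "\<bar>x\<bar> \<le> 1"
  define y where "y = - x"
  have y: "y > 0" using False by (simp add: y_def)
  have "1 \<le> (1 + y) * (1 - y + y\<^sup>2)"
  proof -
    have "(1 + y) * (1 - y + y\<^sup>2) = 1 + y ^ 3" by (simp add: algebra_simps power2_eq_square power3_eq_cube)
    then show ?thesis using y by simp
  qed
  also have "\<dots> \<le> exp y * (1 - y + y\<^sup>2)"
  proof (rule mult_right_mono)
    have "0 < (1 + y) * (1 - y + y\<^sup>2)" using calculation by linarith
    then show "0 \<le> 1 - y + y\<^sup>2" using y by (simp add: zero_less_mult_iff)
  qed simp
  finally have "exp (- y) \<le> 1 - y + y\<^sup>2" by (simp add: exp_minus field_simps)
  then show ?thesis by (simp add: y_def)
qed (simp add: exp_bound)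

text \<open>A bound on the growth rate of word entropies without reference to a limit. It depends on
  these numbers only and therefore passes unchanged through time reversal.\<close>

definition word_entropy_rate_le :: "((int \<Rightarrow> 'n) \<times> circle) measure \<Rightarrow> real \<Rightarrow> bool" where
  "word_entropy_rate_le \<nu> L \<longleftrightarrow> (\<forall>e>0. \<exists>n0. \<forall>n\<ge>n0. word_entropy \<nu> n \<le> real n * (L + e))"

lemma (in random_circle) metric_entropy_le_rate:
  "invariant_prob (skew f) \<nu> \<Longrightarrow> word_entropy_rate_le \<nu> L \<Longrightarrow> metric_entropy (skew f) \<nu> \<le> ereal L"
  by (rule metric_entropy_le) (auto simp: word_entropy_rate_le_def)

lemma (in random_circle) metric_entropy_le_log_card:
  assumes inv: "invariant_prob (skew f) \<nu>"
  shows "metric_entropy (skew f) \<nu> \<le> ereal (ln (real CARD('n)))"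
proof (rule metric_entropy_le[OF inv])
  fix e :: real assume "e > 0"
  interpret prob_space \<nu> by (rule invariant_prob_facts[OF inv])
  have "word_entropy \<nu> n \<le> real n * (ln (real CARD('n)) + e)" for n
  proof -
    have "word_entropy \<nu> n \<le> ln (real (card {w :: 'n list. length w = n}))"
      unfolding word_entropy_def by (rule fun_entropy_le_card[OF simple_function_word[OF invariant_prob_facts(2)[OF inv]]]) auto
    also have "\<dots> = real n * ln (real CARD('n))" by (simp add: card_words ln_realpow)
    finally show ?thesis using \<open>e > 0\<close> by (simp add: algebra_simps add_increasing)
  qed
  then show "\<exists>n0. \<forall>n\<ge>n0. word_entropy \<nu> n \<le> real n * (ln (real CARD('n)) + e)" by blast
qed

text \<open>The itinerary for the partition by the letter at position 0 carries the same information
  as the word, and uniform words have maximal entropy at every length. The statement applies to both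
  extremal measures and to their convex combinations.\<close>

lemma metric_entropy_ge_log_card:
  fixes f :: "'n::{finite,discrete_topology} \<Rightarrow> circle \<Rightarrow> circle"
  assumes \<nu>: "prob_space \<nu>" "sets \<nu> = sets borel" and T: "skew f \<in> measurable \<nu> \<nu>"
    and unif: "\<And>n w. length w = n \<Longrightarrow> measure \<nu> {z. word 0 n (fst z) = w} = 1 / real CARD('n) ^ n"
  shows "ereal (ln (real CARD('n))) \<le> metric_entropy (skew f) \<nu>"
proof -
  interpret prob_space \<nu> by fact
  have sp: "space \<nu> = UNIV" using sets_eq_imp_space_eq[OF \<nu>(2)] by simp
  have fst_it: "fst ((skew f ^^ n) z) i = fst z (i + int n)" for n z i
  proof (induction n arbitrary: i)
    case (Suc n)
    have "fst ((skew f ^^ Suc n) z) i = fst ((skew f ^^ n) z) (i + 1)"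
      by (simp add: skew_def case_prod_unfold)
    then show ?case by (simp add: Suc algebra_simps)
  qed simp
  define A where "A a = {z :: (int \<Rightarrow> 'n) \<times> circle. fst z 0 = a}" for a
  define P where "P = range A"
  have part: "partition_on UNIV P"
    unfolding partition_on_def
  proof (intro conjI)
    show "\<Union>P = UNIV" by (auto simp: P_def A_def)
    show "disjoint P" by (auto simp: P_def A_def disjoint_def)
    have "((\<lambda>_. a), 0) \<in> A a" for a by (simp add: A_def)
    then show "{} \<notin> P" by (auto simp: P_def)
  qed
  have A_open: "open (A a)" for a
  proof -
    have "A a = {\<xi>. \<xi> 0 = a} \<times> UNIV" by (auto simp: A_def)
    then show ?thesis by (simp add: open_Times open_coordinate)
  qed
  have As: "A a \<in> sets \<nu>" for a using A_open by (simp add: \<nu>(2))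
  have label: "cell_of P z = A (fst z 0)" for z
    by (rule cell_of(3)[OF part]) (auto simp: P_def A_def)
  have label_eq: "cell_of P z = cell_of P z' \<longleftrightarrow> fst z 0 = fst z' 0" for z z'
    unfolding label by (auto simp: A_def set_eq_iff)
  have sl: "simple_function \<nu> (cell_of P)"
    unfolding simple_function_def
  proof (intro conjI ballI)
    have "range (cell_of P) \<subseteq> range A" by (auto simp: label)
    then show "finite (cell_of P ` space \<nu>)" unfolding sp by (rule finite_subset) simp
    fix p assume "p \<in> cell_of P ` space \<nu>"
    then obtain z where "p = cell_of P z" by auto
    then have "y \<in> cell_of P -` {p} \<longleftrightarrow> y \<in> A (fst z 0)" for y
      using label_eq[of y z] by (simp add: A_def)
    then have "cell_of P -` {p} \<inter> space \<nu> = A (fst z 0)" unfolding sp by blast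
    then show "cell_of P -` {p} \<inter> space \<nu> \<in> sets \<nu>" using As by simp
  qed
  have Pf: "P \<in> finite_partitions \<nu>"
    unfolding finite_partitions_def using part As by (auto simp: P_def sp)
  have H: "partition_entropy \<nu> (iterated_partition (skew f) \<nu> P n) = real n * ln (real CARD('n))" for n
  proof -
    have sw: "simple_function \<nu> (\<lambda>z. word 0 n (fst z))" by (rule simple_function_word[OF \<nu>(2)])
    have si: "simple_function \<nu> (itinerary (skew f) (cell_of P) n)"
      by (rule simple_function_itinerary[OF T sl])
    have det: "itinerary (skew f) (cell_of P) n z = itinerary (skew f) (cell_of P) n z' \<longleftrightarrow> word 0 n (fst z) = word 0 n (fst z')" for z z'
      unfolding itinerary_eq_iff label_eq fst_it by (auto simp: word_def)
    have "fun_entropy \<nu> (itinerary (skew f) (cell_of P) n) = fun_entropy \<nu> (\<lambda>z. word 0 n (fst z))"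
      using fun_entropy_data_processing[OF sw si] fun_entropy_data_processing[OF si sw] det by (intro antisym) auto
    also have "\<dots> = (\<integral>z. - ln (fiber_prob \<nu> (\<lambda>z. word 0 n (fst z)) (word 0 n (fst z))) \<partial>\<nu>)"
      by (rule fun_entropy_integral[OF sw])
    also have "\<dots> = (\<integral>z. real n * ln (real CARD('n)) \<partial>\<nu>)"
    proof (rule Bochner_Integration.integral_cong[OF refl])
      fix z :: "(int \<Rightarrow> 'n) \<times> circle"
      have "fiber_prob \<nu> (\<lambda>z. word 0 n (fst z)) (word 0 n (fst z)) = 1 / real CARD('n) ^ n"
        unfolding fiber_prob_def sp using unif[of "word 0 n (fst z)" n] by (simp add: vimage_def)
      then show "- ln (fiber_prob \<nu> (\<lambda>z. word 0 n (fst z)) (word 0 n (fst z))) = real n * ln (real CARD('n))"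
        by (simp add: ln_div ln_realpow)
    qed
    finally have "fun_entropy \<nu> (itinerary (skew f) (cell_of P) n) = real n * ln (real CARD('n))"
      by (simp add: prob_space)
    then show ?thesis using partition_entropy_iterated[OF part sp, of "skew f" n] by simp
  qed
  have "(\<lambda>n. partition_entropy \<nu> (iterated_partition (skew f) \<nu> P n) / real n) \<longlonglongrightarrow> ln (real CARD('n))"
    by (rule tendsto_eventually, rule eventually_sequentiallyI[of 1]) (simp add: H)
  then have "entropy_wrt_partition (skew f) \<nu> P = ln (real CARD('n))"
    unfolding entropy_wrt_partition_def by (rule limI)
  then show ?thesis unfolding metric_entropy_def using SUP_upper[OF Pf, of "\<lambda>P. ereal (entropy_wrt_partition (skew f) \<nu> P)"] by simp
qed

section \<open>The entropy gap and uniqueness on one side\<close>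

context random_diffeo
begin

lemma local_fun_step:
  assumes "local_fun a 0 \<phi>" shows "local_fun a 0 (\<lambda>z. \<phi> (step i z))"
proof -
  have "local_fun a 0 (\<lambda>(\<xi>, x). \<phi> ((\<lambda>\<xi> j. if j = - 1 then i else \<xi> (j + 1)) \<xi>, f ((\<lambda>_. i) \<xi>) x))"
    by (rule local_fun_compose[OF assms cont]) auto
  then show ?thesis by (simp add: step_def case_prod_unfold)
qed

lemma markov_1: "markov (Suc 0) \<phi> z = (\<Sum>i\<in>UNIV. \<phi> (step i z)) / real CARD('n)"
  by (simp add: markov_def wavg_1)

lemma local_fun_markov:
  assumes "local_fun a 0 \<phi>" shows "local_fun a 0 (markov j \<phi>)"
proof (induction j)
  case 0
  then show ?case using assms by (simp add: markov_def[abs_def])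
next
  case (Suc j)
  have "local_fun a 0 (\<lambda>z. (1 / real CARD('n)) * (\<Sum>i\<in>UNIV. markov j \<phi> (step i z)))"
    by (intro local_fun_mult local_fun_const local_fun_sum local_fun_step Suc)
  then show ?case using markov_append[of "Suc 0" j \<phi>] by (simp add: markov_1[of "markov j \<phi>"] fun_eq_iff[symmetric] markov_append[of "Suc 0" j \<phi>, simplified, abs_def])
qed

text \<open>
  Subtracting a coboundary turns \<open>\<phi>\<close> into a function whose conditional mean given the past is
  uniformly negative, so that its small multiples have exponential moments at most \<open>1\<close>.
\<close>

lemma entropy_gap:
  assumes \<phi>: "local_fun a 0 \<phi>" and D: "D > 0"
  shows "\<exists>\<kappa>>0. \<forall>\<nu>. ergodic_prob (skew f) \<nu> \<longrightarrow> lyapunov f \<nu> \<le> 0 \<longrightarrow> integral\<^sup>L mu \<phi> + D \<le> integral\<^sup>L \<nu> \<phi> \<longrightarrow>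
     word_entropy_rate_le \<nu> (ln (real CARD('n)) - \<kappa>)"
proof -
  define N where "N = real CARD('n)"
  have N: "N > 0" by (simp add: N_def)
  define c where "c = integral\<^sup>L mu \<phi>"
  obtain m where m: "\<And>z. \<bar>markov m \<phi> z - c\<bar> \<le> D / 4"
    using markov_converges[OF \<phi>, of "D / 4"] D unfolding c_def by auto
  \<comment> \<open>A truncated solution of the Poisson equation: applying the one-step operator to
    g and subtracting g leaves \<open>markov m \<phi> - \<phi>\<close>, by telescoping.\<close>
  define g where "g z = (\<Sum>j<m. markov j \<phi> z)" for z
  have g: "local_fun a 0 g" unfolding g_def[abs_def] by (intro local_fun_sum local_fun_markov \<phi>)
  \<comment> \<open>The level \<open>c + D / 2\<close> lies halfway between the mean c under
    \<open>mu\<close> and the lower bound for \<nu>. The conditional mean given the past is then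
    \<open>markov m \<phi> - c - D / 2\<close>, at most -D/4, while the mean under \<nu> is at least
    D/2, as the coboundary integrates to 0.\<close>
  define \<beta>0 where "\<beta>0 z = (\<phi> z - (c + D / 2)) + (g (skew f z) - g z)" for z
  define a' where "a' = min a 0"
  have gF: "local_fun a' 1 (\<lambda>z. g (skew f z))"
    by (rule local_fun_skew[OF g cont]) (auto simp: a'_def)
  have mono: "local_fun a' 1 h" if "local_fun a 0 h" for h
    by (rule local_fun_mono[OF that]) (auto simp: a'_def)
  have \<beta>0: "local_fun a' 1 \<beta>0"
    unfolding \<beta>0_def[abs_def] by (intro local_fun_add local_fun_diff local_fun_const gF mono \<phi> g)
  obtain B where B: "B > 0" "\<And>z. \<bar>\<beta>0 z\<bar> \<le> B" using local_fun_bound[OF \<beta>0] by blast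
  have avg0: "(\<Sum>i\<in>UNIV. \<beta>0 (\<xi>(0 := i), x)) / N \<le> - D / 4" for \<xi> x
  proof -
    have p: "h (\<xi>(0 := i), x) = h (\<xi>, x)" if "local_fun a 0 h" for h i
      by (rule local_fun_cong[OF that]) auto
    have s: "g (skew f (\<xi>(0 := i), x)) = g (step i (\<xi>, x))" for i
    proof -
      have "skew f (\<xi>(0 := i), x) = step i (\<xi>(0 := i), x)" by (simp add: skew_eq_step)
      also have "g \<dots> = g (step i (\<xi>, x))"
        unfolding step_def snd_conv by (rule local_fun_cong[OF g]) auto
      finally show ?thesis .
    qed
    have "(\<Sum>i\<in>UNIV. \<beta>0 (\<xi>(0 := i), x)) = (\<Sum>i\<in>(UNIV :: 'n set). (\<phi> (\<xi>, x) - (c + D / 2) - g (\<xi>, x)) + g (step i (\<xi>, x)))"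
      unfolding \<beta>0_def s p[OF \<phi>] p[OF g] by (intro sum.cong refl) simp
    also have "\<dots> = N * (\<phi> (\<xi>, x) - (c + D / 2) - g (\<xi>, x)) + N * markov (Suc 0) g (\<xi>, x)"
      by (simp add: sum.distrib N_def markov_1)
    finally have "(\<Sum>i\<in>UNIV. \<beta>0 (\<xi>(0 := i), x)) / N = \<phi> (\<xi>, x) - (c + D / 2) - g (\<xi>, x) + markov (Suc 0) g (\<xi>, x)"
      using N by (simp add: field_simps)
    also have "markov (Suc 0) g (\<xi>, x) = (\<Sum>j<m. markov (Suc j) \<phi> (\<xi>, x))"
    proof -
      have "markov (Suc j) \<phi> (\<xi>, x) = markov (Suc 0) (markov j \<phi>) (\<xi>, x)" for j using markov_append[of "Suc 0" j \<phi> "(\<xi>, x)"] by simp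
      then show ?thesis unfolding markov_1 g_def by (subst sum.swap) (simp add: sum_divide_distrib markov_1)
    qed
    also have "\<dots> = g (\<xi>, x) - \<phi> (\<xi>, x) + markov m \<phi> (\<xi>, x)"
      using sum_lessThan_telescope[of "\<lambda>j. markov j \<phi> (\<xi>, x)" m] by (simp add: g_def sum_subtractf markov_def[of 0])
    finally show ?thesis using m[of "(\<xi>, x)"] by linarith
  qed
  \<comment> \<open>The first bound on s makes the quadratic estimate for \<open>exp\<close>
    applicable; the second lets the negative conditional mean absorb the second-order term.\<close>
  define s where "s = min (1 / B) (D / (4 * B\<^sup>2))"
  have s: "s > 0" "s * B \<le> 1" "s * B\<^sup>2 \<le> D / 4"
  proof -
    show "s > 0" using B(1) D by (simp add: s_def)
    have "s * B \<le> 1 / B * B" using B(1) by (intro mult_right_mono) (auto simp: s_def)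
    then show "s * B \<le> 1" using B(1) by simp
    have "s * B\<^sup>2 \<le> D / (4 * B\<^sup>2) * B\<^sup>2" by (intro mult_right_mono) (auto simp: s_def)
    then show "s * B\<^sup>2 \<le> D / 4" using B(1) by simp
  qed
  define \<beta> where "\<beta> z = s * \<beta>0 z" for z
  have \<beta>: "local_fun a' 1 \<beta>" unfolding \<beta>_def[abs_def] by (intro local_fun_mult local_fun_const \<beta>0)
  have avg: "(\<Sum>i\<in>UNIV. exp (\<beta> (\<xi>(0 := i), x))) / N \<le> 1" for \<xi> x
  proof -
    have "(\<Sum>i\<in>UNIV. exp (\<beta> (\<xi>(0 := i), x))) \<le> (\<Sum>i\<in>UNIV. (1 + s\<^sup>2 * B\<^sup>2) + s * \<beta>0 (\<xi>(0 := i), x))"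
    proof (rule sum_mono)
      fix i
      let ?b = "\<beta>0 (\<xi>(0 := i), x)"
      have sb: "\<bar>s * ?b\<bar> \<le> s * B" using B(2) s(1) by (simp add: abs_mult)
      then have "exp (s * ?b) \<le> 1 + s * ?b + (s * ?b)\<^sup>2" using s(2) by (intro exp_le_quadratic) linarith
      moreover have "(s * ?b)\<^sup>2 \<le> (s * B)\<^sup>2" using sb by (metis abs_ge_zero power2_abs power_mono)
      ultimately show "exp (\<beta> (\<xi>(0 := i), x)) \<le> (1 + s\<^sup>2 * B\<^sup>2) + s * ?b"
        by (simp add: \<beta>_def power_mult_distrib)
    qed
    also have "\<dots> = N * (1 + s\<^sup>2 * B\<^sup>2) + s * (\<Sum>i\<in>UNIV. \<beta>0 (\<xi>(0 := i), x))"
      by (simp add: sum.distrib N_def sum_distrib_left)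
    also have "\<dots> \<le> N * (1 + s\<^sup>2 * B\<^sup>2) + s * (N * (- D / 4))"
      using avg0[of \<xi> x] s(1) N by (intro add_left_mono mult_left_mono) (auto simp: divide_le_eq mult.commute)
    also have "\<dots> = N * (1 + s * (s * B\<^sup>2 - D / 4))" by (simp add: algebra_simps power2_eq_square)
    also have "\<dots> \<le> N * (1 + s * 0)" using s N by (intro mult_left_mono add_left_mono) auto
    finally show ?thesis using N by (simp add: divide_le_eq)
  qed
  have "word_entropy_rate_le \<nu> (ln (real CARD('n)) - s * D / 2)"
    if erg: "ergodic_prob (skew f) \<nu>" and lyap: "lyapunov f \<nu> \<le> 0" and big: "c + D \<le> integral\<^sup>L \<nu> \<phi>" for \<nu>
  proof -
    have inv: "invariant_prob (skew f) \<nu>" using erg by (simp add: ergodic_prob_def)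
    note nf = invariant_prob_facts[OF inv]
    interpret prob_space \<nu> by (rule nf)
    have i: "integrable \<nu> \<phi>" "integrable \<nu> g" "integrable \<nu> (\<lambda>z. g (skew f z))"
      using local_fun_integrable[OF \<phi> nf(2,1)] local_fun_integrable[OF g nf(2,1)] local_fun_integrable[OF gF nf(2,1)] by auto
    have "(\<integral>z. g (skew f z) \<partial>\<nu>) = integral\<^sup>L \<nu> g"
      using invariant_integral_iterate[OF inv local_fun_measurable[OF g refl], of 1] by simp
    then have "integral\<^sup>L \<nu> \<beta>0 = integral\<^sup>L \<nu> \<phi> - (c + D / 2)"
      unfolding \<beta>0_def using i by (simp add: prob_space)
    then have "integral\<^sup>L \<nu> \<beta>0 \<ge> D / 2" using big by simp
    then have "s * (D / 2) \<le> s * integral\<^sup>L \<nu> \<beta>0" using s(1) by (intro mult_left_mono) auto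
    then have Ib: "s * D / 2 \<le> integral\<^sup>L \<nu> \<beta>" by (simp add: \<beta>_def[abs_def])
    show ?thesis
      unfolding word_entropy_rate_le_def
    proof (intro allI impI)
      fix e :: real assume "e > 0"
      obtain n0 where n0: "\<And>n. n \<ge> n0 \<Longrightarrow> word_entropy \<nu> n \<le> real n * (ln (real CARD('n)) - integral\<^sup>L \<nu> \<beta> + e)"
        using entropy_gap_finite[OF erg lyap \<beta> avg[unfolded N_def] \<open>e > 0\<close>] by blast
      have "real n * (ln (real CARD('n)) - integral\<^sup>L \<nu> \<beta> + e) \<le> real n * (ln (real CARD('n)) - s * D / 2 + e)" for n
        using Ib by (intro mult_left_mono) auto
      then show "\<exists>n0. \<forall>n\<ge>n0. word_entropy \<nu> n \<le> real n * (ln (real CARD('n)) - s * D / 2 + e)"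
        using n0 order_trans by blast
    qed
  qed
  then show ?thesis using s(1) D unfolding c_def by (intro exI[of _ "s * D / 2"]) auto
qed

lemma entropy_mu: "metric_entropy (skew f) mu = ereal (ln (real CARD('n)))"
proof (rule antisym)
  show "metric_entropy (skew f) mu \<le> ereal (ln (real CARD('n)))"
    by (rule metric_entropy_le_log_card[OF invariant_prob_mu])
  show "ereal (ln (real CARD('n))) \<le> metric_entropy (skew f) mu"
    by (rule metric_entropy_ge_log_card[OF prob_space_mu sets_mu _ measure_mu_word])
      (use invariant_prob_facts[OF invariant_prob_mu] in auto)
qed

text \<open>A larger integral of some observable of the past under \<nu> would produce an entropy
  gap. Applied to an observable and its negative, this identifies all such integrals, hence by
  invariance all integrals of local observables.\<close>

lemma eq_mu_if_max_entropy:
  assumes erg: "ergodic_prob (skew f) \<nu>" and lyap: "lyapunov f \<nu> \<le> 0"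
    and ent: "\<And>\<kappa>. \<kappa> > 0 \<Longrightarrow> \<not> word_entropy_rate_le \<nu> (ln (real CARD('n)) - \<kappa>)"
  shows "\<nu> = mu"
proof -
  have inv: "invariant_prob (skew f) \<nu>" using erg by (simp add: ergodic_prob_def)
  note nf = invariant_prob_facts[OF inv]
  have le: "integral\<^sup>L \<nu> \<phi> \<le> integral\<^sup>L mu \<phi>" if \<phi>: "local_fun a 0 \<phi>" for a \<phi>
  proof (rule ccontr)
    assume "\<not> integral\<^sup>L \<nu> \<phi> \<le> integral\<^sup>L mu \<phi>"
    then have D: "integral\<^sup>L \<nu> \<phi> - integral\<^sup>L mu \<phi> > 0" by simp
    obtain \<kappa> where \<kappa>: "\<kappa> > 0" "word_entropy_rate_le \<nu> (ln (real CARD('n)) - \<kappa>)"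
      using entropy_gap[OF \<phi> D] erg lyap by auto
    then show False using ent by blast
  qed
  have eq: "integral\<^sup>L \<nu> \<phi> = integral\<^sup>L mu \<phi>" if \<phi>: "local_fun a 0 \<phi>" for a \<phi>
  proof (rule antisym[OF le[OF \<phi>]])
    have "local_fun a 0 (\<lambda>z. 0 - \<phi> z)" by (intro local_fun_diff local_fun_const \<phi>)
    from le[OF this] show "integral\<^sup>L mu \<phi> \<le> integral\<^sup>L \<nu> \<phi>" by simp
  qed
  show ?thesis
  proof (rule measure_eq_local_fun[OF nf(1,2) prob_space_mu sets_mu])
    fix K and \<phi> :: "(int \<Rightarrow> 'n) \<times> circle \<Rightarrow> real" assume \<phi>: "local_fun (- int K) (int K) \<phi>"
    define \<psi> where "\<psi> z = \<phi> ((skew_inv f ^^ K) z)" for z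
    obtain a where \<psi>: "local_fun a 0 \<psi>"
      unfolding \<psi>_def[abs_def] using local_fun_past[where f = f, OF \<phi> cont_inv] by blast
    have e: "\<phi> z = \<psi> ((skew f ^^ K) z)" for z by (simp add: \<psi>_def skew_inv_iterate)
    have m: "\<psi> \<in> borel_measurable borel" by (rule local_fun_measurable[OF \<psi> refl])
    show "integral\<^sup>L \<nu> \<phi> = integral\<^sup>L mu \<phi>"
      unfolding e[abs_def] invariant_integral_iterate[OF inv m] invariant_integral_iterate[OF invariant_prob_mu m]
      by (rule eq[OF \<psi>])
  qed
qed

end

subsection \<open>Time reversal\<close>

text \<open>The reflection of positions that exchanges 0 and -1: the letter undone by the inverse
  skew product becomes the letter read next. It conjugates this inverse to the skew product of the
  inverse fiber maps.\<close>

definition reflect :: "(int \<Rightarrow> 'n) \<times> circle \<Rightarrow> (int \<Rightarrow> 'n) \<times> circle" where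
  "reflect z = ((\<lambda>i. fst z (- 1 - i)), snd z)"

lemma reflect_reflect [simp]: "reflect (reflect z) = z"
  by (simp add: reflect_def)

lemma surj_reflect: "surj reflect"
  by (rule surjI[of _ reflect]) simp

lemma reflect_skew_inv: "skew (\<lambda>i. inv (f i)) (reflect z) = reflect (skew_inv f z)"
  by (simp add: skew_def skew_inv_def reflect_def case_prod_unfold algebra_simps)

lemma continuous_reflect: "continuous_on UNIV (reflect :: (int \<Rightarrow> 'n::discrete_topology) \<times> circle \<Rightarrow> _)"
proof -
  have "continuous_on UNIV (\<lambda>z :: (int \<Rightarrow> 'n) \<times> circle. \<lambda>i. fst z (- 1 - i))"
  proof (rule continuous_on_coordinatewise_then_product)
    fix i
    show "continuous_on UNIV (\<lambda>z :: (int \<Rightarrow> 'n) \<times> circle. fst z (- 1 - i))"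
      by (rule continuous_on_compose2[OF continuous_on_product_coordinates continuous_on_fst[OF continuous_on_id]]) auto
  qed
  from continuous_on_Pair[OF this continuous_on_snd[OF continuous_on_id]] show ?thesis
    by (simp add: reflect_def[abs_def])
qed

lemma measurable_reflect: "(reflect :: (int \<Rightarrow> 'n::discrete_topology) \<times> circle \<Rightarrow> _) \<in> measurable borel borel"
  by (rule borel_measurable_continuous_onI[OF continuous_reflect])

definition mirror :: "((int \<Rightarrow> 'n::discrete_topology) \<times> circle) measure \<Rightarrow> ((int \<Rightarrow> 'n) \<times> circle) measure" where
  "mirror \<nu> = distr \<nu> borel reflect"

lemma sets_mirror [simp]: "sets (mirror \<nu>) = sets borel"
  by (simp add: mirror_def)

lemma measurable_reflect': "sets \<nu> = sets borel \<Longrightarrow> reflect \<in> measurable \<nu> (borel :: ((int \<Rightarrow> 'n::discrete_topology) \<times> circle) measure)"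
  using measurable_reflect measurable_cong_sets[OF _ refl] by blast

lemma mirror_mirror:
  fixes \<nu> :: "((int \<Rightarrow> 'n::discrete_topology) \<times> circle) measure"
  assumes "sets \<nu> = sets borel" shows "mirror (mirror \<nu>) = \<nu>"
proof -
  have "mirror (mirror \<nu>) = distr \<nu> borel (reflect \<circ> reflect)"
    unfolding mirror_def by (rule distr_distr[OF measurable_reflect measurable_reflect'[OF assms]])
  also have "reflect \<circ> reflect = (\<lambda>z :: (int \<Rightarrow> 'n) \<times> circle. z)" by auto
  also have "distr \<nu> borel (\<lambda>z. z) = \<nu>" using assms by (intro distr_id2) simp
  finally show ?thesis .
qed

lemma integral_mirror:
  fixes \<phi> :: "(int \<Rightarrow> 'n::discrete_topology) \<times> circle \<Rightarrow> real"
  assumes "sets \<nu> = sets borel" "\<phi> \<in> borel_measurable borel"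
  shows "integral\<^sup>L (mirror \<nu>) \<phi> = (\<integral>z. \<phi> (reflect z) \<partial>\<nu>)"
  unfolding mirror_def by (rule integral_distr[OF measurable_reflect'[OF assms(1)] assms(2)])

context random_circle
begin

lemma invariant_skew_inv:
  assumes inv: "invariant_prob (skew f) \<nu>" shows "distr \<nu> borel (skew_inv f) = \<nu>"
proof -
  note nf = invariant_prob_facts[OF inv]
  have "distr \<nu> borel (skew_inv f) = distr (distr \<nu> \<nu> (skew f)) borel (skew_inv f)" by (simp add: nf(4))
  also have "\<dots> = distr \<nu> borel (skew_inv f \<circ> skew f)"
    by (rule distr_distr[OF _ nf(3)]) (use measurable_skew_inv in \<open>simp add: measurable_cong_sets[OF nf(2) refl]\<close>)
  also have "skew_inv f \<circ> skew f = (\<lambda>z. z)" by (auto simp: skew_inverse[OF bij])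
  also have "distr \<nu> borel (\<lambda>z. z) = \<nu>" using nf(2) by (intro distr_id2) simp
  finally show ?thesis .
qed

lemma invariant_mirror:
  assumes inv: "invariant_prob (skew f) \<nu>"
  shows "invariant_prob (skew (\<lambda>i. inv (f i))) (mirror \<nu>)"
proof -
  note nf = invariant_prob_facts[OF inv]
  let ?G = "skew (\<lambda>i. inv (f i))"
  have Gm: "?G \<in> measurable borel borel"
    by (rule borel_measurable_continuous_onI[OF continuous_skew[OF cont_inv]])
  have p: "prob_space (mirror \<nu>)" unfolding mirror_def by (rule prob_space.prob_space_distr[OF nf(1) measurable_reflect'[OF nf(2)]])
  have "distr (mirror \<nu>) (mirror \<nu>) ?G = distr (mirror \<nu>) borel ?G" by (rule distr_cong) auto
  also have "\<dots> = distr \<nu> borel (?G \<circ> reflect)"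
    unfolding mirror_def by (rule distr_distr[OF Gm measurable_reflect'[OF nf(2)]])
  also have "?G \<circ> reflect = reflect \<circ> skew_inv f" by (auto simp: reflect_skew_inv)
  also have "distr \<nu> borel (reflect \<circ> skew_inv f) = distr (distr \<nu> borel (skew_inv f)) borel reflect"
    by (rule distr_distr[symmetric, OF measurable_reflect]) (use measurable_skew_inv in \<open>simp add: measurable_cong_sets[OF nf(2) refl]\<close>)
  also have "\<dots> = mirror \<nu>" by (simp add: invariant_skew_inv[OF inv] mirror_def)
  finally show ?thesis
    unfolding invariant_prob_def using p Gm by (simp add: measurable_cong_sets[OF sets_mirror sets_mirror])
qed

lemma ergodic_mirror:
  assumes erg: "ergodic_prob (skew f) \<nu>"
  shows "ergodic_prob (skew (\<lambda>i. inv (f i))) (mirror \<nu>)"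
  unfolding ergodic_prob_def
proof (intro conjI ballI impI)
  have inv: "invariant_prob (skew f) \<nu>" using erg by (simp add: ergodic_prob_def)
  note nf = invariant_prob_facts[OF inv]
  let ?G = "skew (\<lambda>i. inv (f i))"
  show "invariant_prob ?G (mirror \<nu>)" by (rule invariant_mirror[OF inv])
  fix A assume "A \<in> sets (mirror \<nu>)" and A: "?G -` A = A"
  then have As: "A \<in> sets borel" by simp
  define B where "B = reflect -` A"
  have Bs: "B \<in> sets \<nu>"
    using measurable_sets[OF measurable_reflect'[OF nf(2)] As] by (simp add: B_def nf(5))
  have "skew f z \<in> B \<longleftrightarrow> z \<in> B" for z
  proof -
    have "skew f z \<in> B \<longleftrightarrow> reflect (skew f z) \<in> ?G -` A" by (simp only: A B_def vimage_eq)
    also have "\<dots> \<longleftrightarrow> reflect (skew_inv f (skew f z)) \<in> A" by (simp add: reflect_skew_inv)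
    finally show ?thesis by (simp add: skew_inverse[OF bij] B_def)
  qed
  then have "skew f -` B = B" by (auto simp del: split_paired_All simp: set_eq_iff vimage_eq)
  then have "measure \<nu> B = 0 \<or> measure \<nu> B = 1" using erg Bs by (simp add: ergodic_prob_def)
  moreover have "measure (mirror \<nu>) A = measure \<nu> B"
    unfolding mirror_def using measure_distr[OF measurable_reflect'[OF nf(2)] As] by (simp add: B_def nf(5))
  ultimately show "measure (mirror \<nu>) A = 0 \<or> measure (mirror \<nu>) A = 1" by simp
qed

text \<open>The first n letters after reflection are the last n letters of the past read backwards.
  Reversal is injective, and the shift to positions 0 to n - 1 preserves the measure.\<close>

lemma word_entropy_mirror:
  assumes inv: "invariant_prob (skew f) \<nu>" shows "word_entropy (mirror \<nu>) n = word_entropy \<nu> n"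
proof -
  note nf = invariant_prob_facts[OF inv]
  interpret prob_space \<nu> by (rule nf)
  have w: "word 0 n (fst (reflect z)) = rev (word (- int n) n (fst z))" for z :: "(int \<Rightarrow> 'n) \<times> circle"
    by (rule nth_equalityI) (auto simp: word_def reflect_def rev_nth of_nat_diff algebra_simps)
  have "fiber_prob (mirror \<nu>) (\<lambda>z. word 0 n (fst z)) a = fiber_prob \<nu> (\<lambda>z. word 0 n (fst (reflect z))) a" for a
  proof -
    have "(\<lambda>z :: (int \<Rightarrow> 'n) \<times> circle. word 0 n (fst z)) -` {a} \<in> sets borel"
      using measurable_sets[OF measurable_word_fst[of 0 n], of "{a}"] by simp
    from measure_distr[OF measurable_reflect'[OF nf(2)] this] show ?thesis
      by (simp add: fiber_prob_def mirror_def nf(5) vimage_def)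
  qed
  moreover have "range (\<lambda>z :: (int \<Rightarrow> 'n) \<times> circle. word 0 n (fst z)) = range (\<lambda>z. word 0 n (fst (reflect z :: (int \<Rightarrow> 'n) \<times> circle)))"
  proof -
    have "range (\<lambda>z :: (int \<Rightarrow> 'n) \<times> circle. word 0 n (fst z)) = (\<lambda>z. word 0 n (fst z)) ` range (reflect :: (int \<Rightarrow> 'n) \<times> circle \<Rightarrow> _)"
      by (simp only: surj_reflect)
    then show ?thesis by (simp only: image_image)
  qed
  ultimately have "word_entropy (mirror \<nu>) n = fun_entropy \<nu> (\<lambda>z. word 0 n (fst (reflect z)))"
    by (simp add: word_entropy_def fun_entropy_def nf(5) mirror_def)
  also have "\<dots> = fun_entropy \<nu> (\<lambda>z. rev (word (- int n) n (fst z)))" by (simp only: w)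
  also have "\<dots> = fun_entropy \<nu> (\<lambda>z. word (- int n) n (fst z))"
  proof -
    have s: "simple_function \<nu> (\<lambda>z. word (- int n) n (fst z))" by (rule simple_function_word[OF nf(2)])
    have s': "simple_function \<nu> (\<lambda>z. rev (word (- int n) n (fst z)))" by (rule simple_function_compose1[OF s])
    show ?thesis by (intro antisym fun_entropy_data_processing[OF s s'] fun_entropy_data_processing[OF s' s]) auto
  qed
  also have "\<dots> = word_entropy \<nu> n" by (rule fun_entropy_word[OF inv])
  finally show ?thesis .
qed

text \<open>Under \<open>mu\<close> the fiber point is a function of the past alone and so is
  independent of the letter at position 0.\<close>

lemma mu_letter:
  assumes \<phi>: "continuous_on UNIV (\<phi> :: circle \<Rightarrow> real)"
  shows "(\<integral>z. indicator {i} (fst z 0) * \<phi> (snd z) \<partial>mu) = (\<integral>z. \<phi> (snd z) \<partial>mu) / real CARD('n)"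
proof (rule LIMSEQ_unique)
  have l1: "local_fun 0 1 (\<lambda>z :: (int \<Rightarrow> 'n) \<times> circle. indicator {i} (fst z 0) * \<phi> (snd z))"
    by (rule local_fun_fiber[of "\<lambda>j x. indicator {i} j * \<phi> x"]) (intro continuous_intros \<phi>)
  have l2: "local_fun 0 1 (\<lambda>z :: (int \<Rightarrow> 'n) \<times> circle. \<phi> (snd z))"
    by (rule local_fun_fiber[of "\<lambda>j x. \<phi> x"]) (rule \<phi>)
  show "(\<lambda>k. \<integral>\<xi>. indicator {i} (\<xi> 0) * \<phi> (pull (times k) \<xi>) \<partial>bern) \<longlonglongrightarrow> (\<integral>z. indicator {i} (fst z 0) * \<phi> (snd z) \<partial>mu)"
    using integral_pull_tendsto[OF l1] by simp
  have eq: "(\<integral>\<xi>. indicator {i} (\<xi> 0) * \<phi> (pull m \<xi>) \<partial>bern) = (\<integral>\<xi>. \<phi> (pull m \<xi>) \<partial>bern) / real CARD('n)" for m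
  proof -
    have w: "word (- int m) (Suc m) \<xi> = word (- int m) m \<xi> @ [\<xi> 0]" for \<xi> :: "int \<Rightarrow> 'n" by (simp add: word_snoc)
    have "(\<integral>\<xi>. indicator {i} (\<xi> 0) * \<phi> (pull m \<xi>) \<partial>bern)
        = (\<integral>\<xi>. (\<lambda>v. indicator {i} (last v) * \<phi> (fold f (butlast v) 0)) (word (- int m) (Suc m) \<xi>) \<partial>bern)"
      by (simp add: w pull_def)
    also have "\<dots> = wavg (Suc m) (\<lambda>v. indicator {i} (last v) * \<phi> (fold f (butlast v) 0))"
      by (rule integral_word)
    also have "\<dots> = wavg m (\<lambda>u. \<phi> (fold f u 0) / real CARD('n))"
      unfolding wavg_snoc by (intro wavg_cong) (simp add: sum_distrib_right[symmetric] indicator_def sum.delta)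
    also have "\<dots> = wavg m (\<lambda>u. \<phi> (fold f u 0)) / real CARD('n)" by (rule wavg_divide)
    also have "wavg m (\<lambda>u. \<phi> (fold f u 0)) = (\<integral>\<xi>. \<phi> (pull m \<xi>) \<partial>bern)"
      unfolding pull_def by (rule integral_word[symmetric])
    finally show ?thesis .
  qed
  show "(\<lambda>k. \<integral>\<xi>. indicator {i} (\<xi> 0) * \<phi> (pull (times k) \<xi>) \<partial>bern) \<longlonglongrightarrow> (\<integral>z. \<phi> (snd z) \<partial>mu) / real CARD('n)"
    unfolding eq using tendsto_divide[OF integral_pull_tendsto[OF l2] tendsto_const[of "real CARD('n)"]] by simp
qed

text \<open>A common invariant measure would be a point mass at a common fixed point, by synchronization.\<close>

lemma no_common_invariant_measure:
  assumes \<nu>: "prob_space \<nu>" "sets \<nu> = sets (borel :: ((int \<Rightarrow> 'n) \<times> circle) measure)"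
    and inv: "\<And>i \<phi>. continuous_on UNIV \<phi> \<Longrightarrow> (\<integral>z. \<phi> (f i (snd z)) \<partial>\<nu>) = (\<integral>z. (\<phi> (snd z) :: real) \<partial>\<nu>)"
  shows False
proof -
  interpret prob_space \<nu> by fact
  define I where "I \<phi> = (\<integral>z. \<phi> (snd z) \<partial>\<nu>)" for \<phi> :: "circle \<Rightarrow> real"
  have int: "integrable \<nu> (\<lambda>z. \<phi> (snd z))" if "continuous_on UNIV \<phi>" for \<phi> :: "circle \<Rightarrow> real"
    by (rule local_fun_integrable[OF local_fun_fiber[of "\<lambda>j x. \<phi> x"] \<nu>(2,1)]) (rule that)
  have Iw: "I (\<lambda>x. \<phi> (fold f w x)) = I \<phi>" if "continuous_on UNIV \<phi>" for w and \<phi> :: "circle \<Rightarrow> real"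
  proof (induction w)
    case (Cons i w)
    have c: "continuous_on UNIV (\<lambda>x. \<phi> (fold f w x))"
      by (rule continuous_on_compose2[OF that continuous_fold[OF cont]]) auto
    show ?case using inv[OF c, of i] Cons by (simp add: I_def)
  qed simp
  have cd: "continuous_on UNIV (\<lambda>x :: circle. dist x p)" for p by (intro continuous_intros)
  \<comment> \<open>By synchronization the average over words of the distance between the images of
    a random point and of 0 is at most e, so some word w achieves this bound. Invariance removes w
    from the random point, and p is the image of 0.\<close>
  have ex: "\<exists>p. I (\<lambda>x. dist x p) \<le> e" if epos: "e > 0" for e
  proof -
    have "\<exists>n. \<forall>x y. wavg n (\<lambda>w. of_bool (e/2 \<le> dist (fold f w x) (fold f w y))) \<le> e/2"
    proof -
      have "e/2 > 0" using epos by simp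
      from synchronization[OF this this] show ?thesis by blast
    qed
    then obtain n where n: "\<And>x y. wavg n (\<lambda>w. of_bool (e/2 \<le> dist (fold f w x) (fold f w y))) \<le> e/2"
      by blast
    have cw: "continuous_on UNIV (\<lambda>x. dist (fold f w x) (fold f w 0))" for w
      by (intro continuous_intros continuous_fold cont)
    have "wavg n (\<lambda>w. I (\<lambda>x. dist (fold f w x) (fold f w 0))) = (\<integral>z. wavg n (\<lambda>w. dist (fold f w (snd z)) (fold f w 0)) \<partial>\<nu>)"
      unfolding I_def wavg_def by (simp add: Bochner_Integration.integral_sum int[OF cw])
    also have "\<dots> \<le> (\<integral>z. e \<partial>\<nu>)"
    proof (rule integral_mono)
      show "integrable \<nu> (\<lambda>z. wavg n (\<lambda>w. dist (fold f w (snd z)) (fold f w 0)))"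
        unfolding wavg_def by (intro Bochner_Integration.integrable_sum integrable_divide int[OF cw])
      fix z :: "(int \<Rightarrow> 'n) \<times> circle"
      have "wavg n (\<lambda>w. dist (fold f w (snd z)) (fold f w 0)) \<le> wavg n (\<lambda>w. e/2 + of_bool (e/2 \<le> dist (fold f w (snd z)) (fold f w 0)))"
      proof (rule wavg_mono)
        fix w
        show "dist (fold f w (snd z)) (fold f w 0) \<le> e/2 + of_bool (e/2 \<le> dist (fold f w (snd z)) (fold f w 0))"
          using dist_circle_le_half[of "fold f w (snd z)" "fold f w 0"] that
          by (cases "e/2 \<le> dist (fold f w (snd z)) (fold f w 0)") auto
      qed
      also have "\<dots> \<le> e" using n[of "snd z" 0] by (simp add: wavg_add)
      finally show "wavg n (\<lambda>w. dist (fold f w (snd z)) (fold f w 0)) \<le> e" .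
    qed auto
    finally have avg: "wavg n (\<lambda>w. I (\<lambda>x. dist (fold f w x) (fold f w 0))) \<le> e" by (simp add: prob_space)
    show ?thesis
    proof (rule ccontr)
      assume "\<nexists>p. I (\<lambda>x. dist x p) \<le> e"
      then have gt: "e < I (\<lambda>x. dist x p)" for p by (simp add: not_le)
      have gt': "e < I (\<lambda>x. dist (fold f w x) (fold f w 0))" for w
        using gt[of "fold f w 0"] Iw[OF cd[of "fold f w 0"], of w] by simp
      have "replicate n undefined \<in> {w :: 'n list. length w = n}" by simp
      then have ne: "{w :: 'n list. length w = n} \<noteq> {}" by (metis empty_iff)
      have "(\<Sum>w :: 'n list | length w = n. e) < (\<Sum>w | length w = n. I (\<lambda>x. dist (fold f w x) (fold f w 0)))"
        by (rule sum_strict_mono[OF finite_words ne]) (rule gt')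
      then have "e < wavg n (\<lambda>w. I (\<lambda>x. dist (fold f w x) (fold f w 0)))"
        by (simp add: wavg_def card_words less_divide_eq mult.commute)
      with avg show False by simp
    qed
  qed
  have lip: "I (\<lambda>x. dist x p) \<le> I (\<lambda>x. dist x q) + dist q p" for p q
  proof -
    have "I (\<lambda>x. dist x p) \<le> (\<integral>z. dist (snd z) q + dist q p \<partial>\<nu>)"
      unfolding I_def by (intro integral_mono int[OF cd] Bochner_Integration.integrable_add integrable_const dist_triangle)
    also have "\<dots> = I (\<lambda>x. dist x q) + dist q p" unfolding I_def using int[OF cd] by (simp add: prob_space)
    finally show ?thesis .
  qed
  have "continuous_on UNIV (\<lambda>p. I (\<lambda>x. dist x p))"
  proof (unfold continuous_on_iff, intro ballI allI impI)
    fix p and e :: real assume "e > 0"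
    then show "\<exists>d>0. \<forall>q\<in>UNIV. dist q p < d \<longrightarrow> dist (I (\<lambda>x. dist x q)) (I (\<lambda>x. dist x p)) < e"
    proof (intro exI[of _ e] conjI ballI impI)
      fix q assume "dist q p < e"
      then show "dist (I (\<lambda>x. dist x q)) (I (\<lambda>x. dist x p)) < e"
        using lip[of p q] lip[of q p] by (simp add: dist_real_def dist_commute abs_less_iff)
    qed
  qed
  \<comment> \<open>The mean distance to p is continuous in p and attains its infimum, which is 0.
    The fiber marginal is thus concentrated at one point, and invariance makes this point fixed by
    every map.\<close>
  then obtain p where p: "\<And>q. I (\<lambda>x. dist x p) \<le> I (\<lambda>x. dist x q)"
    using continuous_attains_inf[OF compact_circle UNIV_not_empty, of "\<lambda>p. I (\<lambda>x. dist x p)"] by auto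
  have "I (\<lambda>x. dist x p) \<le> 0"
  proof (rule field_le_epsilon)
    fix e :: real assume "e > 0"
    from ex[OF this] obtain q where "I (\<lambda>x. dist x q) \<le> e" by (elim exE)
    then show "I (\<lambda>x. dist x p) \<le> 0 + e" using p[of q] by simp
  qed
  moreover have "0 \<le> I (\<lambda>x. dist x p)" unfolding I_def by (rule Bochner_Integration.integral_nonneg) simp
  ultimately have I0: "I (\<lambda>x. dist x p) = 0" by simp
  have AEp: "AE z in \<nu>. snd z = p"
    using I0 integral_nonneg_eq_0_iff_AE[OF int[OF cd]] unfolding I_def by auto
  have "f i p = p" for i
  proof -
    have c: "continuous_on UNIV (\<lambda>x. dist (f i x) p)" by (intro continuous_intros cont)
    have "(\<integral>z. dist (f i (snd z)) p \<partial>\<nu>) = 0" using inv[OF cd[of p], of i] I0 by (simp add: I_def)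
    then have "AE z in \<nu>. f i (snd z) = p"
      using integral_nonneg_eq_0_iff_AE[OF int[OF c]] by auto
    with AEp have "AE z in \<nu>. f i p = p" by eventually_elim auto
    then show ?thesis by simp
  qed
  then show False using no_finite_invariant[of "{p}" p] by auto
qed

end

text \<open>Reflection brings the letter at -1 into play; one step of the skew product then places
  the derivative of the inverse at the image point, where it is reciprocal to that of the fiber
  map.\<close>

lemma (in random_diffeo) lyapunov_mirror:
  assumes inv: "invariant_prob (skew f) \<nu>"
  shows "lyapunov (\<lambda>i. inv (f i)) (mirror \<nu>) = - lyapunov f \<nu>"
proof -
  note nf = invariant_prob_facts[OF inv]
  let ?h = "\<lambda>z :: (int \<Rightarrow> 'n) \<times> circle. ln \<bar>circle_deriv (inv (f (fst z 0))) (snd z)\<bar>"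
  let ?k = "\<lambda>z :: (int \<Rightarrow> 'n) \<times> circle. ln \<bar>circle_deriv (inv (f (fst z (- 1)))) (snd z)\<bar>"
  have cl: "continuous_on UNIV (\<lambda>x. ln \<bar>circle_deriv (inv (f i)) x\<bar>)" for i
  proof -
    have "continuous_on UNIV (circle_deriv (inv (f i)))" using diffeo by (simp add: C1_circle_diffeo_def C1_circle_map_def)
    then show ?thesis
      using circle_deriv_nonzero[OF C1_diffeo_inv[OF diffeo]] by (intro continuous_on_ln continuous_on_rabs) auto
  qed
  have hm: "?h \<in> borel_measurable borel"
    by (rule borel_measurable_continuous_onI[OF continuous_fiber[OF cl]])
  have km: "?k \<in> borel_measurable borel"
    by (rule borel_measurable_continuous_onI[OF continuous_fiber[OF cl]])
  have "lyapunov (\<lambda>i. inv (f i)) (mirror \<nu>) = integral\<^sup>L (mirror \<nu>) ?h"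
    by (simp add: lyapunov_def case_prod_unfold)
  also have "\<dots> = integral\<^sup>L \<nu> ?k"
    by (subst integral_mirror[OF nf(2) hm]) (simp add: reflect_def)
  also have "\<dots> = (\<integral>z. ?k (skew f z) \<partial>\<nu>)"
    using invariant_integral_iterate[OF inv km, of 1] by simp
  also have "\<dots> = (\<integral>z. - logder z \<partial>\<nu>)"
  proof (rule Bochner_Integration.integral_cong[OF refl])
    fix z :: "(int \<Rightarrow> 'n) \<times> circle"
    let ?g = "f (fst z 0)" and ?x = "snd z"
    have "\<bar>circle_deriv (inv ?g) (?g ?x)\<bar> * \<bar>circle_deriv ?g ?x\<bar> = 1"
      using circle_deriv_inv[OF diffeo, of "fst z 0" ?x] by (simp flip: abs_mult)
    then have "ln (\<bar>circle_deriv (inv ?g) (?g ?x)\<bar> * \<bar>circle_deriv ?g ?x\<bar>) = 0" by simp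
    then have "ln \<bar>circle_deriv (inv ?g) (?g ?x)\<bar> + ln \<bar>circle_deriv ?g ?x\<bar> = 0"
      using circle_deriv_nonzero[OF diffeo] circle_deriv_nonzero[OF C1_diffeo_inv[OF diffeo]] by (subst (asm) ln_mult) auto
    then show "?k (skew f z) = - logder z" by (simp add: skew_def case_prod_unfold logder_def)
  qed
  also have "\<dots> = - lyapunov f \<nu>" by (simp add: lyapunov_logder)
  finally show ?thesis .
qed

text \<open>\<open>logder\<close> reads the letter at position 0. One inverse step turns it into an
  observable of the past with the same integral against every invariant measure.\<close>

lemma (in random_diffeo) entropy_gap_logder:
  assumes D: "D > 0"
  shows "\<exists>\<kappa>>0. \<forall>\<nu>. ergodic_prob (skew f) \<nu> \<longrightarrow> lyapunov f \<nu> \<le> 0 \<longrightarrow> lyapunov f mu + D \<le> lyapunov f \<nu> \<longrightarrow>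
     word_entropy_rate_le \<nu> (ln (real CARD('n)) - \<kappa>)"
proof -
  define \<psi> where "\<psi> z = logder ((skew_inv f ^^ 1) z)" for z
  have l: "local_fun 0 (int 1) logder" using local_fun_logder by simp
  obtain a where \<psi>: "local_fun a 0 \<psi>"
    unfolding \<psi>_def[abs_def] using local_fun_past[where f = f, OF l cont_inv] by blast
  have m: "\<psi> \<in> borel_measurable borel" by (rule local_fun_measurable[OF \<psi> refl])
  have e: "logder z = \<psi> ((skew f ^^ 1) z)" for z unfolding \<psi>_def skew_inv_iterate ..
  have I: "integral\<^sup>L \<nu> \<psi> = lyapunov f \<nu>" if "invariant_prob (skew f) \<nu>" for \<nu>
    unfolding lyapunov_logder e[abs_def] by (rule invariant_integral_iterate[OF that m, symmetric])
  have erg_inv: "invariant_prob (skew f) \<nu>" if "ergodic_prob (skew f) \<nu>" for \<nu>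
    using that by (simp add: ergodic_prob_def)
  show ?thesis
  proof -
    from entropy_gap[OF \<psi> D] obtain \<kappa> where \<kappa>: "\<kappa> > 0" "\<forall>\<nu>. ergodic_prob (skew f) \<nu> \<longrightarrow> lyapunov f \<nu> \<le> 0 \<longrightarrow> integral\<^sup>L mu \<psi> + D \<le> integral\<^sup>L \<nu> \<psi> \<longrightarrow>
     word_entropy_rate_le \<nu> (ln (real CARD('n)) - \<kappa>)" by blast
    show ?thesis
    proof (intro exI[of _ \<kappa>] conjI allI impI \<kappa>(1))
      fix \<nu> assume \<nu>: "ergodic_prob (skew f) \<nu>" "lyapunov f \<nu> \<le> 0" "lyapunov f mu + D \<le> lyapunov f \<nu>"
      show "word_entropy_rate_le \<nu> (ln (real CARD('n)) - \<kappa>)"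
        using \<kappa>(2)[rule_format, OF \<nu>(1,2)] \<nu>(3) unfolding I[OF invariant_prob_mu] I[OF erg_inv[OF \<nu>(1)]] by blast
    qed
  qed
qed

lemma (in random_diffeo) mu_full_rate: "\<kappa> > 0 \<Longrightarrow> \<not> word_entropy_rate_le mu (ln (real CARD('n)) - \<kappa>)"
proof
  assume "\<kappa> > 0" "word_entropy_rate_le mu (ln (real CARD('n)) - \<kappa>)"
  from metric_entropy_le_rate[OF invariant_prob_mu this(2)] entropy_mu
  have "ereal (ln (real CARD('n))) \<le> ereal (ln (real CARD('n)) - \<kappa>)" by simp
  then show False using \<open>\<kappa> > 0\<close> by simp
qed

subsection \<open>Convex combinations of measures\<close>

context
  fixes M M' :: "'a measure" and t :: real
  assumes M: "prob_space M" and M': "prob_space M'" and sets_eq: "sets M' = sets M" and t: "0 \<le> t" "t \<le> 1"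
begin

lemma sets_convex_comb: "sets (convex_comb t M M') = sets M"
  by (simp add: convex_comb_def)

lemma space_convex_comb: "space (convex_comb t M M') = space M"
  by (simp add: convex_comb_def)

lemma emeasure_convex_comb:
  assumes A: "A \<in> sets M"
  shows "emeasure (convex_comb t M M') A = ennreal t * emeasure M A + ennreal (1 - t) * emeasure M' A"
proof (rule emeasure_measure_of[OF convex_comb_def])
  show "sets M \<subseteq> Pow (space M)" by (rule sets.space_closed)
  show "A \<in> sets (convex_comb t M M')" using A by (simp add: sets_convex_comb)
  show "positive (sets (convex_comb t M M')) (\<lambda>A. ennreal t * emeasure M A + ennreal (1 - t) * emeasure M' A)"
    by (simp add: positive_def)
  show "countably_additive (sets (convex_comb t M M')) (\<lambda>A. ennreal t * emeasure M A + ennreal (1 - t) * emeasure M' A)"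
  proof (rule countably_additiveI)
    fix A :: "nat \<Rightarrow> 'a set" assume A: "range A \<subseteq> sets (convex_comb t M M')" "disjoint_family A"
    then have "range A \<subseteq> sets M" "range A \<subseteq> sets M'" by (simp_all add: sets_convex_comb sets_eq)
    then have "(\<Sum>i. emeasure M (A i)) = emeasure M (\<Union>i. A i)" "(\<Sum>i. emeasure M' (A i)) = emeasure M' (\<Union>i. A i)"
      using A(2) by (auto intro: suminf_emeasure)
    moreover have "(\<Sum>i. ennreal t * emeasure M (A i) + ennreal (1 - t) * emeasure M' (A i))
        = ennreal t * (\<Sum>i. emeasure M (A i)) + ennreal (1 - t) * (\<Sum>i. emeasure M' (A i))"
      by (simp add: suminf_add[OF summableI summableI, symmetric] ennreal_suminf_cmult)
    ultimately show "(\<Sum>i. ennreal t * emeasure M (A i) + ennreal (1 - t) * emeasure M' (A i))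
        = ennreal t * emeasure M (\<Union>i. A i) + ennreal (1 - t) * emeasure M' (\<Union>i. A i)" by simp
  qed
qed

lemma prob_space_convex_comb: "prob_space (convex_comb t M M')"
proof
  interpret M: prob_space M by (rule M)
  interpret M': prob_space M' by (rule M')
  have "space M' = space M" by (rule sets_eq_imp_space_eq[OF sets_eq])
  then have "emeasure (convex_comb t M M') (space M) = ennreal t * 1 + ennreal (1 - t) * 1"
    using M.emeasure_space_1 M'.emeasure_space_1 by (simp add: emeasure_convex_comb)
  also have "\<dots> = 1" using t by (simp flip: ennreal_plus)
  finally show "emeasure (convex_comb t M M') (space (convex_comb t M M')) = 1" by (simp add: space_convex_comb)
qed

lemma measure_convex_comb:
  assumes "A \<in> sets M" shows "measure (convex_comb t M M') A = t * measure M A + (1 - t) * measure M' A"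
proof -
  interpret M: prob_space M by (rule M)
  interpret M': prob_space M' by (rule M')
  have "emeasure (convex_comb t M M') A = ennreal (t * measure M A + (1 - t) * measure M' A)"
    using t by (simp add: emeasure_convex_comb[OF assms] M.emeasure_eq_measure M'.emeasure_eq_measure ennreal_mult[symmetric] ennreal_plus[symmetric] del: ennreal_plus)
  then show ?thesis using t by (simp add: measure_def[of "convex_comb t M M'"] del: ennreal_plus)
qed

lemma nn_integral_convex_comb:
  assumes u: "u \<in> borel_measurable M"
  shows "(\<integral>\<^sup>+ x. u x \<partial>convex_comb t M M') = ennreal t * (\<integral>\<^sup>+ x. u x \<partial>M) + ennreal (1 - t) * (\<integral>\<^sup>+ x. u x \<partial>M')"
  using u
proof (induction rule: borel_measurable_induct)
  case (cong u v)
  have sp: "space M' = space M" by (rule sets_eq_imp_space_eq[OF sets_eq])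
  have "(\<integral>\<^sup>+ x. u x \<partial>L) = (\<integral>\<^sup>+ x. v x \<partial>L)" if "space L = space M" for L
    by (rule nn_integral_cong) (simp add: cong(3) that)
  then show ?case using cong(4) by (simp add: space_convex_comb sp)
next
  case (set A)
  then show ?case by (simp add: sets_convex_comb sets_eq emeasure_convex_comb)
next
  case (mult u c)
  have m: "u \<in> borel_measurable M'" "u \<in> borel_measurable (convex_comb t M M')"
    using mult(2) by (simp_all add: measurable_cong_sets[OF sets_eq refl] measurable_cong_sets[OF sets_convex_comb refl])
  show ?case using mult m by (simp add: nn_integral_cmult distrib_left mult.left_commute)
next
  case (add u v)
  have m: "u \<in> borel_measurable M'" "u \<in> borel_measurable (convex_comb t M M')"
    "v \<in> borel_measurable M'" "v \<in> borel_measurable (convex_comb t M M')"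
    using add by (simp_all add: measurable_cong_sets[OF sets_eq refl] measurable_cong_sets[OF sets_convex_comb refl])
  show ?case using add m by (simp add: nn_integral_add distrib_left ac_simps)
next
  case (seq U)
  have m: "U i \<in> borel_measurable M'" "U i \<in> borel_measurable (convex_comb t M M')" for i
    using seq(1) by (simp_all add: measurable_cong_sets[OF sets_eq refl] measurable_cong_sets[OF sets_convex_comb refl])
  have lim: "(\<integral>\<^sup>+ x. (SUP i. U i) x \<partial>L) = (SUP i. \<integral>\<^sup>+ x. U i x \<partial>L)" if "\<And>i. U i \<in> borel_measurable L" for L
    unfolding SUP_apply by (rule nn_integral_monotone_convergence_SUP[OF seq(3) that])
  have inc: "incseq (\<lambda>i. \<integral>\<^sup>+ x. U i x \<partial>L)" for L
    using seq(3) by (auto simp: incseq_def le_fun_def intro!: nn_integral_mono)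
  have "(SUP i. ennreal t * (\<integral>\<^sup>+ x. U i x \<partial>M) + ennreal (1 - t) * (\<integral>\<^sup>+ x. U i x \<partial>M'))
      = (SUP i. ennreal t * (\<integral>\<^sup>+ x. U i x \<partial>M)) + (SUP i. ennreal (1 - t) * (\<integral>\<^sup>+ x. U i x \<partial>M'))"
    by (rule ennreal_SUP_add) (use inc in \<open>auto simp: incseq_def intro: mult_left_mono\<close>)
  also have "\<dots> = ennreal t * (SUP i. \<integral>\<^sup>+ x. U i x \<partial>M) + ennreal (1 - t) * (SUP i. \<integral>\<^sup>+ x. U i x \<partial>M')"
    by (simp add: SUP_mult_left_ennreal)
  finally show ?case
    unfolding seq(4) lim[OF m(2)] lim[OF seq(1)] lim[OF m(1)] seq.IH .
qed

text \<open>Adding the bound B makes the function nonnegative, which reduces the claim to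
  nonnegative integrals.\<close>

lemma integral_convex_comb:
  fixes \<phi> :: "'a \<Rightarrow> real"
  assumes \<phi>: "\<phi> \<in> borel_measurable M" and B: "\<And>x. \<bar>\<phi> x\<bar> \<le> B"
  shows "integral\<^sup>L (convex_comb t M M') \<phi> = t * integral\<^sup>L M \<phi> + (1 - t) * integral\<^sup>L M' \<phi>"
proof -
  interpret M: prob_space M by (rule M)
  interpret M': prob_space M' by (rule M')
  interpret C: prob_space "convex_comb t M M'" by (rule prob_space_convex_comb)
  have m: "\<phi> \<in> borel_measurable M'" "\<phi> \<in> borel_measurable (convex_comb t M M')"
    using \<phi> by (simp_all add: measurable_cong_sets[OF sets_eq refl] measurable_cong_sets[OF sets_convex_comb refl])
  have pos: "0 \<le> \<phi> x + B" for x using B[of x] by linarith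
  have iM: "integrable M \<phi>" by (rule M.integrable_const_bound[of _ B]) (use B \<phi> in auto)
  have iM': "integrable M' \<phi>" by (rule M'.integrable_const_bound[of _ B]) (use B m in auto)
  have iC: "integrable (convex_comb t M M') \<phi>" by (rule C.integrable_const_bound[of _ B]) (use B m in auto)
  have nn: "(\<integral>\<^sup>+ x. ennreal (\<phi> x + B) \<partial>L) = ennreal (integral\<^sup>L L \<phi> + B)" "0 \<le> integral\<^sup>L L \<phi> + B"
    if "prob_space L" "integrable L \<phi>" for L
  proof -
    interpret L: prob_space L by fact
    have i: "integrable L (\<lambda>x. \<phi> x + B)" using that(2) by auto
    have e: "integral\<^sup>L L (\<lambda>x. \<phi> x + B) = integral\<^sup>L L \<phi> + B" using that(2) by (simp add: L.prob_space)
    show "(\<integral>\<^sup>+ x. ennreal (\<phi> x + B) \<partial>L) = ennreal (integral\<^sup>L L \<phi> + B)"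
      using nn_integral_eq_integral[OF i] pos e by simp
    show "0 \<le> integral\<^sup>L L \<phi> + B" unfolding e[symmetric] by (intro Bochner_Integration.integral_nonneg pos)
  qed
  have "(\<lambda>x. ennreal (\<phi> x + B)) \<in> borel_measurable M" using \<phi> by measurable
  from nn_integral_convex_comb[OF this]
  have "ennreal (integral\<^sup>L (convex_comb t M M') \<phi> + B) = ennreal t * ennreal (integral\<^sup>L M \<phi> + B) + ennreal (1 - t) * ennreal (integral\<^sup>L M' \<phi> + B)"
    by (simp only: nn(1)[OF prob_space_convex_comb iC] nn(1)[OF M iM] nn(1)[OF M' iM'])
  also have "\<dots> = ennreal (t * (integral\<^sup>L M \<phi> + B) + (1 - t) * (integral\<^sup>L M' \<phi> + B))"
    using t nn(2)[OF M iM] nn(2)[OF M' iM'] by (simp add: ennreal_mult[symmetric] ennreal_plus[symmetric] del: ennreal_plus)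
  finally have "integral\<^sup>L (convex_comb t M M') \<phi> + B = t * (integral\<^sup>L M \<phi> + B) + (1 - t) * (integral\<^sup>L M' \<phi> + B)"
    using nn(2)[OF prob_space_convex_comb iC] nn(2)[OF M iM] nn(2)[OF M' iM'] t by (subst (asm) ennreal_inj) (auto intro!: add_nonneg_nonneg mult_nonneg_nonneg)
  then show ?thesis by (simp add: algebra_simps)
qed

end

subsection \<open>The two measures of maximal entropy\<close>

locale two_sided = fw: random_diffeo f + bw: random_diffeo "\<lambda>i. inv (f i)"
  for f :: "'n::{finite,discrete_topology} \<Rightarrow> circle \<Rightarrow> circle"
begin

lemma inv_inv: "(\<lambda>i. inv (inv (f i))) = f"
  by (simp add: inv_inv_eq fw.bij)

lemma swap: "two_sided (\<lambda>i. inv (f i))"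
  unfolding two_sided_def inv_inv by (intro conjI fw.random_diffeo_axioms bw.random_diffeo_axioms)

text \<open>Otherwise the reflection of \<open>fw.mu\<close> has nonpositive exponent and full
  entropy for the inverse maps, hence equals \<open>bw.mu\<close>. Then under \<open>fw.mu\<close>
  the fiber point is independent of the letter at 0 and also of the letter at -1, and together with
  invariance this makes the fiber marginal invariant under each map separately.\<close>

lemma lyapunov_mu_negative: "lyapunov f fw.mu < 0"
proof (rule ccontr)
  assume "\<not> lyapunov f fw.mu < 0"
  then have "lyapunov (\<lambda>i. inv (f i)) (mirror fw.mu) \<le> 0"
    by (simp add: fw.lyapunov_mirror[OF fw.invariant_prob_mu])
  moreover have "\<not> word_entropy_rate_le (mirror fw.mu) (ln (real CARD('n)) - \<kappa>)" if "\<kappa> > 0" for \<kappa>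
    using fw.mu_full_rate[OF that] by (simp add: word_entropy_rate_le_def fw.word_entropy_mirror[OF fw.invariant_prob_mu])
  ultimately have eq: "mirror fw.mu = bw.mu"
    by (intro bw.eq_mu_if_max_entropy fw.ergodic_mirror[OF fw.ergodic_prob_mu])
  show False
  proof (rule fw.no_common_invariant_measure[OF fw.prob_space_mu fw.sets_mu])
    fix i and \<phi> :: "circle \<Rightarrow> real" assume \<phi>: "continuous_on UNIV \<phi>"
    have c: "continuous_on UNIV (\<lambda>x. \<phi> (f i x))"
      by (rule continuous_on_compose2[OF \<phi> fw.cont]) auto
    have h0: "(\<lambda>z :: (int \<Rightarrow> 'n) \<times> circle. indicator {i} (fst z k) * \<phi> (snd z)) \<in> borel_measurable borel" for k
      by (rule borel_measurable_continuous_onI[OF continuous_fiber[of "\<lambda>j x. indicator {i} j * \<phi> x"]])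
        (intro continuous_intros \<phi>)
    have hs: "(\<lambda>z :: (int \<Rightarrow> 'n) \<times> circle. \<phi> (snd z)) \<in> borel_measurable borel"
      by (rule borel_measurable_continuous_onI[OF continuous_fiber[of "\<lambda>j x. \<phi> x" 0]]) (rule \<phi>)
    \<comment> \<open>Condition on the letter i at position 0, apply one step so that i sits at -1,
      and use the independence from that letter supplied by \<open>bw.mu\<close>.\<close>
    have "(\<integral>z. \<phi> (f i (snd z)) \<partial>fw.mu) / real CARD('n) = (\<integral>z. indicator {i} (fst z 0) * \<phi> (f i (snd z)) \<partial>fw.mu)"
      by (rule fw.mu_letter[OF c, symmetric])
    also have "\<dots> = (\<integral>z. indicator {i} (fst (skew f z) (- 1)) * \<phi> (snd (skew f z)) \<partial>fw.mu)"
      by (intro Bochner_Integration.integral_cong refl) (auto simp: skew_def case_prod_unfold indicator_def)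
    also have "\<dots> = (\<integral>z. indicator {i} (fst z (- 1)) * \<phi> (snd z) \<partial>fw.mu)"
      using fw.invariant_integral_iterate[OF fw.invariant_prob_mu h0[of "- 1"], of 1] by simp
    also have "\<dots> = (\<integral>z. indicator {i} (fst (reflect z) 0) * \<phi> (snd (reflect z)) \<partial>fw.mu)"
      by (simp add: reflect_def)
    also have "\<dots> = (\<integral>z. indicator {i} (fst z 0) * \<phi> (snd z) \<partial>bw.mu)"
      unfolding eq[symmetric] by (rule integral_mirror[OF fw.sets_mu h0, symmetric])
    also have "\<dots> = (\<integral>z. \<phi> (snd z) \<partial>bw.mu) / real CARD('n)"
      by (rule bw.mu_letter[OF \<phi>])
    also have "(\<integral>z. \<phi> (snd z) \<partial>bw.mu) = (\<integral>z. \<phi> (snd z) \<partial>fw.mu)"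
      unfolding eq[symmetric] by (subst integral_mirror[OF fw.sets_mu hs]) (simp add: reflect_def)
    finally show "(\<integral>z. \<phi> (f i (snd z)) \<partial>fw.mu) = (\<integral>z. \<phi> (snd z) \<partial>fw.mu)" by simp
  qed
qed

definition mu_plus :: "((int \<Rightarrow> 'n) \<times> circle) measure" where "mu_plus = mirror bw.mu"

lemma mu_plus_ergodic: "ergodic_prob (skew f) mu_plus"
  using bw.ergodic_mirror[OF bw.ergodic_prob_mu] by (simp add: mu_plus_def inv_inv)

lemma mu_plus_facts: "prob_space mu_plus" "sets mu_plus = sets borel"
  using mu_plus_ergodic by (auto simp: ergodic_prob_def invariant_prob_def)

lemma lyapunov_mu_plus: "lyapunov f mu_plus = - lyapunov (\<lambda>i. inv (f i)) bw.mu" "lyapunov f mu_plus > 0"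
proof -
  show e: "lyapunov f mu_plus = - lyapunov (\<lambda>i. inv (f i)) bw.mu"
    using bw.lyapunov_mirror[OF bw.invariant_prob_mu] by (simp add: mu_plus_def inv_inv)
  show "lyapunov f mu_plus > 0" using two_sided.lyapunov_mu_negative[OF swap] by (simp add: e)
qed

lemma measure_mu_plus_word:
  assumes "length w = n" shows "measure mu_plus {z. word 0 n (fst z) = w} = 1 / real CARD('n) ^ n"
proof -
  have "{z :: (int \<Rightarrow> 'n) \<times> circle. word 0 n (fst z) = w} \<in> sets borel"
    using measurable_sets[OF measurable_word_fst[of 0 n], of "{w}"] by (simp add: vimage_def)
  then have "measure mu_plus {z. word 0 n (fst z) = w} = measure bw.mu (reflect -` {z. word 0 n (fst z) = w} \<inter> space bw.mu)"
    unfolding mu_plus_def mirror_def by (rule measure_distr[OF measurable_reflect'[OF bw.sets_mu]])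
  also have "reflect -` {z. word 0 n (fst z) = w} \<inter> space bw.mu = {z. word (- int n) n (fst z) = rev w}"
  proof -
    have "word 0 n (fst (reflect z)) = rev (word (- int n) n (fst z))" for z :: "(int \<Rightarrow> 'n) \<times> circle"
      by (rule nth_equalityI) (auto simp: word_def reflect_def rev_nth of_nat_diff algebra_simps)
    moreover have "space bw.mu = UNIV" using sets_eq_imp_space_eq[OF bw.sets_mu] by simp
    ultimately show ?thesis by auto
  qed
  also have "measure bw.mu \<dots> = 1 / real CARD('n) ^ n" by (rule bw.measure_mu_word) (simp add: assms)
  finally show ?thesis .
qed

lemma measurable_skew_on: "sets \<nu> = sets borel \<Longrightarrow> skew f \<in> measurable \<nu> \<nu>"
  using fw.measurable_skew measurable_cong_sets[of \<nu> borel \<nu> borel] by simp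

lemma entropy_mu_plus: "metric_entropy (skew f) mu_plus = ereal (ln (real CARD('n)))"
proof (rule antisym)
  show "metric_entropy (skew f) mu_plus \<le> ereal (ln (real CARD('n)))"
    using mu_plus_ergodic by (intro fw.metric_entropy_le_log_card) (simp add: ergodic_prob_def)
  show "ereal (ln (real CARD('n))) \<le> metric_entropy (skew f) mu_plus"
    by (rule metric_entropy_ge_log_card[OF mu_plus_facts measurable_skew_on[OF mu_plus_facts(2)] measure_mu_plus_word])
qed

lemma eq_mu_plus:
  assumes erg: "ergodic_prob (skew f) \<nu>" and lyap: "lyapunov f \<nu> \<ge> 0"
    and ent: "\<And>\<kappa>. \<kappa> > 0 \<Longrightarrow> \<not> word_entropy_rate_le \<nu> (ln (real CARD('n)) - \<kappa>)"
  shows "\<nu> = mu_plus"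
proof -
  have inv: "invariant_prob (skew f) \<nu>" using erg by (simp add: ergodic_prob_def)
  have "mirror \<nu> = bw.mu"
  proof (rule bw.eq_mu_if_max_entropy[OF fw.ergodic_mirror[OF erg]])
    show "lyapunov (\<lambda>i. inv (f i)) (mirror \<nu>) \<le> 0" using lyap by (simp add: fw.lyapunov_mirror[OF inv])
    show "\<not> word_entropy_rate_le (mirror \<nu>) (ln (real CARD('n)) - \<kappa>)" if "\<kappa> > 0" for \<kappa>
      using ent[OF that] by (simp add: word_entropy_rate_le_def fw.word_entropy_mirror[OF inv])
  qed
  then show ?thesis using mirror_mirror[of \<nu>] inv by (simp add: mu_plus_def invariant_prob_def)
qed

text \<open>Maximality forces entropy \<open>ln (real CARD('n))\<close>, so no gap is possible; the
  sign of the exponent selects which of the two uniqueness statements applies.\<close>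

lemma ergodic_max_entropy_iff: "ergodic_max_entropy (skew f) \<nu> \<longleftrightarrow> \<nu> = fw.mu \<or> \<nu> = mu_plus"
proof
  assume max: "ergodic_max_entropy (skew f) \<nu>"
  then have erg: "ergodic_prob (skew f) \<nu>" by (simp add: ergodic_max_entropy_def)
  then have inv: "invariant_prob (skew f) \<nu>" by (simp add: ergodic_prob_def)
  have ent: "\<not> word_entropy_rate_le \<nu> (ln (real CARD('n)) - \<kappa>)" if "\<kappa> > 0" for \<kappa>
  proof
    assume "word_entropy_rate_le \<nu> (ln (real CARD('n)) - \<kappa>)"
    then have "metric_entropy (skew f) \<nu> \<le> ereal (ln (real CARD('n)) - \<kappa>)"
      by (rule fw.metric_entropy_le_rate[OF inv])
    moreover have "ereal (ln (real CARD('n))) \<le> metric_entropy (skew f) \<nu>"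
      using max fw.invariant_prob_mu fw.entropy_mu by (auto simp: ergodic_max_entropy_def)
    ultimately have "ereal (ln (real CARD('n))) \<le> ereal (ln (real CARD('n)) - \<kappa>)" by (rule order_trans[rotated])
    then show False using that by simp
  qed
  show "\<nu> = fw.mu \<or> \<nu> = mu_plus"
    using fw.eq_mu_if_max_entropy[OF erg _ ent] eq_mu_plus[OF erg _ ent] by linarith
next
  assume "\<nu> = fw.mu \<or> \<nu> = mu_plus"
  then show "ergodic_max_entropy (skew f) \<nu>"
    using fw.ergodic_prob_mu mu_plus_ergodic fw.metric_entropy_le_log_card
    by (auto simp: ergodic_max_entropy_def fw.entropy_mu entropy_mu_plus)
qed

text \<open>Weak convergence passes to the exponents because \<open>logder\<close> is continuous.
  Their limit lies strictly between the exponents of the two extremal measures, so the gaps bound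
  the entropies away from that of the combination.\<close>

lemma no_approximation:
  assumes t: "0 < t" "t < 1" and erg: "\<And>k. ergodic_prob (skew f) (\<nu> k)"
    and weak: "weak_star_conv \<nu> (convex_comb t fw.mu mu_plus)"
    and ent: "(\<lambda>k. metric_entropy (skew f) (\<nu> k)) \<longlonglongrightarrow> metric_entropy (skew f) (convex_comb t fw.mu mu_plus)"
  shows False
proof -
  define C where "C = convex_comb t fw.mu mu_plus"
  define L where "L = ln (real CARD('n))"
  define \<chi>m where "\<chi>m = lyapunov f fw.mu"
  define \<chi>p where "\<chi>p = lyapunov f mu_plus"
  have \<chi>: "\<chi>m < 0" "0 < \<chi>p" using lyapunov_mu_negative lyapunov_mu_plus(2) by (auto simp: \<chi>m_def \<chi>p_def)
  have t': "0 \<le> t" "t \<le> 1" using t by auto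
  have se: "sets mu_plus = sets fw.mu" by (simp add: mu_plus_facts)
  note cc = fw.prob_space_mu mu_plus_facts(1) se t'
  have Cs: "sets C = sets borel" unfolding C_def by (simp add: sets_convex_comb[OF cc])
  have Cp: "prob_space C" unfolding C_def by (rule prob_space_convex_comb[OF cc])
  have unif: "measure C {z. word 0 n (fst z) = w} = 1 / real CARD('n) ^ n" if "length w = n" for n w
  proof -
    have "{z :: (int \<Rightarrow> 'n) \<times> circle. word 0 n (fst z) = w} \<in> sets fw.mu"
      using measurable_sets[OF measurable_word_fst[of 0 n], of "{w}"] by (simp add: vimage_def)
    from measure_convex_comb[OF cc this] show ?thesis
      unfolding C_def fw.measure_mu_word[OF that] measure_mu_plus_word[OF that] by (simp flip: add_divide_distrib)
  qed
  \<comment> \<open>Both extremal measures have uniform words and so does their combination.\<close>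
  have entC: "ereal L \<le> metric_entropy (skew f) C"
    unfolding L_def by (rule metric_entropy_ge_log_card[OF Cp Cs measurable_skew_on[OF Cs] unif])
  obtain B where B: "\<And>z. \<bar>fw.logder z\<bar> \<le> B" using local_fun_bound[OF fw.local_fun_logder] by blast
  have "integral\<^sup>L C fw.logder = t * \<chi>m + (1 - t) * \<chi>p"
    unfolding C_def \<chi>m_def \<chi>p_def fw.lyapunov_logder
    by (rule integral_convex_comb[OF cc local_fun_measurable[OF fw.local_fun_logder fw.sets_mu] B])
  then have lim: "(\<lambda>k. lyapunov f (\<nu> k)) \<longlonglongrightarrow> t * \<chi>m + (1 - t) * \<chi>p"
    using weak local_fun_continuous[OF fw.local_fun_logder]
    unfolding weak_star_conv_def C_def[symmetric] fw.lyapunov_logder by auto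
  \<comment> \<open>Half the distances from the limiting exponent to the lower and to the upper one,
    so that exponents close to the limit stay D1 above the lower and D2 below the upper one.\<close>
  define D1 where "D1 = (1 - t) * (\<chi>p - \<chi>m) / 2"
  define D2 where "D2 = t * (\<chi>p - \<chi>m) / 2"
  have D: "D1 > 0" "D2 > 0" using t \<chi> by (auto simp: D1_def D2_def)
  have lim1: "t * \<chi>m + (1 - t) * \<chi>p = \<chi>m + 2 * D1" and lim2: "t * \<chi>m + (1 - t) * \<chi>p = \<chi>p - 2 * D2"
    by (simp_all add: D1_def D2_def field_simps)
  have ev1: "\<forall>\<^sub>F k in sequentially. \<chi>m + D1 < lyapunov f (\<nu> k)"
    by (rule order_tendstoD(1)[OF lim]) (use lim1 D in linarith)
  have ev2: "\<forall>\<^sub>F k in sequentially. lyapunov f (\<nu> k) < \<chi>p - D2"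
    by (rule order_tendstoD(2)[OF lim]) (use lim2 D in linarith)
  obtain \<kappa>1 where \<kappa>1: "\<kappa>1 > 0" "\<And>\<nu>. ergodic_prob (skew f) \<nu> \<Longrightarrow> lyapunov f \<nu> \<le> 0 \<Longrightarrow> \<chi>m + D1 \<le> lyapunov f \<nu> \<Longrightarrow>
      word_entropy_rate_le \<nu> (L - \<kappa>1)"
    using fw.entropy_gap_logder[OF D(1)] unfolding \<chi>m_def L_def by blast
  obtain \<kappa>2 where \<kappa>2: "\<kappa>2 > 0" "\<And>\<nu>. ergodic_prob (skew (\<lambda>i. inv (f i))) \<nu> \<Longrightarrow> lyapunov (\<lambda>i. inv (f i)) \<nu> \<le> 0 \<Longrightarrow>
      lyapunov (\<lambda>i. inv (f i)) bw.mu + D2 \<le> lyapunov (\<lambda>i. inv (f i)) \<nu> \<Longrightarrow> word_entropy_rate_le \<nu> (L - \<kappa>2)"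
    using bw.entropy_gap_logder[OF D(2)] unfolding L_def by blast
  define \<kappa> where "\<kappa> = min \<kappa>1 \<kappa>2"
  have "\<kappa> > 0" using \<kappa>1 \<kappa>2 by (simp add: \<kappa>_def)
  have "\<forall>\<^sub>F k in sequentially. ereal (L - \<kappa>) < metric_entropy (skew f) (\<nu> k)"
  proof (rule order_tendstoD(1)[OF ent])
    have "ereal (L - \<kappa>) < ereal L" using \<open>\<kappa> > 0\<close> by simp
    also note entC
    finally show "ereal (L - \<kappa>) < metric_entropy (skew f) (convex_comb t fw.mu mu_plus)" by (simp add: C_def)
  qed
  with ev1 ev2 have "\<forall>\<^sub>F k in sequentially. False"
  proof eventually_elim
    case (elim k)
    have inv: "invariant_prob (skew f) (\<nu> k)" using erg[of k] by (simp add: ergodic_prob_def)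
    have le: False if "word_entropy_rate_le (\<nu> k) (L - \<kappa>')" "\<kappa> \<le> \<kappa>'" for \<kappa>'
    proof -
      have "metric_entropy (skew f) (\<nu> k) \<le> ereal (L - \<kappa>')" by (rule fw.metric_entropy_le_rate[OF inv that(1)])
      also have "\<dots> \<le> ereal (L - \<kappa>)" using that(2) by simp
      finally show False using elim(3) by simp
    qed
    show False
    \<comment> \<open>A nonpositive exponent is excluded by the forward gap at distance D1, a
      positive one by the gap for the reflected measure at distance D2.\<close>
    proof (cases "lyapunov f (\<nu> k) \<le> 0")
      case True
      show False by (rule le[OF \<kappa>1(2)[OF erg True]]) (use elim(1) in \<open>simp_all add: \<kappa>_def\<close>)
    next
      case False
      have "word_entropy_rate_le (mirror (\<nu> k)) (L - \<kappa>2)"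
      proof (rule \<kappa>2(2)[OF fw.ergodic_mirror[OF erg]])
        show "lyapunov (\<lambda>i. inv (f i)) (mirror (\<nu> k)) \<le> 0"
          using False by (simp add: fw.lyapunov_mirror[OF inv])
        show "lyapunov (\<lambda>i. inv (f i)) bw.mu + D2 \<le> lyapunov (\<lambda>i. inv (f i)) (mirror (\<nu> k))"
          using elim(2) lyapunov_mu_plus(1) by (simp add: fw.lyapunov_mirror[OF inv] \<chi>p_def)
      qed
      then have "word_entropy_rate_le (\<nu> k) (L - \<kappa>2)" by (simp add: word_entropy_rate_le_def fw.word_entropy_mirror[OF inv])
      then show False by (rule le) (simp add: \<kappa>_def)
    qed
  qed
  then show False by simp
qed

end

section \<open>From the axioms to the two-sided setting\<close>

text \<open>Proximality is a limit at both ends of time: large positive times give contracting words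
  for the fiber maps, and large negative times give them for the inverse maps, after reversal of the
  word.\<close>

lemma two_sided_from_axioms:
  fixes f :: "'n::{finite, discrete_topology} \<Rightarrow> circle \<Rightarrow> circle"
  assumes diffeo: "\<And>i. C1_circle_diffeo (f i)"
    and trans: "topologically_transitive (skew f)"
    and ax: "axioms_CEC_Acc f" and prox: "proximal f"
  shows "two_sided f"
proof -
  let ?g = "\<lambda>i. inv (f i)"
  have bij: "bij (f i)" for i using diffeo by (simp add: C1_circle_diffeo_def)
  have dg: "C1_circle_diffeo (?g i)" for i by (rule C1_diffeo_inv[OF diffeo])
  have bg: "bij (?g i)" for i using dg by (simp add: C1_circle_diffeo_def)
  have c: "continuous_on UNIV (f i)" "continuous_on UNIV (?g i)" for i
    using diffeo dg by (auto simp: C1_circle_diffeo_def intro: C1_circle_map_continuous)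
  have ii: "(\<lambda>i. inv (?g i)) = f" by (simp add: inv_inv_eq bij)
  have ci: "continuous_on UNIV (inv (?g i))" for i by (simp add: inv_inv_eq bij c)
  have near: "\<exists>w. dist (fold f w x) (fold f w y) < e" "\<exists>w. dist (fold ?g w x) (fold ?g w y) < e" if "e > 0" for x y e
  proof -
    obtain \<xi> where \<xi>: "((\<lambda>n. dist (fiber_iterate f \<xi> n x) (fiber_iterate f \<xi> n y)) \<longlongrightarrow> 0) (sup at_top at_bot)"
      using prox unfolding proximal_def by blast
    from order_tendstoD(2)[OF this that]
    have ev: "\<forall>\<^sub>F n in at_top. dist (fiber_iterate f \<xi> n x) (fiber_iterate f \<xi> n y) < e"
      "\<forall>\<^sub>F n in at_bot. dist (fiber_iterate f \<xi> n x) (fiber_iterate f \<xi> n y) < e"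
      by (auto simp: eventually_sup)
    obtain n where "n \<ge> 0" "dist (fiber_iterate f \<xi> n x) (fiber_iterate f \<xi> n y) < e"
      using eventually_happens[OF eventually_conj[OF ev(1) eventually_ge_at_top[of 0]]] by auto
    then show "\<exists>w. dist (fold f w x) (fold f w y) < e" by (auto simp: fiber_iterate_def)
    \<comment> \<open>Times at most -1, since \<open>fiber_iterate\<close> treats time 0 as
      forward.\<close>
    obtain m where "m \<le> - 1" "dist (fiber_iterate f \<xi> m x) (fiber_iterate f \<xi> m y) < e"
      using eventually_happens[OF eventually_conj[OF ev(2) eventually_le_at_bot[of "- 1"]]] by auto
    then have "m < 0" "dist (fiber_iterate f \<xi> m x) (fiber_iterate f \<xi> m y) < e" by auto
    then have "dist (inv (fold f (map \<xi> [m..- 1])) x) (inv (fold f (map \<xi> [m..- 1])) y) < e"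
      by (simp add: fiber_iterate_def)
    then show "\<exists>w. dist (fold ?g w x) (fold ?g w y) < e" unfolding inv_fold[OF bij] by blast
  qed
  have "random_diffeo f"
    by unfold_locales
      (fact bij c diffeo | rule forward_minimal[OF bij c(1) trans ax] backward_minimal[OF bij c(2) trans ax] near; assumption)+
  moreover have "random_diffeo ?g"
    by (unfold_locales; (unfold ii)?)
      (fact bg c ci dg | rule forward_minimal[OF bij c(1) trans ax] backward_minimal[OF bij c(2) trans ax] near; assumption)+
  ultimately show ?thesis by (simp add: two_sided_def)
qed

theorem corollary3:
  fixes f :: "'n::{finite, discrete_topology} \<Rightarrow> circle \<Rightarrow> circle"
  assumes "CARD('n) \<ge> 2"
    and "\<And>i. C1_circle_diffeo (f i)"
    and "topologically_transitive (skew f)"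
    and "axioms_CEC_Acc f"
    and "proximal f"
  shows "\<exists>\<mu>m \<mu>p.
    \<mu>m \<noteq> \<mu>p \<and> {\<mu>. ergodic_max_entropy (skew f) \<mu>} = {\<mu>m, \<mu>p} \<and>
    metric_entropy (skew f) \<mu>m = ereal (ln (real CARD('n))) \<and>
    metric_entropy (skew f) \<mu>p = ereal (ln (real CARD('n))) \<and>
    lyapunov f \<mu>m < 0 \<and> 0 < lyapunov f \<mu>p \<and>
    (\<forall>t::real. 0 < t \<and> t < 1 \<longrightarrow>
      \<not> (\<exists>\<nu>. (\<forall>k. ergodic_prob (skew f) (\<nu> k)) \<and>
            weak_star_conv \<nu> (convex_comb t \<mu>m \<mu>p) \<and>
            (\<lambda>k. metric_entropy (skew f) (\<nu> k)) \<longlonglongrightarrow>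
              metric_entropy (skew f) (convex_comb t \<mu>m \<mu>p)))"
proof -
  interpret two_sided f by (rule two_sided_from_axioms) (fact assms)+
  show ?thesis
  proof (rule exI[of _ fw.mu], rule exI[of _ mu_plus], intro conjI)
    show "fw.mu \<noteq> mu_plus" using lyapunov_mu_negative lyapunov_mu_plus(2) by auto
    show "{\<mu>. ergodic_max_entropy (skew f) \<mu>} = {fw.mu, mu_plus}" using ergodic_max_entropy_iff by blast
    show "\<forall>t. 0 < t \<and> t < 1 \<longrightarrow> \<not> (\<exists>\<nu>. (\<forall>k. ergodic_prob (skew f) (\<nu> k)) \<and>
            weak_star_conv \<nu> (convex_comb t fw.mu mu_plus) \<and>
            (\<lambda>k. metric_entropy (skew f) (\<nu> k)) \<longlonglongrightarrow> metric_entropy (skew f) (convex_comb t fw.mu mu_plus))"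
      using no_approximation by blast
  qed (fact fw.entropy_mu entropy_mu_plus lyapunov_mu_negative lyapunov_mu_plus(2))+
qed

end
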